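(* Let $1\le k\le d$, let $\mathcal{D}=\mathcal{D}_1\times\cdots\times\mathcal{D}_d$ be a known product distribution on $\mathbb{R}^d$, and let $\varepsilon\in(0,1)$. There exists a (randomized) meta-algorithm $\mathcal{M}$ which, given oracle access to an arbitrary function $f:\mathbb{R}^d\to[0,1]$, produces a function $\mathcal{M}_f:\mathbb{R}^d\to[0,1]$ such that: 1. with high probability, $\mathcal{M}_f$ is $k$-marginally monotone; 2. $\mathcal{M}_f$ is feasible: $\mathcal{M}_f(x)\le\max_{y\le x}f(y)$ for every $x\in\mathbb{R}^d$; 3. the query complexity of $\mathcal{M}$ is $\tilde{O}\left(\frac{d^{2k+6}}{\varepsilon^{2k+3}}\right)$; 4. $\mathbb{E}[\mathcal{M}_f(x)]\ge\mathbb{E}_{x\sim\mathcal{D}}[f(x)]-\varepsilon$, where the first expectation is over $x\sim\mathcal{D}$ and the internal randomness of the meta-algorithm.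
   Context: For vectors $x,y$ of the same length, $x\le y$ means $x_i\le y_i$ for all $i$. Functions are assumed measurable so that expectations make sense, and $\max_{y\le x} f(y)$ is read as a supremum when it is not attained. $k$-marginal monotonicity: for $\mathcal{I}\subseteq\{1,\dots,d\}$ write $x_{\mathcal{I}}$ for the coordinates of $x$ in $\mathcal{I}$ and $x_{-\mathcal{I}}$ for the remaining ones. A function $g:\mathbb{R}^d\to[0,1]$ is $k$-marginally monotone (with respect to $\mathcal{D}$) if for every $\mathcal{I}\subseteq\{1,\dots,d\}$ with $|\mathcal{I}|\le k$ the function $g_{\mathcal{I}}(x_{\mathcal{I}})=\mathbb{E}_{x_{-\mathcal{I}}}[g(x_{\mathcal{I}},x_{-\mathcal{I}})]$ (with $x_{-\mathcal{I}}$ drawn from the product of the $\mathcal{D}_i$, $i\notin\mathcal{I}$) is monotone, i.e. $x_{\mathcal{I}}\le y_{\mathcal{I}}$ implies $g_{\mathcal{I}}(x_{\mathcal{I}})\le g_{\mathcal{I}}(y_{\mathcal{I}})$. Meta-algorithm: a procedure that knows $\mathcal{D}$, $k$ and $\varepsilon$, draws a random seed (internal randomness) independent of the inputs and shared by all inputs, may query the oracle for $f$ before seeing the input, and on an input $x$ adaptively queries $f$ and outputs a number $\mathcal{M}_f(x)\in[0,1]$. For a fixed seed, $\mathcal{M}_f$ is a deterministic function of $x$. Feasibility is required for every realization of the seed. "With high probability" is over the seed: the probability is $1-o(1)$ as $d/\varepsilon\to\infty$. Query complexity: the maximum number of oracle calls to $f$ made in order to answer a single input $x$ (including preliminary queries).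 $\tilde{O}$ hides factors polylogarithmic in $d/\varepsilon$ and factors depending only on $k$. *)

theory Defs
  imports "HOL-Probability.Probability"
begin

type_synonym vec = "nat \<Rightarrow> real"

text \<open>The coordinates are indexed by \<open>{..<d}\<close>, and points of \<open>R^d\<close> are extensional functions,
  so that equality of points is equality of their \<open>d\<close> coordinates.\<close>

abbreviation Rd :: "nat \<Rightarrow> vec measure" where
  "Rd d \<equiv> PiM {..<d} (\<lambda>_. borel)"

definition oracles :: "nat \<Rightarrow> (vec \<Rightarrow> real) set" where
  "oracles d = {f \<in> borel_measurable (Rd d). \<forall>x\<in>space (Rd d). f x \<in> {0..1}}"

definition marginal :: "nat \<Rightarrow> (nat \<Rightarrow> real measure) \<Rightarrow> (vec \<Rightarrow> real) \<Rightarrow> nat set \<Rightarrow> vec \<Rightarrow> real" where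
  "marginal d D g I u =
     (\<integral>v. g (merge I ({..<d} - I) (u, v)) \<partial>PiM ({..<d} - I) D)"

definition marginally_monotone ::
    "nat \<Rightarrow> nat \<Rightarrow> (nat \<Rightarrow> real measure) \<Rightarrow> (vec \<Rightarrow> real) \<Rightarrow> bool" where
  "marginally_monotone k d D g \<longleftrightarrow>
     (\<forall>I. I \<subseteq> {..<d} \<and> card I \<le> k \<longrightarrow>
       (\<forall>u \<in> I \<rightarrow>\<^sub>E UNIV. \<forall>v \<in> I \<rightarrow>\<^sub>E UNIV.
         (\<forall>i\<in>I. u i \<le> v i) \<longrightarrow> marginal d D g I u \<le> marginal d D g I v))"

definition feasible :: "nat \<Rightarrow> (vec \<Rightarrow> real) \<Rightarrow> (vec \<Rightarrow> real) \<Rightarrow> bool" where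
  "feasible d f g \<longleftrightarrow>
     (\<forall>x\<in>space (Rd d). g x \<le> (SUP y \<in> {y \<in> space (Rd d). \<forall>i<d. y i \<le> x i}. f y))"

text \<open>Deterministic adaptive query procedures: \<open>Query q c\<close> asks the oracle for its value at \<open>q\<close>
  and continues with \<open>c\<close> applied to the answer. Being a datatype, every procedure terminates on
  every oracle. The set function \<open>queries\<close> collects the query points, and \<open>results\<close> the results,
  of all branches.\<close>

datatype (queries: 'q, results: 'r) oracle_comp =
  Return 'r
| Query 'q "real \<Rightarrow> ('q, 'r) oracle_comp"

primrec run :: "('q \<Rightarrow> real) \<Rightarrow> ('q, 'r) oracle_comp \<Rightarrow> 'r" where
  "run f (Return r) = r"
| "run f (Query q c) = run f (c (f q))"

primrec calls :: "('q \<Rightarrow> real) \<Rightarrow> ('q, 'r) oracle_comp \<Rightarrow> nat" where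
  "calls f (Return r) = 0"
| "calls f (Query q c) = Suc (calls f (c (f q)))"

text \<open>For a seed \<open>\<omega>\<close>, \<open>procedure M \<omega>\<close> is the preliminary phase, which is run before the input
  is seen. Its result maps each input to the query procedure that answers this input; this
  covers an arbitrary state carried over from the preliminary phase. The type of seeds has to
  be fixed; sequences of reals leave room for countably many real random variables.\<close>

record meta_algorithm =
  seed :: "(nat \<Rightarrow> real) measure"
  procedure :: "(nat \<Rightarrow> real) \<Rightarrow> (vec, vec \<Rightarrow> (vec, real) oracle_comp) oracle_comp"

definition meta_fun :: "meta_algorithm \<Rightarrow> (vec \<Rightarrow> real) \<Rightarrow> (nat \<Rightarrow> real) \<Rightarrow> vec \<Rightarrow> real" where
  "meta_fun M f \<omega> x = run f (run f (procedure M \<omega>) x)"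

definition calls_on :: "meta_algorithm \<Rightarrow> (vec \<Rightarrow> real) \<Rightarrow> (nat \<Rightarrow> real) \<Rightarrow> vec \<Rightarrow> nat" where
  "calls_on M f \<omega> x = calls f (procedure M \<omega>) + calls f (run f (procedure M \<omega>) x)"

definition query_complexity :: "nat \<Rightarrow> meta_algorithm \<Rightarrow> enat" where
  "query_complexity d M =
     (SUP (f, \<omega>, x) \<in> oracles d \<times> space (seed M) \<times> space (Rd d). enat (calls_on M f \<omega> x))"

text \<open>Joint measurability in seed and input is what makes the expectation over both meaningful;
  it implies measurability of \<open>meta_fun M f \<omega>\<close> for each seed \<open>\<omega>\<close>.\<close>

definition valid_meta_algorithm :: "nat \<Rightarrow> meta_algorithm \<Rightarrow> bool" where
  "valid_meta_algorithm d M \<longleftrightarrow>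
     prob_space (seed M) \<and>
     (\<forall>\<omega>\<in>space (seed M). queries (procedure M \<omega>) \<subseteq> space (Rd d) \<and>
        (\<forall>h\<in>results (procedure M \<omega>). \<forall>x\<in>space (Rd d). queries (h x) \<subseteq> space (Rd d))) \<and>
     (\<forall>f\<in>oracles d.
        (\<forall>\<omega>\<in>space (seed M). \<forall>x\<in>space (Rd d). meta_fun M f \<omega> x \<in> {0..1}) \<and>
        (\<lambda>(\<omega>, x). meta_fun M f \<omega> x) \<in> borel_measurable (seed M \<Otimes>\<^sub>M Rd d))"

text \<open>The set of all \<open>\<omega>\<close> with \<open>P \<omega>\<close> need not be measurable.\<close>

definition with_prob_at_least :: "'a measure \<Rightarrow> real \<Rightarrow> ('a \<Rightarrow> bool) \<Rightarrow> bool" where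
  "with_prob_at_least M p P \<longleftrightarrow> (\<exists>A\<in>sets M. (\<forall>\<omega>\<in>A. P \<omega>) \<and> measure M A \<ge> p)"

end

theory Submission
  imports Defs
begin

text \<open>Each coordinate is cut into levels of mass at least \<open>\<kappa> = \<epsilon> / (16 d)\<close>. A random representative of
  each level, which with probability \<open>1 - 2 \<kappa>\<close> lies below the whole level and averages to the given
  distribution, reduces the theorem to a function \<open>F\<close> on a finite grid. A slice of the grid fixes at
  most \<open>k\<close> coordinates.

  Slices in which the marginal of \<open>F\<close> is tiny are removed one by one, by sampling; replacing the
  samples of one slice does not affect the process before that slice is removed, so the estimates
  behave as if they used fresh samples. On the remaining slices the algorithm plays an online game
  with multiplicative weights on the constraints that marginals do not decrease from a slice to its
  upper neighbours. In each round the points walk down the grid, each step being drawn with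
  probability proportional to the weight of the constraints that ask for it. This makes the expected
  total weight nonincreasing, so that the average over the rounds of the values of \<open>F\<close> at the end
  points of the walks violates each constraint at most by a small factor, relative to the marginals.
  Multiplying the value at \<open>z\<close> by a product of weights of its levels, increasing in each level, turns
  this approximate monotonicity into an exact one. Walking down and multiplying by factors at most 1
  keeps the output feasible.\<close>

section \<open>Query procedures\<close>

text \<open>The game leaves an additive error \<open>32 * Q * L / \<eta>\<close>, while the final
  weights can repair only relative violations. That is why tiny marginals have to go first: below
  every surviving slice lies one whose marginal is at least of order
  \<open>\<epsilon> / d ^ k\<close>, and the constraints of the game themselves carry this lower
  bound upwards. With at most \<open>d / \<kappa>\<close> levels in all and a total loss of order
  \<open>\<epsilon>\<close>, the margins are about \<open>\<epsilon> * \<kappa> / d\<close>. A round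
  draws a single grid point that serves all slices at once, and reweighting it to a slice of mass
  \<open>\<kappa> ^ k\<close> costs the factor \<open>Q = (1 / \<kappa>) ^ k\<close>. Hence about
  \<open>d ^ k / \<epsilon> * Q / \<eta>^2\<close> rounds are needed, each with about
  \<open>d\<close> queries; for \<open>\<kappa>\<close> of order \<open>\<epsilon> / d\<close> this
  is \<open>d ^ (2 * k + 5) / \<epsilon> ^ (k + 5)\<close>, which fits the budget unless
  \<open>k = 1\<close>. There a factor \<open>1 / \<epsilon>\<close> is saved by margins that depend
  on the marginals.\<close>

primrec oc_bind :: "('q, 'r) oracle_comp \<Rightarrow> ('r \<Rightarrow> ('q, 's) oracle_comp) \<Rightarrow> ('q, 's) oracle_comp" where
  "oc_bind (Return r) h = h r"
| "oc_bind (Query q c) h = Query q (\<lambda>y. oc_bind (c y) h)"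

lemma run_oc_bind: "run f (oc_bind c h) = run f (h (run f c))"
  by (induction c) auto

lemma calls_oc_bind: "calls f (oc_bind c h) = calls f c + calls f (h (run f c))"
  by (induction c) auto

lemma queries_oc_bind: "queries c \<subseteq> Q \<Longrightarrow> (\<And>r. queries (h r) \<subseteq> Q) \<Longrightarrow> queries (oc_bind c h) \<subseteq> Q"
  by (induction c) (auto, blast+)

lemma results_oc_bind: "results (oc_bind c h) \<subseteq> (\<Union>r\<in>results c. results (h r))"
  by (induction c) (auto, blast)

text \<open>Programs are never written out below: a step of the algorithm is given by its value as a
  function of the oracle, and this predicate asserts that some query procedure computes it. The
  bound depends on \<open>f\<close> because an adaptive procedure may make different numbers of
  calls on different oracles.\<close>

definition computable :: "'q set \<Rightarrow> (('q \<Rightarrow> real) \<Rightarrow> nat) \<Rightarrow> (('q \<Rightarrow> real) \<Rightarrow> 'r) \<Rightarrow> bool" where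
  "computable Q m G \<longleftrightarrow> (\<exists>c. queries c \<subseteq> Q \<and> (\<forall>f. run f c = G f \<and> calls f c \<le> m f))"

lemma computable_const: "computable Q (\<lambda>_. 0) (\<lambda>_. r)"
  unfolding computable_def by (rule exI[of _ "Return r"]) auto

lemma computable_bind:
  assumes "computable Q m G" "\<And>r. computable Q (m' r) (H r)"
  shows "computable Q (\<lambda>f. m f + m' (G f) f) (\<lambda>f. H (G f) f)"
proof -
  obtain c where c: "queries c \<subseteq> Q" "\<And>f. run f c = G f" "\<And>f. calls f c \<le> m f"
    using assms(1) unfolding computable_def by auto
  have "\<forall>r. \<exists>c. queries c \<subseteq> Q \<and> (\<forall>f. run f c = H r f \<and> calls f c \<le> m' r f)"
    using assms(2) unfolding computable_def by auto
  then obtain h where h: "\<And>r. queries (h r) \<subseteq> Q" "\<And>r f. run f (h r) = H r f" "\<And>r f. calls f (h r) \<le> m' r f"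
    by metis
  show ?thesis unfolding computable_def
    by (rule exI[of _ "oc_bind c h"])
      (auto simp: run_oc_bind calls_oc_bind c h intro!: add_mono c(3) queries_oc_bind[THEN subsetD, OF c(1) h(1)])
qed

lemma computable_mono:
  assumes "computable Q m G" "\<And>f. m f \<le> m' f" "\<And>f. G f = G' f"
  shows "computable Q m' G'"
  using assms unfolding computable_def by (metis order_trans)

lemma computable_query: "q \<in> Q \<Longrightarrow> computable Q (\<lambda>_. 1) (\<lambda>f. f q)"
  unfolding computable_def by (rule exI[of _ "Query q Return"]) auto

lemma computable_restrict:
  assumes "finite S" "S \<subseteq> Q"
  shows "computable Q (\<lambda>_. card S) (\<lambda>f. restrict f S)"
  using assms
proof (induction S rule: finite_induct)
  case empty
  have *: "(\<lambda>f. restrict f {}) = (\<lambda>f::'a \<Rightarrow> real. \<lambda>_. undefined)" by (auto simp: restrict_def)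
  show ?case unfolding * using computable_const by auto
next
  case (insert x S)
  have "computable Q (\<lambda>f. card S + 1) (\<lambda>f. (restrict f S)(x := f x))"
  proof (rule computable_bind[OF insert.IH])
    show "computable Q (\<lambda>_. 1) (\<lambda>f. r(x := f x))" for r
      using computable_bind[OF computable_query[of x Q] computable_const, of "\<lambda>y. r(x := y)"] insert.prems
      by simp
  qed (use insert.prems in auto)
  then show ?case
    by (rule computable_mono) (use insert.hyps in \<open>auto simp: fun_eq_iff\<close>)
qed

text \<open>An adaptive procedure is given by the growing set \<open>R t f\<close> of points read in its first \<open>t\<close> steps.\<close>

lemma computable_reads:
  fixes R :: "nat \<Rightarrow> ('q \<Rightarrow> real) \<Rightarrow> 'q set"
  assumes R0: "\<And>f. R 0 f = {}"
    and loc: "\<And>t f g. (\<forall>q\<in>R t f. f q = g q) \<Longrightarrow> R (Suc t) f = R (Suc t) g"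
    and mono: "\<And>t f. R t f \<subseteq> R (Suc t) f"
    and fin: "\<And>t f. finite (R t f)" and Q: "\<And>f t. R t f \<subseteq> Q"
    and card: "\<And>f. card (R T f) \<le> n"
    and G: "\<And>f g. (\<forall>q\<in>R T f. f q = g q) \<Longrightarrow> G f = G g"
  shows "computable Q (\<lambda>_. n) G"
proof -
  \<comment> \<open>By locality the transcript \<open>restrict f (R t f)\<close> determines both
    \<open>R t f\<close> and \<open>R (Suc t) f\<close>, so the next set to read can be computed
    from the transcript alone.\<close>
  have Rr: "R t (restrict f (R t f)) = R t f" for t f
  proof (cases t)
    case (Suc u)
    then have "R (Suc u) f = R (Suc u) (restrict f (R t f))"
      using mono[of u f] by (intro loc) auto
    then show ?thesis using Suc by simp
  qed (simp add: R0)
  have Rr': "R (Suc t) (restrict f (R t f)) = R (Suc t) f" for t f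
    using loc[of t f "restrict f (R t f)"] by auto
  have "computable Q (\<lambda>f. card (R t f)) (\<lambda>f. restrict f (R t f))" for t
  proof (induction t)
    case 0
    show ?case
      by (rule computable_mono[OF computable_const[of Q "\<lambda>_. undefined"]]) (auto simp: R0)
  next
    case (Suc t)
    let ?S = "\<lambda>r. R (Suc t) r - R t r"
    \<comment> \<open>Only points outside \<open>R t r\<close> are queried. Repeated reads are free,
      and the total count is the size of the final set.\<close>
    have 1: "computable Q (\<lambda>_. card (?S r) + 0) (\<lambda>f. \<lambda>q\<in>R (Suc t) r. if q \<in> R t r then r q else restrict f (?S r) q)" for r
      by (rule computable_bind[OF computable_restrict, of _ _ "\<lambda>_ _. 0"]) (use fin subsetD[OF Q] in \<open>auto intro!: computable_const finite_Diff\<close>)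
    have 2: "computable Q (\<lambda>f. card (R t f) + (card (?S (restrict f (R t f))) + 0))
        (\<lambda>f. \<lambda>q\<in>R (Suc t) (restrict f (R t f)). if q \<in> R t (restrict f (R t f)) then restrict f (R t f) q
          else restrict f (?S (restrict f (R t f))) q)"
      by (rule computable_bind[OF Suc.IH 1])
    show ?case
    proof (rule computable_mono[OF 2])
      show "card (R t f) + (card (?S (restrict f (R t f))) + 0) \<le> card (R (Suc t) f)" for f
        using fin[of t f] fin[of "Suc t" f] mono[of t f]
        by (simp add: Rr Rr' card_Diff_subset card_mono)
    qed (use mono in \<open>auto simp: Rr Rr' fun_eq_iff\<close>)
  qed
  from computable_bind[OF this[of T] computable_const]
  have "computable Q (\<lambda>f. card (R T f) + 0) (\<lambda>f. G (restrict f (R T f)))" .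
  then show ?thesis
    by (rule computable_mono) (use card G in \<open>auto intro!: G[symmetric]\<close>)
qed

section \<open>Finite distributions\<close>

abbreviation expect :: "'a pmf \<Rightarrow> ('a \<Rightarrow> real) \<Rightarrow> real" where
  "expect \<equiv> measure_pmf.expectation"

section \<open>Expectations and probabilities over finite supports\<close>

lemma finite_Pi_pmf:
  "finite A \<Longrightarrow> (\<And>x. x \<in> A \<Longrightarrow> finite (set_pmf (p x))) \<Longrightarrow> finite (set_pmf (Pi_pmf A d p))"
  by (simp add: set_Pi_pmf finite_PiE_dflt)

lemma expect_mono:
  assumes "finite (set_pmf p)" "\<And>x. x \<in> set_pmf p \<Longrightarrow> f x \<le> g x"
  shows "expect p f \<le> expect p g"
  using assms by (intro integral_mono_AE integrable_measure_pmf_finite) (auto simp: AE_measure_pmf_iff)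

lemma expect_cong: "(\<And>x. x \<in> set_pmf p \<Longrightarrow> f x = g x) \<Longrightarrow> expect p f = expect p g"
  by (intro integral_cong_AE) (auto simp: AE_measure_pmf_iff)

lemma expect_nonneg: "(\<And>x. x \<in> set_pmf p \<Longrightarrow> 0 \<le> f x) \<Longrightarrow> 0 \<le> expect p f"
  by (intro integral_nonneg_AE) (auto simp: AE_measure_pmf_iff)

lemma expect_add: "finite (set_pmf p) \<Longrightarrow> expect p (\<lambda>x. f x + g x) = expect p f + expect p g"
  by (simp add: integrable_measure_pmf_finite)

lemma expect_diff: "finite (set_pmf p) \<Longrightarrow> expect p (\<lambda>x. f x - g x) = expect p f - expect p g"
  by (simp add: integrable_measure_pmf_finite)

lemma expect_sum: "finite (set_pmf p) \<Longrightarrow> expect p (\<lambda>x. \<Sum>i\<in>A. f i x) = (\<Sum>i\<in>A. expect p (f i))"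
  by (simp add: integrable_measure_pmf_finite)

lemma expect_le_const:
  assumes "finite (set_pmf p)" "\<And>x. x \<in> set_pmf p \<Longrightarrow> f x \<le> c"
  shows "expect p f \<le> c"
  using expect_mono[OF assms(1), of f "\<lambda>_. c"] assms(2) by simp

lemma expect_ge_const:
  assumes "finite (set_pmf p)" "\<And>x. x \<in> set_pmf p \<Longrightarrow> c \<le> f x"
  shows "c \<le> expect p f"
  using expect_mono[OF assms(1), of "\<lambda>_. c" f] assms(2) by simp

lemma expect_pair:
  assumes "finite (set_pmf p)" "finite (set_pmf q)"
  shows "expect (pair_pmf p q) f = expect p (\<lambda>x. expect q (\<lambda>y. f (x, y)))"
proof -
  have 1: "pair_pmf p q = bind_pmf p (\<lambda>x. map_pmf (Pair x) q)"
    by (simp add: pair_pmf_def map_pmf_def)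
  have "expect (pair_pmf p q) f = (\<Sum>x\<in>set_pmf p. pmf p x *\<^sub>R expect (map_pmf (Pair x) q) f)"
    unfolding 1 using assms by (intro pmf_expectation_bind) auto
  also have "\<dots> = (\<Sum>x\<in>set_pmf p. pmf p x *\<^sub>R expect q (\<lambda>y. f (x, y)))" by simp
  also have "\<dots> = expect p (\<lambda>x. expect q (\<lambda>y. f (x, y)))"
    by (rule integral_measure_pmf[symmetric]) (use assms in auto)
  finally show ?thesis .
qed

lemma prob_eq_expect: "measure_pmf.prob p {x. P x} = expect p (\<lambda>x. of_bool (P x))"
proof -
  have "expect p (\<lambda>x. of_bool (P x)) = expect p (indicator {x. P x})"
    by (intro expect_cong) (auto simp: indicator_def)
  then show ?thesis by simp
qed

lemma markov_pmf:
  assumes "finite (set_pmf p)" "\<And>x. x \<in> set_pmf p \<Longrightarrow> 0 \<le> f x" "c > 0"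
  shows "measure_pmf.prob p {x. f x \<ge> c} \<le> expect p f / c"
proof -
  have "c * expect p (\<lambda>x. of_bool (f x \<ge> c)) = expect p (\<lambda>x. c * of_bool (f x \<ge> c))" by simp
  also have "\<dots> \<le> expect p f" using assms by (intro expect_mono) auto
  finally show ?thesis using assms by (simp add: prob_eq_expect field_simps)
qed

lemma prob_Un_le: "measure_pmf.prob p {x. P x \<or> Q x} \<le> measure_pmf.prob p {x. P x} + measure_pmf.prob p {x. Q x}"
proof -
  have "{x. P x \<or> Q x} = {x. P x} \<union> {x. Q x}" by auto
  then show ?thesis using measure_subadditive[of "{x. P x}" "measure_pmf p" "{x. Q x}"] by simp
qed

lemma prob_Ex_le:
  fixes e :: real
  assumes "finite A" "\<And>a. a \<in> A \<Longrightarrow> measure_pmf.prob p {x. P a x} \<le> e"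
  shows "measure_pmf.prob p {x. \<exists>a\<in>A. P a x} \<le> card A * e"
proof -
  have "{x. \<exists>a\<in>A. P a x} = (\<Union>a\<in>A. {x. P a x})" by auto
  then have "measure_pmf.prob p {x. \<exists>a\<in>A. P a x} \<le> (\<Sum>a\<in>A. measure_pmf.prob p {x. P a x})"
    using measure_pmf.finite_measure_subadditive_finite[of A "\<lambda>a. {x. P a x}" p] assms by simp
  also have "\<dots> \<le> card A * e" using assms(2) by (intro sum_bounded_above) auto
  finally show ?thesis .
qed

text \<open>Independence is used only in this form: resampling some coordinates changes no expectation.\<close>

lemma resample_pmf:
  assumes "finite A" "B \<subseteq> A"
  shows "map_pmf (\<lambda>(y, x) i. if i \<in> B then y i else x i) (pair_pmf (Pi_pmf A d p) (Pi_pmf A d p)) = Pi_pmf A d p"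
proof -
  let ?P = "Pi_pmf A d p"
  let ?r = "\<lambda>S f x. if x \<in> S then f x else d"
  have fin: "finite B" using assms finite_subset by auto
  have out: "f i = d" if "f \<in> set_pmf ?P" "i \<notin> A" for f i
    using that by (auto simp: set_Pi_pmf[OF assms(1)] PiE_dflt_def)
  have 1: "Pi_pmf B d p = map_pmf (?r B) ?P" "Pi_pmf (A - B) d p = map_pmf (?r (A - B)) ?P"
    by (rule Pi_pmf_subset[OF assms]) (rule Pi_pmf_subset[OF assms(1) Diff_subset])
  have "Pi_pmf (B \<union> (A - B)) d p
      = map_pmf (\<lambda>(f,g) x. if x \<in> B then f x else g x) (pair_pmf (Pi_pmf B d p) (Pi_pmf (A - B) d p))"
    using assms fin by (intro Pi_pmf_union) auto
  also have "\<dots> = map_pmf (\<lambda>(f,g) x. if x \<in> B then ?r B f x else ?r (A - B) g x) (pair_pmf ?P ?P)"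
    unfolding 1 by (simp add: map_pair[symmetric] map_pmf_comp case_prod_unfold cong: if_cong)
  also have "\<dots> = map_pmf (\<lambda>(y, x) i. if i \<in> B then y i else x i) (pair_pmf ?P ?P)"
    using out[symmetric] by (intro map_pmf_cong) (auto simp: fun_eq_iff)
  finally show ?thesis using assms by (simp add: Un_absorb1)
qed

lemma expect_resample:
  assumes "finite A" "B \<subseteq> A" "\<And>i. i \<in> A \<Longrightarrow> finite (set_pmf (p i))"
  shows "expect (Pi_pmf A d p) g
    = expect (Pi_pmf A d p) (\<lambda>x. expect (Pi_pmf A d p) (\<lambda>y. g (\<lambda>i. if i \<in> B then y i else x i)))"
proof -
  let ?P = "Pi_pmf A d p"
  have fin: "finite (set_pmf ?P)" using assms by (intro finite_Pi_pmf) auto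
  have "expect ?P g = expect (pair_pmf ?P ?P) (\<lambda>p. g (\<lambda>i. if i \<in> B then fst p i else snd p i))"
    by (subst resample_pmf[OF assms(1,2), symmetric]) (simp add: case_prod_unfold)
  also have "\<dots> = expect (map_pmf prod.swap (pair_pmf ?P ?P)) (\<lambda>p. g (\<lambda>i. if i \<in> B then fst p i else snd p i))"
    by (subst (1) pair_commute_pmf) (simp add: prod.swap_def case_prod_unfold cong: if_cong)
  also have "\<dots> = expect (pair_pmf ?P ?P) (\<lambda>p. g (\<lambda>i. if i \<in> B then snd p i else fst p i))"
    by (simp cong: if_cong)
  finally show ?thesis using fin by (simp add: expect_pair cong: if_cong)
qed

lemma expect_resample1:
  assumes "finite A" "t \<in> A" "\<And>i. i \<in> A \<Longrightarrow> finite (set_pmf (p i))"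
  shows "expect (Pi_pmf A d p) g = expect (Pi_pmf A d p) (\<lambda>x. expect (p t) (\<lambda>y. g (x(t := y))))"
proof -
  let ?P = "Pi_pmf A d p"
  have "expect ?P g = expect ?P (\<lambda>x. expect ?P (\<lambda>y. g (x(t := y t))))"
  proof (subst expect_resample[of _ "{t}"], goal_cases)
    case 4
    then show ?case by (simp add: fun_upd_def cong: if_cong)
  qed (use assms in auto)
  also have "\<dots> = expect ?P (\<lambda>x. expect (map_pmf (\<lambda>f. f t) ?P) (\<lambda>y. g (x(t := y))))"
    by simp
  finally show ?thesis using assms by (simp add: Pi_pmf_component)
qed

lemma expect_prod_iid:
  assumes "finite A" "J \<subseteq> A" "\<And>i. i \<in> J \<Longrightarrow> p i = q" "finite (set_pmf q)" "\<And>x. 0 \<le> g x"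
  shows "expect (Pi_pmf A d p) (\<lambda>x. \<Prod>i\<in>J. g (x i)) = expect q g ^ card J"
proof -
  have "finite J" using assms(1,2) finite_subset by blast
  have "expect (Pi_pmf A d p) (\<lambda>x. \<Prod>i\<in>J. g (x i))
      = expect (map_pmf (\<lambda>f x. if x \<in> J then f x else d) (Pi_pmf A d p)) (\<lambda>x. \<Prod>i\<in>J. g (x i))"
    by simp
  also have "\<dots> = expect (Pi_pmf J d p) (\<lambda>x. \<Prod>i\<in>J. g (x i))"
    using assms by (subst Pi_pmf_subset[symmetric]) auto
  also have "\<dots> = (\<Prod>i\<in>J. expect (p i) g)"
    using assms \<open>finite J\<close> by (intro expectation_prod_Pi_pmf) (auto simp: integrable_measure_pmf_finite)
  finally show ?thesis using assms by simp
qed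

text \<open>Chords of the convex function \<open>exp\<close> over the unit interval and its mirror
  image, with \<open>exp 1 \<le> 3\<close> and \<open>exp (- 1) \<le> 1/2\<close> at the end
  points.\<close>

lemma exp_convex_bound:
  fixes x :: real assumes "0 \<le> x" "x \<le> 1"
  shows "exp x \<le> 1 + 2 * x" "exp (- x) \<le> 1 - x / 2"
proof -
  have c: "convex_on UNIV (exp :: real \<Rightarrow> real)" by (rule exp_convex)
  have e: "exp 1 \<le> (3::real)" using exp_le by simp
  have "exp ((1 - x) *\<^sub>R 0 + x *\<^sub>R 1) \<le> (1 - x) * exp 0 + x * exp (1::real)"
    by (rule convex_onD[OF c]) (use assms in auto)
  also have "\<dots> \<le> (1 - x) + x * 3" using e assms by (intro add_mono mult_left_mono) auto
  finally show "exp x \<le> 1 + 2 * x" by simp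
  have e2: "exp (-1) \<le> (1/2::real)" using exp_ge_add_one_self[of 1] by (simp add: exp_minus field_simps)
  have "exp ((1 - x) *\<^sub>R 0 + x *\<^sub>R (-1)) \<le> (1 - x) * exp 0 + x * exp (-1::real)"
    by (rule convex_onD[OF c]) (use assms in auto)
  also have "\<dots> \<le> (1 - x) + x * (1/2)" using e2 assms by (intro add_mono mult_left_mono) auto
  finally show "exp (- x) \<le> 1 - x / 2" by simp
qed

text \<open>The exponential moment method with the fixed parameters 1 and -1. The mean is distorted
  by a factor 2, but the failure probability depends only on the additive slack \<open>a\<close>,
  neither on the mean nor on the number of samples.\<close>

lemma chernoff_pmf:
  assumes A: "finite A" "J \<subseteq> A" "\<And>i. i \<in> J \<Longrightarrow> p i = q" and fq: "\<And>i. i \<in> A \<Longrightarrow> finite (set_pmf (p i))" "finite (set_pmf q)"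
    and h: "\<And>x. 0 \<le> h x" "\<And>x. h x \<le> (1::real)"
  shows "measure_pmf.prob (Pi_pmf A d p) {x. (\<Sum>i\<in>J. h (x i)) \<ge> 2 * (card J * expect q h) + a} \<le> exp (- a)"
    and "measure_pmf.prob (Pi_pmf A d p) {x. (\<Sum>i\<in>J. h (x i)) \<le> card J * expect q h / 2 - a} \<le> exp (- a)"
proof -
  let ?P = "Pi_pmf A d p" and ?m = "expect q h" and ?n = "card J"
  have fin: "finite (set_pmf ?P)" using A fq by (intro finite_Pi_pmf) auto
  have finJ: "finite J" using A finite_subset by auto
  have "expect ?P (\<lambda>x. exp (\<Sum>i\<in>J. h (x i))) = expect q (\<lambda>y. exp (h y)) ^ ?n"
    using A fq finJ by (subst expect_prod_iid[symmetric, of A]) (auto simp: exp_sum)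
  also have "\<dots> \<le> exp (2 * ?m) ^ ?n"
  proof (intro power_mono expect_nonneg)
    have "expect q (\<lambda>y. exp (h y)) \<le> expect q (\<lambda>y. 1 + 2 * h y)"
      using h fq exp_convex_bound by (intro expect_mono) auto
    also have "\<dots> = 1 + 2 * ?m" using fq by (simp add: expect_add)
    also have "\<dots> \<le> exp (2 * ?m)" by (rule exp_ge_add_one_self)
    finally show "expect q (\<lambda>y. exp (h y)) \<le> exp (2 * ?m)" .
  qed auto
  finally have 1: "expect ?P (\<lambda>x. exp (\<Sum>i\<in>J. h (x i))) \<le> exp (2 * (?n * ?m))"
    by (simp add: exp_of_nat_mult[symmetric] mult_ac)
  have "measure_pmf.prob ?P {x. (\<Sum>i\<in>J. h (x i)) \<ge> 2 * (?n * ?m) + a}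
      = measure_pmf.prob ?P {x. exp (\<Sum>i\<in>J. h (x i)) \<ge> exp (2 * (?n * ?m) + a)}" by simp
  also have "\<dots> \<le> expect ?P (\<lambda>x. exp (\<Sum>i\<in>J. h (x i))) / exp (2 * (?n * ?m) + a)"
    using fin by (intro markov_pmf) auto
  also have "\<dots> \<le> exp (2 * (?n * ?m)) / exp (2 * (?n * ?m) + a)" using 1 by (intro divide_right_mono) auto
  also have "\<dots> = exp (- a)" by (simp add: exp_diff[symmetric])
  finally show "measure_pmf.prob ?P {x. (\<Sum>i\<in>J. h (x i)) \<ge> 2 * (?n * ?m) + a} \<le> exp (- a)" .
  have "expect ?P (\<lambda>x. exp (- (\<Sum>i\<in>J. h (x i)))) = expect q (\<lambda>y. exp (- h y)) ^ ?n"
    using A fq finJ by (subst expect_prod_iid[symmetric, of A]) (auto simp: exp_sum sum_negf[symmetric])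
  also have "\<dots> \<le> exp (- ?m / 2) ^ ?n"
  proof (intro power_mono expect_nonneg)
    have "expect q (\<lambda>y. exp (- h y)) \<le> expect q (\<lambda>y. 1 - h y / 2)"
      using h fq exp_convex_bound by (intro expect_mono) auto
    also have "\<dots> = 1 - ?m / 2" using fq by (simp add: expect_diff)
    also have "\<dots> \<le> exp (- ?m / 2)" using exp_ge_add_one_self[of "- ?m / 2"] by simp
    finally show "expect q (\<lambda>y. exp (- h y)) \<le> exp (- ?m / 2)" .
  qed auto
  finally have 1: "expect ?P (\<lambda>x. exp (- (\<Sum>i\<in>J. h (x i)))) \<le> exp (- (?n * ?m / 2))"
    by (simp add: exp_of_nat_mult[symmetric] mult_ac)
  have "measure_pmf.prob ?P {x. (\<Sum>i\<in>J. h (x i)) \<le> ?n * ?m / 2 - a}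
      = measure_pmf.prob ?P {x. exp (- (\<Sum>i\<in>J. h (x i))) \<ge> exp (a - ?n * ?m / 2)}" by (simp add: algebra_simps)
  also have "\<dots> \<le> expect ?P (\<lambda>x. exp (- (\<Sum>i\<in>J. h (x i)))) / exp (a - ?n * ?m / 2)"
    using fin by (intro markov_pmf) auto
  also have "\<dots> \<le> exp (- (?n * ?m / 2)) / exp (a - ?n * ?m / 2)" using 1 by (intro divide_right_mono) auto
  also have "\<dots> = exp (- a)" by (simp add: exp_diff[symmetric])
  finally show "measure_pmf.prob ?P {x. (\<Sum>i\<in>J. h (x i)) \<le> ?n * ?m / 2 - a} \<le> exp (- a)" .
qed

section \<open>Grids and slices\<close>

type_synonym point = "nat \<Rightarrow> nat"

text \<open>A slice \<open>(I, v)\<close> stands for the set of grid points \<open>z\<close> with \<open>z i = v i\<close> for \<open>i \<in> I\<close>.\<close>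

type_synonym slice = "nat set \<times> point"

lemma card_small_subsets:
  assumes "finite W"
  shows "finite {S. S \<subseteq> W \<and> S \<noteq> {} \<and> card S \<le> k}" "card {S. S \<subseteq> W \<and> S \<noteq> {} \<and> card S \<le> k} \<le> card W ^ k"
proof -
  let ?A = "{S. S \<subseteq> W \<and> S \<noteq> {} \<and> card S \<le> k}"
  let ?P = "PiE {..<k} (\<lambda>_. W)"
  have sub: "?A \<subseteq> (\<lambda>f. f ` {..<k}) ` ?P"
  proof
    fix S assume "S \<in> ?A"
    then have S: "S \<subseteq> W" "S \<noteq> {}" "card S \<le> k" by auto
    have fS: "finite S" using S assms finite_subset by auto
    obtain g where g: "bij_betw g {..<card S} S"
      using ex_bij_betw_nat_finite[OF fS] by (auto simp: atLeast0LessThan)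
    obtain s where s: "s \<in> S" using S by auto
    define f where "f = (\<lambda>i\<in>{..<k}. if i < card S then g i else s)"
    have im: "g ` {..<card S} = S" using g by (simp add: bij_betw_def)
    have "f ` {..<k} = S"
    proof
      show "f ` {..<k} \<subseteq> S" using im s by (auto simp: f_def)
      show "S \<subseteq> f ` {..<k}"
      proof
        fix x assume "x \<in> S"
        then obtain i where "i < card S" "x = g i" using im by auto
        then show "x \<in> f ` {..<k}" using S(3) by (intro image_eqI[of _ _ i]) (auto simp: f_def)
      qed
    qed
    moreover have "f i \<in> W" if "i < k" for i
      using \<open>f ` {..<k} = S\<close> S(1) that by auto
    then have "f \<in> ?P" by (auto simp: f_def)
    ultimately show "S \<in> (\<lambda>f. f ` {..<k}) ` ?P" by (intro image_eqI[of _ _ f]) auto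
  qed
  have fin: "finite ?P" using assms by (intro finite_PiE) auto
  show "finite ?A" by (rule finite_surj[OF fin sub])
  have "card ?A \<le> card ?P" using sub fin by (rule surj_card_le[rotated])
  then show "card ?A \<le> card W ^ k" by (simp add: card_PiE)
qed

definition override :: "slice \<Rightarrow> point \<Rightarrow> point" where
  "override c z = (\<lambda>i. if i \<in> fst c then snd c i else z i)"

definition in_slice :: "slice \<Rightarrow> point \<Rightarrow> bool" where
  "in_slice c z \<longleftrightarrow> (\<forall>i\<in>fst c. z i = snd c i)"

text \<open>From level 1 this leads to level 0. The result is then no member of
  \<open>slices\<close>, and all grid functions of interest vanish on it.\<close>

definition lower :: "slice \<Rightarrow> nat \<Rightarrow> slice" where
  "lower c i = (fst c, (snd c)(i := snd c i - 1))"

definition level_slice :: "nat \<Rightarrow> nat \<Rightarrow> slice" where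
  "level_slice i j = ({i}, (\<lambda>_. 0)(i := j))"

definition weight :: "(nat \<Rightarrow> nat \<Rightarrow> real) \<Rightarrow> nat set \<Rightarrow> point \<Rightarrow> real" where
  "weight w A z = (\<Prod>i\<in>A. w i (z i))"

lemma override_lower: "i \<in> fst c \<Longrightarrow> (override c z)(i := override c z i - 1) = override (lower c i) z"
  by (auto simp: override_def lower_def)

lemma fst_lower [simp]: "fst (lower c i) = fst c"
  by (simp add: lower_def)

text \<open>Level 0 is exempt from \<open>mass\<close>: it collects the remainder at the left end of
  a coordinate, whose mass has no lower bound. Slices therefore fix positive levels only, and grid
  functions will vanish wherever some coordinate is 0.\<close>

locale grid =
  fixes d :: nat and r :: "nat \<Rightarrow> nat" and bp :: "nat \<Rightarrow> nat pmf" and \<kappa> :: real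
  assumes supp: "\<And>i. i < d \<Longrightarrow> set_pmf (bp i) \<subseteq> {..r i}"
    and mass: "\<And>i j. i < d \<Longrightarrow> 1 \<le> j \<Longrightarrow> j \<le> r i \<Longrightarrow> \<kappa> \<le> pmf (bp i) j"
    and kappa: "0 < \<kappa>" "\<kappa> \<le> 1" and d_pos: "1 \<le> d"
begin

definition X :: "point set" where "X = PiE_dflt {..<d} 0 (\<lambda>i. {..r i})"

definition pz :: "point pmf" where "pz = Pi_pmf {..<d} 0 bp"

definition mg :: "slice \<Rightarrow> (point \<Rightarrow> real) \<Rightarrow> real" where
  "mg c h = expect pz (\<lambda>z. h (override c z))"

definition slices :: "nat \<Rightarrow> slice set" where
  "slices k = {(I, v). I \<subseteq> {..<d} \<and> I \<noteq> {} \<and> card I \<le> k \<and> v \<in> PiE_dflt I 0 (\<lambda>i. {1..r i})}"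

definition slice_mass :: "slice \<Rightarrow> real" where
  "slice_mass c = (\<Prod>i\<in>fst c. pmf (bp i) (snd c i))"

text \<open>The marginal of the reweighted function without the weights of the fixed coordinates,
  which are constant on the slice (\<open>mg_weight\<close>). The game is played with these
  marginals because its average is multiplied by \<open>weight w\<close> in the end.\<close>

definition mgw :: "(nat \<Rightarrow> nat \<Rightarrow> real) \<Rightarrow> slice \<Rightarrow> (point \<Rightarrow> real) \<Rightarrow> real" where
  "mgw w c h = expect pz (\<lambda>z. weight w ({..<d} - fst c) z * h (override c z))"

text \<open>The importance weight with respect to \<open>pz\<close> whose expectation is
  \<open>mgw\<close> (\<open>expect_density\<close>): one sample of the whole grid yields an
  unbiased estimate for every slice.\<close>

definition density :: "(nat \<Rightarrow> nat \<Rightarrow> real) \<Rightarrow> slice \<Rightarrow> point \<Rightarrow> real" where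
  "density w c z = of_bool (in_slice c z) * weight w ({..<d} - fst c) z / slice_mass c"

section \<open>Masses and marginals of slices\<close>

lemma finite_bp: "i < d \<Longrightarrow> finite (set_pmf (bp i))"
  using supp finite_subset by blast

lemma finite_X: "finite X"
  unfolding X_def by (intro finite_PiE_dflt) auto

lemma set_pz: "set_pmf pz \<subseteq> X"
  using supp by (auto simp: pz_def X_def set_Pi_pmf PiE_dflt_def)

lemma finite_pz: "finite (set_pmf pz)"
  using set_pz finite_X finite_subset by blast

lemma X_outside: "z \<in> X \<Longrightarrow> \<not> i < d \<Longrightarrow> z i = 0"
  by (auto simp: X_def PiE_dflt_def)

lemma X_bound: "z \<in> X \<Longrightarrow> i < d \<Longrightarrow> z i \<le> r i"
  by (auto simp: X_def PiE_dflt_def)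

lemma slicesD:
  assumes "c \<in> slices k"
  shows "fst c \<subseteq> {..<d}" "fst c \<noteq> {}" "card (fst c) \<le> k" "finite (fst c)"
    "\<And>i. i \<in> fst c \<Longrightarrow> 1 \<le> snd c i" "\<And>i. i \<in> fst c \<Longrightarrow> snd c i \<le> r i" "\<And>i. i \<notin> fst c \<Longrightarrow> snd c i = 0"
  using assms finite_subset[of "fst c" "{..<d}"] by (auto simp: slices_def PiE_dflt_def)

lemma level_slice_in: "i < d \<Longrightarrow> 1 \<le> j \<Longrightarrow> j \<le> r i \<Longrightarrow> 1 \<le> k \<Longrightarrow> level_slice i j \<in> slices k"
  by (auto simp: level_slice_def slices_def PiE_dflt_def)

lemma sum_mass: "i < d \<Longrightarrow> (\<Sum>j\<le>r i. pmf (bp i) j) = 1"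
  using supp by (intro sum_pmf_eq_1) auto

lemma r_kappa: assumes "i < d" shows "real (r i) * \<kappa> \<le> 1"
proof -
  have "real (r i) * \<kappa> = (\<Sum>j\<in>{1..r i}. \<kappa>)" by simp
  also have "\<dots> \<le> (\<Sum>j\<in>{1..r i}. pmf (bp i) j)" using mass assms by (intro sum_mono) auto
  also have "\<dots> \<le> (\<Sum>j\<le>r i. pmf (bp i) j)" by (intro sum_mono2) auto
  also have "\<dots> = 1" using sum_mass assms by simp
  finally show ?thesis .
qed

lemma r_le: "i < d \<Longrightarrow> real (r i) \<le> 1 / \<kappa>"
  using r_kappa kappa by (simp add: field_simps)

lemma slice_mass_ge:
  assumes "c \<in> slices k" shows "slice_mass c \<ge> \<kappa> ^ k" "slice_mass c > 0"
proof -
  note c = slicesD[OF assms]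
  have "\<kappa> ^ k \<le> \<kappa> ^ card (fst c)" using kappa c by (intro power_decreasing) auto
  also have "\<dots> = (\<Prod>i\<in>fst c. \<kappa>)" by simp
  also have "\<dots> \<le> slice_mass c" unfolding slice_mass_def using c kappa by (intro prod_mono) (auto intro!: mass)
  finally show "slice_mass c \<ge> \<kappa> ^ k" .
  then show "slice_mass c > 0" using kappa by (meson less_le_trans zero_less_power)
qed

lemma expect_in_slice:
  assumes "fst c \<subseteq> {..<d}"
  shows "expect pz (\<lambda>z. of_bool (in_slice c z) * h z) = slice_mass c * mg c h"
proof -
  have fI: "finite (fst c)" using assms finite_subset by auto
  have "expect pz (\<lambda>z. of_bool (in_slice c z)) = measure_pmf.prob pz (Pi (fst c) (\<lambda>i. {snd c i}))"
    by (auto simp: in_slice_def prob_eq_expect[symmetric] intro!: arg_cong[of _ _ "measure_pmf.prob pz"])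
  also have "\<dots> = measure_pmf.prob pz (Pi {..<d} (\<lambda>i. if i \<in> fst c then {snd c i} else UNIV))"
    using assms by (intro arg_cong[of _ _ "measure_pmf.prob pz"]) (auto simp: Pi_def)
  also have "\<dots> = (\<Prod>i<d. measure_pmf.prob (bp i) (if i \<in> fst c then {snd c i} else UNIV))"
    unfolding pz_def by (rule measure_Pi_pmf_Pi) simp
  also have "\<dots> = (\<Prod>i<d. if i \<in> fst c then pmf (bp i) (snd c i) else 1)"
    by (intro prod.cong) (auto simp: measure_pmf_single)
  also have "\<dots> = slice_mass c"
    unfolding slice_mass_def using assms fI by (subst prod.inter_restrict[symmetric]) (auto simp: Int_absorb1 intro!: prod.cong)
  finally have m: "expect pz (\<lambda>z. of_bool (in_slice c z)) = slice_mass c" .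
  \<comment> \<open>Resampling the coordinates of the slice separates the event
    \<open>in_slice c\<close> from the coordinates on which the marginal depends.\<close>
  have "expect pz (\<lambda>z. of_bool (in_slice c z) * h z)
      = expect pz (\<lambda>x. expect pz (\<lambda>y. of_bool (in_slice c y) * h (override c x)))"
    unfolding pz_def
  proof (subst expect_resample[of _ "fst c"], goal_cases)
    case 4
    have "in_slice c (\<lambda>i. if i \<in> fst c then y i else x i) = in_slice c y" for x y
      by (auto simp: in_slice_def)
    moreover have "(\<lambda>i. if i \<in> fst c then y i else x i) = override c x" if "in_slice c y" for x y
      using that by (auto simp: in_slice_def override_def)
    ultimately show ?case by (intro expect_cong) (auto simp: of_bool_def)
  qed (use assms finite_bp in auto)
  also have "\<dots> = expect pz (\<lambda>x. slice_mass c * h (override c x))" by (simp add: m)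
  finally show ?thesis by (simp add: mg_def)
qed

lemma expect_density:
  assumes "c \<in> slices k"
  shows "expect pz (\<lambda>z. density w c z * h z) = mgw w c h"
proof -
  have "expect pz (\<lambda>z. density w c z * h z)
      = expect pz (\<lambda>z. of_bool (in_slice c z) * (weight w ({..<d} - fst c) z * h z / slice_mass c))"
    by (intro expect_cong) (simp add: density_def)
  also have "\<dots> = slice_mass c * mg c (\<lambda>z. weight w ({..<d} - fst c) z * h z / slice_mass c)"
    using slicesD[OF assms] by (intro expect_in_slice) auto
  also have "\<dots> = mgw w c h"
    using slice_mass_ge[OF assms]
    by (simp add: mg_def mgw_def override_def weight_def cong: prod.cong_simp)
  finally show ?thesis .
qed

lemma mg_weight:
  assumes "c \<in> slices k"
  shows "mg c (\<lambda>z. weight w {..<d} z * h z) = weight w (fst c) (snd c) * mgw w c h"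
proof -
  note c = slicesD[OF assms]
  have "weight w {..<d} (override c z) = weight w (fst c) (snd c) * weight w ({..<d} - fst c) z" for z
  proof -
    have "weight w {..<d} (override c z)
        = (\<Prod>i\<in>{..<d} - fst c. w i (override c z i)) * (\<Prod>i\<in>fst c. w i (override c z i))"
      unfolding weight_def using c by (intro prod.subset_diff) auto
    then show ?thesis by (simp add: weight_def override_def cong: prod.cong_simp)
  qed
  then show ?thesis by (simp add: mg_def mgw_def mult.assoc)
qed

lemma mgw_lower:
  "i \<in> fst c \<Longrightarrow> mgw w c (\<lambda>z. h (z(i := z i - 1))) = mgw w (lower c i) h"
  by (simp add: mgw_def override_lower del: One_nat_def)

lemma mgw_sum: "mgw w c (\<lambda>z. \<Sum>t\<in>A. h t z) = (\<Sum>t\<in>A. mgw w c (h t))"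
  by (simp add: mgw_def sum_distrib_left expect_sum[OF finite_pz])

lemma mgw_scale: "mgw w c (\<lambda>z. a * h z) = a * mgw w c h"
  by (simp add: mgw_def mult.left_commute[of _ a])

lemma expect_levels:
  assumes "i < d"
  shows "expect pz h = (\<Sum>j\<le>r i. pmf (bp i) j * mg (level_slice i j) h)"
proof -
  have "expect pz h = expect pz (\<lambda>z. \<Sum>j\<le>r i. of_bool (in_slice (level_slice i j) z) * h z)"
  proof (intro expect_cong)
    fix z assume "z \<in> set_pmf pz"
    then have "z i \<le> r i" using set_pz X_bound assms by auto
    then show "h z = (\<Sum>j\<le>r i. of_bool (in_slice (level_slice i j) z) * h z)"
      by (subst sum.cong[OF refl, of _ _ "\<lambda>j. if j = z i then h z else 0"])
        (auto simp: in_slice_def level_slice_def)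
  qed
  also have "\<dots> = (\<Sum>j\<le>r i. slice_mass (level_slice i j) * mg (level_slice i j) h)"
    using assms by (subst expect_sum[OF finite_pz]) (auto simp: expect_in_slice level_slice_def)
  finally show ?thesis by (simp add: slice_mass_def level_slice_def)
qed

text \<open>A slice is determined by the graph of its level map, a nonempty set of at most
  \<open>k\<close> pairs out of the at most \<open>d / \<kappa>\<close> pairs of a coordinate and a
  positive level.\<close>

lemma finite_slices: "finite (slices k)"
  and card_slices: "real (card (slices k)) \<le> (d / \<kappa>) ^ k"
proof -
  define W where "W = (SIGMA i:{..<d}. {1..r i})"
  define A where "A = {S. S \<subseteq> W \<and> S \<noteq> {} \<and> card S \<le> k}"
  have fW: "finite W" unfolding W_def by auto
  define gr where "gr = (\<lambda>c::slice. (\<lambda>i. (i, snd c i)) ` fst c)"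
  have inj: "inj_on gr (slices k)"
  proof (rule inj_onI)
    fix c c' assume cc: "c \<in> slices k" "c' \<in> slices k" "gr c = gr c'"
    have 1: "fst c = fst ` gr c" for c by (force simp: gr_def)
    have "fst c = fst c'" using 1[of c] 1[of c'] cc by simp
    moreover have "snd c i = snd c' i" for i
    proof (cases "i \<in> fst c")
      case True
      then have "(i, snd c i) \<in> gr c'" using cc by (auto simp: gr_def)
      then show ?thesis by (auto simp: gr_def)
    qed (use slicesD(7)[OF cc(1)] slicesD(7)[OF cc(2)] \<open>fst c = fst c'\<close> in auto)
    ultimately show "c = c'" by (auto simp: prod_eq_iff)
  qed
  have sub: "gr ` slices k \<subseteq> A"
  proof safe
    fix I v assume "(I, v) \<in> slices k"
    note c = slicesD[OF this]
    have "card (gr (I, v)) \<le> card I" unfolding gr_def using c(4) by (auto intro: card_image_le)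
    then show "gr (I, v) \<in> A" using c by (force simp: A_def W_def gr_def)
  qed
  have fA: "finite A" "card A \<le> card W ^ k" unfolding A_def using card_small_subsets[OF fW] by auto
  show "finite (slices k)" using inj sub fA finite_imageD finite_subset by metis
  have "card (slices k) \<le> card W ^ k" using card_mono[OF fA(1) sub] card_image[OF inj] fA by linarith
  then have "real (card (slices k)) \<le> real (card W) ^ k" by (metis of_nat_le_iff of_nat_power)
  also have "\<dots> \<le> (d / \<kappa>) ^ k"
  proof (intro power_mono)
    have "real (card W) = (\<Sum>i<d. real (r i))" unfolding W_def by simp
    also have "\<dots> \<le> (\<Sum>i<d. 1 / \<kappa>)" using r_le by (intro sum_mono) auto
    finally show "real (card W) \<le> d / \<kappa>" by simp
  qed auto
  finally show "real (card (slices k)) \<le> (d / \<kappa>) ^ k" .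
qed

text \<open>Slices with the same index set are disjoint events, so their masses sum to at most 1,
  and there are at most \<open>d ^ k\<close> index sets. This bounds what pruning loses through the
  floor \<open>\<rho>\<close> of its threshold.\<close>

lemma sum_slice_mass: "(\<Sum>c\<in>slices k. slice_mass c) \<le> real d ^ k"
proof -
  define A where "A = {I. I \<subseteq> {..<d} \<and> I \<noteq> {} \<and> card I \<le> k}"
  have A: "finite A" "card A \<le> d ^ k" unfolding A_def using card_small_subsets[of "{..<d}" k] by auto
  have "(\<Sum>c\<in>slices k. slice_mass c) = (\<Sum>I\<in>A. \<Sum>c\<in>{c\<in>slices k. fst c = I}. slice_mass c)"
    using finite_slices A by (intro sum.group[symmetric]) (auto simp: A_def slices_def)
  also have "\<dots> \<le> (\<Sum>I\<in>A. 1)"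
  proof (intro sum_mono)
    fix I assume I: "I \<in> A"
    let ?S = "{c\<in>slices k. fst c = I}"
    have "(\<Sum>c\<in>?S. slice_mass c) = (\<Sum>c\<in>?S. expect pz (\<lambda>z. of_bool (in_slice c z)))"
      using expect_in_slice[of _ "\<lambda>_. 1"] I by (intro sum.cong) (auto simp: A_def mg_def)
    also have "\<dots> = expect pz (\<lambda>z. \<Sum>c\<in>?S. of_bool (in_slice c z))" by (simp add: expect_sum[OF finite_pz])
    also have "\<dots> \<le> 1"
    proof (intro expect_le_const finite_pz)
      fix z
      have *: "c = c'" if "c \<in> ?S" "c' \<in> ?S" "in_slice c z" "in_slice c' z" for c c'
      proof -
        have "snd c i = snd c' i" for i
          using that slicesD(7)[of c k i] slicesD(7)[of c' k i] by (cases "i \<in> I") (auto simp: in_slice_def)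
        then show ?thesis using that by (auto simp: prod_eq_iff)
      qed
      have "(\<Sum>c\<in>?S. of_bool (in_slice c z) :: real) = (\<Sum>c\<in>{c\<in>?S. in_slice c z}. 1)"
        using finite_slices by (intro sum.mono_neutral_cong_right) auto
      also have "\<dots> = card {c\<in>?S. in_slice c z}" by simp
      also have "\<dots> \<le> 1" using * by (simp, intro card_le_Suc0_iff_eq[THEN iffD2]) (use finite_slices in auto)
      finally show "(\<Sum>c\<in>?S. of_bool (in_slice c z) :: real) \<le> 1" .
    qed
    finally show "(\<Sum>c\<in>?S. slice_mass c) \<le> 1" .
  qed
  also have "\<dots> \<le> real d ^ k" using A by (simp flip: of_nat_power)
  finally show ?thesis .
qed

end

section \<open>Walks\<close>

text \<open>Branch 0 means to stop and branch \<open>Suc i\<close> to step down in coordinate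
  \<open>i\<close>, the same numbering as in the second component of a constraint.\<close>

definition step_down :: "(point \<Rightarrow> nat) \<Rightarrow> point \<Rightarrow> point" where
  "step_down \<beta> z = (if \<beta> z = 0 then z else z(\<beta> z - 1 := z (\<beta> z - 1) - 1))"

lemma step_down_le: "step_down \<beta> z i \<le> z i"
  by (simp add: step_down_def)

lemma funpow_step_down_le: "(step_down \<beta> ^^ n) z i \<le> z i"
  by (induction n) (auto intro: order_trans[OF step_down_le])

lemma funpow_step_down_cong:
  assumes "\<And>x. (\<And>i. x i \<le> z i) \<Longrightarrow> \<beta> x = \<beta>' x"
  shows "(step_down \<beta> ^^ n) z = (step_down \<beta>' ^^ n) z"
proof (induction n)
  case (Suc n)
  have "\<beta> ((step_down \<beta>' ^^ n) z) = \<beta>' ((step_down \<beta>' ^^ n) z)"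
    by (rule assms) (rule funpow_step_down_le)
  then have "step_down \<beta> ((step_down \<beta>' ^^ n) z) = step_down \<beta>' ((step_down \<beta>' ^^ n) z)"
    by (simp add: step_down_def)
  then show ?case using Suc by simp
qed simp

lemma card_nat_interval_ge:
  fixes a b :: real and K :: nat
  assumes "0 \<le> a" "b \<le> K"
  shows "real (card {c. c < K \<and> a \<le> real c \<and> real c < b}) \<ge> b - a - 1"
proof (cases "a \<le> b")
  case True
  have sub: "{nat \<lceil>a\<rceil>..<nat \<lceil>b\<rceil>} \<subseteq> {c. c < K \<and> a \<le> real c \<and> real c < b}"
  proof
    fix c assume "c \<in> {nat \<lceil>a\<rceil>..<nat \<lceil>b\<rceil>}"
    then have c: "nat \<lceil>a\<rceil> \<le> c" "c < nat \<lceil>b\<rceil>" by auto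
    then have "a \<le> c" by linarith
    moreover have "real c < b" using c by linarith
    ultimately show "c \<in> {c. c < K \<and> a \<le> real c \<and> real c < b}" using assms by auto
  qed
  have "b - a - 1 \<le> real (card {nat \<lceil>a\<rceil>..<nat \<lceil>b\<rceil>})" using True assms by simp linarith
  also have "\<dots> \<le> real (card {c. c < K \<and> a \<le> real c \<and> real c < b})"
    using sub by (intro of_nat_mono card_mono) auto
  finally show ?thesis .
qed simp

lemma finite_set_coin: "K > 0 \<Longrightarrow> finite (set_pmf (pmf_of_set {..<K::nat}))"
  by (subst set_pmf_of_set) (auto simp: lessThan_empty_iff)

text \<open>\<open>pick d q K c\<close> turns a uniform coin \<open>c < K\<close> into an index \<open>j \<le> d\<close> with distribution
  proportional to \<open>q\<close>, up to an error \<open>1 / K\<close> in each probability. Coins with finitely many values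
  keep the whole algorithm discrete.\<close>

definition pick :: "nat \<Rightarrow> (nat \<Rightarrow> real) \<Rightarrow> nat \<Rightarrow> nat \<Rightarrow> nat" where
  "pick d q K c = (let P = (\<lambda>j. real c * (\<Sum>i\<le>d. q i) < (\<Sum>i\<le>j. q i) * real K)
    in if \<exists>j\<le>d. P j then (LEAST j. P j) else 0)"

lemma pick_le: "pick d q K c \<le> d"
  unfolding pick_def Let_def by (auto intro: Least_le order_trans)

text \<open>The coins that pick \<open>j\<close> fill an interval of length
  \<open>q j * K / W\<close>, which contains at least that many integers minus one. Each of the
  \<open>d + 1\<close> indices thus loses at most \<open>1 / K\<close> of its probability, and
  values in the unit interval turn this into the error term.\<close>

lemma pick_expect:
  assumes q: "\<And>j. 0 \<le> q j" and V: "\<And>j. 0 \<le> V j" "\<And>j. V j \<le> 1" and K: "K > 0"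
  shows "(\<Sum>j\<le>d. q j * V j) - (\<Sum>j\<le>d. q j) * (real d + 1) / K
    \<le> (\<Sum>j\<le>d. q j) * expect (pmf_of_set {..<K}) (\<lambda>c. V (pick d q K c))"
proof (cases "(\<Sum>j\<le>d. q j) = 0")
  case True
  then have "\<forall>j\<in>{..d}. q j = 0" using q by (subst (asm) sum_nonneg_eq_0_iff) auto
  then show ?thesis using True by simp
next
  case False
  define W where "W = (\<Sum>j\<le>d. q j)"
  have W: "W > 0" using False q sum_nonneg[of "{..d}" q] unfolding W_def by (simp add: order_less_le)
  define S where "S = (\<lambda>j. \<Sum>i<j. q i)"
  have S: "S (Suc j) = S j + q j" for j by (simp add: S_def)
  have Smono: "i \<le> j \<Longrightarrow> S i \<le> S j" for i j unfolding S_def using q by (intro sum_mono2) auto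
  have S0: "0 \<le> S j" for j unfolding S_def using q by (intro sum_nonneg) auto
  have Sd: "S (Suc d) = W" by (simp add: S_def W_def lessThan_Suc_atMost)
  have Seq: "(\<Sum>i\<le>j. q i) = S (Suc j)" for j by (simp add: S_def lessThan_Suc_atMost)
  have pk: "pick d q K c = j" if "j \<le> d" "S j * K / W \<le> c" "c < S (Suc j) * K / W" for c j
  proof -
    let ?P = "\<lambda>j. real c * W < S (Suc j) * real K"
    have "?P j" using that W by (simp add: field_simps)
    moreover have "j \<le> i" if "?P i" for i
    proof (rule ccontr)
      assume "\<not> j \<le> i"
      then have "S (Suc i) * K \<le> S j * K" using Smono[of "Suc i" j] by (intro mult_right_mono) auto
      also have "\<dots> \<le> c * W" using \<open>S j * K / W \<le> c\<close> W by (simp add: field_simps)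
      finally show False using that by simp
    qed
    ultimately have "(LEAST j. ?P j) = j" by (intro Least_equality) auto
    then show ?thesis using \<open>?P j\<close> that(1) unfolding pick_def Let_def Seq Sd by auto
  qed
  have cnt: "real (card {c\<in>{..<K}. pick d q K c = j}) \<ge> q j * K / W - 1" if "j \<le> d" for j
  proof -
    have "S (Suc j) \<le> W" using Smono[of "Suc j" "Suc d"] that Sd by simp
    then have "S (Suc j) * K / W \<le> W * K / W" using W by (intro divide_right_mono mult_right_mono) auto
    also have "\<dots> = K" using W by simp
    finally have "S (Suc j) * K / W \<le> K" .
    then have "S (Suc j) * K / W - S j * K / W - 1 \<le> real (card {c. c < K \<and> S j * K / W \<le> real c \<and> real c < S (Suc j) * K / W})"
      using S0 W by (intro card_nat_interval_ge) auto
    also have "\<dots> \<le> real (card {c\<in>{..<K}. pick d q K c = j})"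
      using pk that by (intro of_nat_mono card_mono) auto
    finally show ?thesis by (simp add: S distrib_right add_divide_distrib)
  qed
  have "K * expect (pmf_of_set {..<K}) (\<lambda>c. V (pick d q K c)) = (\<Sum>c<K. V (pick d q K c))"
    using K by (subst integral_pmf_of_set) (auto simp: field_simps)
  also have "\<dots> = (\<Sum>j\<le>d. \<Sum>c\<in>{c\<in>{..<K}. pick d q K c = j}. V (pick d q K c))"
    by (intro sum.group[symmetric]) (auto simp: pick_le)
  also have "\<dots> = (\<Sum>j\<le>d. real (card {c\<in>{..<K}. pick d q K c = j}) * V j)"
    by (intro sum.cong) auto
  also have "\<dots> \<ge> (\<Sum>j\<le>d. (q j * K / W) * V j - 1)"
  proof (intro sum_mono)
    fix j assume "j \<in> {..d}"
    then have "(q j * K / W - 1) * V j \<le> real (card {c\<in>{..<K}. pick d q K c = j}) * V j"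
      using cnt V by (intro mult_right_mono) auto
    then show "(q j * K / W) * V j - 1 \<le> real (card {c\<in>{..<K}. pick d q K c = j}) * V j"
      using V[of j] by (simp add: algebra_simps)
  qed
  finally have "(\<Sum>j\<le>d. (q j * K / W) * V j) - (d + 1) \<le> K * expect (pmf_of_set {..<K}) (\<lambda>c. V (pick d q K c))"
    by (simp add: sum_subtractf)
  then have "(W / K) * ((\<Sum>j\<le>d. (q j * K / W) * V j) - (d + 1)) \<le> (W / K) * (K * expect (pmf_of_set {..<K}) (\<lambda>c. V (pick d q K c)))"
    using W by (intro mult_left_mono) auto
  moreover have "(W / K) * (\<Sum>j\<le>d. (q j * K / W) * V j) = (\<Sum>j\<le>d. q j * V j)"
    using W K by (simp add: sum_distrib_left)
  ultimately show ?thesis using K W unfolding W_def[symmetric] by (simp add: right_diff_distrib add.commute)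
qed

context grid
begin

text \<open>A step from a positive level in a coordinate below \<open>d\<close> lowers the
  coordinate sum by exactly one. With this number of iterations the walk has the same end from
  \<open>z\<close> and from its first successor (\<open>walk_end_move\<close>).\<close>

definition walk_end :: "(point \<Rightarrow> nat) \<Rightarrow> point \<Rightarrow> point" where
  "walk_end \<beta> z = (step_down \<beta> ^^ (\<Sum>i<d. z i)) z"

lemma walk_end_le: "walk_end \<beta> z i \<le> z i"
  by (simp add: walk_end_def funpow_step_down_le)

lemma walk_end_cong:
  assumes "\<And>x. (\<And>i. x i \<le> z i) \<Longrightarrow> \<beta> x = \<beta>' x" shows "walk_end \<beta> z = walk_end \<beta>' z"
  unfolding walk_end_def using assms by (rule funpow_step_down_cong)

lemma walk_end_stop: assumes "\<beta> z = 0" shows "walk_end \<beta> z = z"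
proof -
  have "(step_down \<beta> ^^ n) z = z" for n using assms by (induction n) (auto simp: step_down_def)
  then show ?thesis by (simp add: walk_end_def)
qed

lemma walk_end_move:
  assumes "\<beta> z = Suc i" "i < d" "1 \<le> z i"
  shows "walk_end \<beta> z = walk_end \<beta> (z(i := z i - 1))"
proof -
  have "(\<Sum>l<d. z l) = z i + (\<Sum>l\<in>{..<d} - {i}. z l)" using assms by (intro sum.remove) auto
  moreover have "(\<Sum>l<d. (z(i := z i - 1)) l) = (z i - 1) + (\<Sum>l\<in>{..<d} - {i}. z l)"
    using assms by (subst sum.remove[of _ i]) auto
  ultimately have "(\<Sum>l<d. z l) = Suc (\<Sum>l<d. (z(i := z i - 1)) l)" using assms by linarith
  moreover have "step_down \<beta> z = z(i := z i - 1)" using assms by (simp add: step_down_def)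
  ultimately show ?thesis unfolding walk_end_def by (simp add: funpow_swap1)
qed

text \<open>One coin for each grid point, shared by all walks of a round: walks that meet coalesce,
  and after its first step the walk from \<open>z\<close> is the walk from the successor.\<close>

definition coins :: "nat \<Rightarrow> (point \<Rightarrow> nat) pmf" where
  "coins K = Pi_pmf X 0 (\<lambda>_. pmf_of_set {..<K})"

definition branch :: "(point \<Rightarrow> nat \<Rightarrow> real) \<Rightarrow> nat \<Rightarrow> (point \<Rightarrow> nat) \<Rightarrow> point \<Rightarrow> nat" where
  "branch q K u z = pick d (q z) K (u z)"

definition walk_value :: "(point \<Rightarrow> real) \<Rightarrow> (point \<Rightarrow> nat) \<Rightarrow> point \<Rightarrow> real" where
  "walk_value F \<beta> z = F (walk_end \<beta> z)"

definition target :: "(point \<Rightarrow> real) \<Rightarrow> (point \<Rightarrow> nat) \<Rightarrow> nat \<Rightarrow> point \<Rightarrow> real" where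
  "target F \<beta> j z = (case j of 0 \<Rightarrow> F z | Suc i \<Rightarrow> walk_value F \<beta> (z(i := z i - 1)))"

lemma finite_coins: "K > 0 \<Longrightarrow> finite (set_pmf (coins K))"
  unfolding coins_def using finite_X by (intro finite_Pi_pmf finite_set_coin) auto

text \<open>The value of the walk at \<open>z\<close> is the target of the branch picked by the coin
  at \<open>z\<close>. The targets do not depend on this coin, since a walk started strictly below
  \<open>z\<close> never returns to \<open>z\<close>. Averaging over this one coin therefore makes
  the walk value the \<open>q\<close>-weighted mean of the targets, up to the rounding of
  \<open>pick\<close>.\<close>

lemma walk_balance:
  assumes z: "z \<in> X" and q: "\<And>j. 0 \<le> q z j" and F: "\<And>z. 0 \<le> F z" "\<And>z. F z \<le> 1"
    and F0: "\<And>z i. i < d \<Longrightarrow> z i = 0 \<Longrightarrow> F z = 0" and K: "K > 0"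
  shows "expect (coins K) (\<lambda>u. \<Sum>j\<le>d. q z j * (walk_value F (branch q K u) z - target F (branch q K u) j z))
    \<ge> - ((\<Sum>j\<le>d. q z j) * (real d + 1) / K)"
proof (cases "\<forall>i<d. 1 \<le> z i")
  \<comment> \<open>In this case a step in coordinate \<open>i\<close> would stay at
    \<open>z\<close>; but every point below \<open>z\<close> has a zero at \<open>i\<close> too, so
    that all values are 0.\<close>
  case False
  then obtain i where i: "i < d" "z i = 0" by (auto simp: not_le)
  have F0': "F y = 0" if "\<And>i. y i \<le> z i" for y using that[of i] i F0 by auto
  have v: "walk_value F \<beta> y = 0" if "\<And>i. y i \<le> z i" for y \<beta>
    unfolding walk_value_def by (rule F0', rule order_trans, rule walk_end_le, rule that)
  have "walk_value F \<beta> (z(l := z l - 1)) = 0" for l \<beta> by (rule v) simp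
  then have "target F \<beta> j z = 0" for j \<beta>
    using F0 i by (simp add: target_def split: nat.split)
  then show ?thesis using v[of z] q by (simp add: sum_nonneg)
next
  case True
  let ?C = "pmf_of_set {..<K}" and ?W = "\<Sum>j\<le>d. q z j"
  let ?g = "\<lambda>u. \<Sum>j\<le>d. q z j * (walk_value F (branch q K u) z - target F (branch q K u) j z)"
  have "expect (coins K) ?g = expect (coins K) (\<lambda>u. expect ?C (\<lambda>y. ?g (u(z := y))))"
    unfolding coins_def using z finite_X K by (intro expect_resample1 finite_set_coin) auto
  also have "\<dots> \<ge> - (?W * (real d + 1) / K)"
  proof (rule expect_ge_const[OF finite_coins[OF K]])
    fix u
    define V where "V = (\<lambda>j. target F (branch q K u) j z)"
    have low: "walk_end (branch q K (u(z := y))) (z(i := z i - 1)) = walk_end (branch q K u) (z(i := z i - 1))"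
      if "i < d" for i y
    proof (intro walk_end_cong)
      fix x assume "\<And>l. x l \<le> (z(i := z i - 1)) l"
      from this[of i] have "x i \<noteq> z i" using True that by (auto simp: Suc_le_eq)
      then have "x \<noteq> z" by auto
      then show "branch q K (u(z := y)) x = branch q K u x" by (simp add: branch_def)
    qed
    have tar: "target F (branch q K (u(z := y))) j z = V j" if "j \<le> d" for j y
      using that low by (cases j) (auto simp: V_def target_def walk_value_def)
    have val: "walk_value F (branch q K (u(z := y))) z = V (pick d (q z) K y)" for y
    proof -
      let ?b = "branch q K (u(z := y))"
      have b: "?b z = pick d (q z) K y" by (simp add: branch_def)
      show ?thesis
      proof (cases "pick d (q z) K y")
        case 0
        then show ?thesis using b by (simp add: walk_value_def walk_end_stop V_def target_def)
      next
        case (Suc i)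
        then have i: "i < d" using pick_le[of d "q z" K y] by simp
        have "walk_value F ?b z = walk_value F ?b (z(i := z i - 1))"
          unfolding walk_value_def using walk_end_move[of ?b z i] b Suc i True by simp
        also have "\<dots> = target F ?b (Suc i) z" by (simp add: target_def)
        finally show ?thesis using tar[of "Suc i" y] i Suc by simp
      qed
    qed
    have fC: "finite (set_pmf ?C)" using K by (rule finite_set_coin)
    have "expect ?C (\<lambda>y. ?g (u(z := y))) = expect ?C (\<lambda>y. ?W * V (pick d (q z) K y) - (\<Sum>j\<le>d. q z j * V j))"
      using tar val by (intro expect_cong) (simp add: right_diff_distrib sum_subtractf sum_distrib_right)
    also have "\<dots> = ?W * expect ?C (\<lambda>y. V (pick d (q z) K y)) - (\<Sum>j\<le>d. q z j * V j)"
      using fC by (simp add: expect_diff)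
    also have "\<dots> \<ge> - (?W * (real d + 1) / K)"
    proof -
      have "0 \<le> V j" "V j \<le> 1" for j using F by (auto simp: V_def target_def walk_value_def split: nat.splits)
      from pick_expect[of "q z" V K d, OF q this K] show ?thesis by linarith
    qed
    finally show "- (?W * (real d + 1) / K) \<le> expect ?C (\<lambda>y. ?g (u(z := y)))" by linarith
  qed
  finally show ?thesis .
qed

end

section \<open>The game\<close>

text \<open>Multiplying the right-hand side by \<open>1 - x\<close> gives
  \<open>1 + x^2 * (1/3 - 4/3 * x)\<close>, and 4/3 is the least factor that works up to
  \<open>x = 1/4\<close>. The bound is for the reciprocals of update factors.\<close>

lemma inverse_quadratic_bound:
  fixes x :: real assumes "\<bar>x\<bar> \<le> 1/4"
  shows "1 / (1 - x) \<le> 1 + x + 4/3 * x^2"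
proof -
  have "0 \<le> x^2 * (1/3 - 4/3 * x)" using assms by (intro mult_nonneg_nonneg) auto
  then have "1 \<le> 1 + x^2 * (1/3 - 4/3 * x)" by simp
  also have "\<dots> = (1 + x + 4/3 * x^2) * (1 - x)" by (simp add: field_simps power2_eq_square power3_eq_cube)
  finally show ?thesis using assms by (simp add: divide_le_eq)
qed

text \<open>The size \<open>K\<close> of the coins keeps the rounding of \<open>pick\<close> below a
  \<open>1 / T\<close> fraction of the total weight in each round, hence below a factor
  \<open>exp 1\<close> over the whole game. The weights \<open>w\<close> of the final reweighting
  are known in advance and enter the game as parameters.\<close>

locale game = grid d r bp \<kappa> for d r bp \<kappa> +
  fixes F :: "point \<Rightarrow> real" and w \<eta> :: "nat \<Rightarrow> nat \<Rightarrow> real" and \<eta>0 :: real and k K T :: nat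
  assumes F: "\<And>z. 0 \<le> F z" "\<And>z. F z \<le> 1"
    and F0: "\<And>z i. i < d \<Longrightarrow> z i = 0 \<Longrightarrow> F z = 0"
    and w: "\<And>i j. 0 < w i j" "\<And>i j. w i j \<le> 1"
    and \<eta>: "\<And>i j. 0 < \<eta> i j" "\<And>i j. \<eta> i j \<le> 1/4" "0 < \<eta>0" "\<eta>0 \<le> 1/4"
    and K: "T * (d + 1) \<le> K" and T: "1 \<le> T"
begin

text \<open>The constraint \<open>(c, 0)\<close> asks that \<open>M\<close> have at least the marginal of \<open>F\<close> at the slice \<open>c\<close>,
  and \<open>(c, Suc i)\<close> that the marginal of \<open>M\<close> not decrease from \<open>lower c i\<close> to \<open>c\<close>.\<close>

definition constraints :: "(slice \<times> nat) set" where
  "constraints = {(c, j). c \<in> slices k \<and> (j = 0 \<or> (\<exists>i\<in>fst c. j = Suc i))}"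

definition Q :: real where "Q = (1 / \<kappa>) ^ k"

definition margin :: "slice \<times> nat \<Rightarrow> real" where
  "margin a = (case snd a of 0 \<Rightarrow> \<eta>0 | Suc i \<Rightarrow> \<eta> i (snd (fst a) i))"

text \<open>Since densities are at most \<open>Q\<close>, an update changes a weight by a relative
  amount of at most 1/4, and its second-order term is at most the fraction
  \<open>margin a / 3\<close> of the values that the constraint compares.\<close>

definition rate :: "slice \<times> nat \<Rightarrow> real" where
  "rate a = margin a / (8 * Q)"

definition demand :: "(slice \<times> nat \<Rightarrow> real) \<Rightarrow> point \<Rightarrow> nat \<Rightarrow> real" where
  "demand \<pi> z j = (\<Sum>a\<in>{a\<in>constraints. snd a = j}. rate a * \<pi> a * density w (fst a) z)"

definition gap :: "(point \<Rightarrow> nat) \<Rightarrow> point \<Rightarrow> slice \<times> nat \<Rightarrow> real" where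
  "gap \<beta> z a = (1 + margin a) * walk_value F \<beta> z - target F \<beta> (snd a) z"

definition update :: "(slice \<times> nat \<Rightarrow> real) \<Rightarrow> (point \<Rightarrow> nat) \<Rightarrow> point \<Rightarrow> slice \<times> nat \<Rightarrow> real" where
  "update \<pi> \<beta> z = (\<lambda>a. \<pi> a * (1 - rate a * (density w (fst a) z * gap \<beta> z a)))"

primrec weights :: "(nat \<Rightarrow> point \<times> (point \<Rightarrow> nat)) \<Rightarrow> nat \<Rightarrow> slice \<times> nat \<Rightarrow> real" where
  "weights \<xi> 0 = (\<lambda>_. 1)"
| "weights \<xi> (Suc t) = update (weights \<xi> t) (branch (demand (weights \<xi> t)) K (snd (\<xi> t))) (fst (\<xi> t))"

definition walk :: "(nat \<Rightarrow> point \<times> (point \<Rightarrow> nat)) \<Rightarrow> nat \<Rightarrow> point \<Rightarrow> nat" where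
  "walk \<xi> t = branch (demand (weights \<xi> t)) K (snd (\<xi> t))"

definition round_seed :: "(point \<times> (point \<Rightarrow> nat)) pmf" where
  "round_seed = pair_pmf pz (coins K)"

definition game_seed :: "(nat \<Rightarrow> point \<times> (point \<Rightarrow> nat)) pmf" where
  "game_seed = Pi_pmf {..<T} undefined (\<lambda>_. round_seed)"

section \<open>Ranges of the quantities of one round\<close>

lemma K_pos: "K > 0" using K T by (cases K) auto

lemma Q: "Q \<ge> 1" using kappa by (simp add: Q_def)

lemma weights_Suc: "weights \<xi> (Suc t) = update (weights \<xi> t) (walk \<xi> t) (fst (\<xi> t))"
  by (simp add: walk_def)

lemma weights_cong: "(\<And>s. s < t \<Longrightarrow> \<xi> s = \<xi>' s) \<Longrightarrow> weights \<xi> t = weights \<xi>' t"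
  by (induction t) auto

lemma walk_cong: "(\<And>s. s \<le> t \<Longrightarrow> \<xi> s = \<xi>' s) \<Longrightarrow> walk \<xi> t = walk \<xi>' t"
  using weights_cong[of t \<xi> \<xi>'] by (simp add: walk_def)

lemma constraints_sub: "constraints \<subseteq> slices k \<times> {..d}"
  unfolding constraints_def using slicesD(1) by fastforce

lemma finite_constraints: "finite constraints"
  using constraints_sub finite_slices finite_subset by blast

lemma card_constraints: "card constraints \<le> card (slices k) * (d + 1)"
  using card_mono[OF _ constraints_sub] finite_slices by (simp add: card_cartesian_product)

lemma constraint_slice: "a \<in> constraints \<Longrightarrow> fst a \<in> slices k"
  using constraints_sub by auto

lemma margin: "0 < margin a" "margin a \<le> 1/4"
  using \<eta> by (auto simp: margin_def split: nat.split)

lemma rate_pos: "0 < rate a" using margin Q by (auto simp: rate_def intro!: divide_pos_pos)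

lemma rate_Q: "rate a * Q = margin a / 8" using Q by (simp add: rate_def)

lemma weight_01: "0 < weight w A z" "weight w A z \<le> 1"
proof -
  show "0 < weight w A z" unfolding weight_def using w(1) by (rule prod_pos)
  show "weight w A z \<le> 1" unfolding weight_def using w by (intro prod_le_1) (simp add: less_imp_le)
qed

lemma density_01: assumes "c \<in> slices k" shows "0 \<le> density w c z" "density w c z \<le> Q"
proof -
  note m = slice_mass_ge[OF assms]
  show "0 \<le> density w c z" unfolding density_def using m weight_01 by (auto intro!: divide_nonneg_pos less_imp_le mult_nonneg_nonneg)
  have "density w c z \<le> 1 / slice_mass c"
    unfolding density_def using m weight_01 by (intro divide_right_mono) (auto simp: of_bool_def)
  also have "\<dots> \<le> Q" unfolding Q_def power_one_over using m kappa
    by (intro divide_left_mono) (auto intro!: mult_pos_pos)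
  finally show "density w c z \<le> Q" .
qed

lemma walk_value_01: "0 \<le> walk_value F \<beta> z" "walk_value F \<beta> z \<le> 1"
  using F by (auto simp: walk_value_def)

lemma target_01: "0 \<le> target F \<beta> j z" "target F \<beta> j z \<le> 1"
  using F walk_value_01 by (auto simp: target_def split: nat.split)

text \<open>The last bound charges the square of the gap to the two nonnegative values that it
  compares. This makes the second-order error of the game relative to the marginals instead of
  constant.\<close>

lemma gap_bounds: "- 1 \<le> gap \<beta> z a" "gap \<beta> z a \<le> 5/4"
    "(gap \<beta> z a)^2 \<le> 2 * ((1 + margin a) * walk_value F \<beta> z + target F \<beta> (snd a) z)"
proof -
  let ?m = "(1 + margin a) * walk_value F \<beta> z" and ?v = "target F \<beta> (snd a) z"
  have m: "0 \<le> ?m" "?m \<le> 5/4" "0 \<le> ?v" "?v \<le> 1"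
    using margin[of a] walk_value_01[of \<beta> z] target_01 mult_mono[of "1 + margin a" "5/4" "walk_value F \<beta> z" 1] by auto
  then show "- 1 \<le> gap \<beta> z a" "gap \<beta> z a \<le> 5/4" by (auto simp: gap_def)
  have "(?m - ?v)^2 = \<bar>?m - ?v\<bar> * \<bar>?m - ?v\<bar>" by (simp add: power2_eq_square)
  also have "\<dots> \<le> 2 * (?m + ?v)" using m by (intro mult_mono) auto
  finally show "(gap \<beta> z a)^2 \<le> 2 * (?m + ?v)" by (simp add: gap_def)
qed

lemma step_small:
  assumes "a \<in> constraints" shows "\<bar>rate a * (density w (fst a) z * gap \<beta> z a)\<bar> \<le> 1/4"
proof -
  have "\<bar>density w (fst a) z * gap \<beta> z a\<bar> \<le> Q * (5/4)"
    unfolding abs_mult using density_01[OF constraint_slice[OF assms], of z] gap_bounds[of \<beta> z a] by (intro mult_mono) auto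
  then have "rate a * \<bar>density w (fst a) z * gap \<beta> z a\<bar> \<le> rate a * (Q * (5/4))"
    using rate_pos[of a] by (intro mult_left_mono) auto
  also have "\<dots> = (margin a / 8) * (5/4)" by (simp add: rate_Q flip: mult.assoc)
  also have "\<dots> \<le> 1/4" using margin[of a] by simp
  finally show ?thesis using rate_pos[of a] by (simp add: abs_mult)
qed

lemma update_pos:
  "a \<in> constraints \<Longrightarrow> 0 < \<pi> a \<Longrightarrow> 0 < update \<pi> \<beta> z a"
  using step_small[of a z \<beta>] by (auto simp: update_def intro!: mult_pos_pos)

lemma weights_pos: "a \<in> constraints \<Longrightarrow> 0 < weights \<xi> t a"
  by (induction t) (auto intro: update_pos)

lemma finite_round: "finite (set_pmf round_seed)"
  unfolding round_seed_def using finite_pz finite_coins[OF K_pos] by simp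

lemma finite_game: "finite (set_pmf game_seed)"
  unfolding game_seed_def using finite_round by (intro finite_Pi_pmf) auto

lemma sum_by_kind:
  "(\<Sum>a\<in>constraints. h a) = (\<Sum>j\<le>d. \<Sum>a\<in>{a\<in>constraints. snd a = j}. h a)"
  using finite_constraints constraints_sub by (intro sum.group[symmetric]) auto

text \<open>The branch probabilities of the walk are proportional to \<open>demand\<close>, which makes the total
  weight a supermartingale, up to the rounding of the coins.\<close>

lemma total_weight_step:
  assumes \<pi>: "\<And>a. a \<in> constraints \<Longrightarrow> 0 < \<pi> a"
  shows "expect round_seed (\<lambda>y. \<Sum>a\<in>constraints. update \<pi> (branch (demand \<pi>) K (snd y)) (fst y) a)
    \<le> (1 + 1 / T) * (\<Sum>a\<in>constraints. \<pi> a)"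
proof -
  let ?P = "\<Sum>a\<in>constraints. \<pi> a"
  have "expect (coins K) (\<lambda>u. \<Sum>a\<in>constraints. update \<pi> (branch (demand \<pi>) K u) z a) \<le> (1 + 1 / T) * ?P"
    if z: "z \<in> X" for z
  proof -
    let ?W = "\<Sum>j\<le>d. demand \<pi> z j"
    let ?b = "\<lambda>u. branch (demand \<pi>) K u"
    let ?D = "\<lambda>u j. walk_value F (?b u) z - target F (?b u) j z"
    have q0: "0 \<le> demand \<pi> z j" for j
      unfolding demand_def using \<pi> rate_pos density_01 constraint_slice
      by (intro sum_nonneg mult_nonneg_nonneg) (auto intro: less_imp_le)
    have "?W = (\<Sum>a\<in>constraints. rate a * \<pi> a * density w (fst a) z)"
      unfolding sum_by_kind demand_def ..
    also have "\<dots> \<le> (\<Sum>a\<in>constraints. \<pi> a)"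
    proof (intro sum_mono)
      fix a assume a: "a \<in> constraints"
      have "rate a * density w (fst a) z \<le> rate a * Q"
        using density_01[OF constraint_slice[OF a]] rate_pos[of a] by (intro mult_left_mono) auto
      also have "\<dots> \<le> 1" using margin[of a] by (simp add: rate_Q)
      finally have "\<pi> a * (rate a * density w (fst a) z) \<le> \<pi> a * 1" using \<pi>[OF a] by (intro mult_left_mono) auto
      then show "rate a * \<pi> a * density w (fst a) z \<le> \<pi> a" by (simp add: mult_ac)
    qed
    finally have W: "?W \<le> ?P" .
    have P0: "0 \<le> ?P" using \<pi> by (intro sum_nonneg) (auto intro: less_imp_le)
    have upd: "(\<Sum>a\<in>constraints. update \<pi> (?b u) z a) \<le> ?P - (\<Sum>j\<le>d. demand \<pi> z j * ?D u j)" for u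
    proof -
      have "(\<Sum>a\<in>constraints. update \<pi> (?b u) z a) \<le> (\<Sum>a\<in>constraints. \<pi> a - rate a * \<pi> a * density w (fst a) z * ?D u (snd a))"
      proof (intro sum_mono)
        fix a assume a: "a \<in> constraints"
        \<comment> \<open>Without its margin the gap depends on \<open>a\<close> only through the
          branch \<open>snd a\<close>, so the sum over the constraints can be grouped into
          \<open>demand\<close>.\<close>
        have "?D u (snd a) \<le> gap (?b u) z a"
          using margin[of a] walk_value_01[of "?b u" z] by (simp add: gap_def distrib_right)
        then have "(rate a * \<pi> a * density w (fst a) z) * ?D u (snd a) \<le> (rate a * \<pi> a * density w (fst a) z) * gap (?b u) z a"
          using \<pi>[OF a] rate_pos[of a] density_01[OF constraint_slice[OF a]] by (intro mult_left_mono) auto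
        then show "update \<pi> (?b u) z a \<le> \<pi> a - rate a * \<pi> a * density w (fst a) z * ?D u (snd a)"
          by (simp add: update_def algebra_simps)
      qed
      also have "\<dots> = ?P - (\<Sum>j\<le>d. demand \<pi> z j * ?D u j)"
        unfolding sum_subtractf sum_by_kind[of "\<lambda>a. rate a * \<pi> a * density w (fst a) z * ?D u (snd a)"] demand_def sum_distrib_right
        by simp
      finally show ?thesis .
    qed
    have "expect (coins K) (\<lambda>u. \<Sum>a\<in>constraints. update \<pi> (?b u) z a)
        \<le> expect (coins K) (\<lambda>u. ?P - (\<Sum>j\<le>d. demand \<pi> z j * ?D u j))"
      using finite_coins[OF K_pos] upd by (intro expect_mono) auto
    also have "\<dots> = ?P - expect (coins K) (\<lambda>u. \<Sum>j\<le>d. demand \<pi> z j * ?D u j)"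
      using finite_coins[OF K_pos] by (simp add: expect_diff)
    also have "\<dots> \<le> ?P + ?W * (real d + 1) / K"
    proof -
      have "- (?W * (real d + 1) / K) \<le> expect (coins K) (\<lambda>u. \<Sum>j\<le>d. demand \<pi> z j * ?D u j)"
        by (rule walk_balance[where q="demand \<pi>", OF z q0 F _ K_pos]) (rule F0)
      then show ?thesis by linarith
    qed
    also have "?W * (real d + 1) / K \<le> ?P * (1 / T)"
    proof -
      have "real (T * (d + 1)) \<le> real K" using K by (simp only: of_nat_le_iff)
      then have "(real d + 1) / K \<le> 1 / T" using K_pos T by (simp add: field_simps)
      then have "?W * ((real d + 1) / K) \<le> ?P * (1 / T)" using W P0 by (intro mult_mono) auto
      then show ?thesis by simp
    qed
    finally show ?thesis by (simp add: algebra_simps)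
  qed
  then have "expect pz (\<lambda>z. expect (coins K) (\<lambda>u. \<Sum>a\<in>constraints. update \<pi> (branch (demand \<pi>) K u) z a)) \<le> (1 + 1 / T) * ?P"
    using set_pz by (intro expect_le_const[OF finite_pz]) auto
  then show ?thesis using finite_pz finite_coins[OF K_pos] by (simp add: round_seed_def expect_pair)
qed

text \<open>Resampling round \<open>t\<close> takes the place of the conditional expectation given
  the other rounds. This is the induction step of both supermartingale arguments.\<close>

lemma expect_game_step:
  assumes "t < T"
    "\<And>\<xi>. expect round_seed (\<lambda>y. g (\<xi>(t := y))) \<le> h \<xi>"
  shows "expect game_seed g \<le> expect game_seed h"
proof -
  have "expect game_seed g = expect game_seed (\<lambda>\<xi>. expect round_seed (\<lambda>y. g (\<xi>(t := y))))"
    unfolding game_seed_def using assms finite_round by (intro expect_resample1) auto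
  also have "\<dots> \<le> expect game_seed h" using assms by (intro expect_mono finite_game)
  finally show ?thesis .
qed

lemma total_weight:
  "expect game_seed (\<lambda>\<xi>. \<Sum>a\<in>constraints. weights \<xi> T a) \<le> 3 * card constraints"
proof -
  have "t \<le> T \<Longrightarrow> expect game_seed (\<lambda>\<xi>. \<Sum>a\<in>constraints. weights \<xi> t a) \<le> (1 + 1 / T) ^ t * card constraints" for t
  proof (induction t)
    case (Suc t)
    have "expect game_seed (\<lambda>\<xi>. \<Sum>a\<in>constraints. weights \<xi> (Suc t) a)
        \<le> expect game_seed (\<lambda>\<xi>. (1 + 1 / T) * (\<Sum>a\<in>constraints. weights \<xi> t a))"
    proof (rule expect_game_step)
      fix \<xi>
      have "weights (\<xi>(t := y)) t = weights \<xi> t" for y by (rule weights_cong) auto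
      then show "expect round_seed (\<lambda>y. \<Sum>a\<in>constraints. weights (\<xi>(t := y)) (Suc t) a) \<le> (1 + 1 / T) * (\<Sum>a\<in>constraints. weights \<xi> t a)"
        using total_weight_step[of "weights \<xi> t"] weights_pos by simp
    qed (use Suc in auto)
    also have "\<dots> = (1 + 1 / T) * expect game_seed (\<lambda>\<xi>. \<Sum>a\<in>constraints. weights \<xi> t a)" by simp
    also have "\<dots> \<le> (1 + 1 / T) * ((1 + 1 / T) ^ t * card constraints)" using Suc by (intro mult_left_mono) auto
    finally show ?case by simp
  qed simp
  from this[of T] have "expect game_seed (\<lambda>\<xi>. \<Sum>a\<in>constraints. weights \<xi> T a) \<le> (1 + 1 / T) ^ T * card constraints" by simp
  also have "(1 + 1 / real T) ^ T \<le> exp 1"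
    using exp_ge_one_plus_x_over_n_power_n[of T 1] T by simp
  also have "exp 1 \<le> (3::real)" by (rule exp_le)
  finally show ?thesis by (simp add: mult_right_mono)
qed

text \<open>The mean \<open>(1 + margin a) * m - v\<close> of the gap in the slice, where
  \<open>m\<close> and \<open>v\<close> are the marginals of the walk value and of the target, plus
  the bound \<open>margin a / 3 * ((1 + margin a) * m + v)\<close> for the second-order
  term.\<close>

definition drift :: "(point \<Rightarrow> nat) \<Rightarrow> slice \<times> nat \<Rightarrow> real" where
  "drift \<beta> a = (1 + margin a) * (1 + margin a / 3) * mgw w (fst a) (walk_value F \<beta>)
    - (1 - margin a / 3) * mgw w (fst a) (target F \<beta> (snd a))"

text \<open>The reciprocal is expanded to second order; \<open>gap_bounds\<close> and
  \<open>rate_Q\<close> convert the quadratic term into a multiple of the values compared, whose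
  expectations are again marginals of the slice.\<close>

lemma inverse_step:
  assumes a: "a \<in> constraints"
  shows "expect pz (\<lambda>z. 1 / (1 - rate a * (density w (fst a) z * gap \<beta> z a))) \<le> exp (rate a * drift \<beta> a)"
proof -
  note c = constraint_slice[OF a]
  let ?p = "density w (fst a)" and ?g = "\<lambda>z. gap \<beta> z a" and ?s = "rate a" and ?e = "margin a"
  let ?S = "\<lambda>z. (1 + ?e) * walk_value F \<beta> z + target F \<beta> (snd a) z"
  let ?m = "mgw w (fst a) (walk_value F \<beta>)" and ?v = "mgw w (fst a) (target F \<beta> (snd a))"
  have Eg: "expect pz (\<lambda>z. ?p z * ?g z) = (1 + ?e) * ?m - ?v"
    using expect_density[OF c, of w ?g] finite_pz
    by (simp add: gap_def mgw_def right_diff_distrib expect_diff mult.left_commute[of _ "1 + ?e"])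
  have ES: "expect pz (\<lambda>z. ?p z * ?S z) = (1 + ?e) * ?m + ?v"
    using expect_density[OF c, of w ?S] finite_pz
    by (simp add: mgw_def distrib_left expect_add mult.left_commute[of _ "1 + ?e"])
  have pt: "1 / (1 - ?s * (?p z * ?g z)) \<le> 1 + (?s * (?p z * ?g z) + ?s * (?e / 3) * (?p z * ?S z))" for z
  proof -
    note p = density_01[OF c, of z]
    have "(?s * (?p z * ?g z))^2 = ?s * (?s * ?p z) * ?p z * (?g z)^2" by (simp add: power2_eq_square)
    also have "\<dots> \<le> ?s * (?s * Q) * ?p z * (2 * ?S z)"
      using p rate_pos[of a] gap_bounds[of \<beta> z a] by (intro mult_mono mult_nonneg_nonneg) auto
    also have "\<dots> = ?s * (?e / 4) * (?p z * ?S z)" by (simp add: rate_Q)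
    finally have "4/3 * (?s * (?p z * ?g z))^2 \<le> ?s * (?e / 3) * (?p z * ?S z)" by simp
    then show ?thesis using inverse_quadratic_bound[OF step_small[OF a, of z \<beta>]] by linarith
  qed
  have "expect pz (\<lambda>z. 1 / (1 - ?s * (?p z * ?g z))) \<le> expect pz (\<lambda>z. 1 + (?s * (?p z * ?g z) + ?s * (?e / 3) * (?p z * ?S z)))"
    using pt by (intro expect_mono finite_pz)
  also have "\<dots> = 1 + (?s * ((1 + ?e) * ?m - ?v) + ?s * (?e / 3) * ((1 + ?e) * ?m + ?v))"
    using finite_pz Eg ES by (simp add: expect_add)
  also have "\<dots> = 1 + ?s * drift \<beta> a" by (simp add: drift_def algebra_simps add_divide_distrib)
  also have "\<dots> \<le> exp (?s * drift \<beta> a)" by (rule exp_ge_add_one_self)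
  finally show ?thesis .
qed

text \<open>A supermartingale that starts at 1. Through Markov's inequality it shows that the
  sampled weights are not much smaller than their drift predicts.\<close>

definition deviation :: "(nat \<Rightarrow> point \<times> (point \<Rightarrow> nat)) \<Rightarrow> nat \<Rightarrow> slice \<times> nat \<Rightarrow> real" where
  "deviation \<xi> t a = exp (- (\<Sum>s<t. rate a * drift (walk \<xi> s) a)) / weights \<xi> t a"

lemma deviation_expect:
  assumes a: "a \<in> constraints" shows "expect game_seed (\<lambda>\<xi>. deviation \<xi> T a) \<le> 1"
proof -
  have "t \<le> T \<Longrightarrow> expect game_seed (\<lambda>\<xi>. deviation \<xi> t a) \<le> 1" for t
  proof (induction t)
    case (Suc t)
    have "expect game_seed (\<lambda>\<xi>. deviation \<xi> (Suc t) a) \<le> expect game_seed (\<lambda>\<xi>. deviation \<xi> t a)"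
    proof (rule expect_game_step)
      fix \<xi>
      let ?b = "\<lambda>u. branch (demand (weights \<xi> t)) K u"
      let ?e = "\<lambda>b z. rate a * (density w (fst a) z * gap b z a)"
      have W: "weights (\<xi>(t := y)) t = weights \<xi> t" for y by (rule weights_cong) auto
      have walk: "walk (\<xi>(t := y)) s = walk \<xi> s" if "s < t" for y s using that by (intro walk_cong) auto
      have "deviation (\<xi>(t := y)) (Suc t) a
          = deviation \<xi> t a * (exp (- rate a * drift (?b (snd y)) a) * (1 / (1 - ?e (?b (snd y)) (fst y))))" for y
        using W walk weights_pos[OF a, of \<xi> t]
        by (simp add: deviation_def weights_Suc update_def walk_def[of _ t] exp_add exp_diff exp_minus divide_simps)
      moreover have "expect round_seed (\<lambda>y. exp (- rate a * drift (?b (snd y)) a) * (1 / (1 - ?e (?b (snd y)) (fst y)))) \<le> 1"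
      proof -
        \<comment> \<open>The coins are drawn first: they fix the walk of this round, and
          \<open>inverse_step\<close> then applies to the sampled grid point.\<close>
        have "expect round_seed (\<lambda>y. exp (- rate a * drift (?b (snd y)) a) * (1 / (1 - ?e (?b (snd y)) (fst y))))
           = expect (pair_pmf (coins K) pz) (\<lambda>y. exp (- rate a * drift (?b (fst y)) a) * (1 / (1 - ?e (?b (fst y)) (snd y))))"
          unfolding round_seed_def by (subst pair_commute_pmf) (simp add: case_prod_unfold)
        also have "\<dots> = expect (coins K) (\<lambda>u. exp (- rate a * drift (?b u) a) * expect pz (\<lambda>z. 1 / (1 - ?e (?b u) z)))"
          using finite_pz finite_coins[OF K_pos] by (simp only: expect_pair fst_conv snd_conv integral_mult_right_zero)
        also have "\<dots> \<le> 1"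
        proof (rule expect_le_const[OF finite_coins[OF K_pos]])
          fix u
          have "exp (- rate a * drift (?b u) a) * expect pz (\<lambda>z. 1 / (1 - ?e (?b u) z))
              \<le> exp (- rate a * drift (?b u) a) * exp (rate a * drift (?b u) a)"
            using inverse_step[OF a] by (intro mult_left_mono) auto
          then show "exp (- rate a * drift (?b u) a) * expect pz (\<lambda>z. 1 / (1 - ?e (?b u) z)) \<le> 1"
            by (simp flip: exp_add)
        qed
        finally show ?thesis .
      qed
      moreover have "0 \<le> deviation \<xi> t a" using weights_pos[OF a, of \<xi> t] by (simp add: deviation_def)
      ultimately show "expect round_seed (\<lambda>y. deviation (\<xi>(t := y)) (Suc t) a) \<le> deviation \<xi> t a"
        by (simp only: integral_mult_right_zero) (rule mult_left_le)
    qed (use Suc in auto)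
    then show ?case using Suc by simp
  qed (simp add: deviation_def)
  then show ?thesis by simp
qed

definition payoff :: "(nat \<Rightarrow> point \<times> (point \<Rightarrow> nat)) \<Rightarrow> slice \<Rightarrow> real" where
  "payoff \<xi> c = (\<Sum>t<T. mgw w c (walk_value F (walk \<xi> t)))"

text \<open>The usual guarantee of multiplicative weights, for sums over the rounds: a relative
  error proportional to the margin, and an additive error that does not grow with
  \<open>T\<close>.\<close>

definition regret_bound :: "real \<Rightarrow> (nat \<Rightarrow> point \<times> (point \<Rightarrow> nat)) \<Rightarrow> bool" where
  "regret_bound L \<xi> \<longleftrightarrow> (\<forall>c\<in>slices k.
     T * mgw w c F \<le> (1 + 2 * \<eta>0) * payoff \<xi> c + 32 * Q * L / \<eta>0 \<and>
     (\<forall>i\<in>fst c. payoff \<xi> (lower c i) \<le> (1 + 2 * \<eta> i (snd c i)) * payoff \<xi> c + 32 * Q * L / \<eta> i (snd c i)))"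

text \<open>Markov's inequality bounds the total weight by \<open>?B\<close>, and with a union bound
  it gives the same for every \<open>deviation\<close>. Otherwise
  \<open>exp (- (\<Sum>s<T. rate a * drift (walk \<xi> s) a))\<close> is at most
  \<open>?B * ?B = exp (2 * L)\<close>, and division by \<open>rate a\<close> leaves the
  regret.\<close>

lemma prob_regret_bound:
  assumes \<delta>: "0 < \<delta>" "\<delta> \<le> 1" and L: "L = ln (3 * real (card constraints) / \<delta>)"
  shows "measure_pmf.prob game_seed {\<xi>. \<not> regret_bound L \<xi>} \<le> 2 * \<delta>"
proof (cases "constraints = {}")
  case True
  then have "slices k = {}" by (auto simp: constraints_def)
  then show ?thesis using \<delta> by (simp add: regret_bound_def)
next
  case False
  let ?N = "real (card constraints)"
  have N: "?N \<ge> 1" using False finite_constraints by (simp add: card_gt_0_iff Suc_le_eq)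
  let ?B = "3 * ?N / \<delta>"
  have B: "?B > 0" using N \<delta> by simp
  have eL: "exp L = ?B" unfolding L using B by (rule exp_ln)
  let ?bad1 = "\<lambda>\<xi>. (\<Sum>a\<in>constraints. weights \<xi> T a) \<ge> ?B"
  let ?bad2 = "\<lambda>a \<xi>. deviation \<xi> T a \<ge> ?B"
  have b1: "measure_pmf.prob game_seed {\<xi>. ?bad1 \<xi>} \<le> \<delta>"
  proof -
    have "measure_pmf.prob game_seed {\<xi>. ?bad1 \<xi>} \<le> expect game_seed (\<lambda>\<xi>. \<Sum>a\<in>constraints. weights \<xi> T a) / ?B"
      by (rule markov_pmf[OF finite_game _ B]) (intro sum_nonneg less_imp_le weights_pos)
    also have "\<dots> \<le> 3 * ?N / ?B" using total_weight B by (intro divide_right_mono) auto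
    finally show ?thesis using N \<delta> by simp
  qed
  have "measure_pmf.prob game_seed {\<xi>. ?bad2 a \<xi>} \<le> \<delta> / ?N" if a: "a \<in> constraints" for a
  proof -
    have "measure_pmf.prob game_seed {\<xi>. ?bad2 a \<xi>} \<le> expect game_seed (\<lambda>\<xi>. deviation \<xi> T a) / ?B"
      using B weights_pos[OF a] by (intro markov_pmf finite_game) (auto simp: deviation_def intro!: divide_nonneg_pos)
    also have "\<dots> \<le> 1 / ?B" using deviation_expect[OF a] B by (intro divide_right_mono) auto
    also have "\<dots> \<le> \<delta> / ?N" using N \<delta> by (simp add: field_simps)
    finally show ?thesis .
  qed
  then have b2: "measure_pmf.prob game_seed {\<xi>. \<exists>a\<in>constraints. ?bad2 a \<xi>} \<le> \<delta>"
    using prob_Ex_le[OF finite_constraints, of game_seed ?bad2 "\<delta> / ?N"] N by simp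
  have good: "regret_bound L \<xi>" if g: "\<not> ?bad1 \<xi>" "\<not> (\<exists>a\<in>constraints. ?bad2 a \<xi>)" for \<xi>
  proof -
    have key: "(\<Sum>t<T. mgw w (fst a) (target F (walk \<xi> t) (snd a))) \<le> (1 + 2 * margin a) * payoff \<xi> (fst a) + 32 * Q * L / margin a"
      if a: "a \<in> constraints" for a
    proof -
      let ?e = "margin a" and ?V = "\<Sum>t<T. mgw w (fst a) (target F (walk \<xi> t) (snd a))" and ?M = "payoff \<xi> (fst a)"
      have "weights \<xi> T a \<le> (\<Sum>a\<in>constraints. weights \<xi> T a)"
        using weights_pos finite_constraints a by (intro member_le_sum) (auto intro: less_imp_le)
      then have w1: "weights \<xi> T a < ?B" using g by auto
      have w2: "deviation \<xi> T a < ?B" using g a by auto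
      note wp = weights_pos[OF a, of \<xi> T]
      have "exp (- (\<Sum>s<T. rate a * drift (walk \<xi> s) a)) = deviation \<xi> T a * weights \<xi> T a"
        using wp by (simp add: deviation_def)
      also have "\<dots> \<le> ?B * ?B" using w1 w2 wp by (intro mult_mono) (auto simp: deviation_def)
      also have "\<dots> = exp (2 * L)" by (simp only: mult_2 exp_add eL)
      finally have "- (\<Sum>s<T. rate a * drift (walk \<xi> s) a) \<le> 2 * L" by simp
      then have "- (rate a * (\<Sum>s<T. drift (walk \<xi> s) a)) \<le> 2 * L" by (simp add: sum_distrib_left)
      then have "- (\<Sum>s<T. drift (walk \<xi> s) a) \<le> 2 * L / rate a"
        using rate_pos[of a] by (simp add: pos_le_divide_eq mult.commute)
      moreover have "2 * L / rate a = 16 * Q * L / ?e" using Q margin[of a] by (simp add: rate_def field_simps)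
      moreover have "(\<Sum>s<T. drift (walk \<xi> s) a) = (1 + ?e) * (1 + ?e/3) * ?M - (1 - ?e/3) * ?V"
        by (simp add: drift_def payoff_def sum_subtractf sum_distrib_left)
      ultimately have 1: "(1 - ?e/3) * ?V \<le> (1 + ?e) * (1 + ?e/3) * ?M + 16 * Q * L / ?e" by linarith
      have M0: "0 \<le> ?M" unfolding payoff_def mgw_def using weight_01 walk_value_01
        by (intro sum_nonneg expect_nonneg mult_nonneg_nonneg) (auto intro: less_imp_le)
      have "?B \<ge> 1" using N \<delta> by (simp add: field_simps)
      then have L0': "0 \<le> 16 * Q * L / ?e" using Q margin[of a] by (auto simp: L intro!: divide_nonneg_pos mult_nonneg_nonneg)
      have e: "0 < ?e" "?e \<le> 1/4" using margin by auto
      \<comment> \<open>The difference of the two sides is \<open>?e / 3 - ?e^2\<close>. Here the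
        relative error \<open>2 * ?e\<close> absorbs the margin together with both second-order
        corrections.\<close>
      have 2: "(1 + ?e) * (1 + ?e/3) \<le> (1 - ?e/3) * (1 + 2 * ?e)"
      proof -
        have "?e * ?e \<le> ?e * (1/4)" using e by (intro mult_left_mono) auto
        then show ?thesis using e by (simp add: algebra_simps add_divide_distrib)
      qed
      have "(1 - ?e/3) * ?V \<le> (1 - ?e/3) * (1 + 2 * ?e) * ?M + (1 - ?e/3) * (32 * Q * L / ?e)"
      proof -
        have "(1 + ?e) * (1 + ?e/3) * ?M \<le> (1 - ?e/3) * (1 + 2 * ?e) * ?M" using 2 M0 by (intro mult_right_mono)
        moreover have "(1/2) * (32 * Q * L / ?e) \<le> (1 - ?e/3) * (32 * Q * L / ?e)" using e L0' by (intro mult_right_mono) auto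
        moreover have "(1/2) * (32 * Q * L / ?e) = 16 * Q * L / ?e" by simp
        ultimately show ?thesis using 1 by linarith
      qed
      then have "(1 - ?e/3) * ?V \<le> (1 - ?e/3) * ((1 + 2 * ?e) * ?M + 32 * Q * L / ?e)" by (simp add: algebra_simps)
      then show ?thesis using e by (subst (asm) mult_le_cancel_left_pos) auto
    qed
    show ?thesis unfolding regret_bound_def
    proof (intro ballI conjI)
      fix c assume c: "c \<in> slices k"
      have "(c, 0) \<in> constraints" using c by (simp add: constraints_def)
      from key[OF this] show "T * mgw w c F \<le> (1 + 2 * \<eta>0) * payoff \<xi> c + 32 * Q * L / \<eta>0"
        by (simp add: margin_def target_def[abs_def])
      fix i assume i: "i \<in> fst c"
      then have "(c, Suc i) \<in> constraints" using c by (simp add: constraints_def)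
      have "mgw w c (\<lambda>z. walk_value F (walk \<xi> t) (z(i := z i - 1))) = mgw w (lower c i) (walk_value F (walk \<xi> t))" for t
        using i by (rule mgw_lower)
      with key[OF \<open>(c, Suc i) \<in> constraints\<close>]
      show "payoff \<xi> (lower c i) \<le> (1 + 2 * \<eta> i (snd c i)) * payoff \<xi> c + 32 * Q * L / \<eta> i (snd c i)"
        by (simp add: margin_def target_def[abs_def] payoff_def del: One_nat_def)
    qed
  qed
  have "measure_pmf.prob game_seed {\<xi>. \<not> regret_bound L \<xi>} \<le> measure_pmf.prob game_seed {\<xi>. ?bad1 \<xi> \<or> (\<exists>a\<in>constraints. ?bad2 a \<xi>)}"
    by (rule measure_pmf.finite_measure_mono) (use good in \<open>blast, simp\<close>)
  also have "\<dots> \<le> 2 * \<delta>" using prob_Un_le[of game_seed ?bad1 "\<lambda>\<xi>. \<exists>a\<in>constraints. ?bad2 a \<xi>"] b1 b2 by linarith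
  finally show ?thesis .
qed

end

section \<open>Pruning\<close>

text \<open>In a decreasing sequence the union over a set of times is the member at the first of
  these times. This counts the queries for one slice over all steps of the pruning.\<close>

lemma bounded_union_of_chain:
  fixes D :: "nat \<Rightarrow> 'a set"
  assumes "\<And>s t. s \<le> t \<Longrightarrow> D t \<subseteq> D s" "\<And>t. P t \<Longrightarrow> finite (D t) \<and> card (D t) \<le> m"
  shows "finite (\<Union>t\<in>{t. P t}. D t) \<and> card (\<Union>t\<in>{t. P t}. D t) \<le> m"
proof (cases "\<exists>t. P t")
  case True
  define t0 where "t0 = (LEAST t. P t)"
  have t0: "P t0" unfolding t0_def using True by (auto intro: LeastI)
  have "t0 \<le> t" if "P t" for t unfolding t0_def using that by (rule Least_le)
  then have "(\<Union>t\<in>{t. P t}. D t) = D t0" using assms(1)[of t0] t0 by blast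
  then show ?thesis using assms(2)[OF t0] by simp
qed auto

definition alive :: "nat \<Rightarrow> slice set \<Rightarrow> point \<Rightarrow> bool" where
  "alive d K z \<longleftrightarrow> (\<forall>i<d. 1 \<le> z i) \<and> (\<forall>c\<in>K. \<not> in_slice c z)"

text \<open>The number of samples of a slice is inversely proportional to its alive mass. Rounded up
  to a power of 2 it takes few values while the mass shrinks, so that the same samples are reused
  over many steps.\<close>

definition level_of :: "real \<Rightarrow> nat" where
  "level_of a = nat \<lceil>log 2 (1 / a)\<rceil>"

lemma level_of:
  assumes "0 < a" "a \<le> 1"
  shows "1 \<le> 2 ^ level_of a * a" "2 ^ level_of a * a \<le> 2"
proof -
  have l: "0 \<le> log 2 (1 / a)" using assms by (simp add: zero_le_log_cancel_iff)
  have c: "real (level_of a) = of_int \<lceil>log 2 (1 / a)\<rceil>" unfolding level_of_def using l by (simp add: of_nat_nat)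
  have "1 / a = 2 powr (log 2 (1 / a))" using assms by simp
  also have "\<dots> \<le> 2 powr (real (level_of a))" using c by (intro powr_mono) auto
  also have "\<dots> = 2 ^ level_of a" by (simp add: powr_realpow)
  finally show "1 \<le> 2 ^ level_of a * a" using assms by (simp add: field_simps)
  have "2 ^ level_of a = 2 powr (real (level_of a))" by (simp add: powr_realpow)
  also have "\<dots> \<le> 2 powr (log 2 (1 / a) + 1)" 
  proof (intro powr_mono)
    show "real (level_of a) \<le> log 2 (1 / a) + 1" using c by linarith
  qed simp
  also have "\<dots> = 2 / a" using assms by (simp add: powr_add)
  finally show "2 ^ level_of a * a \<le> 2" using assms by (simp add: field_simps)
qed

lemma level_of_antimono: "0 < a \<Longrightarrow> a \<le> b \<Longrightarrow> level_of b \<le> level_of a"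
  unfolding level_of_def by (intro nat_mono ceiling_mono) (simp add: divide_left_mono)

locale pruning = grid d r bp \<kappa> for d r bp \<kappa> +
  fixes k n :: nat and \<epsilon>1 \<rho> :: real
  assumes eps1: "0 < \<epsilon>1" "\<epsilon>1 \<le> 1" and rho: "0 < \<rho>" "\<rho> \<le> 1" and n: "1 \<le> n"
begin

definition admissible :: "(point \<Rightarrow> real) \<Rightarrow> bool" where
  "admissible F \<longleftrightarrow> (\<forall>z. 0 \<le> F z \<and> F z \<le> 1) \<and> (\<forall>z. \<forall>i<d. z i = 0 \<longrightarrow> F z = 0)"

definition cut :: "(point \<Rightarrow> real) \<Rightarrow> slice set \<Rightarrow> point \<Rightarrow> real" where
  "cut F K z = F z * of_bool (alive d K z)"

text \<open>Determined by the known distribution and the removed slices, hence available without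
  queries.\<close>

definition alive_mass :: "slice set \<Rightarrow> slice \<Rightarrow> real" where
  "alive_mass K c = mg c (\<lambda>z. of_bool (alive d K z))"

definition samples :: "slice set \<Rightarrow> slice \<Rightarrow> nat" where
  "samples K c = n * 2 ^ level_of (alive_mass K c)"

definition sample :: "(slice \<times> nat \<Rightarrow> point) \<Rightarrow> slice \<Rightarrow> nat \<Rightarrow> point" where
  "sample \<zeta> c s = override c (\<zeta> (c, s))"

definition live_samples :: "(slice \<times> nat \<Rightarrow> point) \<Rightarrow> slice set \<Rightarrow> slice \<Rightarrow> nat set" where
  "live_samples \<zeta> K c = {s. s < samples K c \<and> alive d K (sample \<zeta> c s)}"

text \<open>The cap makes the query bound valid for every seed; it is tested before \<open>F\<close>
  is read. About \<open>n\<close> to \<open>2 * n\<close> live samples are expected, and a Chernoff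
  bound with slack \<open>n\<close> gives \<open>2 * (2 * n) + n = 5 * n\<close>. Slices of alive
  mass below \<open>\<rho>\<close> would need too many samples.\<close>

definition measured :: "(slice \<times> nat \<Rightarrow> point) \<Rightarrow> slice set \<Rightarrow> slice \<Rightarrow> bool" where
  "measured \<zeta> K c \<longleftrightarrow> \<rho> \<le> alive_mass K c \<and> card (live_samples \<zeta> K c) \<le> 5 * n"

text \<open>An estimate of \<open>mg c (cut F K)\<close> that queries \<open>F\<close> only at live samples.\<close>

definition est :: "(point \<Rightarrow> real) \<Rightarrow> (slice \<times> nat \<Rightarrow> point) \<Rightarrow> slice set \<Rightarrow> slice \<Rightarrow> real" where
  "est F \<zeta> K c = (if measured \<zeta> K c then (\<Sum>s<samples K c. cut F K (sample \<zeta> c s)) / samples K c else 0)"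

text \<open>The first term charges the values of \<open>F\<close> lost with a slice to the alive
  mass that disappears with it, a quantity that telescopes over the removals. The floor
  \<open>\<rho>\<close> is what the marginals of minimal survivors inherit.\<close>

definition threshold :: "slice set \<Rightarrow> slice \<Rightarrow> real" where
  "threshold K c = max (\<epsilon>1 * alive_mass K c) \<rho>"

text \<open>Slices are tested from the bottom up, which keeps the set of removed slices closed
  downwards. Level 1 has no slice below it.\<close>

definition minimal :: "slice set \<Rightarrow> slice \<Rightarrow> bool" where
  "minimal K c \<longleftrightarrow> (\<forall>i\<in>fst c. 2 \<le> snd c i \<longrightarrow> lower c i \<in> K)"

definition failing :: "(point \<Rightarrow> real) \<Rightarrow> (slice \<times> nat \<Rightarrow> point) \<Rightarrow> slice set \<Rightarrow> slice set \<Rightarrow> slice set" where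
  "failing F \<zeta> J K = {c \<in> slices k - K - J. minimal K c \<and> est F \<zeta> K c < 2 * threshold K c}"

text \<open>The least element in a fixed enumeration. The choice has to be stable: discarding an
  element that is not chosen does not change it (\<open>first_diff\<close>).\<close>

definition first :: "slice set \<Rightarrow> slice" where
  "first S = inv_into (slices k) (to_nat_on (slices k)) (Min (to_nat_on (slices k) ` S))"

text \<open>The slices in \<open>J\<close> are immune: the algorithm uses \<open>J = {}\<close>, and \<open>J = {c}\<close> gives a process
  that is independent of the samples of \<open>c\<close> but agrees with the algorithm as long as that one
  does not remove \<open>c\<close>.\<close>

primrec removed :: "(point \<Rightarrow> real) \<Rightarrow> (slice \<times> nat \<Rightarrow> point) \<Rightarrow> slice set \<Rightarrow> nat \<Rightarrow> slice set" where
  "removed F \<zeta> J 0 = {}"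
| "removed F \<zeta> J (Suc t) = (let K = removed F \<zeta> J t; S = failing F \<zeta> J K
    in if S = {} then K else insert (first S) K)"

definition max_samples :: nat where "max_samples = n * 2 ^ level_of \<rho>"

definition prune_seed :: "(slice \<times> nat \<Rightarrow> point) pmf" where
  "prune_seed = Pi_pmf (slices k \<times> {..<max_samples}) undefined (\<lambda>_. pz)"

definition accurate :: "(point \<Rightarrow> real) \<Rightarrow> (slice \<times> nat \<Rightarrow> point) \<Rightarrow> slice set \<Rightarrow> slice \<Rightarrow> bool" where
  "accurate F \<zeta> K c \<longleftrightarrow> alive_mass K c < \<rho> \<or> (card (live_samples \<zeta> K c) \<le> 5 * n \<and>
     mg c (cut F K) / 2 - threshold K c \<le> est F \<zeta> K c \<and> est F \<zeta> K c \<le> 2 * mg c (cut F K) + threshold K c)"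

text \<open>\<open>removed F \<zeta> {c} t\<close> does not depend on the samples of
  \<open>c\<close>, so each of these events is as likely as for a fixed set of removed slices, and a
  union bound over slices and times is affordable.\<close>

definition all_accurate :: "(point \<Rightarrow> real) \<Rightarrow> (slice \<times> nat \<Rightarrow> point) \<Rightarrow> bool" where
  "all_accurate F \<zeta> \<longleftrightarrow> (\<forall>c\<in>slices k. \<forall>t\<le>card (slices k). accurate F \<zeta> (removed F \<zeta> {c} t) c)"

text \<open>The set of the slices that have been removed, not of those that survive. A step removes
  a new slice as long as one fails, so the process is stationary after
  \<open>card (slices k)\<close> steps (\<open>failing_final\<close>).\<close>

definition survivors_cut :: "(point \<Rightarrow> real) \<Rightarrow> (slice \<times> nat \<Rightarrow> point) \<Rightarrow> slice set" where
  "survivors_cut F \<zeta> = removed F \<zeta> {} (card (slices k))"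

section \<open>The pruning process and its dependence on the samples\<close>

lemma cut_01: "admissible F \<Longrightarrow> 0 \<le> cut F K z" "admissible F \<Longrightarrow> cut F K z \<le> 1"
  by (auto simp: cut_def admissible_def)

lemma admissible_cut: "admissible F \<Longrightarrow> admissible (cut F K)"
  by (auto simp: cut_def admissible_def)

lemma mg_le: "(\<And>z. f z \<le> g z) \<Longrightarrow> mg c f \<le> mg c g"
  unfolding mg_def by (intro expect_mono finite_pz)

lemma alive_mass_01: "0 \<le> alive_mass K c" "alive_mass K c \<le> 1"
  unfolding alive_mass_def mg_def by (auto intro!: expect_nonneg expect_le_const[OF finite_pz])

lemma mg_cut_le: "admissible F \<Longrightarrow> mg c (cut F K) \<le> alive_mass K c"
  unfolding alive_mass_def by (rule mg_le) (auto simp: cut_def admissible_def)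

lemma mg_cut_nonneg: "admissible F \<Longrightarrow> 0 \<le> mg c (cut F K)"
  unfolding mg_def by (intro expect_nonneg cut_01)

lemma samples_le: "\<rho> \<le> alive_mass K c \<Longrightarrow> samples K c \<le> max_samples"
  unfolding samples_def max_samples_def using level_of_antimono rho by (intro mult_le_mono2 power_increasing) auto

lemma threshold_pos: "0 < threshold K c" "\<rho> \<le> threshold K c" using rho by (auto simp: threshold_def)

lemma finite_live: "finite (live_samples \<zeta> K c)"
  by (simp add: live_samples_def)

lemma first_in:
  assumes "S \<subseteq> slices k" "S \<noteq> {}" shows "first S \<in> S"
proof -
  let ?f = "to_nat_on (slices k)"
  have inj: "inj_on ?f (slices k)" by (intro inj_on_to_nat_on countable_finite finite_slices)
  have "finite S" using assms finite_slices finite_subset by blast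
  then have "Min (?f ` S) \<in> ?f ` S" using assms by (intro Min_in) auto
  then obtain c where "c \<in> S" "Min (?f ` S) = ?f c" by auto
  then show ?thesis unfolding first_def using inv_into_f_f[OF inj, of c] assms by auto
qed

lemma first_diff:
  assumes "S \<subseteq> slices k" "S \<noteq> {}" "first S \<noteq> c"
  shows "S - {c} \<noteq> {}" "first (S - {c}) = first S"
proof -
  let ?f = "to_nat_on (slices k)"
  have inj: "inj_on ?f (slices k)" by (intro inj_on_to_nat_on countable_finite finite_slices)
  have fin: "finite S" using assms finite_slices finite_subset by blast
  have "Min (?f ` S) \<in> ?f ` S" using assms fin by (intro Min_in) auto
  then obtain b where b: "b \<in> S" "Min (?f ` S) = ?f b" by auto
  then have "first S = b" unfolding first_def using inv_into_f_f[OF inj, of b] assms by auto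
  then have bc: "b \<in> S - {c}" using b assms by auto
  then show "S - {c} \<noteq> {}" by auto
  have "Min (?f ` (S - {c})) = ?f b"
  proof (rule Min_eqI)
    fix y assume "y \<in> ?f ` (S - {c})"
    then have "y \<in> ?f ` S" by auto
    then show "?f b \<le> y" using b fin by (metis Min_le finite_imageI)
  qed (use fin bc in auto)
  then show "first (S - {c}) = first S" using b by (simp add: first_def)
qed

lemma failing_sub: "failing F \<zeta> J K \<subseteq> slices k - K"
  by (auto simp: failing_def)

lemma failingD: "c \<in> failing F \<zeta> J K \<Longrightarrow> c \<in> slices k" "c \<in> failing F \<zeta> J K \<Longrightarrow> c \<notin> K"
  by (auto simp: failing_def)

lemma removed_Suc_cases:
  obtains "failing F \<zeta> J (removed F \<zeta> J t) = {}" "removed F \<zeta> J (Suc t) = removed F \<zeta> J t"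
  | c where "c \<in> failing F \<zeta> J (removed F \<zeta> J t)" "removed F \<zeta> J (Suc t) = insert c (removed F \<zeta> J t)"
      "c = first (failing F \<zeta> J (removed F \<zeta> J t))"
proof (cases "failing F \<zeta> J (removed F \<zeta> J t) = {}")
  case True
  then show ?thesis using that(1) by simp
next
  case False
  have "first (failing F \<zeta> J (removed F \<zeta> J t)) \<in> failing F \<zeta> J (removed F \<zeta> J t)"
    using failing_sub False by (intro first_in) blast+
  then show ?thesis using that(2) False by (simp add: Let_def)
qed

declare removed.simps(2) [simp del]

lemma removed_sub: "removed F \<zeta> J t \<subseteq> slices k"
proof (induction t)
  case (Suc t)
  then show ?case by (cases rule: removed_Suc_cases[of F \<zeta> J t]) (auto dest: failingD)
qed simp

lemma removed_mono: "s \<le> t \<Longrightarrow> removed F \<zeta> J s \<subseteq> removed F \<zeta> J t"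
proof (induction t rule: dec_induct)
  case (step t)
  then show ?case by (cases rule: removed_Suc_cases[of F \<zeta> J t]) auto
qed simp

lemma removed_lower:
  "c \<in> removed F \<zeta> J t \<Longrightarrow> i \<in> fst c \<Longrightarrow> 2 \<le> snd c i \<Longrightarrow> lower c i \<in> removed F \<zeta> J t"
proof (induction t arbitrary: c)
  case (Suc t)
  show ?case
  proof (cases rule: removed_Suc_cases[of F \<zeta> J t])
    case 1 then show ?thesis using Suc by simp
  next
    case (2 b)
    then have "lower b i \<in> removed F \<zeta> J t" if "i \<in> fst b" "2 \<le> snd b i"
      using that by (auto simp: failing_def minimal_def)
    have "c = b \<or> c \<in> removed F \<zeta> J t" using Suc.prems(1) 2(2) by simp
    then have "lower c i \<in> removed F \<zeta> J t"
      using \<open>i \<in> fst b \<Longrightarrow> 2 \<le> snd b i \<Longrightarrow> lower b i \<in> removed F \<zeta> J t\<close> Suc.prems(2,3) Suc.IH by blast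
    then show ?thesis using 2(2) by simp
  qed
qed simp

lemma finite_removed: "finite (removed F \<zeta> J t)"
  by (rule finite_subset[OF removed_sub finite_slices])

lemma failing_final: "failing F \<zeta> J (removed F \<zeta> J (card (slices k))) = {}"
proof -
  have "failing F \<zeta> J (removed F \<zeta> J t) = {} \<or> card (removed F \<zeta> J t) = t" for t
  proof (induction t)
    case (Suc t)
    show ?case
    proof (cases rule: removed_Suc_cases[of F \<zeta> J t])
      case 1 then show ?thesis by simp
    next
      case (2 b)
      have "b \<notin> removed F \<zeta> J t" using 2(1) by (rule failingD)
      then show ?thesis using 2 Suc by (auto simp: finite_removed)
    qed
  qed simp
  from this[of "card (slices k)"] show ?thesis
  proof
    assume "card (removed F \<zeta> J (card (slices k))) = card (slices k)"
    then have "removed F \<zeta> J (card (slices k)) = slices k"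
      using removed_sub finite_slices by (intro card_subset_eq) auto
    then show ?thesis using failingD by fastforce
  qed
qed

text \<open>Immunity only deletes \<open>c\<close> from the failing slices, and by
  \<open>first_diff\<close> this does not affect a choice that falls on another slice.\<close>

lemma removed_immune:
  "c \<notin> removed F \<zeta> {} t \<Longrightarrow> removed F \<zeta> {c} t = removed F \<zeta> {} t"
proof (induction t)
  case (Suc t)
  let ?K = "removed F \<zeta> {} t"
  have c: "c \<notin> ?K" using Suc.prems removed_mono[of t "Suc t"] by auto
  note IH = Suc.IH[OF c]
  have f: "failing F \<zeta> {c} ?K = failing F \<zeta> {} ?K - {c}" by (auto simp: failing_def)
  show ?case
  proof (cases rule: removed_Suc_cases[of F \<zeta> "{}" t])
    case 1 then show ?thesis using IH f by (simp add: removed.simps(2))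
  next
    case (2 b)
    then have ne: "failing F \<zeta> {} ?K \<noteq> {}" "first (failing F \<zeta> {} ?K) \<noteq> c" using Suc.prems by auto
    have "failing F \<zeta> {} ?K \<subseteq> slices k" using failing_sub by blast
    note fd = first_diff[OF this ne]
    then show ?thesis using IH f 2 ne by (simp add: Let_def removed.simps(2))
  qed
qed simp

lemma est_cong_seed:
  assumes "\<And>s. s < max_samples \<Longrightarrow> \<zeta> (c, s) = \<zeta>' (c, s)" "\<rho> \<le> alive_mass K c"
  shows "live_samples \<zeta> K c = live_samples \<zeta>' K c" "est F \<zeta> K c = est F \<zeta>' K c"
proof -
  have *: "sample \<zeta> c s = sample \<zeta>' c s" if "s < samples K c" for s
    using assms samples_le[OF assms(2)] that by (simp add: sample_def)
  then show l: "live_samples \<zeta> K c = live_samples \<zeta>' K c" by (auto simp: live_samples_def)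
  show "est F \<zeta> K c = est F \<zeta>' K c"
    using * unfolding est_def measured_def l by (simp cong: sum.cong_simp)
qed

lemma accurate_cong_seed:
  assumes "\<And>s. s < max_samples \<Longrightarrow> \<zeta> (c, s) = \<zeta>' (c, s)"
  shows "accurate F \<zeta> K c = accurate F \<zeta>' K c"
proof (cases "\<rho> \<le> alive_mass K c")
  case True
  have "live_samples \<zeta> K c = live_samples \<zeta>' K c" "est F \<zeta> K c = est F \<zeta>' K c"
    by (rule est_cong_seed[OF _ True], rule assms, assumption)+
  then show ?thesis by (simp add: accurate_def)
qed (simp add: accurate_def)

lemma est_small_mass: "alive_mass K c < \<rho> \<Longrightarrow> est F \<zeta> K c = 0"
  by (simp add: est_def measured_def)

lemma removed_cong_seed:
  assumes "\<And>b s. b \<noteq> c \<Longrightarrow> s < max_samples \<Longrightarrow> \<zeta> (b, s) = \<zeta>' (b, s)"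
  shows "removed F \<zeta> {c} t = removed F \<zeta>' {c} t"
proof (induction t)
  case (Suc t)
  have "est F \<zeta> K b = est F \<zeta>' K b" if "b \<noteq> c" for K b
  proof (cases "\<rho> \<le> alive_mass K b")
    case True
    then show ?thesis by (rule est_cong_seed(2)[rotated]) (rule assms[OF that])
  next
    case False
    then show ?thesis by (simp add: est_small_mass)
  qed
  then have "failing F \<zeta> {c} K = failing F \<zeta>' {c} K" for K by (auto simp: failing_def)
  then show ?case using Suc by (simp add: removed.simps(2))
qed simp

lemma finite_prune_seed: "finite (set_pmf prune_seed)"
  unfolding prune_seed_def using finite_slices finite_pz by (intro finite_Pi_pmf) auto

text \<open>The set \<open>K\<close> is fixed here. The number \<open>N\<close> of samples satisfies
  \<open>n \<le> N * a \<le> 2 * n\<close> for the alive mass \<open>a\<close>, so that a slack of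
  \<open>N\<close> times the threshold is at least \<open>n * \<epsilon>1\<close>. The three ways to
  fail are an estimate too high, an estimate too low, and too many live samples.\<close>

lemma prob_inaccurate:
  assumes F: "admissible F" and c: "c \<in> slices k"
  shows "measure_pmf.prob prune_seed {\<zeta>. \<not> accurate F \<zeta> K c} \<le> 3 * exp (- (n * \<epsilon>1))"
proof (cases "alive_mass K c < \<rho>")
  case True
  then show ?thesis by (simp add: accurate_def)
next
  case False
  let ?a = "alive_mass K c" and ?N = "samples K c" and ?m = "mg c (cut F K)" and ?h = "threshold K c"
  have a: "\<rho> \<le> ?a" "0 < ?a" "?a \<le> 1" using False rho alive_mass_01 by auto
  let ?A = "slices k \<times> {..<max_samples}" and ?J = "{c} \<times> {..<samples K c}"
  have A: "finite ?A" "?J \<subseteq> ?A" using finite_slices c samples_le[OF a(1)] by auto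
  have J: "card ?J = ?N" by (simp add: card_cartesian_product)
  have Jsum: "(\<Sum>i\<in>?J. g (\<zeta> i)) = (\<Sum>s<?N. g (\<zeta> (c, s)))" for g :: "point \<Rightarrow> real" and \<zeta>
  proof -
    have "?J = Pair c ` {..<?N}" by auto
    then show ?thesis by (simp add: sum.reindex inj_on_def)
  qed
  note ch = chernoff_pmf[OF A, where d=undefined and p="\<lambda>_. pz" and q=pz, OF refl finite_pz finite_pz, folded prune_seed_def, unfolded J Jsum]
  have l: "n \<le> ?N * ?a" "?N * ?a \<le> 2 * n"
  proof -
    have "real n * 1 \<le> real n * (2 ^ level_of ?a * ?a)" "real n * (2 ^ level_of ?a * ?a) \<le> real n * 2"
      by (rule mult_left_mono[OF level_of(1)[OF a(2,3)]], simp) (rule mult_left_mono[OF level_of(2)[OF a(2,3)]], simp)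
    then show "n \<le> ?N * ?a" "?N * ?a \<le> 2 * n" by (auto simp: samples_def mult.assoc)
  qed
  have Npos: "?N > 0" using n by (simp add: samples_def)
  have Nh: "n * \<epsilon>1 \<le> ?N * ?h"
  proof -
    have "n * \<epsilon>1 \<le> (?N * ?a) * \<epsilon>1" using l eps1 by (intro mult_right_mono) auto
    also have "\<dots> = ?N * (\<epsilon>1 * ?a)" by simp
    also have "\<dots> \<le> ?N * ?h" by (intro mult_left_mono) (auto simp: threshold_def)
    finally show ?thesis .
  qed
  let ?S = "\<lambda>\<zeta>. \<Sum>s<?N. cut F K (override c (\<zeta> (c, s)))"
  let ?C = "\<lambda>\<zeta>. \<Sum>s<?N. of_bool (alive d K (override c (\<zeta> (c, s)))) :: real"
  have p1: "measure_pmf.prob prune_seed {\<zeta>. ?S \<zeta> \<ge> 2 * (?N * ?m) + ?N * ?h} \<le> exp (- (?N * ?h))"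
    and p2: "measure_pmf.prob prune_seed {\<zeta>. ?S \<zeta> \<le> ?N * ?m / 2 - ?N * ?h} \<le> exp (- (?N * ?h))"
    using ch[of "\<lambda>z. cut F K (override c z)" "?N * ?h"] cut_01[OF F] by (auto simp: mg_def)
  have p3: "measure_pmf.prob prune_seed {\<zeta>. ?C \<zeta> \<ge> 2 * (?N * ?a) + n} \<le> exp (- real n)"
    using ch(1)[of "\<lambda>z. of_bool (alive d K (override c z))" "real n"] by (auto simp: mg_def alive_mass_def)
  have card: "real (card (live_samples \<zeta> K c)) = ?C \<zeta>" for \<zeta>
  proof -
    have "?C \<zeta> = (\<Sum>s\<in>live_samples \<zeta> K c. 1)"
      unfolding live_samples_def sample_def by (intro sum.mono_neutral_cong_right) auto
    then show ?thesis by simp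
  qed
  have sub: "\<not> accurate F \<zeta> K c \<Longrightarrow> (?S \<zeta> \<ge> 2 * (?N * ?m) + ?N * ?h \<or> ?S \<zeta> \<le> ?N * ?m / 2 - ?N * ?h) \<or> ?C \<zeta> \<ge> 2 * (?N * ?a) + n" for \<zeta>
  proof (rule ccontr)
    assume na: "\<not> accurate F \<zeta> K c" and "\<not> ((?S \<zeta> \<ge> 2 * (?N * ?m) + ?N * ?h \<or> ?S \<zeta> \<le> ?N * ?m / 2 - ?N * ?h) \<or> ?C \<zeta> \<ge> 2 * (?N * ?a) + n)"
    then have h: "?S \<zeta> \<le> 2 * (?N * ?m) + ?N * ?h" "?N * ?m / 2 - ?N * ?h \<le> ?S \<zeta>" "?C \<zeta> < 2 * (?N * ?a) + n" by auto
    have "real (card (live_samples \<zeta> K c)) \<le> 5 * n" using h(3) l card by simp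
    then have c5: "card (live_samples \<zeta> K c) \<le> 5 * n" by linarith
    then have e: "est F \<zeta> K c = ?S \<zeta> / ?N" using a by (simp add: est_def measured_def sample_def)
    have "?S \<zeta> / ?N \<le> 2 * ?m + ?h" using h(1) Npos by (simp add: divide_le_eq algebra_simps)
    moreover have "?m / 2 - ?h \<le> ?S \<zeta> / ?N" using h(2) Npos by (simp add: le_divide_eq algebra_simps)
    ultimately show False using na c5 e by (simp add: accurate_def)
  qed
  have e1: "exp (- (?N * ?h)) \<le> exp (- (n * \<epsilon>1))" using Nh by simp
  have e2: "exp (- real n) \<le> exp (- (n * \<epsilon>1))" using eps1 mult_left_le[of \<epsilon>1 "real n"] by simp
  have "measure_pmf.prob prune_seed {\<zeta>. \<not> accurate F \<zeta> K c}
      \<le> measure_pmf.prob prune_seed {\<zeta>. (?S \<zeta> \<ge> 2 * (?N * ?m) + ?N * ?h \<or> ?S \<zeta> \<le> ?N * ?m / 2 - ?N * ?h) \<or> ?C \<zeta> \<ge> 2 * (?N * ?a) + n}"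
    by (rule measure_pmf.finite_measure_mono) (use sub in \<open>blast, simp\<close>)
  also have "\<dots> \<le> measure_pmf.prob prune_seed {\<zeta>. ?S \<zeta> \<ge> 2 * (?N * ?m) + ?N * ?h \<or> ?S \<zeta> \<le> ?N * ?m / 2 - ?N * ?h}
      + measure_pmf.prob prune_seed {\<zeta>. ?C \<zeta> \<ge> 2 * (?N * ?a) + n}"
    by (rule prob_Un_le)
  also have "measure_pmf.prob prune_seed {\<zeta>. ?S \<zeta> \<ge> 2 * (?N * ?m) + ?N * ?h \<or> ?S \<zeta> \<le> ?N * ?m / 2 - ?N * ?h}
      \<le> measure_pmf.prob prune_seed {\<zeta>. ?S \<zeta> \<ge> 2 * (?N * ?m) + ?N * ?h} + measure_pmf.prob prune_seed {\<zeta>. ?S \<zeta> \<le> ?N * ?m / 2 - ?N * ?h}"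
    by (rule prob_Un_le)
  finally show ?thesis using p1 p2 p3 e1 e2 by linarith
qed

text \<open>Resampling the entries of \<open>c\<close> leaves the process with \<open>c\<close>
  immune unchanged. Given the other samples its set of removed slices is therefore constant, which
  is the situation of \<open>prob_inaccurate\<close>.\<close>

lemma prob_all_accurate:
  assumes F: "admissible F"
  shows "measure_pmf.prob prune_seed {\<zeta>. \<not> all_accurate F \<zeta>}
    \<le> card (slices k) * ((card (slices k) + 1) * (3 * exp (- (n * \<epsilon>1))))"
proof -
  let ?e = "3 * exp (- (n * \<epsilon>1))" and ?S = "card (slices k)"
  have 1: "measure_pmf.prob prune_seed {\<zeta>. \<not> accurate F \<zeta> (removed F \<zeta> {c} t) c} \<le> ?e" if c: "c \<in> slices k" for c t
  proof -
    let ?A = "slices k \<times> {..<max_samples}" and ?B = "{c} \<times> {..<max_samples}"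
    let ?mix = "\<lambda>x y i. if i \<in> ?B then y i else (x i :: point)"
    have "measure_pmf.prob prune_seed {\<zeta>. \<not> accurate F \<zeta> (removed F \<zeta> {c} t) c}
        = expect prune_seed (\<lambda>\<zeta>. of_bool (\<not> accurate F \<zeta> (removed F \<zeta> {c} t) c))"
      by (rule prob_eq_expect)
    also have "\<dots> = expect prune_seed (\<lambda>x. expect prune_seed (\<lambda>y. of_bool (\<not> accurate F (?mix x y) (removed F (?mix x y) {c} t) c)))"
      unfolding prune_seed_def using c finite_slices finite_pz by (intro expect_resample) auto
    also have "\<dots> = expect prune_seed (\<lambda>x. measure_pmf.prob prune_seed {y. \<not> accurate F y (removed F x {c} t) c})"
    proof -
      have "removed F (?mix x y) {c} t = removed F x {c} t" for x y by (rule removed_cong_seed) auto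
      moreover have "accurate F (?mix x y) K c = accurate F y K c" for x y K by (rule accurate_cong_seed) auto
      ultimately show ?thesis by (simp only: prob_eq_expect)
    qed
    also have "\<dots> \<le> ?e" by (rule expect_le_const[OF finite_prune_seed]) (rule prob_inaccurate[OF F c])
    finally show ?thesis .
  qed
  have 2: "measure_pmf.prob prune_seed {\<zeta>. \<exists>t\<in>{..?S}. \<not> accurate F \<zeta> (removed F \<zeta> {c} t) c} \<le> (?S + 1) * ?e"
    if "c \<in> slices k" for c
    using prob_Ex_le[of "{..?S}" prune_seed "\<lambda>t \<zeta>. \<not> accurate F \<zeta> (removed F \<zeta> {c} t) c" ?e] 1[OF that] by simp
  have "{\<zeta>. \<not> all_accurate F \<zeta>} = {\<zeta>. \<exists>c\<in>slices k. \<exists>t\<in>{..?S}. \<not> accurate F \<zeta> (removed F \<zeta> {c} t) c}"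
    by (auto simp: all_accurate_def)
  then show ?thesis
    using prob_Ex_le[OF finite_slices[of k], of prune_seed "\<lambda>c \<zeta>. \<exists>t\<in>{..?S}. \<not> accurate F \<zeta> (removed F \<zeta> {c} t) c" "(?S + 1) * ?e"] 2
    by simp
qed

lemma accurate_while_present:
  "all_accurate F \<zeta> \<Longrightarrow> t \<le> card (slices k) \<Longrightarrow> c \<in> slices k \<Longrightarrow> c \<notin> removed F \<zeta> {} t \<Longrightarrow>
    accurate F \<zeta> (removed F \<zeta> {} t) c"
  using removed_immune by (fastforce simp: all_accurate_def)

lemma mg_failing:
  assumes F: "admissible F" and acc: "accurate F \<zeta> K c" and e: "est F \<zeta> K c < 2 * threshold K c"
  shows "mg c (cut F K) \<le> 6 * (\<epsilon>1 * alive_mass K c + \<rho>)"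
proof -
  have t: "threshold K c \<le> \<epsilon>1 * alive_mass K c + \<rho>" using eps1 rho alive_mass_01[of K c] by (simp add: threshold_def)
  show ?thesis
  proof (cases "alive_mass K c < \<rho>")
    case True
    then have "mg c (cut F K) \<le> \<rho>" using mg_cut_le[OF F, of c K] by simp
    moreover have "0 \<le> \<epsilon>1 * alive_mass K c" using eps1 alive_mass_01 by simp
    ultimately show ?thesis using rho by simp
  next
    case False
    \<comment> \<open>This is \<open>mg c (cut F K) < 6 * threshold K c\<close>, the origin of the
      factor 6 in the loss.\<close>
    then have "mg c (cut F K) / 2 - threshold K c < 2 * threshold K c" using acc e by (simp add: accurate_def)
    then show ?thesis using t by simp
  qed
qed

text \<open>Removing \<open>c\<close> costs at most \<open>6 * \<epsilon>1\<close> times the alive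
  mass that vanishes plus \<open>6 * \<rho>\<close> times the mass of \<open>c\<close>. The first
  part telescopes to at most \<open>6 * \<epsilon>1\<close>, the second is summed by
  \<open>sum_slice_mass\<close>.\<close>

lemma prune_loss:
  assumes F: "admissible F" and acc: "all_accurate F \<zeta>"
  shows "expect pz (cut F (survivors_cut F \<zeta>)) \<ge> expect pz F - 6 * \<epsilon>1 - 6 * \<rho> * real d ^ k"
proof -
  let ?K = "removed F \<zeta> {}" and ?al = "\<lambda>K. expect pz (\<lambda>z. of_bool (alive d K z))"
  have "t \<le> card (slices k) \<Longrightarrow> expect pz (cut F (?K t)) \<ge> expect pz F - 6 * \<epsilon>1 * (1 - ?al (?K t)) - 6 * \<rho> * (\<Sum>c\<in>?K t. slice_mass c)" for t
  proof (induction t)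
    case 0
    have "cut F {} z = F z" for z using F by (auto simp: cut_def alive_def admissible_def Suc_le_eq)
    moreover have "?al {} \<le> 1" by (rule expect_le_const[OF finite_pz]) simp
    ultimately show ?case using eps1 by simp
  next
    case (Suc t)
    show ?case
    proof (cases rule: removed_Suc_cases[of F \<zeta> "{}" t])
      case 1 then show ?thesis using Suc by simp
    next
      case (2 c)
      let ?A = "?K t"
      have c: "c \<in> slices k" "c \<notin> ?A" "est F \<zeta> ?A c < 2 * threshold ?A c" using 2 by (auto simp: failing_def)
      have "accurate F \<zeta> ?A c" using accurate_while_present[OF acc] Suc.prems c by simp
      note m = mg_failing[OF F this c(3)]
      have cI: "fst c \<subseteq> {..<d}" using slicesD[OF c(1)] by auto
      have e1: "expect pz (cut F ?A) - expect pz (cut F (insert c ?A)) = slice_mass c * mg c (cut F ?A)"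
        unfolding expect_in_slice[OF cI, symmetric] expect_diff[OF finite_pz, symmetric]
        by (intro expect_cong) (auto simp: cut_def alive_def)
      have e2: "?al ?A - ?al (insert c ?A) = slice_mass c * alive_mass ?A c"
        unfolding alive_mass_def expect_in_slice[OF cI, symmetric] expect_diff[OF finite_pz, symmetric]
        by (intro expect_cong) (auto simp: alive_def)
      have sm: "(\<Sum>c\<in>insert c ?A. slice_mass c) = slice_mass c + (\<Sum>c\<in>?A. slice_mass c)"
        using c removed_sub[of F \<zeta> "{}" t] finite_slices finite_subset by (subst sum.insert) auto
      have "slice_mass c * mg c (cut F ?A) \<le> slice_mass c * (6 * (\<epsilon>1 * alive_mass ?A c + \<rho>))"
        using m slice_mass_ge[OF c(1)] by (intro mult_left_mono) auto
      also have "\<dots> = 6 * \<epsilon>1 * (?al ?A - ?al (insert c ?A)) + 6 * \<rho> * slice_mass c"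
        unfolding e2 by (simp add: algebra_simps)
      finally show ?thesis using Suc e1 sm 2 by (simp add: algebra_simps)
    qed
  qed
  from this[of "card (slices k)"]
  have "expect pz (cut F (survivors_cut F \<zeta>)) \<ge> expect pz F - 6 * \<epsilon>1 * (1 - ?al (survivors_cut F \<zeta>)) - 6 * \<rho> * (\<Sum>c\<in>survivors_cut F \<zeta>. slice_mass c)"
    by (simp add: survivors_cut_def)
  moreover have "6 * \<epsilon>1 * (1 - ?al (survivors_cut F \<zeta>)) \<le> 6 * \<epsilon>1 * 1"
    using eps1 by (intro mult_left_mono) (auto intro!: expect_nonneg)
  moreover have "6 * \<rho> * (\<Sum>c\<in>survivors_cut F \<zeta>. slice_mass c) \<le> 6 * \<rho> * real d ^ k"
  proof (intro mult_left_mono)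
    have "(\<Sum>c\<in>survivors_cut F \<zeta>. slice_mass c) \<le> (\<Sum>c\<in>slices k. slice_mass c)"
      using removed_sub finite_slices slice_mass_ge by (intro sum_mono2) (auto simp: survivors_cut_def intro: less_imp_le)
    also have "\<dots> \<le> real d ^ k" by (rule sum_slice_mass)
    finally show "(\<Sum>c\<in>survivors_cut F \<zeta>. slice_mass c) \<le> real d ^ k" .
  qed (use rho in auto)
  ultimately show ?thesis by linarith
qed

lemma survivor_est:
  assumes acc: "all_accurate F \<zeta>" and c: "c \<in> slices k" "c \<notin> survivors_cut F \<zeta>" and F: "admissible F"
  shows "mg c (cut F (survivors_cut F \<zeta>)) / 2 - \<epsilon>1 - \<rho> \<le> est F \<zeta> (survivors_cut F \<zeta>) c"
    "est F \<zeta> (survivors_cut F \<zeta>) c \<le> 2 * mg c (cut F (survivors_cut F \<zeta>)) + \<epsilon>1 + \<rho>"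
proof -
  let ?K = "survivors_cut F \<zeta>"
  have a: "accurate F \<zeta> ?K c" using accurate_while_present[OF acc] c by (simp add: survivors_cut_def)
  have "\<epsilon>1 * alive_mass ?K c \<le> \<epsilon>1" using eps1 alive_mass_01[of ?K c] by (simp add: mult_left_le)
  then have t: "threshold ?K c \<le> \<epsilon>1 + \<rho>"
    unfolding threshold_def using eps1 rho by (intro max.boundedI) linarith+
  note m = mg_cut_nonneg[OF F, of c ?K] mg_cut_le[OF F, of c ?K]
  show "mg c (cut F ?K) / 2 - \<epsilon>1 - \<rho> \<le> est F \<zeta> ?K c" "est F \<zeta> ?K c \<le> 2 * mg c (cut F ?K) + \<epsilon>1 + \<rho>"
    using a t m est_small_mass[of ?K c F \<zeta>] eps1 rho by (auto simp: accurate_def)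
qed

text \<open>Descending from \<open>c\<close> through surviving slices ends at a minimal one. Since
  it did not fail, its estimate is at least twice the threshold, and accuracy leaves at least half
  the threshold for the marginal itself.\<close>

lemma minimal_survivor:
  assumes acc: "all_accurate F \<zeta>" and F: "admissible F"
  shows "c \<in> slices k \<Longrightarrow> c \<notin> survivors_cut F \<zeta> \<Longrightarrow> \<exists>u\<in>slices k. u \<notin> survivors_cut F \<zeta> \<and> fst u = fst c \<and> (\<forall>i. snd u i \<le> snd c i) \<and>
    \<rho> / 2 \<le> mg u (cut F (survivors_cut F \<zeta>))"
proof (induction "\<Sum>i\<in>fst c. snd c i" arbitrary: c rule: less_induct)
  case less
  let ?K = "survivors_cut F \<zeta>"
  show ?case
  proof (cases "minimal ?K c")
    case True
    have a: "accurate F \<zeta> ?K c" using accurate_while_present[OF acc] less.prems by (simp add: survivors_cut_def)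
    have "c \<notin> failing F \<zeta> {} ?K" using failing_final[of F \<zeta> "{}"] by (simp add: survivors_cut_def)
    then have e: "est F \<zeta> ?K c \<ge> 2 * threshold ?K c" using True less.prems by (simp add: failing_def)
    then have "\<not> alive_mass ?K c < \<rho>" using est_small_mass[of ?K c F \<zeta>] threshold_pos[of ?K c] by auto
    then have "\<rho> / 2 \<le> mg c (cut F ?K)" using a e threshold_pos[of ?K c] by (auto simp: accurate_def)
    then show ?thesis using less.prems by blast
  next
    case False
    then obtain i where i: "i \<in> fst c" "2 \<le> snd c i" "lower c i \<notin> ?K" by (auto simp: minimal_def)
    have l: "lower c i \<in> slices k"
      using less.prems(1) i by (auto simp: slices_def lower_def PiE_dflt_def)
    have "(\<Sum>l\<in>fst (lower c i). snd (lower c i) l) < (\<Sum>l\<in>fst c. snd c l)"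
      unfolding fst_lower using i slicesD(4)[OF less.prems(1)] by (intro sum_strict_mono_ex1) (auto simp: lower_def)
    from less.hyps[OF this l i(3)] obtain u where u: "u \<in> slices k" "u \<notin> ?K" "fst u = fst c"
      "\<forall>l. snd u l \<le> snd (lower c i) l" "\<rho> / 2 \<le> mg u (cut F ?K)" by auto
    have "snd (lower c i) l \<le> snd c l" for l by (simp add: lower_def)
    then have "\<forall>l. snd u l \<le> snd c l" using u(4) order_trans by blast
    then show ?thesis using u by blast
  qed
qed

section \<open>Grid points read by the pruning\<close>

definition reads :: "(slice \<times> nat \<Rightarrow> point) \<Rightarrow> slice set \<Rightarrow> point set" where
  "reads \<zeta> K = {sample \<zeta> c s |c s. c \<in> slices k - K \<and> measured \<zeta> K c \<and> s \<in> live_samples \<zeta> K c}"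

lemma est_local:
  assumes "\<And>z. z \<in> reads \<zeta> K \<Longrightarrow> F z = F' z" "c \<in> slices k - K"
  shows "est F \<zeta> K c = est F' \<zeta> K c"
proof -
  have "cut F K (sample \<zeta> c s) = cut F' K (sample \<zeta> c s)" if "measured \<zeta> K c" "s < samples K c" for s
  proof (cases "alive d K (sample \<zeta> c s)")
    case True
    then have "sample \<zeta> c s \<in> reads \<zeta> K" using that assms(2) unfolding reads_def live_samples_def by blast
    then show ?thesis by (simp add: cut_def assms(1))
  qed (simp add: cut_def)
  then show ?thesis by (simp add: est_def)
qed

lemma removed_local:
  assumes "\<And>z s. s < t \<Longrightarrow> z \<in> reads \<zeta> (removed F \<zeta> {} s) \<Longrightarrow> F z = F' z"
  shows "removed F \<zeta> {} t = removed F' \<zeta> {} t"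
  using assms
proof (induction t)
  case (Suc t)
  have "removed F \<zeta> {} t = removed F' \<zeta> {} t"
    by (rule Suc.IH) (rule Suc.prems[OF less_SucI])
  moreover have "est F \<zeta> (removed F \<zeta> {} t) c = est F' \<zeta> (removed F \<zeta> {} t) c"
    if "c \<in> slices k - removed F \<zeta> {} t" for c
    by (rule est_local[OF _ that]) (rule Suc.prems[OF lessI])
  then have "failing F \<zeta> {} (removed F \<zeta> {} t) = failing F' \<zeta> {} (removed F \<zeta> {} t)"
    unfolding failing_def by (intro Collect_cong) (metis Diff_empty)
  ultimately show ?case by (simp add: removed.simps(2))
qed simp

text \<open>For a fixed slice and a fixed sampling level the live samples only become fewer over
  time. All reads at that level are thus among those of its first occurrence, at most
  \<open>5 * n\<close>.\<close>

lemma card_reads: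
  "finite (\<Union>t\<in>A. reads \<zeta> (removed F \<zeta> {} t))"
  "card (\<Union>t\<in>A. reads \<zeta> (removed F \<zeta> {} t)) \<le> card (slices k) * ((level_of \<rho> + 1) * (5 * n))"
proof -
  let ?K = "\<lambda>t. removed F \<zeta> {} t"
  define D where "D = (\<lambda>c q t. {s. s < n * 2 ^ q \<and> alive d (?K t) (sample \<zeta> c s)})"
  define P where "P = (\<lambda>c q t. measured \<zeta> (?K t) c \<and> level_of (alive_mass (?K t) c) = q)"
  define U where "U = (\<lambda>c q. \<Union>t\<in>{t. P c q t}. D c q t)"
  have U: "finite (U c q) \<and> card (U c q) \<le> 5 * n" for c q unfolding U_def
  proof (rule bounded_union_of_chain)
    show "D c q t \<subseteq> D c q s" if "s \<le> t" for s t
      using removed_mono[OF that, of F \<zeta> "{}"] by (auto simp: D_def alive_def)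
    show "finite (D c q t) \<and> card (D c q t) \<le> 5 * n" if "P c q t" for t
    proof -
      have "D c q t = live_samples \<zeta> (?K t) c" using that by (auto simp: D_def live_samples_def P_def samples_def)
      then show ?thesis using that finite_live by (auto simp: P_def measured_def)
    qed
  qed
  have sub: "(\<Union>t\<in>A. reads \<zeta> (?K t)) \<subseteq> (\<Union>c\<in>slices k. \<Union>q\<in>{..level_of \<rho>}. sample \<zeta> c ` U c q)"
  proof
    fix z assume "z \<in> (\<Union>t\<in>A. reads \<zeta> (?K t))"
    then obtain t c s where z: "c \<in> slices k" "measured \<zeta> (?K t) c" "s \<in> live_samples \<zeta> (?K t) c" "z = sample \<zeta> c s"
      by (auto simp: reads_def)
    let ?q = "level_of (alive_mass (?K t) c)"
    have "?q \<le> level_of \<rho>" using z(2) rho by (intro level_of_antimono) (auto simp: measured_def)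
    moreover have "s \<in> U c ?q" using z by (auto simp: U_def P_def D_def live_samples_def samples_def)
    ultimately show "z \<in> (\<Union>c\<in>slices k. \<Union>q\<in>{..level_of \<rho>}. sample \<zeta> c ` U c q)" using z by auto
  qed
  have fin: "finite (\<Union>c\<in>slices k. \<Union>q\<in>{..level_of \<rho>}. sample \<zeta> c ` U c q)" using U finite_slices by auto
  show "finite (\<Union>t\<in>A. reads \<zeta> (?K t))" using sub fin by (rule finite_subset)
  have "card (\<Union>t\<in>A. reads \<zeta> (?K t)) \<le> card (\<Union>c\<in>slices k. \<Union>q\<in>{..level_of \<rho>}. sample \<zeta> c ` U c q)"
    using sub fin by (intro card_mono)
  also have "\<dots> \<le> (\<Sum>c\<in>slices k. card (\<Union>q\<in>{..level_of \<rho>}. sample \<zeta> c ` U c q))"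
    using finite_slices by (rule card_UN_le)
  also have "\<dots> \<le> (\<Sum>c\<in>slices k. \<Sum>q\<in>{..level_of \<rho>}. card (sample \<zeta> c ` U c q))"
    by (intro sum_mono card_UN_le) simp
  also have "\<dots> \<le> (\<Sum>c\<in>slices k. \<Sum>q\<in>{..level_of \<rho>}. 5 * n)"
    using U by (intro sum_mono order_trans[OF card_image_le]) auto
  finally show "card (\<Union>t\<in>A. reads \<zeta> (?K t)) \<le> card (slices k) * ((level_of \<rho> + 1) * (5 * n))" by simp
qed

end

section \<open>Monotonicity from the game\<close>

text \<open>The 100 in \<open>anchor\<close> allows for all losses on the way up: the payoff of the
  anchor is at least 41 times \<open>bar\<close>, that of the slice just below the one considered 38
  times, and 16 remain at the slice itself.\<close>

locale pruned_game = game d r bp \<kappa> F w \<eta> \<eta>0 k K T for d r bp \<kappa> F w \<eta> \<eta>0 k K T +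
  fixes R :: "slice set" and L :: real
  assumes R_sub: "R \<subseteq> slices k"
    and R_lower: "\<And>c i. c \<in> R \<Longrightarrow> i \<in> fst c \<Longrightarrow> 2 \<le> snd c i \<Longrightarrow> lower c i \<in> R"
    and R_dead: "\<And>c z. c \<in> R \<Longrightarrow> in_slice c z \<Longrightarrow> F z = 0"
    and w_eq: "\<And>i j. w i j = (\<Prod>l\<in>{j<..r i}. 1 / (1 + 4 * \<eta> i l))"
    and eta_sum: "(\<Sum>i<d. \<Sum>l\<in>{1..r i}. 4 * \<eta> i l) \<le> 1/16"
    and eta_le: "\<And>i j. \<eta> i j \<le> \<eta>0"
    and L: "0 \<le> L"
    and anchor: "\<And>c. c \<in> slices k \<Longrightarrow> c \<notin> R \<Longrightarrow> \<exists>u\<in>slices k. u \<notin> R \<and> fst u = fst c \<and> (\<forall>i. snd u i \<le> snd c i) \<and>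
      (\<forall>i\<in>fst c. 100 * Q * L / (\<eta> i (snd c i))^2 \<le> T * mg u F)"
begin

definition outcome :: "(nat \<Rightarrow> point \<times> (point \<Rightarrow> nat)) \<Rightarrow> point \<Rightarrow> real" where
  "outcome \<xi> z = weight w {..<d} z * ((\<Sum>t<T. walk_value F (walk \<xi> t) z) / T)"

text \<open>From 16 times this value on, the additive error \<open>32 * Q * L / \<eta>\<close> of
  the regret bound is at most \<open>2 * \<eta>\<close> times the payoff, which makes the constraint
  purely relative.\<close>

definition bar :: "nat \<Rightarrow> nat \<Rightarrow> real" where
  "bar i j = Q * L / (\<eta> i j)^2"

text \<open>Weierstrass' inequality for products, applied to the factors
  \<open>1 / (1 + 4 * \<eta>)\<close>, each of which is at least
  \<open>1 - 4 * \<eta>\<close>.\<close>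

lemma weight_loss:
  assumes "A \<subseteq> {..<d}" shows "1 - (\<Sum>i\<in>A. \<Sum>l\<in>{z i<..r i}. 4 * \<eta> i l) \<le> weight w A z"
proof -
  have fA: "finite A" using assms finite_subset by blast
  let ?S = "SIGMA i:A. {z i<..r i}"
  let ?f = "\<lambda>(i, l). 1 - 1 / (1 + 4 * \<eta> i l)"
  have f: "1 - 1 / (1 + 4 * x) \<in> {0..1}" "1 - 1 / (1 + 4 * x) \<le> 4 * x" if "0 < x" for x :: real
    using that by (auto simp: field_simps)
  have "1 - (\<Sum>i\<in>A. \<Sum>l\<in>{z i<..r i}. 4 * \<eta> i l) = 1 - (\<Sum>(i, l)\<in>?S. 4 * \<eta> i l)"
    using fA by (simp add: sum.Sigma)
  also have "\<dots> \<le> 1 - (\<Sum>x\<in>?S. ?f x)"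
    using f(2)[OF \<eta>(1)] by (intro diff_left_mono sum_mono) auto
  also have "\<dots> \<le> (\<Prod>x\<in>?S. 1 - ?f x)"
    using f(1)[OF \<eta>(1)] by (intro Weierstrass_prod_ineq) auto
  also have "\<dots> = (\<Prod>(i, l)\<in>?S. 1 / (1 + 4 * \<eta> i l))" by (intro prod.cong) auto
  also have "\<dots> = weight w A z" unfolding weight_def w_eq using fA by (simp add: prod.Sigma)
  finally show ?thesis .
qed

lemma weight_ge: assumes "A \<subseteq> {..<d}" shows "15/16 \<le> weight w A z"
proof -
  have "(\<Sum>l\<in>{z i<..r i}. 4 * \<eta> i l) \<le> (\<Sum>l\<in>{1..r i}. 4 * \<eta> i l)" for i
    using \<eta>(1) by (intro sum_mono2) (auto intro: less_imp_le)
  then have "(\<Sum>i\<in>A. \<Sum>l\<in>{z i<..r i}. 4 * \<eta> i l) \<le> (\<Sum>i\<in>A. \<Sum>l\<in>{1..r i}. 4 * \<eta> i l)"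
    by (rule sum_mono)
  also have "\<dots> \<le> (\<Sum>i<d. \<Sum>l\<in>{1..r i}. 4 * \<eta> i l)"
    using assms \<eta>(1) by (intro sum_mono2) (auto intro!: sum_nonneg simp: less_imp_le)
  finally have "(\<Sum>i\<in>A. \<Sum>l\<in>{z i<..r i}. 4 * \<eta> i l) \<le> (\<Sum>i<d. \<Sum>l\<in>{1..r i}. 4 * \<eta> i l)" .
  then show ?thesis using weight_loss[OF assms, of z] eta_sum by linarith
qed

lemma R_down:
  assumes "c \<in> R" "fst u = fst c" "\<And>i. snd u i \<le> snd c i" "\<And>i. i \<in> fst c \<Longrightarrow> 1 \<le> snd u i"
  shows "u \<in> R"
  using assms
proof (induction "\<Sum>i\<in>fst c. snd c i" arbitrary: c rule: less_induct)
  case less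
  have c: "c \<in> slices k" using less.prems R_sub by auto
  show ?case
  proof (cases "\<exists>i\<in>fst c. snd u i \<noteq> snd c i")
    case True
    then obtain i where i: "i \<in> fst c" "snd u i < snd c i" using less.prems(3) by (metis order_le_less)
    have "2 \<le> snd c i" using i less.prems(4)[of i] by simp
    then have l: "lower c i \<in> R" using R_lower less.prems i by auto
    have "(\<Sum>l\<in>fst (lower c i). snd (lower c i) l) < (\<Sum>l\<in>fst c. snd c l)"
      unfolding fst_lower using i slicesD(4)[OF c] by (intro sum_strict_mono_ex1) (auto simp: lower_def)
    note H = less.hyps[OF this l]
    show ?thesis
    proof (rule H)
      show "snd u m \<le> snd (lower c i) m" for m using less.prems(3)[of m] i by (auto simp: lower_def)
    qed (use less.prems in auto)
  next
    case False
    have "snd u l = snd c l" for l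
      using False slicesD(7)[OF c, of l] less.prems(3)[of l] by (cases "l \<in> fst c") auto
    then have "u = c" using less.prems by (auto simp: prod_eq_iff)
    then show ?thesis using less.prems by simp
  qed
qed

section \<open>Walk values and payoffs at removed slices\<close>

lemma walk_value_zero: "i < d \<Longrightarrow> z i = 0 \<Longrightarrow> walk_value F \<beta> z = 0"
  unfolding walk_value_def using walk_end_le[of \<beta> z i] by (intro F0) auto

text \<open>A walk only lowers levels, so from a removed slice it ends at level 0 of a fixed
  coordinate or in a lower slice, which is removed as well because \<open>R\<close> is closed
  downwards.\<close>

lemma walk_value_dead:
  assumes c: "c \<in> R" and z: "in_slice c z" shows "walk_value F \<beta> z = 0"
proof -
  let ?y = "walk_end \<beta> z"
  have c': "c \<in> slices k" using c R_sub by auto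
  show ?thesis
  proof (cases "\<exists>i\<in>fst c. ?y i = 0")
    case True
    then obtain i where "i \<in> fst c" "?y i = 0" by auto
    then show ?thesis unfolding walk_value_def using slicesD(1)[OF c'] by (intro F0) auto
  next
    case False
    let ?u = "(fst c, \<lambda>i. if i \<in> fst c then ?y i else 0)"
    have "?u \<in> R" using c
    proof (rule R_down)
      show "snd ?u i \<le> snd c i" for i
        using z walk_end_le[of \<beta> z i] by (auto simp: in_slice_def)
    qed (use False in \<open>auto simp: Suc_le_eq\<close>)
    then show ?thesis unfolding walk_value_def by (rule R_dead) (simp add: in_slice_def)
  qed
qed

lemma override_in_slice: "in_slice c (override c z)"
  by (simp add: in_slice_def override_def)

lemma payoff_dead: "c \<in> R \<Longrightarrow> payoff \<xi> c = 0"
  by (simp add: payoff_def mgw_def walk_value_dead override_in_slice)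

lemma payoff_zero: "i \<in> fst c \<Longrightarrow> i < d \<Longrightarrow> snd c i = 0 \<Longrightarrow> payoff \<xi> c = 0"
  by (simp add: payoff_def mgw_def walk_value_zero[of i] override_def)

lemma payoff_nonneg: "0 \<le> payoff \<xi> c"
  unfolding payoff_def mgw_def using weight_01 walk_value_01
  by (intro sum_nonneg expect_nonneg mult_nonneg_nonneg) (auto intro: less_imp_le)

lemma w_lower: "1 \<le> j \<Longrightarrow> j \<le> r i \<Longrightarrow> w i (j - 1) * (1 + 4 * \<eta> i j) = w i j"
proof -
  assume j: "1 \<le> j" "j \<le> r i"
  then have "{j - 1<..r i} = insert j {j<..r i}" by auto
  then have "w i (j - 1) = 1 / (1 + 4 * \<eta> i j) * w i j" unfolding w_eq by simp
  then show ?thesis using \<eta>(1)[of i j] by simp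
qed

lemma weight_lower:
  assumes c: "c \<in> slices k" and i: "i \<in> fst c"
  shows "weight w (fst c) (snd (lower c i)) * (1 + 4 * \<eta> i (snd c i)) = weight w (fst c) (snd c)"
proof -
  note s = slicesD[OF c]
  have "weight w (fst c) (snd (lower c i)) = w i (snd c i - 1) * (\<Prod>l\<in>fst c - {i}. w l (snd c l))"
    unfolding weight_def using s(4) i by (subst prod.remove[of _ i]) (auto simp: lower_def)
  moreover have "weight w (fst c) (snd c) = w i (snd c i) * (\<Prod>l\<in>fst c - {i}. w l (snd c l))"
    unfolding weight_def using s(4) i by (subst prod.remove[of _ i]) auto
  ultimately show ?thesis using w_lower[OF s(5)[OF i] s(6)[OF i]] by (simp add: mult_ac)
qed

lemma lower_slice: "c \<in> slices k \<Longrightarrow> i \<in> fst c \<Longrightarrow> 2 \<le> snd c i \<Longrightarrow> lower c i \<in> slices k"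
  by (auto simp: slices_def lower_def PiE_dflt_def)

context
  fixes \<xi> assumes regret: "regret_bound L \<xi>"
begin

lemma regret_source: "c \<in> slices k \<Longrightarrow> T * mgw w c F \<le> (1 + 2 * \<eta>0) * payoff \<xi> c + 32 * Q * L / \<eta>0"
  using regret by (simp add: regret_bound_def)

lemma regret_step: "c \<in> slices k \<Longrightarrow> i \<in> fst c \<Longrightarrow>
    payoff \<xi> (lower c i) \<le> (1 + 2 * \<eta> i (snd c i)) * payoff \<xi> c + 32 * Q * L / \<eta> i (snd c i)"
  using regret by (auto simp: regret_bound_def)

lemma step_if_large:
  assumes c: "c \<in> slices k" "i \<in> fst c" and large: "16 * bar i (snd c i) \<le> payoff \<xi> c"
  shows "payoff \<xi> (lower c i) \<le> (1 + 4 * \<eta> i (snd c i)) * payoff \<xi> c"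
proof -
  let ?e = "\<eta> i (snd c i)"
  have e: "0 < ?e" by (rule \<eta>)
  have "32 * Q * L / ?e = 2 * ?e * (16 * bar i (snd c i))" using e by (simp add: power2_eq_square bar_def)
  also have "\<dots> \<le> 2 * ?e * payoff \<xi> c" using large e by (intro mult_left_mono) auto
  finally show ?thesis using regret_step[OF c] by (simp add: algebra_simps)
qed

text \<open>A step up in coordinate \<open>i\<close> may divide the payoff by at most
  \<open>1 + 4 * \<eta>\<close>, which is exactly the factor by which the weight of the level
  increases (\<open>weight_lower\<close>). Their product is therefore monotone along a path from
  \<open>u\<close> to \<open>x\<close>.\<close>

lemma payoff_chain:
  assumes x: "x \<in> slices k" and u: "u \<in> slices k" "fst u = fst x" "\<And>i. snd u i \<le> snd x i"
    and large: "\<And>y i. y \<in> slices k \<Longrightarrow> fst y = fst x \<Longrightarrow> (\<And>i. snd u i \<le> snd y i) \<Longrightarrow> (\<And>i. snd y i \<le> snd x i) \<Longrightarrow> i \<in> fst y \<Longrightarrow>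
      payoff \<xi> (lower y i) \<le> (1 + 4 * \<eta> i (snd y i)) * payoff \<xi> y"
  shows "weight w (fst u) (snd u) * payoff \<xi> u \<le> weight w (fst x) (snd x) * payoff \<xi> x"
  using assms
proof (induction "\<Sum>i\<in>fst x. snd x i" arbitrary: x rule: less_induct)
  case less
  note s = slicesD[OF less.prems(1)]
  show ?case
  proof (cases "\<exists>i\<in>fst x. snd u i \<noteq> snd x i")
    case True
    then obtain i where i: "i \<in> fst x" "snd u i < snd x i" using less.prems(4) by (metis order_le_less)
    have "1 \<le> snd u i" using slicesD(5)[OF less.prems(2), of i] less.prems(3) i by auto
    then have i2: "2 \<le> snd x i" using i by simp
    let ?y = "lower x i"
    have y: "?y \<in> slices k" using lower_slice less.prems(1) i i2 by auto
    have yx: "snd ?y l \<le> snd x l" for l by (simp add: lower_def)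
    have uy: "snd u l \<le> snd ?y l" for l using less.prems(4)[of l] i by (auto simp: lower_def)
    have lt: "(\<Sum>l\<in>fst ?y. snd ?y l) < (\<Sum>l\<in>fst x. snd x l)"
      unfolding fst_lower using i s(4) by (intro sum_strict_mono_ex1) (auto simp: lower_def)
    have "weight w (fst u) (snd u) * payoff \<xi> u \<le> weight w (fst ?y) (snd ?y) * payoff \<xi> ?y"
    proof (rule less.hyps[OF lt y])
      fix b l assume b: "b \<in> slices k" "fst b = fst ?y" "\<And>i. snd u i \<le> snd b i" "\<And>l. snd b l \<le> snd ?y l" "l \<in> fst b"
      have "snd b l \<le> snd x l" for l using b(4)[of l] yx[of l] by simp
      then show "payoff \<xi> (lower b l) \<le> (1 + 4 * \<eta> l (snd b l)) * payoff \<xi> b"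
        using b by (intro less.prems(5)) auto
    qed (use less.prems uy in auto)
    also have "\<dots> \<le> weight w (fst x) (snd ?y) * ((1 + 4 * \<eta> i (snd x i)) * payoff \<xi> x)"
      unfolding fst_lower using weight_01 i less.prems(4)
      by (intro mult_left_mono less.prems(5)[OF less.prems(1) refl]) (auto intro: less_imp_le)
    also have "\<dots> = weight w (fst x) (snd x) * payoff \<xi> x"
      using weight_lower[OF less.prems(1) i(1)] by (simp flip: mult.assoc)
    finally show ?thesis .
  next
    case False
    have "snd u l = snd x l" for l
      using False s(7)[of l] less.prems(4)[of l] by (cases "l \<in> fst x") auto
    then have "u = x" using less.prems by (auto simp: prod_eq_iff)
    then show ?thesis by simp
  qed
qed

text \<open>The constraint of kind 0 passes the marginal of \<open>F\<close> on to the payoff, and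
  all weights are at least 15/16; \<open>(15/16 * 100 - 32) / (3/2)\<close> exceeds 41.\<close>

lemma anchor_payoff:
  assumes u: "u \<in> slices k" and T: "100 * Q * L / e^2 \<le> T * mg u F" and e: "0 < e" "e \<le> \<eta>0"
  shows "41 * (Q * L / e^2) \<le> payoff \<xi> u"
proof -
  define B where "B = Q * L / e^2"
  have QL: "0 \<le> Q * L" using Q L by simp
  have e1: "e \<le> 1/4" using e \<eta> by simp
  have "15/16 * mg u F \<le> mgw w u F"
  proof -
    have "15/16 * mg u F = expect pz (\<lambda>z. 15/16 * F (override u z))" by (simp add: mg_def)
    also have "\<dots> \<le> mgw w u F" unfolding mgw_def
      using weight_ge F by (intro expect_mono finite_pz mult_right_mono) auto
    finally show ?thesis .
  qed
  then have "real T * (15/16 * mg u F) \<le> T * mgw w u F" by (intro mult_left_mono) auto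
  moreover have "real T * (15/16 * mg u F) = 15/16 * (T * mg u F)" by simp
  moreover have "100 * B \<le> T * mg u F" using T by (simp add: mult.assoc B_def)
  ultimately have 1: "15/16 * (100 * B) \<le> T * mgw w u F" by linarith
  have 2: "32 * Q * L / \<eta>0 \<le> 32 * B"
  proof -
    have "e^2 \<le> e * 1" using e e1 unfolding power2_eq_square by (intro mult_left_mono) auto
    then have "e^2 \<le> \<eta>0" using e by simp
    then have "32 * (Q * L) / \<eta>0 \<le> 32 * (Q * L) / e^2" using e QL by (intro divide_left_mono) auto
    then show ?thesis by (simp add: mult.assoc B_def)
  qed
  have 3: "(1 + 2 * \<eta>0) * payoff \<xi> u \<le> 3/2 * payoff \<xi> u" using \<eta> payoff_nonneg by (intro mult_right_mono) auto
  have "0 \<le> B" using QL by (simp add: B_def)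
  then show ?thesis using 1 2 3 regret_source[OF u] unfolding B_def[symmetric] by linarith
qed

text \<open>By induction the slices strictly below \<open>c\<close> and above the anchor
  \<open>u\<close> allow exact steps, so \<open>payoff_chain\<close> carries the payoff of
  \<open>u\<close> to the slice \<open>?y\<close> just below \<open>c\<close> at a loss of 15/16.
  For the last step only the regret bound is available; its additive error is at most 8 times
  \<open>bar\<close>, small against 38.\<close>

lemma payoff_large:
  "c \<in> slices k \<Longrightarrow> c \<notin> R \<Longrightarrow> i \<in> fst c \<Longrightarrow> 16 * bar i (snd c i) \<le> payoff \<xi> c"
proof (induction "\<Sum>i\<in>fst c. snd c i" arbitrary: c i rule: less_induct)
  case less
  note s = slicesD[OF less.prems(1)]
  have QL: "0 \<le> Q * L" using Q L by simp
  obtain u where u: "u \<in> slices k" "u \<notin> R" "fst u = fst c" "\<And>i. snd u i \<le> snd c i"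
    "\<And>i. i \<in> fst c \<Longrightarrow> 100 * Q * L / (\<eta> i (snd c i))^2 \<le> T * mg u F"
    using anchor[OF less.prems(1,2)] by auto
  have ap: "41 * bar l (snd c l) \<le> payoff \<xi> u" if "l \<in> fst c" for l
    unfolding bar_def using anchor_payoff[OF u(1) u(5)[OF that]] \<eta> eta_le by auto
  show ?case
  proof (cases "\<exists>i\<in>fst c. snd u i \<noteq> snd c i")
    case False
    have "snd u l = snd c l" for l
      using False s(7)[of l] u(4)[of l] by (cases "l \<in> fst c") auto
    then have "u = c" using u by (auto simp: prod_eq_iff)
    then have "41 * bar i (snd c i) \<le> payoff \<xi> c" using ap[OF less.prems(3)] by simp
    moreover have "0 \<le> bar i (snd c i)" using QL by (simp add: bar_def)
    ultimately show ?thesis by linarith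
  next
    case True
    then obtain l where l: "l \<in> fst c" "snd u l < snd c l" using u(4) by (metis order_le_less)
    have "1 \<le> snd u l" using slicesD(5)[OF u(1), of l] u(3) l by auto
    then have l2: "2 \<le> snd c l" using l by simp
    let ?y = "lower c l" and ?e = "\<eta> l (snd c l)"
    have y: "?y \<in> slices k" using lower_slice less.prems(1) l l2 by auto
    have uy: "snd u m \<le> snd ?y m" for m using u(4)[of m] l by (auto simp: lower_def)
    have chain: "weight w (fst u) (snd u) * payoff \<xi> u \<le> weight w (fst ?y) (snd ?y) * payoff \<xi> ?y"
    proof (rule payoff_chain[OF y u(1)])
      fix b m assume b: "b \<in> slices k" "fst b = fst ?y" "\<And>i. snd u i \<le> snd b i" "\<And>i. snd b i \<le> snd ?y i" "m \<in> fst b"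
      have "(\<Sum>i\<in>fst b. snd b i) \<le> (\<Sum>i\<in>fst ?y. snd ?y i)" unfolding b(2) using b(4) by (intro sum_mono) auto
      also have "\<dots> < (\<Sum>i\<in>fst c. snd c i)"
        unfolding fst_lower using l s(4) by (intro sum_strict_mono_ex1) (auto simp: lower_def)
      finally have lt: "(\<Sum>i\<in>fst b. snd b i) < (\<Sum>i\<in>fst c. snd c i)" .
      have "b \<notin> R"
      proof
        assume "b \<in> R"
        then have "u \<in> R" by (rule R_down) (use b u slicesD(5)[OF u(1)] in auto)
        then show False using u by simp
      qed
      from step_if_large[OF b(1,5) less.hyps[OF lt b(1) this b(5)]]
      show "payoff \<xi> (lower b m) \<le> (1 + 4 * \<eta> m (snd b m)) * payoff \<xi> b" .
    qed (use u uy in auto)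
    have "15/16 * payoff \<xi> u \<le> weight w (fst u) (snd u) * payoff \<xi> u"
      using weight_ge[of "fst u"] slicesD(1)[OF u(1)] payoff_nonneg by (intro mult_right_mono) auto
    also note chain
    also have "weight w (fst ?y) (snd ?y) * payoff \<xi> ?y \<le> payoff \<xi> ?y"
      using weight_01 payoff_nonneg by (intro mult_left_le_one_le) (auto intro: less_imp_le)
    finally have Y: "15/16 * payoff \<xi> u \<le> payoff \<xi> ?y" .
    have Yi: "38 * bar m (snd c m) \<le> payoff \<xi> ?y" if "m \<in> fst c" for m
    proof -
      have "0 \<le> bar m (snd c m)" using QL by (simp add: bar_def)
      then show ?thesis using ap[OF that] Y by linarith
    qed
    have e: "0 < ?e" "?e \<le> 1/4" using \<eta> by auto
    have "32 * Q * L / ?e = 32 * ?e * bar l (snd c l)" using e by (simp add: power2_eq_square bar_def)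
    also have "\<dots> \<le> 8 * bar l (snd c l)" using e QL by (intro mult_right_mono) (auto simp: bar_def)
    finally have "32 * Q * L / ?e \<le> 8 * bar l (snd c l)" .
    moreover have "(1 + 2 * ?e) * payoff \<xi> c \<le> 3/2 * payoff \<xi> c" using e payoff_nonneg by (intro mult_right_mono) auto
    ultimately have "payoff \<xi> ?y \<le> 3/2 * payoff \<xi> c + 8 * bar l (snd c l)" using regret_step[OF less.prems(1) l(1)] by linarith
    \<comment> \<open>The additive error takes at most \<open>8/38\<close> of the payoff of
      \<open>?y\<close>, and \<open>38 * (30/38) / (3/2) = 20\<close> is more than 16. The bound at
      \<open>l\<close> controls the error, the bound at \<open>i\<close> gives the claim.\<close>
    then show ?thesis using Yi[OF l(1)] Yi[OF less.prems(3)] payoff_nonneg[of \<xi> ?y] by linarith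
  qed
qed

lemma payoff_step:
  assumes c: "c \<in> slices k" "i \<in> fst c"
  shows "payoff \<xi> (lower c i) \<le> (1 + 4 * \<eta> i (snd c i)) * payoff \<xi> c"
proof (cases "c \<in> R")
  case True
  have "payoff \<xi> (lower c i) = 0"
  proof (cases "2 \<le> snd c i")
    case True then show ?thesis using R_lower[OF \<open>c \<in> R\<close> c(2)] by (intro payoff_dead) auto
  next
    case False
    then show ?thesis using c slicesD(1)[OF c(1)] by (intro payoff_zero[of i]) (auto simp: lower_def)
  qed
  then show ?thesis using payoff_dead[OF True] by simp
next
  case False
  then show ?thesis using step_if_large[OF c] payoff_large[OF c(1) False c(2)] by simp
qed

lemma mg_outcome: "c \<in> slices k \<Longrightarrow> mg c (outcome \<xi>) = weight w (fst c) (snd c) * (payoff \<xi> c / T)"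
  unfolding outcome_def[abs_def] using mg_weight[of c k w "\<lambda>z. (\<Sum>t<T. walk_value F (walk \<xi> t) z) / T"]
    mgw_scale[of w c "1 / T"] mgw_sum[of w c "\<lambda>t. walk_value F (walk \<xi> t)" "{..<T}"]
  by (simp add: payoff_def)

lemma outcome_01: "0 \<le> outcome \<xi> z" "outcome \<xi> z \<le> 1"
proof -
  have s: "0 \<le> (\<Sum>t<T. walk_value F (walk \<xi> t) z) / T" using walk_value_01 by (intro divide_nonneg_nonneg sum_nonneg) auto
  have "(\<Sum>t<T. walk_value F (walk \<xi> t) z) \<le> (\<Sum>t<T. 1)" using walk_value_01 by (intro sum_mono) auto
  then have s2: "(\<Sum>t<T. walk_value F (walk \<xi> t) z) / T \<le> 1" using T by simp
  show "0 \<le> outcome \<xi> z" unfolding outcome_def using s weight_01 by (intro mult_nonneg_nonneg) (auto intro: less_imp_le)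
  show "outcome \<xi> z \<le> 1" unfolding outcome_def using s s2 weight_01[of "{..<d}" z] by (intro mult_le_one) auto
qed

lemma outcome_monotone:
  assumes "I \<subseteq> {..<d}" "card I \<le> k" "\<And>i. i \<in> I \<Longrightarrow> u i \<le> v i" "\<And>i. i \<in> I \<Longrightarrow> v i \<le> r i" "\<And>i. i \<notin> I \<Longrightarrow> u i = 0" "\<And>i. i \<notin> I \<Longrightarrow> v i = 0"
  shows "mg (I, u) (outcome \<xi>) \<le> mg (I, v) (outcome \<xi>)"
\<comment> \<open>\<open>slices\<close> contains neither empty index sets nor level 0. In the former
  case both sides agree, in the latter the left side is 0.\<close>
proof (cases "I = {} \<or> (\<exists>i\<in>I. u i = 0)")
  case True
  show ?thesis
  proof (cases "\<exists>i\<in>I. u i = 0")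
    case True
    then obtain i where i: "i \<in> I" "u i = 0" by auto
    then have "outcome \<xi> (override (I, u) z) = 0" for z
      using assms(1) by (simp add: outcome_def override_def walk_value_zero[of i] subset_eq)
    then have "mg (I, u) (outcome \<xi>) = 0" by (simp add: mg_def)
    also have "0 \<le> mg (I, v) (outcome \<xi>)" unfolding mg_def by (intro expect_nonneg outcome_01)
    finally show ?thesis .
  next
    case False
    then have "I = {}" using True by auto
    then show ?thesis by (simp add: mg_def override_def)
  qed
next
  case False
  have u: "(I, u) \<in> slices k" and v: "(I, v) \<in> slices k"
    using assms False by (force simp: slices_def PiE_dflt_def Suc_le_eq intro: order_trans)+
  have "u i \<le> v i" for i using assms by (cases "i \<in> I") auto
  then have "weight w (fst (I, u)) (snd (I, u)) * payoff \<xi> (I, u) \<le> weight w (fst (I, v)) (snd (I, v)) * payoff \<xi> (I, v)"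
    by (intro payoff_chain[OF v u] payoff_step) auto
  then show ?thesis unfolding mg_outcome[OF u] mg_outcome[OF v] by (simp add: divide_right_mono)
qed

text \<open>Only constraints of kind 0 at single levels of coordinate 0 are used: these levels
  partition the grid, and level 0 contributes nothing.\<close>

lemma expect_outcome:
  assumes k: "1 \<le> k"
  shows "expect pz (\<lambda>z. weight w {..<d} z * F z) - 2 * \<eta>0 - 32 * Q * L / (\<eta>0 * T) \<le> expect pz (outcome \<xi>)"
proof -
  have d0: "0 < d" using d_pos by simp
  let ?wF = "\<lambda>z. weight w {..<d} z * F z"
  define E where "E = 32 * Q * L / \<eta>0"
  have E0: "0 \<le> E" using Q L \<eta> by (simp add: E_def)
  have lev: "T * mg (level_slice 0 j) ?wF \<le> (1 + 2 * \<eta>0) * (T * mg (level_slice 0 j) (outcome \<xi>)) + E" if "j \<le> r 0" for j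
  proof (cases "j = 0")
    case True
    have "F (override (level_slice 0 j) z) = 0" for z using d0 True by (intro F0[of 0]) (auto simp: override_def level_slice_def)
    then have "mg (level_slice 0 j) ?wF = 0" by (simp add: mg_def)
    moreover have "0 \<le> mg (level_slice 0 j) (outcome \<xi>)" unfolding mg_def by (intro expect_nonneg outcome_01)
    ultimately show ?thesis using E0 \<eta> by simp
  next
    case False
    then have c: "level_slice 0 j \<in> slices k" using that d0 k by (intro level_slice_in) auto
    let ?c = "level_slice 0 j" and ?W = "weight w (fst (level_slice 0 j)) (snd (level_slice 0 j))"
    have "T * mg ?c ?wF = ?W * (T * mgw w ?c F)" using mg_weight[OF c, of w F] by simp
    also have "\<dots> \<le> ?W * ((1 + 2 * \<eta>0) * payoff \<xi> ?c + E)"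
      using regret_source[OF c, folded E_def] weight_01 by (intro mult_left_mono) (auto intro: less_imp_le)
    also have "\<dots> = (1 + 2 * \<eta>0) * (T * mg ?c (outcome \<xi>)) + ?W * E"
      using T mg_outcome[OF c] by (simp add: algebra_simps)
    also have "?W * E \<le> E" using weight_01 E0 by (intro mult_left_le_one_le) (auto intro: less_imp_le)
    finally show ?thesis by simp
  qed
  have "T * expect pz ?wF = (\<Sum>j\<le>r 0. pmf (bp 0) j * (T * mg (level_slice 0 j) ?wF))"
    unfolding expect_levels[OF d0, of ?wF] by (simp add: sum_distrib_left mult_ac)
  also have "\<dots> \<le> (\<Sum>j\<le>r 0. pmf (bp 0) j * ((1 + 2 * \<eta>0) * (T * mg (level_slice 0 j) (outcome \<xi>)) + E))"
    using lev by (intro sum_mono mult_left_mono) auto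
  also have "\<dots> = (1 + 2 * \<eta>0) * T * expect pz (outcome \<xi>) + (\<Sum>j\<le>r 0. pmf (bp 0) j) * E"
    unfolding expect_levels[OF d0, of "outcome \<xi>"] by (simp add: sum_distrib_left sum_distrib_right sum.distrib algebra_simps)
  also have "\<dots> = (1 + 2 * \<eta>0) * T * expect pz (outcome \<xi>) + E" using sum_mass[OF d0] by simp
  finally have "expect pz ?wF \<le> ((1 + 2 * \<eta>0) * T * expect pz (outcome \<xi>) + E) / T" using T by (simp add: field_simps)
  also have "\<dots> = expect pz (outcome \<xi>) + 2 * \<eta>0 * expect pz (outcome \<xi>) + E / T" using T by (simp add: field_simps)
  also have "2 * \<eta>0 * expect pz (outcome \<xi>) \<le> 2 * \<eta>0 * 1"
    using \<eta> outcome_01 by (intro mult_left_mono expect_le_const[OF finite_pz]) auto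
  finally show ?thesis by (simp add: E_def)
qed

end

text \<open>The margin of a level is paid only by points below that level. The sum is kept in this
  form because for \<open>k = 1\<close> margins are large just where \<open>F\<close> is small
  below.\<close>

lemma expect_weighted:
  "expect pz F - (\<Sum>i<d. \<Sum>l\<in>{1..r i}. 4 * \<eta> i l * expect pz (\<lambda>z. F z * of_bool (z i < l)))
    \<le> expect pz (\<lambda>z. weight w {..<d} z * F z)"
proof -
  have "expect pz F - (\<Sum>i<d. \<Sum>l\<in>{1..r i}. 4 * \<eta> i l * expect pz (\<lambda>z. F z * of_bool (z i < l)))
      = expect pz (\<lambda>z. F z - (\<Sum>i<d. \<Sum>l\<in>{1..r i}. 4 * \<eta> i l * (F z * of_bool (z i < l))))"
    by (simp add: expect_diff[OF finite_pz] expect_sum[OF finite_pz])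
  also have "\<dots> \<le> expect pz (\<lambda>z. weight w {..<d} z * F z)"
  proof (intro expect_mono finite_pz)
    fix z
    have "(\<Sum>i<d. \<Sum>l\<in>{1..r i}. 4 * \<eta> i l * (F z * of_bool (z i < l))) = (\<Sum>i<d. \<Sum>l\<in>{z i<..r i}. 4 * \<eta> i l) * F z"
      unfolding sum_distrib_right by (intro sum.cong sum.mono_neutral_cong_right) (auto simp: of_bool_def)
    then have "F z - (\<Sum>i<d. \<Sum>l\<in>{1..r i}. 4 * \<eta> i l * (F z * of_bool (z i < l))) = (1 - (\<Sum>i<d. \<Sum>l\<in>{z i<..r i}. 4 * \<eta> i l)) * F z"
      by (simp add: left_diff_distrib)
    also have "\<dots> \<le> weight w {..<d} z * F z" using weight_loss[of "{..<d}" z] F by (intro mult_right_mono) auto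
    finally show "F z - (\<Sum>i<d. \<Sum>l\<in>{1..r i}. 4 * \<eta> i l * (F z * of_bool (z i < l))) \<le> weight w {..<d} z * F z" .
  qed
  finally show ?thesis .
qed

end

section \<open>The algorithm on the grid\<close>

text \<open>The pruning and the game are described as reading a grid function, and a grid value at
  \<open>z\<close> costs one query at \<open>pt z\<close>. The assumptions concern only functions of
  the form \<open>Ff f\<close>, since only these are known to be admissible.\<close>

lemma computable_reads_via:
  fixes R :: "nat \<Rightarrow> ('p \<Rightarrow> real) \<Rightarrow> 'p set" and \<phi> :: "'p \<Rightarrow> real \<Rightarrow> real" and pt :: "'p \<Rightarrow> 'q"
  defines "Ff \<equiv> \<lambda>f z. \<phi> z (f (pt z))"
  assumes pt: "range pt \<subseteq> Q"
    and R0: "\<And>f. R 0 (Ff f) = {}"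
    and loc: "\<And>t f g. (\<And>z. z \<in> R t (Ff f) \<Longrightarrow> Ff f z = Ff g z) \<Longrightarrow> R (Suc t) (Ff f) = R (Suc t) (Ff g)"
    and mono: "\<And>t f. R t (Ff f) \<subseteq> R (Suc t) (Ff f)"
    and fin: "\<And>t f. finite (R t (Ff f))" and card: "\<And>f. card (R T (Ff f)) \<le> n"
    and G: "\<And>f g. (\<And>z. z \<in> R T (Ff f) \<Longrightarrow> Ff f z = Ff g z) \<Longrightarrow> G (Ff f) = G (Ff g)"
  shows "computable Q (\<lambda>_. n) (\<lambda>f. G (Ff f))"
proof (rule computable_reads[where R="\<lambda>t f. pt ` R t (Ff f)" and T=T])
  have ag: "Ff f z = Ff g z" if "\<forall>q\<in>pt ` R t (Ff f). f q = g q" "z \<in> R t (Ff f)" for t f g z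
    using that by (simp add: Ff_def)
  show "pt ` R (Suc t) (Ff f) = pt ` R (Suc t) (Ff g)" if "\<forall>q\<in>pt ` R t (Ff f). f q = g q" for t f g
    using loc[of t f g] ag[OF that] by simp
  show "G (Ff f) = G (Ff g)" if "\<forall>q\<in>pt ` R T (Ff f). f q = g q" for f g
    using G[of f g] ag[OF that] by simp
  show "pt ` R t (Ff f) \<subseteq> pt ` R (Suc t) (Ff f)" for t f using mono by (rule image_mono)
  show "card (pt ` R T (Ff f)) \<le> n" for f using card_image_le[OF fin, of pt T f] card[of f] by (rule order_trans)
qed (use R0 fin pt in auto)

context game
begin

text \<open>Following a walk needs no queries, because its branches depend on weights and coins
  alone. A round reads \<open>F\<close> only at the sampled point and at the ends of the walks from
  it and from its \<open>d\<close> lower neighbours.\<close>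

definition query_points :: "(nat \<Rightarrow> point \<times> (point \<Rightarrow> nat)) \<Rightarrow> nat \<Rightarrow> point set" where
  "query_points \<xi> t = {fst (\<xi> t), walk_end (walk \<xi> t) (fst (\<xi> t))} \<union>
     (\<lambda>i. walk_end (walk \<xi> t) ((fst (\<xi> t))(i := fst (\<xi> t) i - 1))) ` {..<d}"

lemma query_points_card: "finite (query_points \<xi> t)" "card (query_points \<xi> t) \<le> d + 2"
proof -
  show "finite (query_points \<xi> t)" by (simp add: query_points_def)
  have "card (query_points \<xi> t) \<le> card {fst (\<xi> t), walk_end (walk \<xi> t) (fst (\<xi> t))}
      + card ((\<lambda>i. walk_end (walk \<xi> t) ((fst (\<xi> t))(i := fst (\<xi> t) i - 1))) ` {..<d})"
    unfolding query_points_def by (rule card_Un_le)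
  also have "\<dots> \<le> 2 + card {..<d}" by (intro add_mono card_image_le) (auto simp: card_insert_if)
  finally show "card (query_points \<xi> t) \<le> d + 2" by simp
qed

lemma walk_local:
  assumes "game d r bp \<kappa> F2 w \<eta> \<eta>0 K T" "\<And>s z. s < t \<Longrightarrow> z \<in> query_points \<xi> s \<Longrightarrow> F z = F2 z"
  shows "walk \<xi> t = game.walk d r bp \<kappa> F2 w \<eta> \<eta>0 k K \<xi> t"
proof -
  interpret G2: game d r bp \<kappa> F2 w \<eta> \<eta>0 k K T by (rule assms(1))
  have dem: "demand \<pi> = demand \<pi>'" if "\<And>a. a \<in> constraints \<Longrightarrow> \<pi> a = \<pi>' a" for \<pi> \<pi>'
    using that by (intro ext) (auto simp: demand_def intro!: sum.cong)
  have wk: "walk \<xi> s = G2.walk \<xi> s" if "\<And>a. a \<in> constraints \<Longrightarrow> weights \<xi> s a = G2.weights \<xi> s a" for s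
    using dem[OF that] by (simp add: walk_def G2.walk_def)
  \<comment> \<open>Weights are compared on \<open>constraints\<close> only; for other indices the
    target may lie outside \<open>query_points\<close>.\<close>
  have "(\<And>s z. s < t \<Longrightarrow> z \<in> query_points \<xi> s \<Longrightarrow> F z = F2 z) \<Longrightarrow> \<forall>a\<in>constraints. weights \<xi> t a = G2.weights \<xi> t a" for t
  proof (induction t)
    case (Suc t)
    have IH: "\<forall>a\<in>constraints. weights \<xi> t a = G2.weights \<xi> t a"
      by (rule Suc.IH) (rule Suc.prems[OF less_SucI])
    then have w: "walk \<xi> t = G2.walk \<xi> t" by (intro wk) auto
    have F: "F z = F2 z" if "z \<in> query_points \<xi> t" for z using Suc.prems that by blast
    have "gap (walk \<xi> t) (fst (\<xi> t)) a = G2.gap (walk \<xi> t) (fst (\<xi> t)) a" if a: "a \<in> constraints" for a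
    proof -
      have 1: "walk_value F (walk \<xi> t) (fst (\<xi> t)) = walk_value F2 (walk \<xi> t) (fst (\<xi> t))"
        unfolding walk_value_def by (rule F) (simp add: query_points_def)
      have "target F (walk \<xi> t) (snd a) (fst (\<xi> t)) = target F2 (walk \<xi> t) (snd a) (fst (\<xi> t))"
      proof (cases "snd a")
        case 0
        then show ?thesis using F[of "fst (\<xi> t)"] by (simp add: target_def query_points_def)
      next
        case (Suc i)
        then have "i < d" using a constraints_sub by auto
        then have "walk_end (walk \<xi> t) ((fst (\<xi> t))(i := fst (\<xi> t) i - 1)) \<in> query_points \<xi> t"
          by (auto simp: query_points_def)
        then show ?thesis using Suc F by (simp add: target_def walk_value_def)
      qed
      with 1 show ?thesis by (simp add: gap_def G2.gap_def)
    qed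
    then show ?case using IH unfolding weights_Suc G2.weights_Suc w[symmetric]
      by (simp add: update_def G2.update_def)
  qed simp
  from this[OF assms(2)] show ?thesis by (intro wk) auto
qed

lemma average_bounds:
  assumes B: "\<And>y. (\<And>i. y i \<le> z i) \<Longrightarrow> F y \<le> B" and B0: "0 \<le> B"
  shows "0 \<le> weight w {..<d} z * ((\<Sum>t<T. F (walk_end (\<beta> t) z)) / T)"
    "weight w {..<d} z * ((\<Sum>t<T. F (walk_end (\<beta> t) z)) / T) \<le> B"
proof -
  let ?a = "(\<Sum>t<T. F (walk_end (\<beta> t) z)) / T"
  have a: "0 \<le> ?a" using F by (intro divide_nonneg_nonneg sum_nonneg) auto
  have "(\<Sum>t<T. F (walk_end (\<beta> t) z)) \<le> (\<Sum>t<T. B)" using walk_end_le by (intro sum_mono B)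
  then have "?a \<le> B" using T by (simp add: divide_le_eq mult.commute)
  moreover have "weight w {..<d} z * ?a \<le> ?a" using weight_01 a by (intro mult_left_le_one_le) (auto intro: less_imp_le)
  ultimately show "weight w {..<d} z * ?a \<le> B" by linarith
  show "0 \<le> weight w {..<d} z * ?a" using a weight_01 by (intro mult_nonneg_nonneg) (auto intro: less_imp_le)
qed

end

locale algorithm = grid d r bp \<kappa> for d r bp \<kappa> +
  fixes k :: nat and \<epsilon> \<delta> :: real
  assumes k: "1 \<le> k" and eps: "0 < \<epsilon>" "\<epsilon> < 1" and kappa_le: "\<kappa> \<le> \<epsilon>" and delta: "0 < \<delta>" "\<delta> \<le> 1"
begin

text \<open>With \<open>rh\<close> below, the loss \<open>6 * e1 + 6 * rh * d ^ k\<close> of the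
  pruning is \<open>\<epsilon> / 8\<close>.\<close>

definition e1 :: real where "e1 = \<epsilon> / 96"
definition rh :: real where "rh = \<epsilon> / (96 * real d ^ k)"
definition slice_bound :: real where "slice_bound = (d / \<kappa>) ^ k"
definition nn :: nat where "nn = nat \<lceil>ln (6 * slice_bound ^ 2 / \<delta>) / e1\<rceil> + 1"
text \<open>There are at most \<open>d / \<kappa>\<close> positive levels, so
  \<open>4 * \<eta>1\<close> summed over all of them is at most
  \<open>\<epsilon> / 16\<close>.\<close>

definition \<eta>1 :: real where "\<eta>1 = \<epsilon> * \<kappa> / (64 * d)"
definition \<eta>0 :: real where "\<eta>0 = \<epsilon> / 64"

lemma d_k: "1 \<le> real d ^ k" using d_pos by simp

lemma e1: "0 < e1" "e1 \<le> 1" using eps by (auto simp: e1_def)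

lemma rh: "0 < rh" "rh \<le> e1"
proof -
  show "0 < rh" using eps d_pos by (simp add: rh_def)
  have "\<epsilon> / (96 * real d ^ k) \<le> \<epsilon> / (96 * 1)" using eps d_k by (intro frac_le) auto
  then show "rh \<le> e1" by (simp add: rh_def e1_def)
qed

sublocale pruning d r bp \<kappa> k nn e1 rh
  using e1 rh by unfold_locales (auto simp: nn_def)

definition L :: real where "L = ln (3 * real (card (game.constraints d r k)) / \<delta>)"
text \<open>Up to a constant this is \<open>1 / rh\<close>, the reciprocal of the marginal that a
  minimal survivor is sure to have. For \<open>k = 1\<close> the factor
  \<open>1 / \<epsilon>\<close> is taken over by the larger margins.\<close>

definition \<Theta> :: real where "\<Theta> = (if k = 1 then d else d ^ k / \<epsilon>)"
definition rounds :: nat where "rounds = nat \<lceil>40000 * \<Theta> * game.Q \<kappa> k * L / \<eta>1^2\<rceil> + 1"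
definition coin_size :: nat where "coin_size = rounds * (d + 1)"

text \<open>The floor makes the additive error \<open>e1 + rh\<close> of the estimates at most a
  quarter of the bound. The inserted 0 serves the case that no level survives.\<close>

definition level_bound :: "(point \<Rightarrow> real) \<Rightarrow> (slice \<times> nat \<Rightarrow> point) \<Rightarrow> nat \<Rightarrow> nat \<Rightarrow> real" where
  "level_bound F \<zeta> i j = max (4 * (e1 + rh)) (Max (insert 0 (est F \<zeta> (survivors_cut F \<zeta>) `
     {level_slice i l |l. 1 \<le> l \<and> l \<le> j \<and> l \<le> r i \<and> i < d \<and> level_slice i l \<notin> survivors_cut F \<zeta>})))"

text \<open>For \<open>k = 1\<close> the query budget requires margins that shrink with the square root of the
  marginal; \<open>level_bound\<close> is an estimate of its running maximum.\<close>

definition margins :: "(point \<Rightarrow> real) \<Rightarrow> (slice \<times> nat \<Rightarrow> point) \<Rightarrow> nat \<Rightarrow> nat \<Rightarrow> real" where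
  "margins F \<zeta> i j = \<eta>1 / (if k = 1 then 5 * sqrt (level_bound F \<zeta> i j) else 1)"

definition wgt :: "(nat \<Rightarrow> nat \<Rightarrow> real) \<Rightarrow> nat \<Rightarrow> nat \<Rightarrow> real" where
  "wgt \<eta> i j = (\<Prod>l\<in>{j<..r i}. 1 / (1 + 4 * \<eta> i l))"

abbreviation game_walk :: "(point \<Rightarrow> real) \<Rightarrow> slice set \<Rightarrow> (nat \<Rightarrow> nat \<Rightarrow> real) \<Rightarrow> (nat \<Rightarrow> point \<times> (point \<Rightarrow> nat)) \<Rightarrow> nat \<Rightarrow> point \<Rightarrow> nat" where
  "game_walk F R \<eta> \<equiv> game.walk d r bp \<kappa> (cut F R) (wgt \<eta>) \<eta> \<eta>0 k coin_size"

definition margins_ok :: "(nat \<Rightarrow> nat \<Rightarrow> real) \<Rightarrow> bool" where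
  "margins_ok \<eta> \<longleftrightarrow> (\<forall>i j. 0 < \<eta> i j \<and> \<eta> i j \<le> \<eta>0)"

type_synonym state = "slice set \<times> (nat \<Rightarrow> nat \<Rightarrow> real) \<times> (nat \<Rightarrow> point \<Rightarrow> nat)"

definition prune_state :: "(point \<Rightarrow> real) \<Rightarrow> (slice \<times> nat \<Rightarrow> point) \<Rightarrow> slice set \<times> (nat \<Rightarrow> nat \<Rightarrow> real)" where
  "prune_state F \<zeta> = (survivors_cut F \<zeta>, margins F \<zeta>)"

text \<open>\<open>computable_bind\<close> asks for a continuation after every pair
  \<open>p\<close>, also those that pruning never produces. The guard gives a trivial walk to pairs
  whose margins do not define a game.\<close>

definition walks :: "(point \<Rightarrow> real) \<Rightarrow> slice set \<times> (nat \<Rightarrow> nat \<Rightarrow> real) \<Rightarrow> (nat \<Rightarrow> point \<times> (point \<Rightarrow> nat)) \<Rightarrow> nat \<Rightarrow> point \<Rightarrow> nat" where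
  "walks F p \<xi> = (\<lambda>t. if margins_ok (snd p) \<and> t < rounds then game_walk F (fst p) (snd p) \<xi> t else (\<lambda>_. 0))"

definition final_state :: "(point \<Rightarrow> real) \<Rightarrow> (slice \<times> nat \<Rightarrow> point) \<times> (nat \<Rightarrow> point \<times> (point \<Rightarrow> nat)) \<Rightarrow> state" where
  "final_state F s = (let p = prune_state F (fst s) in (fst p, snd p, walks F p (snd s)))"

definition answer :: "state \<Rightarrow> point \<Rightarrow> (point \<Rightarrow> real) \<Rightarrow> real" where
  "answer st z F = weight (wgt (fst (snd st))) {..<d} z *
     ((\<Sum>t<rounds. cut F (fst st) (walk_end (snd (snd st) t) z)) / rounds)"

definition result :: "(point \<Rightarrow> real) \<Rightarrow> (slice \<times> nat \<Rightarrow> point) \<times> (nat \<Rightarrow> point \<times> (point \<Rightarrow> nat)) \<Rightarrow> point \<Rightarrow> real" where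
  "result F s z = answer (final_state F s) z F"

definition seeds :: "((slice \<times> nat \<Rightarrow> point) \<times> (nat \<Rightarrow> point \<times> (point \<Rightarrow> nat))) pmf" where
  "seeds = pair_pmf prune_seed (game.game_seed d r bp coin_size rounds)"

section \<open>Ranges of the parameters\<close>

lemma eta01: "0 < \<eta>1" "\<eta>1 \<le> \<epsilon> * \<eta>0" "0 < \<eta>0" "\<eta>0 \<le> 1/4" "\<eta>1 \<le> \<eta>0"
proof -
  show "0 < \<eta>1" "0 < \<eta>0" "\<eta>0 \<le> 1/4" using eps kappa d_pos by (auto simp: \<eta>1_def \<eta>0_def)
  have "\<epsilon> * \<kappa> / (64 * d) \<le> \<epsilon> * \<epsilon> / (64 * 1)"
    using eps kappa kappa_le d_pos by (intro frac_le mult_mono) auto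
  then show 1: "\<eta>1 \<le> \<epsilon> * \<eta>0" by (simp add: \<eta>1_def \<eta>0_def)
  have "\<epsilon> * \<eta>0 \<le> 1 * \<eta>0" using eps by (intro mult_right_mono) (auto simp: \<eta>0_def)
  then show "\<eta>1 \<le> \<eta>0" using 1 by simp
qed

lemma level_bound_ge: "4 * (e1 + rh) \<le> level_bound F \<zeta> i j"
  by (simp add: level_bound_def)

lemma level_bound_pos: "0 < level_bound F \<zeta> i j"
proof -
  have "0 < 4 * (e1 + rh)" using e1 rh by simp
  then show ?thesis using level_bound_ge by (rule less_le_trans)
qed

text \<open>For \<open>k = 1\<close> margins may exceed \<open>\<eta>1\<close>, but at most by the
  factor \<open>1 / \<epsilon>\<close>: \<open>level_bound\<close> is at least
  \<open>4 * e1 = \<epsilon> / 24\<close>, and \<open>25 * \<epsilon> / 24\<close> is at least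
  \<open>\<epsilon>^2\<close>.\<close>

lemma eps_le_scale: "\<epsilon> \<le> (if k = 1 then 5 * sqrt (level_bound F \<zeta> i j) else 1)"
proof -
  have "\<epsilon>^2 \<le> \<epsilon> * 1" unfolding power2_eq_square using eps by (intro mult_left_mono) auto
  also have "\<dots> \<le> 25 * (4 * e1)" using eps by (simp add: e1_def)
  also have "\<dots> \<le> 25 * (4 * (e1 + rh))" using rh by simp
  also have "\<dots> \<le> 25 * level_bound F \<zeta> i j" by (intro mult_left_mono level_bound_ge) simp
  finally have "\<epsilon> \<le> sqrt (25 * level_bound F \<zeta> i j)" using eps by (intro real_le_rsqrt)
  also have "sqrt (25 * level_bound F \<zeta> i j) = 5 * sqrt (level_bound F \<zeta> i j)"
    by (simp add: real_sqrt_mult)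
  finally show ?thesis using eps by auto
qed

lemma margins_bounds: "0 < margins F \<zeta> i j" "margins F \<zeta> i j \<le> \<eta>1 / \<epsilon>" "margins F \<zeta> i j \<le> \<eta>0"
proof -
  note s = eps_le_scale[of F \<zeta> i j]
  show "0 < margins F \<zeta> i j" unfolding margins_def using s eps eta01 by (intro divide_pos_pos) auto
  show 1: "margins F \<zeta> i j \<le> \<eta>1 / \<epsilon>" unfolding margins_def using s eps eta01 by (intro divide_left_mono mult_pos_pos) auto
  have "\<eta>1 / \<epsilon> \<le> \<eta>0" using eta01 eps by (simp add: divide_le_eq mult.commute)
  then show "margins F \<zeta> i j \<le> \<eta>0" using 1 by simp
qed

lemma margins_ok: "margins_ok (margins F \<zeta>)"
  using margins_bounds by (simp add: margins_ok_def)

lemma wgt_01: "margins_ok \<eta> \<Longrightarrow> 0 < wgt \<eta> i j" "margins_ok \<eta> \<Longrightarrow> wgt \<eta> i j \<le> 1"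
proof -
  assume m: "margins_ok \<eta>"
  then have p: "0 < \<eta> i l" for l by (simp add: margins_ok_def)
  show "0 < wgt \<eta> i j" unfolding wgt_def using p by (intro prod_pos) (simp add: add_pos_pos)
  have q: "1 \<le> 1 + 4 * \<eta> i l" for l using p[of l] by simp
  show "wgt \<eta> i j \<le> 1" unfolding wgt_def using p q by (intro prod_le_1) (simp add: add_pos_pos less_imp_le)
qed

lemma rounds_pos: "1 \<le> rounds" by (simp add: rounds_def)

lemma game_cut:
  assumes "admissible F" "margins_ok \<eta>" shows "game d r bp \<kappa> (cut F R) (wgt \<eta>) \<eta> \<eta>0 coin_size rounds"
proof unfold_locales
  have "admissible (cut F R)" using assms admissible_cut by auto
  then show "0 \<le> cut F R z" "cut F R z \<le> 1" "i < d \<Longrightarrow> z i = 0 \<Longrightarrow> cut F R z = 0" for z i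
    by (auto simp: admissible_def)
  show "0 < wgt \<eta> i j" "wgt \<eta> i j \<le> 1" for i j using wgt_01 assms by auto
  show "0 < \<eta> i j" "\<eta> i j \<le> 1/4" for i j
    using assms(2) eta01 order_trans[of "\<eta> i j" \<eta>0 "1/4"] by (auto simp: margins_ok_def)
qed (use eta01 rounds_pos in \<open>auto simp: coin_size_def\<close>)

lemma result_eq:
  "result F (\<zeta>, \<xi>) z = weight (wgt (margins F \<zeta>)) {..<d} z *
     ((\<Sum>t<rounds. cut F (survivors_cut F \<zeta>) (walk_end (game_walk F (survivors_cut F \<zeta>) (margins F \<zeta>) \<xi> t) z)) / rounds)"
  by (simp add: result_def answer_def final_state_def prune_state_def walks_def margins_ok Let_def)

lemma result_bounds:
  assumes F: "admissible F" and B: "\<And>y. (\<And>i. y i \<le> z i) \<Longrightarrow> F y \<le> B" "0 \<le> B"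
  shows "0 \<le> result F s z" "result F s z \<le> B"
proof -
  obtain \<zeta> \<xi> where s: "s = (\<zeta>, \<xi>)" by (cases s)
  interpret G: game d r bp \<kappa> "cut F (survivors_cut F \<zeta>)" "wgt (margins F \<zeta>)" "margins F \<zeta>" \<eta>0 k coin_size rounds
    by (rule game_cut[OF F margins_ok])
  have "cut F (survivors_cut F \<zeta>) y \<le> B" if "\<And>i. y i \<le> z i" for y
    using B(1)[OF that] B(2) by (simp add: cut_def)
  from G.average_bounds[OF this B(2)] show "0 \<le> result F s z" "result F s z \<le> B"
    by (auto simp: s result_eq)
qed

section \<open>Queries of the three phases\<close>

definition prune_queries :: nat where
  "prune_queries = card (slices k) * ((level_of rh + 1) * (5 * nn))"

lemma computable_prune:
  fixes \<phi> :: "point \<Rightarrow> real \<Rightarrow> real" and pt :: "point \<Rightarrow> 'q"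
  assumes pt: "range pt \<subseteq> Qs"
  shows "computable Qs (\<lambda>_. prune_queries) (\<lambda>f. prune_state (\<lambda>z. \<phi> z (f (pt z))) \<zeta>)"
\<comment> \<open>One step more than there can be removals: the reads of the final set supply the
  estimates in \<open>level_bound\<close>.\<close>
proof (rule computable_reads_via[where R="\<lambda>t F. \<Union>s\<in>{..<t}. reads \<zeta> (removed F \<zeta> {} s)" and T="card (slices k) + 1"
      and G="\<lambda>F. prune_state F \<zeta>", OF pt], goal_cases)
  case (2 t f g)
  let ?F = "\<lambda>f z. \<phi> z (f (pt z))"
  have "removed (?F f) \<zeta> {} s = removed (?F g) \<zeta> {} s" if "s \<le> t" for s
    by (rule removed_local) (rule 2, use that in auto)
  then show ?case by auto
next
  case (6 f g)
  let ?F = "\<lambda>f z. \<phi> z (f (pt z))"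
  have s: "survivors_cut (?F f) \<zeta> = survivors_cut (?F g) \<zeta>"
    unfolding survivors_cut_def by (rule removed_local) (rule 6, auto)
  have e: "est (?F f) \<zeta> (survivors_cut (?F f) \<zeta>) c = est (?F g) \<zeta> (survivors_cut (?F f) \<zeta>) c"
    if "c \<in> slices k - survivors_cut (?F f) \<zeta>" for c
    by (rule est_local[OF _ that]) (rule 6, use that in \<open>auto simp: survivors_cut_def\<close>)
  have "est (?F f) \<zeta> (survivors_cut (?F f) \<zeta>) ` {level_slice i l |l. 1 \<le> l \<and> l \<le> j \<and> l \<le> r i \<and> i < d \<and> level_slice i l \<notin> survivors_cut (?F f) \<zeta>}
     = est (?F g) \<zeta> (survivors_cut (?F f) \<zeta>) ` {level_slice i l |l. 1 \<le> l \<and> l \<le> j \<and> l \<le> r i \<and> i < d \<and> level_slice i l \<notin> survivors_cut (?F f) \<zeta>}" for i j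
  proof (intro image_cong refl)
    fix c assume "c \<in> {level_slice i l |l. 1 \<le> l \<and> l \<le> j \<and> l \<le> r i \<and> i < d \<and> level_slice i l \<notin> survivors_cut (?F f) \<zeta>}"
    then have "c \<in> slices k - survivors_cut (?F f) \<zeta>" using level_slice_in[OF _ _ _ k] by blast
    then show "est (?F f) \<zeta> (survivors_cut (?F f) \<zeta>) c = est (?F g) \<zeta> (survivors_cut (?F f) \<zeta>) c"
      by (rule e)
  qed
  then have "level_bound (?F f) \<zeta> i j = level_bound (?F g) \<zeta> i j" for i j
    unfolding level_bound_def s by simp
  then have "margins (?F f) \<zeta> = margins (?F g) \<zeta>" by (simp only: margins_def[abs_def])
  then show ?case using s by (simp add: prune_state_def)
next
  case (3 t f)
  show ?case by (intro UN_mono) auto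
next
  case (5 f)
  show ?case unfolding prune_queries_def by (rule card_reads(2))
qed (auto simp: card_reads(1))

lemma computable_walks:
  fixes \<phi> :: "point \<Rightarrow> real \<Rightarrow> real" and pt :: "point \<Rightarrow> 'q"
  assumes pt: "range pt \<subseteq> Qs" and adm: "\<And>f. admissible (\<lambda>z. \<phi> z (f (pt z)))"
  shows "computable Qs (\<lambda>_. rounds * (d + 2)) (\<lambda>f. walks (\<lambda>z. \<phi> z (f (pt z))) p \<xi>)"
proof (cases "margins_ok (snd p)")
  case False
  then have "(\<lambda>f. walks (\<lambda>z. \<phi> z (f (pt z))) p \<xi>) = (\<lambda>_ _ _. 0)" by (simp add: walks_def fun_eq_iff)
  then show ?thesis using computable_mono[OF computable_const] by fastforce
next
  case True
  obtain R \<eta> where p: "p = (R, \<eta>)" by (cases p)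
  then have ok: "margins_ok \<eta>" using True by simp
  let ?F = "\<lambda>f z. \<phi> z (f (pt z))"
  let ?qp = "\<lambda>F s. game.query_points d r bp \<kappa> (cut F R) (wgt \<eta>) \<eta> \<eta>0 k coin_size \<xi> s"
  note gm = game_cut[OF adm ok]
  have loc: "game_walk (?F f) R \<eta> \<xi> t = game_walk (?F g) R \<eta> \<xi> t"
    if "\<And>s z. s < t \<Longrightarrow> z \<in> ?qp (?F f) s \<Longrightarrow> ?F f z = ?F g z" for t f g
    by (rule game.walk_local[OF gm gm]) (auto simp: cut_def that)
  have qp: "?qp (?F f) t = ?qp (?F g) t" if "game_walk (?F f) R \<eta> \<xi> t = game_walk (?F g) R \<eta> \<xi> t" for t f g
    using that by (simp add: game.query_points_def[OF gm])
  show ?thesis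
  proof (rule computable_reads_via[where R="\<lambda>t F. \<Union>s\<in>{..<t}. ?qp F s" and T=rounds and G="\<lambda>F. walks F p \<xi>", OF pt], goal_cases)
    case (2 t f g)
    have "?qp (?F f) s = ?qp (?F g) s" if "s \<le> t" for s
      by (rule qp, rule loc) (rule 2, use that in auto)
    then show ?case by auto
  next
    case (4 t f)
    then show ?case using game.query_points_card(1)[OF gm] by auto
  next
    case (5 f)
    have "card (\<Union>s\<in>{..<rounds}. ?qp (?F f) s) \<le> (\<Sum>s<rounds. card (?qp (?F f) s))" by (intro card_UN_le) simp
    also have "\<dots> \<le> (\<Sum>s<rounds. d + 2)" using game.query_points_card(2)[OF gm] by (intro sum_mono)
    finally show ?case by simp
  next
    case (6 f g)
    have "game_walk (?F f) R \<eta> \<xi> t = game_walk (?F g) R \<eta> \<xi> t" if "t < rounds" for t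
      by (rule loc) (rule 6, use that in auto)
    then show ?case using ok by (auto simp: walks_def p)
  next
    case (3 t f)
    show ?case by (intro UN_mono) auto
  qed auto
qed

lemma computable_final_state:
  fixes \<phi> :: "point \<Rightarrow> real \<Rightarrow> real" and pt :: "point \<Rightarrow> 'q"
  assumes pt: "range pt \<subseteq> Qs" and adm: "\<And>f. admissible (\<lambda>z. \<phi> z (f (pt z)))"
  shows "computable Qs (\<lambda>_. prune_queries + rounds * (d + 2)) (\<lambda>f. final_state (\<lambda>z. \<phi> z (f (pt z))) s)"
proof -
  have 1: "computable Qs (\<lambda>_. rounds * (d + 2) + 0) (\<lambda>f. (fst p, snd p, walks (\<lambda>z. \<phi> z (f (pt z))) p (snd s)))" for p
    by (rule computable_bind[OF computable_walks[OF pt adm], where m'="\<lambda>_ _. 0" and H="\<lambda>w _. (fst p, snd p, w)"])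
      (rule computable_const)
  have 2: "computable Qs (\<lambda>_. prune_queries + (rounds * (d + 2) + 0))
      (\<lambda>f. (\<lambda>p f. (fst p, snd p, walks (\<lambda>z. \<phi> z (f (pt z))) p (snd s))) (prune_state (\<lambda>z. \<phi> z (f (pt z))) (fst s)) f)"
    by (rule computable_bind[OF computable_prune[OF pt] 1])
  show ?thesis by (rule computable_mono[OF 2]) (auto simp: final_state_def Let_def)
qed

lemma computable_answer:
  fixes \<phi> :: "point \<Rightarrow> real \<Rightarrow> real" and pt :: "point \<Rightarrow> 'q"
  assumes pt: "range pt \<subseteq> Qs"
  shows "computable Qs (\<lambda>_. rounds) (\<lambda>f. answer st z (\<lambda>z. \<phi> z (f (pt z))))"
proof (rule computable_reads_via[where R="\<lambda>t F. if t = 0 then {} else (\<lambda>t. walk_end (snd (snd st) t) z) ` {..<rounds}" and T=1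
      and G="answer st z", OF pt], goal_cases)
  case (5 f)
  then show ?case using card_image_le[of "{..<rounds}" "\<lambda>t. walk_end (snd (snd st) t) z"] by simp
next
  case (6 f g)
  then show ?case by (simp add: answer_def cut_def)
qed auto

lemma constraints_card:
  "card (game.constraints d r k) \<le> card (slices k) * (d + 1)" "slices k \<noteq> {} \<Longrightarrow> 1 \<le> card (game.constraints d r k)"
proof -
  have a: "admissible (\<lambda>_. 0)" by (simp add: admissible_def)
  have m: "margins_ok (\<lambda>_ _. \<eta>0)" using eta01 by (simp add: margins_ok_def)
  \<comment> \<open>The constraints do not depend on the grid function, so the game for the zero
    function serves to count them.\<close>
  interpret G: game d r bp \<kappa> "cut (\<lambda>_. 0) {}" "wgt (\<lambda>_ _. \<eta>0)" "\<lambda>_ _. \<eta>0" \<eta>0 k coin_size rounds by (rule game_cut[OF a m])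
  show "card (game.constraints d r k) \<le> card (slices k) * (d + 1)" by (rule G.card_constraints)
  assume "slices k \<noteq> {}"
  then have "game.constraints d r k \<noteq> {}" by (auto simp: G.constraints_def)
  then show "1 \<le> card (game.constraints d r k)" using G.finite_constraints by (simp add: Suc_le_eq card_gt_0_iff)
qed

lemma L_nonneg: "0 \<le> L"
proof (cases "card (game.constraints d r k) = 0")
  case False
  then have "1 \<le> real (card (game.constraints d r k))" by linarith
  then have "1 \<le> 3 * real (card (game.constraints d r k)) / \<delta>" using delta by (simp add: le_divide_eq)
  then show ?thesis by (simp add: L_def)
qed (simp add: L_def)

lemma Q_ge1: "1 \<le> game.Q \<kappa> k"
proof -
  have a: "admissible (\<lambda>_. 0)" by (simp add: admissible_def)
  have m: "margins_ok (\<lambda>_ _. \<eta>0)" using eta01 by (simp add: margins_ok_def)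
  show ?thesis by (rule game.Q[OF game_cut[OF a m]])
qed

lemma Theta_ge1: "1 \<le> \<Theta>"
proof (cases "k = 1")
  case False
  have "1 / 1 \<le> real d ^ k / \<epsilon>" using d_k eps by (intro frac_le) auto
  then show ?thesis using False by (simp add: \<Theta>_def)
next
  case True
  show ?thesis unfolding \<Theta>_def using d_pos True by simp
qed

lemma rounds_ge: "40000 * \<Theta> * (game.Q \<kappa> k * L / \<eta>1^2) \<le> rounds"
  unfolding rounds_def using of_nat_ceiling[of "40000 * \<Theta> * game.Q \<kappa> k * L / \<eta>1^2"] by (simp add: mult.assoc)

lemma slices_one:
  assumes "c \<in> slices 1" obtains i j where "c = level_slice i j" "i < d" "1 \<le> j" "j \<le> r i" "fst c = {i}" "snd c i = j"
proof -
  note s = slicesD[OF assms]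
  have "card (fst c) \<noteq> 0" using s(2,4) by simp
  then have "card (fst c) = 1" using s(3) by linarith
  then obtain i where i: "fst c = {i}" by (auto simp: card_1_singleton_iff)
  have "c = level_slice i (snd c i)" using i s(7) by (auto simp: level_slice_def prod_eq_iff fun_eq_iff)
  then show ?thesis using that[of i "snd c i"] i s by auto
qed

section \<open>Analysis for an accurate pruning seed\<close>

context
  fixes F \<zeta> assumes F: "admissible F" and acc: "all_accurate F \<zeta>"
begin

abbreviation (input) "R \<equiv> survivors_cut F \<zeta>"
abbreviation (input) "F' \<equiv> cut F (survivors_cut F \<zeta>)"

lemma level_bound_cases:
  obtains "level_bound F \<zeta> i j = 4 * (e1 + rh)"
  | l where "level_bound F \<zeta> i j = est F \<zeta> R (level_slice i l)" "1 \<le> l" "l \<le> j" "l \<le> r i" "i < d" "level_slice i l \<notin> R"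
      "4 * (e1 + rh) \<le> est F \<zeta> R (level_slice i l)"
proof -
  let ?S = "est F \<zeta> R ` {level_slice i l |l. 1 \<le> l \<and> l \<le> j \<and> l \<le> r i \<and> i < d \<and> level_slice i l \<notin> R}"
  have "finite {level_slice i l |l. 1 \<le> l \<and> l \<le> j \<and> l \<le> r i \<and> i < d \<and> level_slice i l \<notin> R}"
    by (rule finite_subset[of _ "level_slice i ` {..j}"]) auto
  then have fin: "finite (insert 0 ?S)" by simp
  define M where "M = Max (insert 0 ?S)"
  have lb: "level_bound F \<zeta> i j = max (4 * (e1 + rh)) M" by (simp only: level_bound_def M_def)
  have p: "0 < 4 * (e1 + rh)" using e1 rh by simp
  have "M \<in> insert 0 ?S" unfolding M_def using fin by (intro Max_in) auto
  show ?thesis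
  proof (cases "M \<le> 4 * (e1 + rh)")
    case True
    then show ?thesis using lb by (intro that(1)) simp
  next
    case False
    then have "M \<in> ?S" using \<open>M \<in> insert 0 ?S\<close> p by auto
    then obtain l where l: "M = est F \<zeta> R (level_slice i l)" "1 \<le> l" "l \<le> j" "l \<le> r i" "i < d" "level_slice i l \<notin> R"
      by auto
    have "level_bound F \<zeta> i j = M" using lb False by simp
    then show ?thesis using False l by (intro that(2)[of l]) auto
  qed
qed

lemma est_le_level_bound:
  assumes "1 \<le> l" "l \<le> j" "l \<le> r i" "i < d" "level_slice i l \<notin> R"
  shows "est F \<zeta> R (level_slice i l) \<le> level_bound F \<zeta> i j"
proof -
  let ?A = "{level_slice i l |l. 1 \<le> l \<and> l \<le> j \<and> l \<le> r i \<and> i < d \<and> level_slice i l \<notin> R}"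
  have "finite ?A" by (rule finite_subset[of _ "level_slice i ` {..j}"]) auto
  then have "est F \<zeta> R (level_slice i l) \<le> Max (insert 0 (est F \<zeta> R ` ?A))"
    using assms by (intro Max_ge) auto
  then show ?thesis by (simp add: level_bound_def)
qed

text \<open>For \<open>k > 1\<close> the minimal survivor below \<open>c\<close> serves, as
  \<open>\<Theta> * rh = 1 / 96\<close>. For \<open>k = 1\<close> the margin of a level asks for a
  marginal proportional to its \<open>level_bound\<close>. Either this is the floor, of order
  \<open>\<epsilon>\<close>, and the minimal survivor serves again; or it is the estimate at some
  level \<open>l\<close> not above that of \<open>c\<close>, and then the slice of level
  \<open>l\<close> is itself the anchor.\<close>

lemma anchors:
  assumes c: "c \<in> slices k" "c \<notin> R"
  shows "\<exists>u\<in>slices k. u \<notin> R \<and> fst u = fst c \<and> (\<forall>i. snd u i \<le> snd c i) \<and>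
      (\<forall>i\<in>fst c. 100 * game.Q \<kappa> k * L / (margins F \<zeta> i (snd c i))^2 \<le> rounds * mg u F')"
proof -
  define B where "B = game.Q \<kappa> k * L / \<eta>1^2"
  have B: "0 \<le> B" using Q_ge1 L_nonneg by (simp add: B_def)
  have rB: "40000 * \<Theta> * B \<le> rounds" using rounds_ge by (simp add: B_def)
  obtain u where u: "u \<in> slices k" "u \<notin> R" "fst u = fst c" "\<forall>i. snd u i \<le> snd c i" "rh / 2 \<le> mg u F'"
    using minimal_survivor[OF acc F c] by auto
  have m0: "(40000 * \<Theta> * B) * (rh / 2) \<le> rounds * mg u F'"
    using rB u(5) rh B by (intro mult_mono) auto
  show ?thesis
  proof (cases "k = 1")
    case False
    have "100 * game.Q \<kappa> k * L / (margins F \<zeta> i (snd c i))^2 = 100 * B" for i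
      using False by (simp add: margins_def B_def)
    also have "100 * B \<le> (40000 * \<Theta> * B) * (rh / 2)"
    proof -
      have "\<Theta> * rh = 1 / 96" using False eps d_pos by (simp add: \<Theta>_def rh_def)
      have "(40000 * \<Theta> * B) * (rh / 2) = 20000 * (\<Theta> * rh) * B" by simp
      also have "\<dots> = 20000 * (1 / 96) * B" by (simp only: \<open>\<Theta> * rh = 1 / 96\<close>)
      finally have e: "(40000 * \<Theta> * B) * (rh / 2) = 20000 * (1 / 96) * B" .
      show ?thesis unfolding e using B by simp
    qed
    finally have "100 * game.Q \<kappa> k * L / (margins F \<zeta> i (snd c i))^2 \<le> rounds * mg u F'" for i
      using m0 by (meson order_trans)
    then show ?thesis using u by blast
  next
    case True
    obtain i j where ij: "c = level_slice i j" "i < d" "1 \<le> j" "j \<le> r i" "fst c = {i}" "snd c i = j"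
      using c True slices_one by metis
    let ?\<psi> = "level_bound F \<zeta> i j"
    have marg: "100 * game.Q \<kappa> k * L / (margins F \<zeta> i (snd c i))^2 = 2500 * ?\<psi> * B"
    proof -
      have "margins F \<zeta> i j = \<eta>1 / (5 * sqrt ?\<psi>)" unfolding margins_def using True by simp
      then have "(margins F \<zeta> i j)^2 = \<eta>1^2 / (25 * ?\<psi>)"
        using level_bound_pos[of F \<zeta> i j] by (simp add: power_divide power_mult_distrib)
      then show ?thesis unfolding ij(6) B_def by simp
    qed
    have Th: "\<Theta> = d" unfolding \<Theta>_def using True by simp
    show ?thesis
    proof (cases rule: level_bound_cases[of i j])
      case 1
      \<comment> \<open>With \<open>2500 = 100 * 5^2\<close> from the margins,
        \<open>2500 * 4 * 2 = 40000 / 2\<close> is where the constant of \<open>rounds\<close> comes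
        from.\<close>
      have "e1 = rh * d" unfolding e1_def rh_def using d_pos True by simp
      then have "e1 + rh \<le> 2 * (rh * d)" using rh d_pos by simp
      then have "2500 * (4 * (e1 + rh)) * B \<le> 2500 * (4 * (2 * (rh * d))) * B"
        using B by (intro mult_right_mono) auto
      also have "\<dots> = (40000 * \<Theta> * B) * (rh / 2)" by (simp add: Th)
      finally have "2500 * ?\<psi> * B \<le> rounds * mg u F'" using 1 m0 by simp
      then show ?thesis using u ij marg by auto
    next
      case (2 l)
      let ?u = "level_slice i l"
      have us: "?u \<in> slices k" using level_slice_in 2 k by auto
      have "?\<psi> \<le> 2 * mg ?u F' + e1 + rh" using survivor_est(2)[OF acc us 2(6) F] 2(1) by simp
      moreover have "4 * (e1 + rh) \<le> ?\<psi>" by (rule level_bound_ge)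
      \<comment> \<open>The additive error is at most a quarter of the estimate, which leaves
        \<open>3/4\<close> of it for twice the marginal.\<close>
      moreover have "3/8 * a \<le> m" if "a \<le> 2 * m + x + y" "4 * (x + y) \<le> a" for a m x y :: real
        using that by simp
      ultimately have "3/8 * ?\<psi> \<le> mg ?u F'" by blast
      then have "(40000 * \<Theta> * B) * (3/8 * ?\<psi>) \<le> rounds * mg ?u F'"
        using rB B level_bound_pos[of F \<zeta> i j] Theta_ge1 by (intro mult_mono) auto
      moreover have "2500 * ?\<psi> * B \<le> (40000 * \<Theta> * B) * (3/8 * ?\<psi>)"
      proof -
        define P where "P = ?\<psi> * B"
        have P: "0 \<le> P" using B level_bound_pos[of F \<zeta> i j] by (simp add: P_def)
        then have "1 * P \<le> \<Theta> * P" using Theta_ge1 by (intro mult_right_mono)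
        then have "2500 * P \<le> 15000 * (\<Theta> * P)" using P by linarith
        then show ?thesis by (simp add: P_def mult_ac)
      qed
      ultimately have "2500 * ?\<psi> * B \<le> rounds * mg ?u F'" by (rule order_trans[rotated])
      moreover have "\<forall>m. snd ?u m \<le> snd c m" using 2 ij(1) by (auto simp: level_slice_def)
      ultimately show ?thesis using us 2 ij marg by (intro bexI[of _ ?u]) (auto simp: level_slice_def)
    qed
  qed
qed

lemma eta1_sum: "(\<Sum>i<d. \<Sum>l\<in>{1..r i}. 4 * \<eta>1) \<le> \<epsilon> / 16"
proof -
  have "(\<Sum>i<d. \<Sum>l\<in>{1..r i}. 4 * \<eta>1) = (\<Sum>i<d. real (r i) * (4 * \<eta>1))" by simp
  also have "\<dots> \<le> (\<Sum>i<d. (1 / \<kappa>) * (4 * \<eta>1))" using r_le eta01 by (intro sum_mono mult_right_mono) auto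
  also have "\<dots> = \<epsilon> / 16" using kappa d_pos by (simp add: \<eta>1_def)
  finally show ?thesis .
qed

lemma margins_sum: "(\<Sum>i<d. \<Sum>l\<in>{1..r i}. 4 * margins F \<zeta> i l) \<le> 1/16"
proof -
  have "(\<Sum>i<d. \<Sum>l\<in>{1..r i}. 4 * margins F \<zeta> i l) \<le> (\<Sum>i<d. \<Sum>l\<in>{1..r i}. 4 * (\<eta>1 / \<epsilon>))"
    by (intro sum_mono mult_left_mono margins_bounds(2)) simp
  also have "\<dots> = (\<Sum>i<d. \<Sum>l\<in>{1..r i}. 4 * \<eta>1) / \<epsilon>" by (simp add: sum_divide_distrib)
  also have "\<dots> \<le> (\<epsilon> / 16) / \<epsilon>" using eta1_sum eps by (intro divide_right_mono) auto
  finally show ?thesis using eps by simp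
qed

text \<open>Every surviving level below \<open>l\<close> has a marginal of at most
  \<open>2 * est + 2 * (e1 + rh)\<close>. The estimate is at most the bound \<open>\<psi>\<close>,
  and the error term at most \<open>\<psi> / 2\<close> by its floor.\<close>

lemma below_level:
  assumes i: "i < d" and l: "l \<le> r i" and k1: "k = 1"
  shows "expect pz (\<lambda>z. F' z * of_bool (z i < l)) \<le> 5/2 * level_bound F \<zeta> i l"
proof -
  let ?h = "\<lambda>z. F' z * of_bool (z i < l)" and ?\<psi> = "level_bound F \<zeta> i l"
  have b: "mg (level_slice i j) ?h \<le> 5/2 * ?\<psi>" if "j \<le> r i" for j
  proof -
    have o: "override (level_slice i j) z i = j" for z by (simp add: override_def level_slice_def)
    have adm: "admissible F'" by (rule admissible_cut[OF F])
    show ?thesis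
    proof (cases "j = 0 \<or> l \<le> j \<or> level_slice i j \<in> R")
      case True
      have "?h (override (level_slice i j) z) = 0" for z
      proof (cases "level_slice i j \<in> R")
        case True
        then have "\<not> alive d R (override (level_slice i j) z)" by (auto simp: alive_def in_slice_def override_def)
        then show ?thesis by (simp add: cut_def)
      next
        case False
        then show ?thesis using True o[of z] i adm by (auto simp: admissible_def)
      qed
      then have "mg (level_slice i j) ?h = expect pz (\<lambda>_. 0)" unfolding mg_def by (intro expect_cong) blast
      then show ?thesis using level_bound_pos[of F \<zeta> i l] by simp
    next
      case False
      then have us: "level_slice i j \<in> slices k" using level_slice_in i that k by auto
      have "mg (level_slice i j) ?h \<le> mg (level_slice i j) F'"
        using cut_01(1)[OF F] by (intro mg_le) (simp add: mult_left_le)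
      also have "\<dots> \<le> 2 * est F \<zeta> R (level_slice i j) + 2 * (e1 + rh)"
        using survivor_est(1)[OF acc us _ F] False by simp
      also have "\<dots> \<le> 2 * ?\<psi> + 1/2 * ?\<psi>"
        using est_le_level_bound[of j l i] level_bound_ge[of F \<zeta> i l] False i that by auto
      finally show ?thesis by simp
    qed
  qed
  have "expect pz ?h = (\<Sum>j\<le>r i. pmf (bp i) j * mg (level_slice i j) ?h)" by (rule expect_levels[OF i])
  also have "\<dots> \<le> (\<Sum>j\<le>r i. pmf (bp i) j * (5/2 * ?\<psi>))" using b by (intro sum_mono mult_left_mono) auto
  also have "\<dots> = (\<Sum>j\<le>r i. pmf (bp i) j) * (5/2 * ?\<psi>)" by (rule sum_distrib_right[symmetric])
  also have "\<dots> = 5/2 * ?\<psi>" using sum_mass[OF i] by simp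
  finally show ?thesis .
qed

lemma level_bound_le: assumes "k = 1" shows "level_bound F \<zeta> i j \<le> 4"
proof (cases rule: level_bound_cases[of i j])
  case 1
  then show ?thesis using e1_def rh eps by simp
next
  case (2 l)
  have us: "level_slice i l \<in> slices k" using level_slice_in 2 k by auto
  have "mg (level_slice i l) F' \<le> 1" using mg_cut_le[OF F, of "level_slice i l" R] alive_mass_01(2)[of R "level_slice i l"] by simp
  then show ?thesis using survivor_est(2)[OF acc us 2(6) F] 2(1) e1_def rh eps by simp
qed

lemma margins_loss:
  "(\<Sum>i<d. \<Sum>l\<in>{1..r i}. 4 * margins F \<zeta> i l * expect pz (\<lambda>z. F' z * of_bool (z i < l))) \<le> \<epsilon> / 16"
proof -
  have "margins F \<zeta> i l * expect pz (\<lambda>z. F' z * of_bool (z i < l)) \<le> \<eta>1" if il: "i < d" "l \<le> r i" for i l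
  proof (cases "k = 1")
    case False
    have "expect pz (\<lambda>z. F' z * of_bool (z i < l)) \<le> 1"
      using cut_01[OF F] by (intro expect_le_const[OF finite_pz]) (auto simp: of_bool_def)
    then show ?thesis using False eta01 by (simp add: margins_def mult_left_le)
  next
    case True
    let ?\<psi> = "level_bound F \<zeta> i l"
    have p: "0 < ?\<psi>" "?\<psi> \<le> 4" using level_bound_pos level_bound_le[OF True] by auto
    have "margins F \<zeta> i l * expect pz (\<lambda>z. F' z * of_bool (z i < l)) \<le> margins F \<zeta> i l * (5/2 * ?\<psi>)"
      using below_level[OF il True] margins_bounds(1)[of F \<zeta> i l] by (intro mult_left_mono) auto
    \<comment> \<open>The margin shrinks with the square root only, so a factor
      \<open>sqrt ?\<psi>\<close> remains. Since the bound is at most 4, the scale 5 of the margins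
      makes the product at most \<open>\<eta>1\<close>.\<close>
    also have "\<dots> = \<eta>1 * (sqrt ?\<psi> / 2)"
    proof -
      have "margins F \<zeta> i l = \<eta>1 / (5 * sqrt ?\<psi>)" unfolding margins_def using True by simp
      then have "margins F \<zeta> i l * (5/2 * ?\<psi>) = \<eta>1 * ((?\<psi> / sqrt ?\<psi>) / 2)" by simp
      also have "?\<psi> / sqrt ?\<psi> = sqrt ?\<psi>" using p by (simp add: real_div_sqrt)
      finally show ?thesis .
    qed
    also have "\<dots> \<le> \<eta>1 * 1"
    proof (intro mult_left_mono)
      have "sqrt ?\<psi> \<le> sqrt 4" using p by (intro real_sqrt_le_mono)
      then show "sqrt ?\<psi> / 2 \<le> 1" by simp
    qed (use eta01 in auto)
    finally show ?thesis by simp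
  qed
  then have "(\<Sum>i<d. \<Sum>l\<in>{1..r i}. 4 * margins F \<zeta> i l * expect pz (\<lambda>z. F' z * of_bool (z i < l))) \<le> (\<Sum>i<d. \<Sum>l\<in>{1..r i}. 4 * \<eta>1)"
    by (intro sum_mono) (simp add: mult.assoc)
  then show ?thesis using eta1_sum by linarith
qed

lemma pruned_game: "pruned_game d r bp \<kappa> F' (wgt (margins F \<zeta>)) (margins F \<zeta>) \<eta>0 k coin_size rounds R L"
proof -
  interpret G: game d r bp \<kappa> F' "wgt (margins F \<zeta>)" "margins F \<zeta>" \<eta>0 k coin_size rounds
    by (rule game_cut[OF F margins_ok])
  show ?thesis
  proof unfold_locales
    show "R \<subseteq> slices k" unfolding survivors_cut_def by (rule removed_sub)
    show "lower c i \<in> R" if "c \<in> R" "i \<in> fst c" "2 \<le> snd c i" for c i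
      using that unfolding survivors_cut_def by (rule removed_lower)
    show "F' z = 0" if "c \<in> R" "in_slice c z" for c z using that by (auto simp: cut_def alive_def)
  qed (use margins_sum margins_bounds(3) L_nonneg anchors in \<open>auto simp: wgt_def\<close>)
qed

lemma result_outcome:
  "result F (\<zeta>, \<xi>) = pruned_game.outcome d r bp \<kappa> F' (wgt (margins F \<zeta>)) (margins F \<zeta>) \<eta>0 k coin_size rounds \<xi>"
proof -
  interpret P: pruned_game d r bp \<kappa> F' "wgt (margins F \<zeta>)" "margins F \<zeta>" \<eta>0 k coin_size rounds R L by (rule pruned_game)
  show ?thesis by (intro ext) (simp add: result_eq P.outcome_def walk_value_def)
qed

context
  fixes \<xi> assumes reg: "game.regret_bound d r bp \<kappa> F' (wgt (margins F \<zeta>)) (margins F \<zeta>) \<eta>0 k coin_size rounds L \<xi>"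
begin

lemma result_monotone:
  assumes "I \<subseteq> {..<d}" "card I \<le> k" "\<And>i. i \<in> I \<Longrightarrow> u i \<le> v i" "\<And>i. i \<in> I \<Longrightarrow> v i \<le> r i" "\<And>i. i \<notin> I \<Longrightarrow> u i = 0" "\<And>i. i \<notin> I \<Longrightarrow> v i = 0"
  shows "mg (I, u) (result F (\<zeta>, \<xi>)) \<le> mg (I, v) (result F (\<zeta>, \<xi>))"
  unfolding result_outcome using assms by (intro pruned_game.outcome_monotone[OF pruned_game reg]) auto

text \<open>The losses are \<open>\<epsilon> / 8\<close> for pruning, \<open>\<epsilon> / 16\<close>
  for reweighting, and \<open>\<epsilon> / 32\<close> and \<open>\<epsilon> / 64\<close> for the
  relative and the additive error of the game.\<close>

lemma result_expect: "expect pz F - \<epsilon> / 4 \<le> expect pz (result F (\<zeta>, \<xi>))"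
proof -
  interpret P: pruned_game d r bp \<kappa> F' "wgt (margins F \<zeta>)" "margins F \<zeta>" \<eta>0 k coin_size rounds R L by (rule pruned_game)
  have 1: "expect pz F - 6 * e1 - 6 * rh * real d ^ k \<le> expect pz F'" by (rule prune_loss[OF F acc])
  have 2: "6 * e1 + 6 * rh * real d ^ k = \<epsilon> / 8" using d_pos by (simp add: e1_def rh_def)
  note 3 = P.expect_weighted margins_loss P.expect_outcome[OF reg k]
  have 4: "32 * P.Q * L / (\<eta>0 * rounds) \<le> \<epsilon> / 64"
  proof -
    define B where "B = P.Q * L / \<eta>1^2"
    have B: "0 \<le> B" using Q_ge1 L_nonneg by (simp add: B_def)
    have "40000 * 1 * B \<le> 40000 * \<Theta> * B" using Theta_ge1 B by (intro mult_right_mono) auto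
    then have rB: "40000 * B \<le> rounds" using rounds_ge by (simp add: B_def)
    have "32 * P.Q * L = 32 * B * \<eta>1^2" using eta01 by (simp add: B_def)
    also have "\<dots> \<le> rounds * \<eta>0^2"
      using rB B eta01 by (intro mult_mono power_mono) auto
    finally have "32 * P.Q * L / (\<eta>0 * rounds) \<le> rounds * \<eta>0^2 / (\<eta>0 * rounds)"
      using eta01 rounds_pos by (intro divide_right_mono) auto
    also have "\<dots> = \<epsilon> / 64" using eta01(3) rounds_pos by (simp add: power2_eq_square \<eta>0_def)
    finally show ?thesis .
  qed
  have 5: "2 * \<eta>0 = \<epsilon> / 32" by (simp add: \<eta>0_def)
  show ?thesis unfolding result_outcome using 1 2 3 4 5 eps by linarith
qed

end

end

definition good :: "(point \<Rightarrow> real) \<Rightarrow> (slice \<times> nat \<Rightarrow> point) \<times> (nat \<Rightarrow> point \<times> (point \<Rightarrow> nat)) \<Rightarrow> bool" where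
  "good F s \<longleftrightarrow> all_accurate F (fst s) \<and>
     game.regret_bound d r bp \<kappa> (cut F (survivors_cut F (fst s))) (wgt (margins F (fst s))) (margins F (fst s)) \<eta>0 k coin_size rounds L (snd s)"

lemma good_monotone:
  assumes "admissible F" "good F s"
    "I \<subseteq> {..<d}" "card I \<le> k" "\<And>i. i \<in> I \<Longrightarrow> u i \<le> v i" "\<And>i. i \<in> I \<Longrightarrow> v i \<le> r i" "\<And>i. i \<notin> I \<Longrightarrow> u i = 0" "\<And>i. i \<notin> I \<Longrightarrow> v i = 0"
  shows "mg (I, u) (result F s) \<le> mg (I, v) (result F s)"
  using result_monotone[OF assms(1), of "fst s" "snd s" I u v] assms by (simp add: good_def)

lemma good_expect: "admissible F \<Longrightarrow> good F s \<Longrightarrow> expect pz F - \<epsilon> / 4 \<le> expect pz (result F s)"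
  using result_expect[of F "fst s" "snd s"] by (simp add: good_def)

lemma slice_bound: "real (card (slices k)) \<le> slice_bound" "1 \<le> slice_bound"
proof -
  show "real (card (slices k)) \<le> slice_bound" using card_slices by (simp add: slice_bound_def)
  have "1 / 1 \<le> d / \<kappa>" using d_pos kappa by (intro frac_le) auto
  then show "1 \<le> slice_bound" by (simp add: slice_bound_def)
qed

lemma prob_prune: assumes "admissible F" shows "measure_pmf.prob prune_seed {\<zeta>. \<not> all_accurate F \<zeta>} \<le> \<delta>"
proof -
  let ?S = "real (card (slices k))" and ?e = "exp (- (nn * e1))"
  have "ln (6 * slice_bound ^ 2 / \<delta>) / e1 \<le> nn"
    unfolding nn_def using of_nat_ceiling[of "ln (6 * slice_bound ^ 2 / \<delta>) / e1"] by simp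
  then have "ln (6 * slice_bound ^ 2 / \<delta>) \<le> nn * e1" using e1 by (simp add: divide_le_eq)
  then have "exp (ln (6 * slice_bound ^ 2 / \<delta>)) \<le> exp (nn * e1)" by simp
  then have "6 * slice_bound ^ 2 / \<delta> \<le> exp (nn * e1)" using slice_bound delta by simp
  then have e: "6 * slice_bound ^ 2 * ?e \<le> \<delta>" using delta by (simp add: exp_minus field_simps)
  have "measure_pmf.prob prune_seed {\<zeta>. \<not> all_accurate F \<zeta>} \<le> ?S * ((?S + 1) * (3 * ?e))"
    using prob_all_accurate[OF assms] by (simp add: add.commute)
  also have "\<dots> \<le> slice_bound * ((2 * slice_bound) * (3 * ?e))"
    using slice_bound by (intro mult_mono) auto
  also have "\<dots> = 6 * slice_bound ^ 2 * ?e" by (simp add: power2_eq_square)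
  finally show ?thesis using e by simp
qed

lemma finite_seeds: "finite (set_pmf seeds)"
proof -
  have a: "admissible (\<lambda>_. 0)" by (simp add: admissible_def)
  have m: "margins_ok (\<lambda>_ _. \<eta>0)" using eta01 by (simp add: margins_ok_def)
  show ?thesis unfolding seeds_def using finite_prune_seed game.finite_game[OF game_cut[OF a m]] by simp
qed

text \<open>Pruning fixes the parameters of a game whose seed is independent of it.
  \<open>prob_regret_bound\<close> therefore holds for each pruning seed separately, and the two
  failure probabilities add up.\<close>

lemma prob_good:
  assumes F: "admissible F" shows "1 - 3 * \<delta> \<le> measure_pmf.prob seeds {s. good F s}"
proof -
  let ?gs = "game.game_seed d r bp coin_size rounds"
  have a: "admissible (\<lambda>_. 0)" by (simp add: admissible_def)
  have m: "margins_ok (\<lambda>_ _. \<eta>0)" using eta01 by (simp add: margins_ok_def)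
  have fin: "finite (set_pmf ?gs)" using game.finite_game[OF game_cut[OF a m]] .
  let ?rb = "\<lambda>\<zeta> \<xi>. game.regret_bound d r bp \<kappa> (cut F (survivors_cut F \<zeta>)) (wgt (margins F \<zeta>)) (margins F \<zeta>) \<eta>0 k coin_size rounds L \<xi>"
  have rb: "measure_pmf.prob ?gs {\<xi>. \<not> ?rb \<zeta> \<xi>} \<le> 2 * \<delta>" for \<zeta>
    by (rule game.prob_regret_bound[OF game_cut[OF F margins_ok] delta L_def])
  have "measure_pmf.prob seeds {s. \<not> good F s} \<le> measure_pmf.prob seeds {s. \<not> all_accurate F (fst s)} + measure_pmf.prob seeds {s. \<not> ?rb (fst s) (snd s)}"
    using prob_Un_le[of seeds "\<lambda>s. \<not> all_accurate F (fst s)" "\<lambda>s. \<not> ?rb (fst s) (snd s)"] by (simp add: good_def)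
  also have "measure_pmf.prob seeds {s. \<not> all_accurate F (fst s)} = measure_pmf.prob prune_seed {\<zeta>. \<not> all_accurate F \<zeta>}"
    unfolding seeds_def prob_eq_expect using fin finite_prune_seed by (simp add: expect_pair)
  also have "measure_pmf.prob seeds {s. \<not> ?rb (fst s) (snd s)} = expect prune_seed (\<lambda>\<zeta>. measure_pmf.prob ?gs {\<xi>. \<not> ?rb \<zeta> \<xi>})"
    unfolding seeds_def prob_eq_expect using fin finite_prune_seed by (simp add: expect_pair)
  also have "\<dots> \<le> 2 * \<delta>" by (rule expect_le_const[OF finite_prune_seed rb])
  finally have "measure_pmf.prob seeds {s. \<not> good F s} \<le> 3 * \<delta>" using prob_prune[OF F] by linarith
  moreover have "measure_pmf.prob seeds {s. good F s} = 1 - measure_pmf.prob seeds {s. \<not> good F s}"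
    using measure_pmf.prob_compl[of "{s. \<not> good F s}" seeds] by (simp add: Collect_neg_eq Compl_eq_Diff_UNIV[symmetric])
  ultimately show ?thesis by linarith
qed

end

section \<open>Discretisation of distributions on the line\<close>

text \<open>The thresholds are found from the right, each one as far to the right as the required mass
  allows; this also bounds the mass of a level without its left end point.\<close>

lemma (in real_distribution) levels_below:
  assumes \<kappa>: "0 < \<kappa>" and D: "D = UNIV \<or> (\<exists>t. D = {..<t})" and n: "measure M D < real n * \<kappa>"
  shows "\<exists>(lev :: real \<Rightarrow> nat) r. mono_on D lev \<and> (\<forall>x. lev x \<le> r) \<and> (\<forall>j. 1 \<le> j \<and> j \<le> r \<longrightarrow> \<kappa> \<le> measure M {x\<in>D. lev x = j}) \<and>
    (\<forall>x. measure M {y\<in>D. x < y \<and> lev y = lev x} \<le> \<kappa>) \<and> measure M {x\<in>D. lev x = 0} \<le> \<kappa>"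
  using D n
proof (induction n arbitrary: D)
  case 0
  then show ?case using measure_nonneg[of M D] by simp
next
  case (Suc n)
  have DM: "D \<in> sets M" using Suc.prems(1) by auto
  show ?case
  proof (cases "measure M D \<le> \<kappa>")
    case True
    have "measure M {y\<in>D. x < y} \<le> \<kappa>" for x
      using finite_measure_mono[of "{y\<in>D. x < y}" D] DM True by auto
    then show ?thesis using True by (intro exI[of _ "\<lambda>_. 0"] exI[of _ 0]) (auto simp: mono_on_def)
  next
    case False
    let ?m = "\<lambda>s. measure M (D \<inter> {s..})"
    \<comment> \<open>The top level is \<open>D \<inter> {t..}\<close> for the largest
      \<open>t\<close> that gives it mass \<open>\<kappa>\<close>. An atom at \<open>t\<close> may
      make it much heavier, which is why only the part beyond \<open>t\<close> is bounded by
      \<open>\<kappa>\<close>.\<close>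
    define S where "S = {s. \<kappa> \<le> ?m s}"
    have anti: "?m t \<le> ?m s" if "s \<le> t" for s t using that DM by (intro finite_measure_mono) auto
    have "(\<lambda>i. ?m (- real i)) \<longlonglongrightarrow> measure M (\<Union>i. D \<inter> {- real i..})"
      using DM by (intro finite_Lim_measure_incseq) (auto simp: incseq_def)
    moreover have "(\<Union>i. D \<inter> {- real i..}) = D"
    proof -
      have "\<exists>i. - real i \<le> x" for x using real_arch_simple[of "- x"] by (metis minus_le_iff)
      then show ?thesis by auto
    qed
    ultimately have "eventually (\<lambda>i. \<kappa> < ?m (- real i)) sequentially" using False by (intro order_tendstoD) auto
    then obtain i where "\<kappa> < ?m (- real i)" by (auto simp: eventually_sequentially)
    then have ne: "S \<noteq> {}" unfolding S_def by (auto intro: less_imp_le)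
    have "(\<lambda>i. ?m (real i)) \<longlonglongrightarrow> measure M (\<Inter>i. D \<inter> {real i..})"
      using DM by (intro finite_Lim_measure_decseq) (auto simp: decseq_def)
    moreover have "(\<Inter>i. D \<inter> {real i..}) = {}"
    proof -
      have "\<exists>i. \<not> real i \<le> x" for x using reals_Archimedean2[of x] by (auto simp: not_le)
      then show ?thesis by auto
    qed
    ultimately have "eventually (\<lambda>i. ?m (real i) < \<kappa>) sequentially" using \<kappa> by (intro order_tendstoD) auto
    then obtain i0 where i0: "?m (real i0) < \<kappa>" by (auto simp: eventually_sequentially)
    have bdd: "bdd_above S"
    proof (rule bdd_aboveI)
      fix s assume "s \<in> S"
      then show "s \<le> real i0" using i0 anti[of "real i0" s] unfolding S_def by (cases "s \<le> real i0") auto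
    qed
    define t where "t = Sup S"
    have below: "\<kappa> \<le> ?m s" if "s < t" for s
    proof -
      obtain s' where "s' \<in> S" "s < s'" using \<open>s < t\<close> ne unfolding t_def by (rule less_cSupE)
      then show ?thesis using anti[of s s'] unfolding S_def by auto
    qed
    have above: "?m s < \<kappa>" if "t < s" for s
    proof -
      have "s \<notin> S" using cSup_upper[OF _ bdd, of s] that by (auto simp: t_def)
      then show ?thesis by (simp add: S_def)
    qed
    \<comment> \<open>The mass of \<open>D \<inter> {s..}\<close> is left-continuous in
      \<open>s\<close>, so the supremum is attained; the right limit at \<open>t\<close> bounds the
      part beyond it.\<close>
    have mt: "\<kappa> \<le> ?m t"
    proof -
      have "(\<lambda>i. ?m (t - 1 / real (Suc i))) \<longlonglongrightarrow> measure M (\<Inter>i. D \<inter> {t - 1 / real (Suc i)..})"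
        using DM by (intro finite_Lim_measure_decseq) (auto simp: decseq_def field_simps intro: order_trans[rotated])
      moreover have "(\<Inter>i. D \<inter> {t - 1 / real (Suc i)..}) = D \<inter> {t..}"
      proof -
        have "t \<le> x" if "\<forall>i. t - 1 / real (Suc i) \<le> x" for x
        proof (rule ccontr)
          assume "\<not> t \<le> x"
          then obtain i where "1 / real (Suc i) < t - x" using reals_Archimedean[of "t - x"] by (auto simp: inverse_eq_divide)
          then show False using that[rule_format, of i] by simp
        qed
        then show ?thesis by (auto intro: order_trans[of _ t])
      qed
      ultimately have l: "(\<lambda>i. ?m (t - 1 / real (Suc i))) \<longlonglongrightarrow> ?m t" by simp
      show ?thesis by (rule LIMSEQ_le_const[OF l]) (auto intro!: exI[of _ 0] below)
    qed
    have gt: "measure M (D \<inter> {t<..}) \<le> \<kappa>"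
    proof -
      have "(\<lambda>i. ?m (t + 1 / real (Suc i))) \<longlonglongrightarrow> measure M (\<Union>i. D \<inter> {t + 1 / real (Suc i)..})"
        using DM by (intro finite_Lim_measure_incseq) (auto simp: incseq_def field_simps intro: order_trans[rotated])
      moreover have "(\<Union>i. D \<inter> {t + 1 / real (Suc i)..}) = D \<inter> {t<..}"
      proof -
        have "\<exists>i. t + 1 / real (Suc i) \<le> x" if "t < x" for x
        proof -
          obtain i where "1 / real (Suc i) < x - t"
            using reals_Archimedean[of "x - t"] \<open>t < x\<close> by (auto simp: inverse_eq_divide)
          then show ?thesis by (intro exI[of _ i]) simp
        qed
        moreover have "t < x" if "t + 1 / real (Suc i) \<le> x" for x i
          using that by (smt (verit) of_nat_0_less_iff zero_less_Suc zero_less_divide_1_iff)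
        ultimately show ?thesis by auto
      qed
      ultimately have l: "(\<lambda>i. ?m (t + 1 / real (Suc i))) \<longlonglongrightarrow> measure M (D \<inter> {t<..})" by simp
      show ?thesis by (rule LIMSEQ_le_const2[OF l]) (auto intro!: exI[of _ 0] less_imp_le above)
    qed
    have tD: "{..<t} \<subseteq> D"
    proof (cases "D = UNIV")
      case False
      then obtain b where b: "D = {..<b}" using Suc.prems(1) by auto
      have "s \<le> b" if "s \<in> S" for s
      proof (rule ccontr)
        assume "\<not> s \<le> b"
        then have "D \<inter> {s..} = {}" using b by auto
        then show False using that \<kappa> by (simp add: S_def)
      qed
      then have "t \<le> b" unfolding t_def using ne by (intro cSup_least)
      then show ?thesis using b by auto
    qed simp
    have "measure M D = measure M {..<t} + ?m t"
    proof -
      have "D = {..<t} \<union> (D \<inter> {t..})" using tD by auto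
      moreover have "measure M ({..<t} \<union> (D \<inter> {t..})) = measure M {..<t} + ?m t"
        using DM by (intro finite_measure_Union) auto
      ultimately show ?thesis by simp
    qed
    then have "measure M {..<t} < real n * \<kappa>" using Suc.prems(2) mt by (simp add: algebra_simps)
    moreover have "{..<t} = UNIV \<or> (\<exists>b. {..<t} = {..<b})" by blast
    ultimately have "\<exists>(lev :: real \<Rightarrow> nat) r. mono_on {..<t} lev \<and> (\<forall>x. lev x \<le> r) \<and>
      (\<forall>j. 1 \<le> j \<and> j \<le> r \<longrightarrow> \<kappa> \<le> measure M {x\<in>{..<t}. lev x = j}) \<and>
      (\<forall>x. measure M {y\<in>{..<t}. x < y \<and> lev y = lev x} \<le> \<kappa>) \<and> measure M {x\<in>{..<t}. lev x = 0} \<le> \<kappa>"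
      by (intro Suc.IH)
    then obtain lev :: "real \<Rightarrow> nat" and r where lev0: "mono_on {..<t} lev \<and> (\<forall>x. lev x \<le> r) \<and>
      (\<forall>j. 1 \<le> j \<and> j \<le> r \<longrightarrow> \<kappa> \<le> measure M {x\<in>{..<t}. lev x = j}) \<and>
      (\<forall>x. measure M {y\<in>{..<t}. x < y \<and> lev y = lev x} \<le> \<kappa>) \<and> measure M {x\<in>{..<t}. lev x = 0} \<le> \<kappa>"
      by (elim exE)
    note lev = lev0[THEN conjunct1] lev0[THEN conjunct2, THEN conjunct1] lev0[THEN conjunct2, THEN conjunct2, THEN conjunct1]
      lev0[THEN conjunct2, THEN conjunct2, THEN conjunct2, THEN conjunct1] lev0[THEN conjunct2, THEN conjunct2, THEN conjunct2, THEN conjunct2]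
    have nS: "lev x \<noteq> Suc r" "Suc r \<noteq> lev x" for x using lev(2)[rule_format, of x] by auto
    define lv where "lv = (\<lambda>x. if x < t then lev x else Suc r)"
    have eqt: "{x\<in>D. lv x = j} = {x\<in>{..<t}. lev x = j}" if "j \<le> r" for j
      using tD that by (auto simp: lv_def)
    have eqs: "{x\<in>D. lv x = Suc r} = D \<inter> {t..}" using nS by (auto simp: lv_def split: if_splits)
    show ?thesis
    proof (intro exI conjI allI impI)
      show "mono_on D lv"
        using lev(1,2) by (auto simp: mono_on_def lv_def le_SucI)
      show "lv x \<le> Suc r" for x using lev(2) by (auto simp: lv_def le_SucI)
      show "\<kappa> \<le> measure M {x\<in>D. lv x = j}" if "1 \<le> j \<and> j \<le> Suc r" for j
        using that lev(3) eqt[of j] eqs mt by (cases "j = Suc r") auto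
      show "measure M {y\<in>D. x < y \<and> lv y = lv x} \<le> \<kappa>" for x
      proof (cases "x < t")
        case True
        have "{y\<in>D. x < y \<and> lv y = lv x} = {y\<in>{..<t}. x < y \<and> lev y = lev x}"
          using tD True nS by (auto simp: lv_def split: if_splits)
        then show ?thesis using lev(4) by simp
      next
        case False
        then have "measure M {y\<in>D. x < y \<and> lv y = lv x} \<le> measure M (D \<inter> {t<..})"
          using DM by (intro finite_measure_mono) auto
        then show ?thesis using gt by simp
      qed
      show "measure M {x\<in>D. lv x = 0} \<le> \<kappa>" using eqt[of 0] lev(5) by simp
    qed
  qed
qed

lemma (in real_distribution) levels_exist:
  assumes \<kappa>: "0 < \<kappa>"
  shows "\<exists>(lev :: real \<Rightarrow> nat) r. mono lev \<and> (\<forall>x. lev x \<le> r) \<and> (\<forall>j. 1 \<le> j \<and> j \<le> r \<longrightarrow> \<kappa> \<le> measure M {x. lev x = j}) \<and>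
    (\<forall>x. measure M {y. x < y \<and> lev y = lev x} \<le> \<kappa>) \<and> measure M {x. lev x = 0} \<le> \<kappa>"
proof -
  obtain n where n: "1 / \<kappa> < real n" using reals_Archimedean2 by blast
  then have "1 < real n * \<kappa>" using \<kappa> by (simp add: field_simps)
  then have "measure M UNIV < real n * \<kappa>" by (rule le_less_trans[OF prob_le_1])
  from levels_below[OF \<kappa> _ this] show ?thesis by simp
qed

abbreviation unit_uniform :: "real measure" where
  "unit_uniform \<equiv> restrict_space lborel {0<..<1}"

lemma prob_space_unit_uniform: "prob_space unit_uniform"
  by (auto simp add: emeasure_restrict_space space_restrict_space intro!: prob_spaceI)

lemma nn_integral_unit_uniform: "(\<integral>\<^sup>+u. h u \<partial>unit_uniform) = (\<integral>\<^sup>+u. h u * indicator {0<..<1} u \<partial>lborel)"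
  by (subst nn_integral_restrict_space) auto

text \<open>The unit interval is cut into consecutive pieces of lengths \<open>b j\<close>, each an
  affine image of the unit interval; the cut points are a null set.\<close>

lemma nn_integral_unit_pieces:
  fixes b :: "nat \<Rightarrow> real" and h :: "real \<Rightarrow> ennreal"
  assumes b: "\<And>j. 0 \<le> b j" "(\<Sum>j\<le>r. b j) = 1" and h: "h \<in> borel_measurable borel"
  shows "(\<Sum>j\<le>r. ennreal (b j) * (\<integral>\<^sup>+u. h ((\<Sum>i<j. b i) + u * b j) \<partial>unit_uniform)) = (\<integral>\<^sup>+u. h u \<partial>unit_uniform)"
proof -
  define G where "G = (\<lambda>j. \<Sum>i<j. b i)"
  have G: "G (Suc j) = G j + b j" "0 \<le> G j" for j using b by (auto simp: G_def intro: sum_nonneg)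
  have piece: "ennreal (b j) * (\<integral>\<^sup>+u. h (G j + u * b j) \<partial>unit_uniform) = (\<integral>\<^sup>+s. h s * indicator {G j<..<G (Suc j)} s \<partial>lborel)" for j
  proof (cases "b j = 0")
    case True then show ?thesis by (simp add: G)
  next
    case False
    then have bj: "0 < b j" using b(1)[of j] by simp
    have "(\<integral>\<^sup>+s. h s * indicator {G j<..<G (Suc j)} s \<partial>lborel)
        = ennreal \<bar>b j\<bar> * (\<integral>\<^sup>+u. h (G j + b j * u) * indicator {G j<..<G (Suc j)} (G j + b j * u) \<partial>lborel)"
      using h bj by (intro nn_integral_real_affine) auto
    also have "(\<integral>\<^sup>+u. h (G j + b j * u) * indicator {G j<..<G (Suc j)} (G j + b j * u) \<partial>lborel)
        = (\<integral>\<^sup>+u. h (G j + u * b j) * indicator {0<..<1} u \<partial>lborel)"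
      using bj by (intro nn_integral_cong) (auto simp: G mult.commute indicator_def zero_less_mult_iff)
    finally show ?thesis using bj by (simp add: nn_integral_unit_uniform)
  qed
  have ind: "(\<Sum>j<n. indicator {G j<..<G (Suc j)} s) = (indicator {0<..<G n} s :: ennreal)" if "\<And>j. s \<noteq> G j" for n s
  proof (induction n)
    case (Suc n)
    have "G n \<le> G (Suc n)" "0 \<le> G n" using G b(1)[of n] by auto
    then show ?case using Suc that[of n] by (auto simp: indicator_def)
  qed (simp add: G_def)
  have "(\<Sum>j\<le>r. ennreal (b j) * (\<integral>\<^sup>+u. h (G j + u * b j) \<partial>unit_uniform))
      = (\<integral>\<^sup>+s. (\<Sum>j\<le>r. h s * indicator {G j<..<G (Suc j)} s) \<partial>lborel)"
    using h by (subst nn_integral_sum) (auto simp: piece)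
  also have "\<dots> = (\<integral>\<^sup>+s. h s * indicator {0<..<1} s \<partial>lborel)"
  proof (rule nn_integral_cong_AE)
    have "range G \<in> null_sets lborel" by (intro countable_imp_null_set_lborel) auto
    then have "AE s in lborel. s \<notin> range G" by (rule AE_not_in)
    then show "AE s in lborel. (\<Sum>j\<le>r. h s * indicator {G j<..<G (Suc j)} s) = h s * indicator {0<..<1} s"
    proof eventually_elim
      case (elim s)
      then have "s \<noteq> G j" for j by auto
      from ind[OF this, of "Suc r"] show ?case
        using b(2) by (simp add: sum_distrib_left[symmetric] lessThan_Suc_atMost G_def[of ] cong: sum.cong)
    qed
  qed
  finally show ?thesis by (simp add: G_def nn_integral_unit_uniform)
qed

text \<open>A shift down by \<open>\<kappa>\<close> modulo 1. Wrapping around, in place of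
  truncating, preserves the uniform law, so the representatives have exactly the given
  distribution.\<close>

definition rotate_by :: "real \<Rightarrow> real \<Rightarrow> real" where
  "rotate_by \<kappa> s = (if \<kappa> < s then s - \<kappa> else s + 1 - \<kappa>)"

lemma rotate_by_measurable [measurable]: "rotate_by \<kappa> \<in> borel_measurable borel"
  unfolding rotate_by_def by measurable

lemma nn_integral_rotate:
  fixes g :: "real \<Rightarrow> ennreal"
  assumes \<kappa>: "0 < \<kappa>" "\<kappa> \<le> 1" and g: "g \<in> borel_measurable borel"
  shows "(\<integral>\<^sup>+s. g (rotate_by \<kappa> s) \<partial>unit_uniform) = (\<integral>\<^sup>+s. g s \<partial>unit_uniform)"
proof -
  have "(\<integral>\<^sup>+s. g (rotate_by \<kappa> s) \<partial>unit_uniform)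
      = (\<integral>\<^sup>+s. g (s - \<kappa>) * indicator {\<kappa><..<1} s + g (s + 1 - \<kappa>) * indicator {0<..\<kappa>} s * indicator {0<..<1} s \<partial>lborel)"
    unfolding nn_integral_unit_uniform using \<kappa> by (intro nn_integral_cong) (auto simp: rotate_by_def indicator_def)
  also have "\<dots> = (\<integral>\<^sup>+s. g (s - \<kappa>) * indicator {\<kappa><..<1} s \<partial>lborel) + (\<integral>\<^sup>+s. g (s + 1 - \<kappa>) * indicator {0<..\<kappa>} s * indicator {0<..<1} s \<partial>lborel)"
    using g by (intro nn_integral_add) auto
  also have "(\<integral>\<^sup>+s. g (s - \<kappa>) * indicator {\<kappa><..<1} s \<partial>lborel) = (\<integral>\<^sup>+s. g s * indicator {0<..<1 - \<kappa>} s \<partial>lborel)"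
    using g by (subst nn_integral_real_affine[where c=1 and t="- \<kappa>" and f="\<lambda>s. g s * indicator {0<..<1 - \<kappa>} s"])
      (auto simp: indicator_def intro!: nn_integral_cong)
  also have "(\<integral>\<^sup>+s. g (s + 1 - \<kappa>) * indicator {0<..\<kappa>} s * indicator {0<..<1} s \<partial>lborel)
      = (\<integral>\<^sup>+s. g s * indicator {1 - \<kappa><..1} s * indicator {0<..<1} (s + \<kappa> - 1) \<partial>lborel)"
    using g by (subst nn_integral_real_affine[where c=1 and t="1 - \<kappa>" and f="\<lambda>s. g s * indicator {1 - \<kappa><..1} s * indicator {0<..<1} (s + \<kappa> - 1)"])
      (auto simp: indicator_def algebra_simps intro!: nn_integral_cong)
  also have "(\<integral>\<^sup>+s. g s * indicator {0<..<1 - \<kappa>} s \<partial>lborel) + \<dots>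
      = (\<integral>\<^sup>+s. g s * indicator {0<..<1 - \<kappa>} s + g s * indicator {1 - \<kappa><..1} s * indicator {0<..<1} (s + \<kappa> - 1) \<partial>lborel)"
    using g by (intro nn_integral_add[symmetric]) auto
  also have "\<dots> = (\<integral>\<^sup>+s. g s * indicator {0<..<1} s \<partial>lborel)"
  proof (rule nn_integral_cong_AE)
    have "AE s in lborel. s \<noteq> 1 \<and> s \<noteq> 1 - \<kappa>" using AE_lborel_singleton[of 1] AE_lborel_singleton[of "1 - \<kappa>"] by eventually_elim auto
    then show "AE s in lborel. g s * indicator {0<..<1 - \<kappa>} s + g s * indicator {1 - \<kappa><..1} s * indicator {0<..<1} (s + \<kappa> - 1) = g s * indicator {0<..<1} s"
      by eventually_elim (use \<kappa> in \<open>auto simp: indicator_def\<close>)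
  qed
  finally show ?thesis by (simp add: nn_integral_unit_uniform)
qed

text \<open>A level and an independent uniform seed determine a point with distribution \<open>M\<close>. Shifting the
  quantile down by \<open>\<kappa>\<close> puts it below all points of that level, except on the event \<open>\<not> ok\<close>.\<close>

lemma (in real_distribution) discretisation_exists:
  assumes \<kappa>: "0 < \<kappa>" "\<kappa> \<le> 1"
  obtains lev :: "real \<Rightarrow> nat" and r and rep :: "nat \<Rightarrow> real \<Rightarrow> real" and ok :: "nat \<Rightarrow> real \<Rightarrow> bool"
  where "mono lev" "\<And>x. lev x \<le> r" "\<And>j. 1 \<le> j \<Longrightarrow> j \<le> r \<Longrightarrow> \<kappa> \<le> measure M {x. lev x = j}"
    "\<And>j. rep j \<in> borel_measurable unit_uniform" "\<And>j. {u\<in>space unit_uniform. ok j u} \<in> sets unit_uniform"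
    "\<And>j u x. u \<in> space unit_uniform \<Longrightarrow> ok j u \<Longrightarrow> j \<le> lev x \<Longrightarrow> rep j u \<le> x" "\<And>u. \<not> ok 0 u"
    "\<And>A. A \<in> sets borel \<Longrightarrow> (\<integral>\<^sup>+x. (\<integral>\<^sup>+u. indicator A (rep (lev x) u) \<partial>unit_uniform) \<partial>M) = emeasure M A"
    "(\<integral>\<^sup>+x. (\<integral>\<^sup>+u. of_bool (\<not> ok (lev x) u) \<partial>unit_uniform) \<partial>M) \<le> ennreal (2 * \<kappa>)"
proof -
  interpret cdf_distribution M by unfold_locales
  obtain lev :: "real \<Rightarrow> nat" and r where lv: "mono lev" "\<forall>x. lev x \<le> r" "\<forall>j. 1 \<le> j \<and> j \<le> r \<longrightarrow> \<kappa> \<le> measure M {x. lev x = j}"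
    "\<forall>x. measure M {y. x < y \<and> lev y = lev x} \<le> \<kappa>" "measure M {x. lev x = 0} \<le> \<kappa>"
    using levels_exist[OF \<kappa>(1)] by blast
  have lev: "mono lev" "\<And>x. lev x \<le> r" "\<And>j. 1 \<le> j \<Longrightarrow> j \<le> r \<Longrightarrow> \<kappa> \<le> measure M {x. lev x = j}"
    "\<And>x. measure M {y. x < y \<and> lev y = lev x} \<le> \<kappa>" "measure M {x. lev x = 0} \<le> \<kappa>"
    using lv by simp_all
  have levr: "(\<lambda>x. real (lev x)) \<in> borel_measurable borel"
    by (rule borel_measurable_mono) (use lev(1) in \<open>auto simp: mono_def\<close>)
  have lm: "{x. P (lev x)} \<in> sets borel" for P
  proof -
    have "{x. lev x = j} \<in> sets borel" for j
      using measurable_sets[OF levr, of "{real j}"] by (simp add: vimage_def)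
    then have "(\<Union>j\<in>{j. P j}. {x. lev x = j}) \<in> sets borel" by (intro sets.countable_UN') auto
    also have "(\<Union>j\<in>{j. P j}. {x. lev x = j}) = {x. P (lev x)}" by auto
    finally show ?thesis .
  qed
  define b where "b = (\<lambda>j. measure M {x. lev x = j})"
  define G where "G = (\<lambda>j. \<Sum>i<j. b i)"
  have b0: "0 \<le> b j" for j by (simp add: b_def)
  have cum: "(\<Sum>i<j. b i) = measure M {x. lev x < j}" for j
  proof (induction j)
    case (Suc j)
    have "{x. lev x < Suc j} = {x. lev x < j} \<union> {x. lev x = j}" by auto
    then have "measure M {x. lev x < Suc j} = measure M {x. lev x < j} + measure M {x. lev x = j}"
      using lm by (simp add: finite_measure_Union[symmetric] disjoint_iff)
    then show ?case using Suc by (simp add: b_def)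
  qed simp
  have "{x. lev x < Suc r} = UNIV" using lev(2) by (auto simp: less_Suc_eq_le)
  then have bsum: "(\<Sum>j\<le>r. b j) = 1" using cum[of "Suc r"] prob_space by (simp add: lessThan_Suc_atMost)
  have sum_lev: "(\<integral>\<^sup>+x. c (lev x) \<partial>M) = (\<Sum>j\<le>r. ennreal (b j) * c j)" for c :: "nat \<Rightarrow> ennreal"
  proof -
    have "(\<integral>\<^sup>+x. c (lev x) \<partial>M) = (\<integral>\<^sup>+x. (\<Sum>j\<le>r. c j * indicator {x. lev x = j} x) \<partial>M)"
    proof (intro nn_integral_cong)
      fix x
      have "(\<Sum>j\<le>r. c j * indicator {x. lev x = j} x) = (\<Sum>j\<le>r. if j = lev x then c (lev x) else 0)"
        by (intro sum.cong) (auto simp: indicator_def)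
      then show "c (lev x) = (\<Sum>j\<le>r. c j * indicator {x. lev x = j} x)" using lev(2) by simp
    qed
    also have "\<dots> = (\<Sum>j\<le>r. c j * emeasure M {x. lev x = j})"
      using lm by (subst nn_integral_sum) (auto simp: nn_integral_cmult_indicator)
    finally show ?thesis by (simp add: b_def emeasure_eq_measure mult.commute)
  qed
  \<comment> \<open>\<open>I\<close> is the quantile function of \<open>M\<close>. The rotation maps
    a point of the open unit interval out of it only when that point is \<open>\<kappa>\<close>, so
    the value 0 is an arbitrary choice.\<close>
  define Q where "Q = (\<lambda>s. if 0 < s \<and> s < 1 then I s else 0)"
  have Qm: "Q \<in> borel_measurable borel"
  proof -
    have "(\<lambda>s. if s \<in> {0<..<1} then I s else 0) \<in> borel_measurable borel"
      using measurable_CI by (subst measurable_restrict_space_iff[symmetric]) auto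
    then show ?thesis by (simp add: Q_def)
  qed
  define rep where "rep = (\<lambda>j u. Q (rotate_by \<kappa> (G j + u * b j)))"
  define ok where "ok = (\<lambda>j u. 1 \<le> j \<and> \<kappa> < G j + u * b j)"
  have mb: "f \<in> borel_measurable borel \<Longrightarrow> f \<in> borel_measurable unit_uniform" for f :: "real \<Rightarrow> real"
    by (rule measurable_restrict_space1) simp
  show thesis
  proof (rule that[OF lev(1-3)])
    show "rep j \<in> borel_measurable unit_uniform" for j
      unfolding rep_def by (rule mb) (use Qm in measurable)
    show "{u\<in>space unit_uniform. ok j u} \<in> sets unit_uniform" for j
    proof -
      have "{u\<in>space unit_uniform. ok j u} = {0<..<1} \<inter> {u. ok j u}" by (auto simp: space_restrict_space)
      moreover have "{u. ok j u} \<in> sets lborel" unfolding ok_def by measurable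
      ultimately show ?thesis by (simp add: sets_restrict_space)
    qed
    show "rep j u \<le> x" if u: "u \<in> space unit_uniform" and o: "ok j u" and x: "j \<le> lev x" for j u x
    proof -
      have u: "0 < u" "u < 1" using u by (auto simp: space_restrict_space)
      let ?s = "G j + u * b j"
      have s\<kappa>: "\<kappa> < ?s" using o by (simp add: ok_def)
      \<comment> \<open>The aim is \<open>?s - \<kappa> \<le> C x\<close> for the distribution
        function \<open>C\<close>. Points beyond \<open>x\<close> of level at most \<open>j\<close>
        share the level of \<open>x\<close>, and \<open>lev(4)\<close> bounds their mass by
        \<open>\<kappa>\<close>. The quantile at \<open>?s - \<kappa>\<close> is then at most
        \<open>x\<close>.\<close>
      have "?s \<le> G j + b j" using u b0[of j] by (simp add: mult_left_le_one_le)
      also have "\<dots> = measure M {y. lev y \<le> j}" using cum[of "Suc j"] by (simp add: G_def less_Suc_eq_le)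
      also have "\<dots> \<le> measure M ({..x} \<union> {y. x < y \<and> lev y = lev x})"
      proof (intro finite_measure_mono)
        show "{y. lev y \<le> j} \<subseteq> {..x} \<union> {y. x < y \<and> lev y = lev x}"
        proof
          fix y assume "y \<in> {y. lev y \<le> j}"
          then show "y \<in> {..x} \<union> {y. x < y \<and> lev y = lev x}"
            using monoD[OF lev(1), of x y] x by (cases "y \<le> x") auto
        qed
        have "{x<..} \<inter> {y. lev y = lev x} \<in> sets borel" using lm by (intro sets.Int) auto
        moreover have "{x<..} \<inter> {y. lev y = lev x} = {y. x < y \<and> lev y = lev x}" by auto
        ultimately show "{..x} \<union> {y. x < y \<and> lev y = lev x} \<in> events" by auto
      qed
      also have "\<dots> \<le> C x + \<kappa>"
      proof -
        have "{x<..} \<inter> {y. lev y = lev x} \<in> sets borel" using lm by (intro sets.Int) auto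
        moreover have "{x<..} \<inter> {y. lev y = lev x} = {y. x < y \<and> lev y = lev x}" by auto
        ultimately have "measure M ({..x} \<union> {y. x < y \<and> lev y = lev x}) \<le> measure M {..x} + measure M {y. x < y \<and> lev y = lev x}"
          by (intro measure_subadditive) auto
        then show ?thesis using lev(4)[of x] by (simp add: cdf_def)
      qed
      finally have le: "?s - \<kappa> \<le> C x" by simp
      have "?s \<le> 1"
      proof -
        have "G j + b j = measure M {y. lev y \<le> j}" using cum[of "Suc j"] by (simp add: G_def less_Suc_eq_le)
        then have "?s \<le> measure M {y. lev y \<le> j}" using \<open>?s \<le> G j + b j\<close> by simp
        then show ?thesis by (rule order_trans[OF _ prob_le_1])
      qed
      then have "0 < ?s - \<kappa>" "?s - \<kappa> < 1" using s\<kappa> \<kappa> by auto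
      then show ?thesis using pseudoinverse[of "?s - \<kappa>" x] le s\<kappa> by (simp add: rep_def rotate_by_def Q_def)
    qed
    show "\<not> ok 0 u" for u by (simp add: ok_def)
    show "(\<integral>\<^sup>+x. (\<integral>\<^sup>+u. indicator A (rep (lev x) u) \<partial>unit_uniform) \<partial>M) = emeasure M A" if A: "A \<in> sets borel" for A
    proof -
      have mA: "(\<lambda>s. indicator A (Q s) :: ennreal) \<in> borel_measurable borel"
        using A Qm by (intro measurable_compose[OF Qm]) auto
      then have mA2: "(\<lambda>s. indicator A (Q (rotate_by \<kappa> s)) :: ennreal) \<in> borel_measurable borel"
        by (rule measurable_compose[OF rotate_by_measurable])
      have "(\<integral>\<^sup>+x. (\<integral>\<^sup>+u. indicator A (rep (lev x) u) \<partial>unit_uniform) \<partial>M)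
          = (\<Sum>j\<le>r. ennreal (b j) * (\<integral>\<^sup>+u. indicator A (Q (rotate_by \<kappa> (G j + u * b j))) \<partial>unit_uniform))"
        using sum_lev[of "\<lambda>j. \<integral>\<^sup>+u. indicator A (rep j u) \<partial>unit_uniform"] by (simp add: rep_def)
      also have "\<dots> = (\<integral>\<^sup>+u. indicator A (Q (rotate_by \<kappa> u)) \<partial>unit_uniform)"
        unfolding G_def by (rule nn_integral_unit_pieces[OF b0 bsum mA2])
      also have "\<dots> = (\<integral>\<^sup>+u. indicator A (Q u) \<partial>unit_uniform)" by (rule nn_integral_rotate[OF \<kappa> mA])
      also have "\<dots> = (\<integral>\<^sup>+u. indicator A (I u) \<partial>unit_uniform)"
        by (intro nn_integral_cong) (auto simp: Q_def space_restrict_space)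
      also have "\<dots> = (\<integral>\<^sup>+x. indicator A x \<partial>distr unit_uniform borel I)"
        using A measurable_CI by (subst nn_integral_distr) (auto simp: measurable_cong_sets[OF sets_restrict_space_cong[OF sets_lborel]])
      also have "\<dots> = emeasure M A" using A by (simp add: distr_I_eq_M)
      finally show ?thesis .
    qed
    show "(\<integral>\<^sup>+x. (\<integral>\<^sup>+u. of_bool (\<not> ok (lev x) u) \<partial>unit_uniform) \<partial>M) \<le> ennreal (2 * \<kappa>)"
    proof -
      let ?h = "\<lambda>s. of_bool (s \<le> \<kappa>) :: ennreal"
      interpret UU: prob_space unit_uniform by (rule prob_space_unit_uniform)
      have hm: "?h \<in> borel_measurable borel" by measurable
      \<comment> \<open>There are two ways to fail, each of probability at most
        \<open>\<kappa>\<close>: the level is 0, or the rotation wraps around.\<close>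
      have le: "(\<integral>\<^sup>+u. of_bool (\<not> ok j u) \<partial>unit_uniform) \<le> of_bool (j = 0) + (\<integral>\<^sup>+u. ?h (G j + u * b j) \<partial>unit_uniform)" for j
      proof (cases "j = 0")
        case True
        have "(\<integral>\<^sup>+u. of_bool (\<not> ok j u) \<partial>unit_uniform) \<le> (\<integral>\<^sup>+u. 1 \<partial>unit_uniform)" by (intro nn_integral_mono) auto
        also have "\<dots> = 1" by (simp only: nn_integral_const UU.emeasure_space_1 mult_1)
        finally show ?thesis using True by (simp add: add_increasing2)
      next
        case False
        then show ?thesis by (auto intro!: nn_integral_mono simp: ok_def not_less)
      qed
      have "(\<integral>\<^sup>+x. (\<integral>\<^sup>+u. of_bool (\<not> ok (lev x) u) \<partial>unit_uniform) \<partial>M)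
          = (\<Sum>j\<le>r. ennreal (b j) * (\<integral>\<^sup>+u. of_bool (\<not> ok j u) \<partial>unit_uniform))"
        by (rule sum_lev)
      also have "\<dots> \<le> (\<Sum>j\<le>r. ennreal (b j) * (of_bool (j = 0) + (\<integral>\<^sup>+u. ?h (G j + u * b j) \<partial>unit_uniform)))"
        using le by (intro sum_mono mult_left_mono) auto
      also have "\<dots> = (\<Sum>j\<le>r. if j = 0 then ennreal (b 0) else 0) + (\<Sum>j\<le>r. ennreal (b j) * (\<integral>\<^sup>+u. ?h (G j + u * b j) \<partial>unit_uniform))"
        by (subst sum.distrib[symmetric]) (auto intro!: sum.cong simp: distrib_left)
      also have "\<dots> = ennreal (b 0) + (\<integral>\<^sup>+u. ?h u \<partial>unit_uniform)"
        unfolding G_def nn_integral_unit_pieces[OF b0 bsum hm] by simp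
      also have "\<dots> \<le> ennreal \<kappa> + ennreal \<kappa>"
      proof (intro add_mono)
        show "ennreal (b 0) \<le> ennreal \<kappa>" using lev(5) by (simp add: b_def ennreal_leI)
        have "(\<integral>\<^sup>+u. ?h u \<partial>unit_uniform) \<le> (\<integral>\<^sup>+u. indicator {0..\<kappa>} u \<partial>lborel)"
          unfolding nn_integral_unit_uniform by (intro nn_integral_mono) (auto simp: indicator_def)
        also have "\<dots> = ennreal \<kappa>" using \<kappa> by simp
        finally show "(\<integral>\<^sup>+u. ?h u \<partial>unit_uniform) \<le> ennreal \<kappa>" .
      qed
      also have "\<dots> = ennreal (2 * \<kappa>)" using \<kappa> by (subst ennreal_plus[symmetric]) auto
      finally show ?thesis .
    qed
  qed
qed

section \<open>Lifting to real vectors\<close>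

lemma measurable_finite_range:
  assumes "finite A" "\<And>x. x \<in> space M \<Longrightarrow> T x \<in> A" "\<And>a. a \<in> A \<Longrightarrow> {x\<in>space M. T x = a} \<in> sets M"
  shows "T \<in> measurable M (count_space UNIV)"
proof (rule measurableI)
  fix B
  have "T -` B \<inter> space M = (\<Union>a\<in>A \<inter> B. {x\<in>space M. T x = a})" using assms(2) by auto
  also have "\<dots> \<in> sets M" using assms by (intro sets.finite_UN) auto
  finally show "T -` B \<inter> space M \<in> sets M" .
qed simp

lemma measurable_pair_finite_range:
  assumes T1: "T1 \<in> measurable M (count_space UNIV)" "finite A" "\<And>x. x \<in> space M \<Longrightarrow> T1 x \<in> A"
    and T2: "T2 \<in> measurable M (count_space UNIV)" "finite B" "\<And>x. x \<in> space M \<Longrightarrow> T2 x \<in> B"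
  shows "(\<lambda>x. (T1 x, T2 x)) \<in> measurable M (count_space UNIV)"
proof (rule measurable_finite_range[of "A \<times> B"])
  fix a assume "a \<in> A \<times> B"
  have "{x\<in>space M. (T1 x, T2 x) = a} = (T1 -` {fst a} \<inter> space M) \<inter> (T2 -` {snd a} \<inter> space M)" by auto
  also have "\<dots> \<in> sets M" using T1(1) T2(1) by (intro sets.Int measurable_sets) auto
  finally show "{x\<in>space M. (T1 x, T2 x) = a} \<in> sets M" .
qed (use assms in auto)

lemma mono_measurable_count_space:
  fixes f :: "real \<Rightarrow> nat"
  assumes "mono f" shows "f \<in> measurable borel (count_space UNIV)"
proof -
  have "(\<lambda>x. real (f x)) \<in> borel_measurable borel"
    by (rule borel_measurable_mono) (use assms in \<open>auto simp: mono_def\<close>)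
  from measurable_sets[OF this] have "f -` {j} \<in> sets borel" for j
    using \<open>(\<lambda>x. real (f x)) \<in> borel_measurable borel\<close>[THEN measurable_sets, of "{real j}"] by (simp add: vimage_def)
  then show ?thesis by (subst measurable_count_space_eq_countable) auto
qed

locale lifting = algorithm d r bp \<kappa> k \<epsilon> \<delta> for d r bp \<kappa> k \<epsilon> \<delta> +
  fixes D :: "nat \<Rightarrow> real measure" and lev :: "nat \<Rightarrow> real \<Rightarrow> nat" and rep :: "nat \<Rightarrow> nat \<Rightarrow> real \<Rightarrow> real"
    and ok :: "nat \<Rightarrow> nat \<Rightarrow> real \<Rightarrow> bool" and G :: nat
  assumes D: "\<And>i. real_distribution (D i)"
    and bp_eq: "\<And>i j. i < d \<Longrightarrow> pmf (bp i) j = measure (D i) {x. lev i x = j}"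
    and lev: "\<And>i. mono (lev i)" "\<And>i x. i < d \<Longrightarrow> lev i x \<le> r i"
    and rep: "\<And>i j. rep i j \<in> borel_measurable unit_uniform"
    and ok: "\<And>i j. {u\<in>space unit_uniform. ok i j u} \<in> sets unit_uniform"
    and rep_le: "\<And>i j u x. u \<in> space unit_uniform \<Longrightarrow> ok i j u \<Longrightarrow> j \<le> lev i x \<Longrightarrow> rep i j u \<le> x"
    and ok0: "\<And>i u. \<not> ok i 0 u"
    and law: "\<And>i A. A \<in> sets borel \<Longrightarrow> (\<integral>\<^sup>+x. (\<integral>\<^sup>+u. indicator A (rep i (lev i x) u) \<partial>unit_uniform) \<partial>D i) = emeasure (D i) A"
    and bad: "\<And>i. (\<integral>\<^sup>+x. (\<integral>\<^sup>+u. of_bool (\<not> ok i (lev i x) u) \<partial>unit_uniform) \<partial>D i) \<le> ennreal (2 * \<kappa>)"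
    and G: "1 \<le> G"
begin

definition levels :: "vec \<Rightarrow> point" where
  "levels x = (\<lambda>i. if i < d then lev i (x i) else 0)"

definition coord :: "nat \<Rightarrow> real measure" where
  "coord i = (if i = d then distr (measure_pmf seeds) borel (\<lambda>s. real (to_nat_on (set_pmf seeds) s)) else unit_uniform)"

text \<open>The first \<open>d\<close> coordinates of the seed choose the representatives of the levels, and
  coordinate \<open>d\<close> encodes the seed of the algorithm on the grid.\<close>

definition seed_space :: "(nat \<Rightarrow> real) measure" where
  "seed_space = PiM {..d} coord"

definition decode :: "(nat \<Rightarrow> real) \<Rightarrow> (slice \<times> nat \<Rightarrow> point) \<times> (nat \<Rightarrow> point \<times> (point \<Rightarrow> nat))" where
  "decode \<omega> = from_nat_into (set_pmf seeds) (nat \<lfloor>\<omega> d\<rfloor>)"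

definition lift_point :: "(nat \<Rightarrow> real) \<Rightarrow> point \<Rightarrow> vec" where
  "lift_point \<omega> z = (\<lambda>i\<in>{..<d}. rep i (z i) (\<omega> i))"

text \<open>Where a representative might not lie below its level the value is 0, which is always
  feasible; by \<open>ok0\<close> this covers level 0. Clipping makes the grid function admissible
  for every real function, as query procedures are run on arbitrary oracles.\<close>

definition round_value :: "(nat \<Rightarrow> real) \<Rightarrow> point \<Rightarrow> real \<Rightarrow> real" where
  "round_value \<omega> z y = (if z \<in> X \<and> (\<forall>i<d. ok i (z i) (\<omega> i)) then real_of_int \<lfloor>real G * max 0 (min 1 y)\<rfloor> / real G else 0)"

text \<open>Rounding to multiples of \<open>1 / G\<close> leaves finitely many functions on the grid, so
  that every function of \<open>grid_fun f \<omega>\<close> is measurable in \<open>\<omega>\<close>.\<close>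

definition grid_fun :: "(vec \<Rightarrow> real) \<Rightarrow> (nat \<Rightarrow> real) \<Rightarrow> point \<Rightarrow> real" where
  "grid_fun f \<omega> z = round_value \<omega> z (f (lift_point \<omega> z))"

definition lifted :: "(vec \<Rightarrow> real) \<Rightarrow> (nat \<Rightarrow> real) \<Rightarrow> vec \<Rightarrow> real" where
  "lifted f \<omega> x = result (grid_fun f \<omega>) (decode \<omega>) (levels x)"

section \<open>Measurability, bounds and feasibility of the lifted function\<close>

lemma prob_D: "prob_space (D i)" using D[of i] by (simp add: real_distribution_def)

lemma sets_D [measurable_cong]: "sets (D i) = sets borel" using D[of i] by (simp add: real_distribution_def real_distribution_axioms_def)

lemma space_D: "space (D i) = UNIV" using sets_eq_imp_space_eq[OF sets_D[of i]] by simp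

lemma prob_coord: "prob_space (coord i)"
  unfolding coord_def using prob_space_unit_uniform by (auto intro!: measure_pmf.prob_space_distr)

sublocale DP: product_prob_space D by (intro product_prob_spaceI prob_D)

sublocale CP: product_prob_space coord by (intro product_prob_spaceI prob_coord)

lemma prob_PD: "prob_space (PiM {..<d} D)" by (intro prob_space_PiM prob_D)

lemma prob_seed: "prob_space seed_space" unfolding seed_space_def by (intro prob_space_PiM prob_coord)

lemma sets_PD [measurable_cong]: "sets (PiM {..<d} D) = sets (Rd d)"
  by (intro sets_PiM_cong) (auto simp: sets_D)

lemma seed_component: "i < d \<Longrightarrow> (\<lambda>\<omega>. \<omega> i) \<in> measurable seed_space unit_uniform"
  using measurable_component_singleton[of i "{..d}" coord] by (simp add: seed_space_def coord_def)

lemma seed_in: "\<omega> \<in> space seed_space \<Longrightarrow> i < d \<Longrightarrow> \<omega> i \<in> space unit_uniform"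
  using measurable_space[OF seed_component] by auto

lemma seed_last: "(\<lambda>\<omega>. \<omega> d) \<in> borel_measurable seed_space"
proof -
  have "(\<lambda>\<omega>. \<omega> d) \<in> measurable seed_space (coord d)"
    unfolding seed_space_def by (rule measurable_component_singleton) simp
  also have "measurable seed_space (coord d) = borel_measurable seed_space"
    by (rule measurable_cong_sets) (auto simp: coord_def)
  finally show ?thesis .
qed

lemma decode_measurable: "decode \<in> measurable seed_space (count_space UNIV)"
proof -
  have "(\<lambda>\<omega>. nat \<lfloor>\<omega> d\<rfloor>) \<in> measurable seed_space (count_space UNIV)" using seed_last by measurable
  then show ?thesis unfolding decode_def by (rule measurable_compose) simp
qed

lemma decode_in: "decode \<omega> \<in> set_pmf seeds"
  unfolding decode_def by (intro from_nat_into set_pmf_not_empty)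

lemma lift_point_in: "lift_point \<omega> z \<in> space (Rd d)"
  by (auto simp: lift_point_def space_PiM)

lemma levels_X: "levels x \<in> X"
  using lev(2) by (auto simp: levels_def X_def PiE_dflt_def)

definition grid_values :: "(point \<Rightarrow> real) set" where
  "grid_values = PiE_dflt X 0 (\<lambda>_. (\<lambda>j. real_of_int j / real G) ` {0..int G})"

lemma finite_grid_values: "finite grid_values"
  unfolding grid_values_def using finite_X by (intro finite_PiE_dflt) auto

lemma round_value_bounds:
  "0 \<le> round_value \<omega> z y" "round_value \<omega> z y \<le> 1" "0 \<le> y \<Longrightarrow> round_value \<omega> z y \<le> y"
  "z \<in> X \<Longrightarrow> (\<forall>i<d. ok i (z i) (\<omega> i)) \<Longrightarrow> 0 \<le> y \<Longrightarrow> y \<le> 1 \<Longrightarrow> y - 1 / G \<le> round_value \<omega> z y"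
  "round_value \<omega> z y \<in> insert 0 ((\<lambda>j. real_of_int j / real G) ` {0..int G})"
proof -
  let ?c = "max 0 (min 1 y)"
  have c: "0 \<le> ?c" "?c \<le> 1" by auto
  have G0: "0 < real G" using G by simp
  have f0: "0 \<le> \<lfloor>real G * ?c\<rfloor>" using c G0 by (simp add: mult_nonneg_nonneg)
  have "real G * ?c \<le> real G * 1" using c by (intro mult_left_mono) auto
  then have f1: "\<lfloor>real G * ?c\<rfloor> \<le> int G" by (metis floor_mono floor_of_nat mult_1_right)
  have f2: "real_of_int \<lfloor>real G * ?c\<rfloor> / real G \<le> ?c"
    using G0 of_int_floor_le[of "real G * ?c"] by (simp add: divide_le_eq mult.commute)
  show "0 \<le> round_value \<omega> z y" using f0 G0 by (simp add: round_value_def)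
  show "round_value \<omega> z y \<le> 1" using f2 c by (auto simp: round_value_def)
  show "0 \<le> y \<Longrightarrow> round_value \<omega> z y \<le> y" using f2 by (auto simp: round_value_def)
  show "round_value \<omega> z y \<in> insert 0 ((\<lambda>j. real_of_int j / real G) ` {0..int G})"
    using f0 f1 by (auto simp: round_value_def)
  assume a: "z \<in> X" "\<forall>i<d. ok i (z i) (\<omega> i)" "0 \<le> y" "y \<le> 1"
  have "real G * y - 1 \<le> real_of_int \<lfloor>real G * y\<rfloor>" by linarith
  then have "(real G * y - 1) / G \<le> real_of_int \<lfloor>real G * y\<rfloor> / G" using G0 by (intro divide_right_mono) auto
  moreover have "(real G * y - 1) / G = y - 1 / G" using G0 by (simp add: field_simps)
  ultimately show "y - 1 / G \<le> round_value \<omega> z y" using a by (simp add: round_value_def)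
qed

lemma admissible_round: "admissible (\<lambda>z. round_value \<omega> z (h z))"
  using round_value_bounds ok0 by (auto simp: admissible_def round_value_def)

lemma admissible_grid_fun: "admissible (grid_fun f \<omega>)"
  unfolding grid_fun_def[abs_def] by (rule admissible_round)

lemma grid_fun_in: "grid_fun f \<omega> \<in> grid_values"
proof -
  have "grid_fun f \<omega> z \<in> (\<lambda>j. real_of_int j / real G) ` {0..int G}" for z
    using round_value_bounds(5)[of \<omega> z "f (lift_point \<omega> z)"] by (auto simp: grid_fun_def)
  moreover have "grid_fun f \<omega> z = 0" if "z \<notin> X" for z using that by (simp add: grid_fun_def round_value_def)
  ultimately show ?thesis by (auto simp: grid_values_def PiE_dflt_def)
qed

lemma grid_fun_measurable:
  assumes f: "f \<in> oracles d" shows "grid_fun f \<in> measurable seed_space (count_space UNIV)"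
proof (rule measurable_finite_range[OF finite_grid_values grid_fun_in])
  fix H
  have pt: "(\<lambda>\<omega>. lift_point \<omega> z) \<in> measurable seed_space (Rd d)" for z
    unfolding lift_point_def by (intro measurable_restrict measurable_compose[OF seed_component rep]) auto
  have fm: "f \<in> borel_measurable (Rd d)" using f by (simp add: oracles_def)
  have fl: "(\<lambda>\<omega>. f (lift_point \<omega> z)) \<in> borel_measurable seed_space" for z
    by (rule measurable_compose[OF pt fm])
  have "{\<omega>\<in>space seed_space. ok i j (\<omega> i)} \<in> sets seed_space" if "i < d" for i j
    using measurable_sets[OF seed_component[OF that] ok[of i j]] seed_in that
    by (auto simp: vimage_def Int_def conj_commute cong: conj_cong)
  then have okm: "{\<omega>\<in>space seed_space. \<forall>i\<in>{..<d}. ok i (z i) (\<omega> i)} \<in> sets seed_space" for z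
    by (intro sets.sets_Collect_finite_All) auto
  have gm: "(\<lambda>\<omega>. grid_fun f \<omega> z) \<in> borel_measurable seed_space" for z
  proof (cases "z \<in> X")
    case True
    have "(\<lambda>y. real_of_int \<lfloor>real G * max 0 (min 1 y)\<rfloor> / real G) \<in> borel_measurable borel" by measurable
    from measurable_compose[OF fl this]
    have "(\<lambda>\<omega>. if \<forall>i\<in>{..<d}. ok i (z i) (\<omega> i) then real_of_int \<lfloor>real G * max 0 (min 1 (f (lift_point \<omega> z)))\<rfloor> / real G else 0)
        \<in> borel_measurable seed_space" using okm by (intro measurable_If) auto
    then show ?thesis using True by (simp add: grid_fun_def round_value_def Ball_def)
  qed (simp add: grid_fun_def round_value_def)
  have out: "grid_fun f \<omega> z = 0" if "z \<notin> X" for \<omega> z using that by (simp add: grid_fun_def round_value_def)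
  show "{\<omega>\<in>space seed_space. grid_fun f \<omega> = H} \<in> sets seed_space"
  proof (cases "\<forall>z. z \<notin> X \<longrightarrow> H z = 0")
    case True
    then have "{\<omega>\<in>space seed_space. grid_fun f \<omega> = H} = {\<omega>\<in>space seed_space. \<forall>z\<in>X. grid_fun f \<omega> z = H z}"
      using out by (auto simp: fun_eq_iff)
    also have "\<dots> \<in> sets seed_space"
    proof (intro sets.sets_Collect_finite_All finite_X)
      fix z
      have "(\<lambda>\<omega>. grid_fun f \<omega> z) -` {H z} \<inter> space seed_space \<in> sets seed_space"
        by (intro measurable_sets[OF gm]) auto
      then show "{\<omega>\<in>space seed_space. grid_fun f \<omega> z = H z} \<in> sets seed_space"
        by (simp add: vimage_def Int_def conj_commute)
    qed
    finally show ?thesis .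
  next
    case False
    then have e: "{\<omega>\<in>space seed_space. grid_fun f \<omega> = H} = {}" using out by auto
    show ?thesis unfolding e by simp
  qed
qed

lemma state_measurable:
  assumes f: "f \<in> oracles d" shows "(\<lambda>\<omega>. (grid_fun f \<omega>, decode \<omega>)) \<in> measurable seed_space (count_space UNIV)"
  by (rule measurable_pair_finite_range[OF grid_fun_measurable[OF f] finite_grid_values grid_fun_in decode_measurable finite_seeds decode_in])

lemma state_borel:
  assumes f: "f \<in> oracles d" shows "(\<lambda>\<omega>. h (grid_fun f \<omega>) (decode \<omega>)) \<in> measurable seed_space (count_space UNIV)"
  by (rule measurable_compose[OF state_measurable[OF f], of "\<lambda>(a, b). h a b" "count_space UNIV", simplified])

lemma lev_component: "i < d \<Longrightarrow> (\<lambda>x. lev i (x i)) \<in> measurable (Rd d) (count_space UNIV)"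
proof -
  assume "i < d"
  then have "(\<lambda>x. x i) \<in> measurable (Rd d) borel" by (intro measurable_component_singleton) simp
  then show ?thesis by (rule measurable_compose[OF _ mono_measurable_count_space[OF lev(1)]])
qed

lemma levels_measurable: "levels \<in> measurable (Rd d) (count_space UNIV)"
proof (rule measurable_finite_range[OF finite_X levels_X])
  fix z assume z: "z \<in> X"
  have "{x\<in>space (Rd d). levels x = z} = {x\<in>space (Rd d). \<forall>i\<in>{..<d}. lev i (x i) = z i}"
    using X_outside[OF z] by (auto simp: levels_def fun_eq_iff)
  also have "\<dots> \<in> sets (Rd d)"
  proof (intro sets.sets_Collect_finite_All)
    fix i assume "i \<in> {..<d}"
    then have "(\<lambda>x. lev i (x i)) -` {z i} \<inter> space (Rd d) \<in> sets (Rd d)"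
      by (intro measurable_sets[OF lev_component]) auto
    then show "{x\<in>space (Rd d). lev i (x i) = z i} \<in> sets (Rd d)" by (simp add: vimage_def Int_def conj_commute)
  qed simp
  finally show "{x\<in>space (Rd d). levels x = z} \<in> sets (Rd d)" .
qed

lemma joint_measurable:
  assumes f: "f \<in> oracles d"
  shows "(\<lambda>(\<omega>, x). h (grid_fun f \<omega>) (decode \<omega>) (levels x) :: real) \<in> borel_measurable (seed_space \<Otimes>\<^sub>M Rd d)"
proof -
  have 1: "(\<lambda>p. (grid_fun f (fst p), decode (fst p))) \<in> measurable (seed_space \<Otimes>\<^sub>M Rd d) (count_space UNIV)"
    by (rule measurable_compose[OF measurable_fst state_measurable[OF f]])
  have 2: "(\<lambda>p. levels (snd p)) \<in> measurable (seed_space \<Otimes>\<^sub>M Rd d) (count_space UNIV)"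
    by (rule measurable_compose[OF measurable_snd levels_measurable])
  have "(\<lambda>p. ((grid_fun f (fst p), decode (fst p)), levels (snd p))) \<in> measurable (seed_space \<Otimes>\<^sub>M Rd d) (count_space UNIV)"
    by (rule measurable_pair_finite_range[OF 1 _ _ 2 finite_X levels_X, of "grid_values \<times> set_pmf seeds"])
      (use finite_grid_values finite_seeds grid_fun_in decode_in in auto)
  from measurable_compose[OF this, of "\<lambda>((a, b), z). h a b z" borel] show ?thesis by (simp add: case_prod_unfold)
qed

lemma lifted_01: "0 \<le> lifted f \<omega> x" "lifted f \<omega> x \<le> 1"
  using result_bounds[OF admissible_grid_fun, of "levels x" f \<omega> 1 "decode \<omega>"] admissible_grid_fun[of f \<omega>]
  by (auto simp: lifted_def admissible_def)

text \<open>A grid point below \<open>levels x\<close> carries 0 or the value of \<open>f\<close>,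
  rounded down, at a representative that lies below \<open>x\<close>. The supremum is nonnegative
  because \<open>x\<close> itself competes.\<close>

lemma lifted_feasible:
  assumes f: "f \<in> oracles d" and w: "\<omega> \<in> space seed_space" and x: "x \<in> space (Rd d)"
  shows "lifted f \<omega> x \<le> (SUP y \<in> {y \<in> space (Rd d). \<forall>i<d. y i \<le> x i}. f y)"
proof -
  let ?A = "{y \<in> space (Rd d). \<forall>i<d. y i \<le> x i}"
  have f01: "0 \<le> f y" "f y \<le> 1" if "y \<in> space (Rd d)" for y using f that by (auto simp: oracles_def)
  have bdd: "bdd_above (f ` ?A)" using f01 by (intro bdd_aboveI[of _ 1]) auto
  have "0 \<le> f x" using f01 x by auto
  also have "\<dots> \<le> (SUP y\<in>?A. f y)" using x by (intro cSUP_upper bdd) auto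
  finally have S0: "0 \<le> (SUP y\<in>?A. f y)" .
  show ?thesis unfolding lifted_def
  proof (rule result_bounds(2)[OF admissible_grid_fun _ S0])
    fix z assume z: "\<And>i. z i \<le> levels x i"
    show "grid_fun f \<omega> z \<le> (SUP y\<in>?A. f y)"
    proof (cases "\<forall>i<d. ok i (z i) (\<omega> i)")
      case True
      have "lift_point \<omega> z i \<le> x i" if "i < d" for i
        using rep_le[of "\<omega> i" i "z i" "x i"] seed_in[OF w that] True z[of i] that by (simp add: lift_point_def levels_def)
      then have "lift_point \<omega> z \<in> ?A" using lift_point_in by auto
      then have "f (lift_point \<omega> z) \<le> (SUP y\<in>?A. f y)" by (intro cSUP_upper bdd)
      moreover have "grid_fun f \<omega> z \<le> f (lift_point \<omega> z)"
        unfolding grid_fun_def using f01[OF lift_point_in] by (intro round_value_bounds)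
      ultimately show ?thesis by simp
    next
      case False
      then have "grid_fun f \<omega> z = 0" by (auto simp: grid_fun_def round_value_def)
      then show ?thesis using S0 by simp
    qed
  qed
qed

lemma expect_levels_law:
  assumes J: "J \<subseteq> {..<d}"
  shows "(\<integral>v. g (\<lambda>i. if i \<in> J then lev i (v i) else 0) \<partial>PiM J D) = expect (Pi_pmf J 0 bp) (g :: point \<Rightarrow> real)"
proof -
  have fJ: "finite J" using J finite_subset by auto
  let ?l = "\<lambda>v i. if i \<in> J then lev i (v i) else 0" and ?Y = "PiE_dflt J 0 (\<lambda>i. {..r i})"
  let ?P = "PiM J D"
  interpret P: prob_space ?P by (intro prob_space_PiM prob_D)
  have fY: "finite ?Y" using fJ by (intro finite_PiE_dflt) auto
  have lY: "?l v \<in> ?Y" for v using lev(2) J by (auto simp: PiE_dflt_def)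
  have spP: "space ?P = PiE J (\<lambda>_. UNIV)" by (simp add: space_PiM space_D)
  have levs: "{x. lev i x = j} \<in> sets borel" for i j
    using measurable_sets[OF mono_measurable_count_space[OF lev(1)], of "{j}" i] by (simp add: vimage_def)
  have fib: "{v\<in>space ?P. ?l v = y} = PiE J (\<lambda>i. {x. lev i x = y i})" if "y \<in> ?Y" for y
  proof -
    have "y i = 0" if "i \<notin> J" for i using that \<open>y \<in> ?Y\<close> by (auto simp: PiE_dflt_def)
    then show ?thesis unfolding spP by (auto simp: fun_eq_iff PiE_def Pi_def)
  qed
  have fibS: "{v\<in>space ?P. ?l v = y} \<in> sets ?P" if "y \<in> ?Y" for y
    unfolding fib[OF that] using levs fJ by (intro sets_PiM_I_finite) (auto simp: sets_D)
  have prob: "measure ?P {v\<in>space ?P. ?l v = y} = pmf (Pi_pmf J 0 bp) y" if "y \<in> ?Y" for y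
  proof -
    have "emeasure ?P (PiE J (\<lambda>i. {x. lev i x = y i})) = (\<Prod>i\<in>J. emeasure (D i) {x. lev i x = y i})"
      using levs fJ by (intro DP.emeasure_PiM) (auto simp: sets_D)
    also have "\<dots> = (\<Prod>i\<in>J. ennreal (measure (D i) {x. lev i x = y i}))"
      by (simp add: DP.M.emeasure_eq_measure)
    also have "\<dots> = ennreal (\<Prod>i\<in>J. measure (D i) {x. lev i x = y i})" by (intro prod_ennreal) simp
    also have "(\<Prod>i\<in>J. measure (D i) {x. lev i x = y i}) = (\<Prod>i\<in>J. pmf (bp i) (y i))"
      using bp_eq J by (intro prod.cong) auto
    also have "\<dots> = pmf (Pi_pmf J 0 bp) y" using that fJ by (subst pmf_Pi') (auto simp: PiE_dflt_def)
    finally show ?thesis unfolding fib[OF that] by (simp add: measure_def)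
  qed
  have "(\<integral>v. g (?l v) \<partial>?P) = (\<integral>v. (\<Sum>y\<in>?Y. g y * indicator {v\<in>space ?P. ?l v = y} v) \<partial>?P)"
  proof (intro Bochner_Integration.integral_cong refl)
    fix v assume "v \<in> space ?P"
    then have "(\<Sum>y\<in>?Y. g y * indicator {v\<in>space ?P. ?l v = y} v) = (\<Sum>y\<in>?Y. if y = ?l v then g (?l v) else 0)"
      by (intro sum.cong) (auto simp: indicator_def)
    also have "\<dots> = g (?l v)" using fY lY by (simp only: sum.delta if_True)
    finally show "g (?l v) = (\<Sum>y\<in>?Y. g y * indicator {v\<in>space ?P. ?l v = y} v)" by simp
  qed
  also have "\<dots> = (\<Sum>y\<in>?Y. g y * measure ?P {v\<in>space ?P. ?l v = y})"
  proof -
    have "integrable ?P (\<lambda>v. g y * indicator {v\<in>space ?P. ?l v = y} v)" if "y \<in> ?Y" for y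
      using fibS[OF that] by (intro integrable_mult_right integrable_real_indicator) (auto simp: less_top[symmetric])
    then show ?thesis using fibS by (subst Bochner_Integration.integral_sum) auto
  qed
  also have "\<dots> = (\<Sum>y\<in>?Y. g y * pmf (Pi_pmf J 0 bp) y)" using prob by (intro sum.cong) auto
  also have "\<dots> = expect (Pi_pmf J 0 bp) g"
  proof (rule integral_measure_pmf_real[symmetric, OF fY])
    show "y \<in> ?Y" if "y \<in> set_pmf (Pi_pmf J 0 bp)" for y
      using that supp J fJ by (auto simp: set_Pi_pmf PiE_dflt_def)
  qed
  finally show ?thesis .
qed

text \<open>The output depends on the input only through its levels, whose law is the grid
  distribution.\<close>

lemma marginal_lifted:
  assumes I: "I \<subseteq> {..<d}"
  shows "marginal d D (lifted f \<omega>) I u = mg (I, \<lambda>i. if i \<in> I then lev i (u i) else 0) (result (grid_fun f \<omega>) (decode \<omega>))"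
proof -
  let ?J = "{..<d} - I" and ?h = "result (grid_fun f \<omega>) (decode \<omega>)"
  let ?c = "(I, \<lambda>i. if i \<in> I then lev i (u i) else 0)"
  have lv: "levels (merge I ?J (u, v)) = override ?c (\<lambda>i. if i \<in> ?J then lev i (v i) else 0)" for v
    using I by (auto simp: levels_def merge_def override_def fun_eq_iff)
  have "marginal d D (lifted f \<omega>) I u = (\<integral>v. ?h (override ?c (\<lambda>i. if i \<in> ?J then lev i (v i) else 0)) \<partial>PiM ?J D)"
    by (simp add: marginal_def lifted_def lv)
  also have "\<dots> = expect (Pi_pmf ?J 0 bp) (\<lambda>y. ?h (override ?c y))"
    by (rule expect_levels_law) auto
  also have "\<dots> = expect (map_pmf (\<lambda>z i. if i \<in> ?J then z i else 0) pz) (\<lambda>y. ?h (override ?c y))"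
    unfolding pz_def by (subst Pi_pmf_subset[of "{..<d}"]) auto
  also have "\<dots> = expect pz (\<lambda>z. ?h (override ?c z))"
    unfolding integral_map_pmf
  proof (intro expect_cong)
    fix z assume "z \<in> set_pmf pz"
    then have "z i = 0" if "\<not> i < d" for i using set_pz X_outside that by auto
    then have "override ?c (\<lambda>i. if i \<in> ?J then z i else 0) = override ?c z"
      by (auto simp: override_def fun_eq_iff)
    then show "?h (override ?c (\<lambda>i. if i \<in> ?J then z i else 0)) = ?h (override ?c z)" by simp
  qed
  finally show ?thesis by (simp add: mg_def)
qed

lemma lifted_monotone:
  assumes good: "good (grid_fun f \<omega>) (decode \<omega>)"
  shows "marginally_monotone k d D (lifted f \<omega>)"
  unfolding marginally_monotone_def
proof (intro allI impI ballI)
  fix I and u v :: vec assume I: "I \<subseteq> {..<d} \<and> card I \<le> k" and uv: "\<forall>i\<in>I. u i \<le> v i"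
  have "mg (I, \<lambda>i. if i \<in> I then lev i (u i) else 0) (result (grid_fun f \<omega>) (decode \<omega>))
      \<le> mg (I, \<lambda>i. if i \<in> I then lev i (v i) else 0) (result (grid_fun f \<omega>) (decode \<omega>))"
    using I uv lev by (intro good_monotone[OF admissible_grid_fun good]) (auto intro: monoD)
  then show "marginal d D (lifted f \<omega>) I u \<le> marginal d D (lifted f \<omega>) I v"
    using I by (simp add: marginal_lifted)
qed

lemma lifted_expect: "(\<integral>x. lifted f \<omega> x \<partial>PiM {..<d} D) = expect pz (result (grid_fun f \<omega>) (decode \<omega>))"
  using expect_levels_law[of "{..<d}" "result (grid_fun f \<omega>) (decode \<omega>)"]
  by (simp add: lifted_def levels_def[abs_def] pz_def)

text \<open>The grid function reads only the first \<open>d\<close> coordinates of the seed and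
  stays fixed while coordinate \<open>d\<close>, which encodes the discrete seed, is averaged. This
  makes \<open>prob_good\<close> applicable to each grid function.\<close>

lemma seed_split:
  assumes h: "(\<lambda>\<omega>. h (grid_fun f \<omega>) (decode \<omega>)) \<in> borel_measurable seed_space"
  shows "(\<integral>\<^sup>+\<omega>. h (grid_fun f \<omega>) (decode \<omega>) \<partial>seed_space)
    = (\<integral>\<^sup>+\<omega>. (\<integral>\<^sup>+s. h (grid_fun f \<omega>) s \<partial>measure_pmf seeds) \<partial>PiM {..<d} coord)"
proof -
  have ins: "{..d} = insert d {..<d}" by auto
  let ?enc = "\<lambda>s. real (to_nat_on (set_pmf seeds) s)"
  have gf: "grid_fun f (fun_upd \<omega> d y) = grid_fun f \<omega>" for \<omega> y
    by (intro ext) (simp add: grid_fun_def round_value_def lift_point_def restrict_def cong: if_cong)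
  have "(\<integral>\<^sup>+\<omega>. h (grid_fun f \<omega>) (decode \<omega>) \<partial>seed_space)
      = (\<integral>\<^sup>+\<omega>. (\<integral>\<^sup>+y. h (grid_fun f (fun_upd \<omega> d y)) (decode (fun_upd \<omega> d y)) \<partial>coord d) \<partial>PiM {..<d} coord)"
    using h unfolding seed_space_def ins by (intro CP.product_nn_integral_insert) auto
  also have "\<dots> = (\<integral>\<^sup>+\<omega>. (\<integral>\<^sup>+s. h (grid_fun f \<omega>) s \<partial>measure_pmf seeds) \<partial>PiM {..<d} coord)"
  proof (intro nn_integral_cong)
    fix \<omega>
    have m: "(\<lambda>y::real. h (grid_fun f \<omega>) (from_nat_into (set_pmf seeds) (nat \<lfloor>y\<rfloor>))) \<in> borel_measurable borel"
    proof -
      have "(\<lambda>y::real. nat \<lfloor>y\<rfloor>) \<in> measurable borel (count_space UNIV)" by measurable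
      then show ?thesis by (rule measurable_compose[where g="\<lambda>n. h (grid_fun f \<omega>) (from_nat_into (set_pmf seeds) n)"]) simp
    qed
    have "(\<integral>\<^sup>+y. h (grid_fun f (fun_upd \<omega> d y)) (decode (fun_upd \<omega> d y)) \<partial>coord d)
        = (\<integral>\<^sup>+y. h (grid_fun f \<omega>) (from_nat_into (set_pmf seeds) (nat \<lfloor>y\<rfloor>)) \<partial>distr (measure_pmf seeds) borel ?enc)"
      by (simp add: gf decode_def coord_def)
    also have "\<dots> = (\<integral>\<^sup>+s. h (grid_fun f \<omega>) (from_nat_into (set_pmf seeds) (nat \<lfloor>?enc s\<rfloor>)) \<partial>measure_pmf seeds)"
      using m by (intro nn_integral_distr) auto
    also have "\<dots> = (\<integral>\<^sup>+s. h (grid_fun f \<omega>) s \<partial>measure_pmf seeds)"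
      by (intro nn_integral_cong_AE) (auto simp: AE_measure_pmf_iff from_nat_into_to_nat_on)
    finally show "(\<integral>\<^sup>+y. h (grid_fun f (fun_upd \<omega> d y)) (decode (fun_upd \<omega> d y)) \<partial>coord d)
        = (\<integral>\<^sup>+s. h (grid_fun f \<omega>) s \<partial>measure_pmf seeds)" .
  qed
  finally show ?thesis .
qed

definition good_seeds :: "(vec \<Rightarrow> real) \<Rightarrow> (nat \<Rightarrow> real) set" where
  "good_seeds f = {\<omega>\<in>space seed_space. good (grid_fun f \<omega>) (decode \<omega>)}"

lemma good_seeds_sets: assumes f: "f \<in> oracles d" shows "good_seeds f \<in> sets seed_space"
  using measurable_sets[OF state_borel[OF f, of good], of "{True}"]
  by (simp add: good_seeds_def vimage_def Int_def conj_commute)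

lemma good_seeds_prob: assumes f: "f \<in> oracles d" shows "1 - 3 * \<delta> \<le> measure seed_space (good_seeds f)"
proof -
  interpret S: prob_space seed_space by (rule prob_seed)
  interpret C: prob_space "PiM {..<d} coord" by (intro prob_space_PiM prob_coord)
  have "ennreal (1 - 3 * \<delta>) = (\<integral>\<^sup>+\<omega>. ennreal (1 - 3 * \<delta>) \<partial>PiM {..<d} coord)"
    by (simp only: nn_integral_const C.emeasure_space_1 mult_1_right)
  also have "\<dots> \<le> (\<integral>\<^sup>+\<omega>. (\<integral>\<^sup>+s. of_bool (good (grid_fun f \<omega>) s) \<partial>measure_pmf seeds) \<partial>PiM {..<d} coord)"
  proof (intro nn_integral_mono)
    fix \<omega>
    have "(\<integral>\<^sup>+s. of_bool (good (grid_fun f \<omega>) s) \<partial>measure_pmf seeds) = (\<integral>\<^sup>+s. indicator {s. good (grid_fun f \<omega>) s} s \<partial>measure_pmf seeds)"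
      by (intro nn_integral_cong) (auto simp: indicator_def)
    also have "\<dots> = ennreal (measure_pmf.prob seeds {s. good (grid_fun f \<omega>) s})"
      by (simp add: measure_pmf.emeasure_eq_measure)
    finally show "ennreal (1 - 3 * \<delta>) \<le> (\<integral>\<^sup>+s. of_bool (good (grid_fun f \<omega>) s) \<partial>measure_pmf seeds)"
      using prob_good[OF admissible_grid_fun] by (simp add: ennreal_leI)
  qed
  also have "\<dots> = (\<integral>\<^sup>+\<omega>. of_bool (good (grid_fun f \<omega>) (decode \<omega>)) \<partial>seed_space)"
  proof (rule seed_split[symmetric])
    have "(\<lambda>\<omega>. of_bool (good (grid_fun f \<omega>) (decode \<omega>)) :: ennreal) \<in> measurable seed_space (count_space UNIV)"
      by (rule state_borel[OF f, of "\<lambda>a b. of_bool (good a b)"])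
    then show "(\<lambda>\<omega>. of_bool (good (grid_fun f \<omega>) (decode \<omega>)) :: ennreal) \<in> borel_measurable seed_space"
      by (rule measurable_compose) simp
  qed
  also have "\<dots> = (\<integral>\<^sup>+\<omega>. indicator (good_seeds f) \<omega> \<partial>seed_space)"
    by (intro nn_integral_cong) (auto simp: good_seeds_def indicator_def)
  also have "\<dots> = ennreal (measure seed_space (good_seeds f))"
    using good_seeds_sets[OF f] by (simp add: S.emeasure_eq_measure)
  finally show ?thesis by simp
qed

section \<open>Representatives of a random input\<close>

abbreviation "joint \<equiv> seed_space \<Otimes>\<^sub>M PiM {..<d} D"

lemma joint_cong: "measurable joint = measurable (seed_space \<Otimes>\<^sub>M Rd d)"
  by (intro ext measurable_cong_sets sets_pair_measure_cong sets_PD refl)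

lemma rep_joint:
  assumes i: "i < d" shows "(\<lambda>p. rep i (lev i (snd p i)) (fst p i)) \<in> borel_measurable joint"
proof (rule measurable_compose_countable[where f="\<lambda>j p. rep i j (fst p i)" and g="\<lambda>p. lev i (snd p i)"])
  show "(\<lambda>p. rep i j (fst p i)) \<in> borel_measurable joint" for j
    by (rule measurable_compose[OF measurable_compose[OF measurable_fst seed_component[OF i]] rep])
  show "(\<lambda>p. lev i (snd p i)) \<in> measurable joint (count_space UNIV)"
    unfolding joint_cong by (rule measurable_compose[OF measurable_snd lev_component[OF i]])
qed

lemma ok_joint:
  assumes i: "i < d" shows "Measurable.pred joint (\<lambda>p. ok i (lev i (snd p i)) (fst p i))"
proof (rule measurable_compose_countable[where f="\<lambda>j p. ok i j (fst p i)" and g="\<lambda>p. lev i (snd p i)"])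
  have "Measurable.pred unit_uniform (ok i j)" for j unfolding pred_def by (rule ok)
  then show "Measurable.pred joint (\<lambda>p. ok i j (fst p i))" for j
    by (rule measurable_compose[OF measurable_compose[OF measurable_fst seed_component[OF i]]])
  show "(\<lambda>p. lev i (snd p i)) \<in> measurable joint (count_space UNIV)"
    unfolding joint_cong by (rule measurable_compose[OF measurable_snd lev_component[OF i]])
qed

lemma one_coordinate_measurable:
  assumes "\<And>j. (\<lambda>u. h j u) \<in> borel_measurable unit_uniform"
  shows "(\<lambda>(u, x). h (lev i x) u) \<in> borel_measurable (unit_uniform \<Otimes>\<^sub>M D i)"
proof -
  have "(\<lambda>p. h (lev i (snd p)) (fst p)) \<in> borel_measurable (unit_uniform \<Otimes>\<^sub>M D i)"
  proof (rule measurable_compose_countable)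
    show "(\<lambda>p. h j (fst p)) \<in> borel_measurable (unit_uniform \<Otimes>\<^sub>M D i)" for j
      by (rule measurable_compose[OF measurable_fst assms])
    show "(\<lambda>p. lev i (snd p)) \<in> measurable (unit_uniform \<Otimes>\<^sub>M D i) (count_space UNIV)"
      by (rule measurable_compose[OF measurable_snd])
        (use mono_measurable_count_space[OF lev(1)[of i]] in \<open>simp add: measurable_cong_sets[OF sets_D refl]\<close>)
  qed
  then show ?thesis by (simp add: case_prod_unfold)
qed

lemma one_coordinate_swap:
  fixes h :: "nat \<Rightarrow> real \<Rightarrow> ennreal"
  assumes "\<And>j. (\<lambda>u. h j u) \<in> borel_measurable unit_uniform"
  shows "(\<integral>\<^sup>+u. (\<integral>\<^sup>+x. h (lev i x) u \<partial>D i) \<partial>unit_uniform) = (\<integral>\<^sup>+x. (\<integral>\<^sup>+u. h (lev i x) u \<partial>unit_uniform) \<partial>D i)"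
proof -
  interpret U: prob_space unit_uniform by (rule prob_space_unit_uniform)
  interpret P: pair_sigma_finite unit_uniform "D i" ..
  show ?thesis using P.Fubini'[OF one_coordinate_measurable[where h=h and i=i, OF assms]] by simp
qed

definition representative :: "(nat \<Rightarrow> real) \<times> vec \<Rightarrow> vec" where
  "representative p = (\<lambda>i\<in>{..<d}. rep i (lev i (snd p i)) (fst p i))"

lemma representative_measurable: "representative \<in> measurable joint (Rd d)"
  unfolding representative_def using rep_joint by (intro measurable_restrict) auto

text \<open>On a box the indicator is a product over the coordinates. Integrating first over the
  input and then over the seed factorises it into instances of \<open>law\<close>; coordinate
  \<open>d\<close> of the seed contributes the factor 1.\<close>

lemma representative_law: "distr joint (PiM {..<d} D) representative = PiM {..<d} D"
proof (rule DP.PiM_eqI)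
  have rm: "representative \<in> measurable joint (PiM {..<d} D)"
    using representative_measurable by (simp add: measurable_cong_sets[OF refl sets_PD])
  interpret S: prob_space seed_space by (rule prob_seed)
  interpret PD: prob_space "PiM {..<d} D" by (rule prob_PD)
  fix A assume A: "\<And>i. i \<in> {..<d} \<Longrightarrow> A i \<in> sets (D i)"
  let ?I = "\<lambda>i j u. indicator (A i) (rep i j u) :: ennreal"
  have Im: "(\<lambda>u. ?I i j u) \<in> borel_measurable unit_uniform" if "i < d" for i j
    using A[of i] that by (intro measurable_compose[OF rep]) (auto simp: sets_D)
  define q where "q = (\<lambda>i u. if i < d then (\<integral>\<^sup>+x. ?I i (lev i x) u \<partial>D i) else 1)"
  have qm: "q i \<in> borel_measurable (coord i)" if "i \<in> {..d}" for i
  proof (cases "i = d")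
    case False
    then have i: "i < d" using that by auto
    have "(\<lambda>u. \<integral>\<^sup>+x. ?I i (lev i x) u \<partial>D i) \<in> borel_measurable unit_uniform"
      using DP.M.borel_measurable_nn_integral_fst[OF one_coordinate_measurable[where i=i, OF Im[OF i]]] by simp
    then show ?thesis using i False by (simp add: q_def coord_def)
  qed (simp add: q_def)
  have box: "PiE {..<d} A \<in> sets (PiM {..<d} D)" using A by (intro sets_PiM_I_finite) auto
  have "emeasure (distr joint (PiM {..<d} D) representative) (PiE {..<d} A)
      = (\<integral>\<^sup>+p. indicator (PiE {..<d} A) (representative p) \<partial>joint)"
  proof -
    have "emeasure (distr joint (PiM {..<d} D) representative) (PiE {..<d} A)
        = (\<integral>\<^sup>+y. indicator (PiE {..<d} A) y \<partial>distr joint (PiM {..<d} D) representative)" using box by simp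
    also have "\<dots> = (\<integral>\<^sup>+p. indicator (PiE {..<d} A) (representative p) \<partial>joint)"
      using box by (intro nn_integral_distr rm) simp
    finally show ?thesis .
  qed
  also have "\<dots> = (\<integral>\<^sup>+p. (\<Prod>i<d. ?I i (lev i (snd p i)) (fst p i)) \<partial>joint)"
    by (intro nn_integral_cong) (auto simp: representative_def indicator_def PiE_def Pi_def restrict_def extensional_def split: if_splits)
  also have "\<dots> = (\<integral>\<^sup>+\<omega>. (\<integral>\<^sup>+x. (\<Prod>i<d. ?I i (lev i (x i)) (\<omega> i)) \<partial>PiM {..<d} D) \<partial>seed_space)"
  proof (subst PD.nn_integral_fst[symmetric])
    show "(\<lambda>p. \<Prod>i<d. ?I i (lev i (snd p i)) (fst p i)) \<in> borel_measurable joint"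
    proof (intro borel_measurable_prod_ennreal)
      fix i assume "i \<in> {..<d}"
      then show "(\<lambda>p. ?I i (lev i (snd p i)) (fst p i)) \<in> borel_measurable joint"
        using A[of i] by (intro measurable_compose[OF rep_joint]) (auto simp: sets_D)
    qed
  qed simp
  also have "\<dots> = (\<integral>\<^sup>+\<omega>. (\<Prod>i\<in>{..d}. q i (\<omega> i)) \<partial>seed_space)"
  proof (intro nn_integral_cong)
    fix \<omega> assume w: "\<omega> \<in> space seed_space"
    have "(\<integral>\<^sup>+x. (\<Prod>i<d. ?I i (lev i (x i)) (\<omega> i)) \<partial>PiM {..<d} D) = (\<Prod>i<d. \<integral>\<^sup>+x. ?I i (lev i x) (\<omega> i) \<partial>D i)"
    proof (intro DP.product_nn_integral_prod)
      fix i assume "i \<in> {..<d}"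
      have "(\<lambda>x. ?I i (lev i x) (\<omega> i)) \<in> borel_measurable borel"
        by (rule measurable_compose[OF mono_measurable_count_space[OF lev(1)]]) simp
      then show "(\<lambda>x. ?I i (lev i x) (\<omega> i)) \<in> borel_measurable (D i)"
        by (simp add: measurable_cong_sets[OF sets_D refl])
    qed simp
    also have "\<dots> = (\<Prod>i\<in>{..d}. q i (\<omega> i))"
      by (simp add: q_def lessThan_Suc_atMost[symmetric])
    finally show "(\<integral>\<^sup>+x. (\<Prod>i<d. ?I i (lev i (x i)) (\<omega> i)) \<partial>PiM {..<d} D) = (\<Prod>i\<in>{..d}. q i (\<omega> i))" .
  qed
  also have "\<dots> = (\<Prod>i\<in>{..d}. \<integral>\<^sup>+u. q i u \<partial>coord i)"
    unfolding seed_space_def using qm by (intro CP.product_nn_integral_prod) auto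
  also have "\<dots> = (\<Prod>i<d. \<integral>\<^sup>+u. q i u \<partial>coord i)"
  proof -
    have "(\<integral>\<^sup>+u. q d u \<partial>coord d) = 1" by (simp add: q_def CP.M.emeasure_space_1)
    then show ?thesis by (simp add: lessThan_Suc_atMost[symmetric])
  qed
  also have "\<dots> = (\<Prod>i<d. emeasure (D i) (A i))"
  proof (intro prod.cong refl)
    fix i assume "i \<in> {..<d}"
    then have i: "i < d" by simp
    have "(\<integral>\<^sup>+u. q i u \<partial>coord i) = (\<integral>\<^sup>+u. (\<integral>\<^sup>+x. ?I i (lev i x) u \<partial>D i) \<partial>unit_uniform)"
      using i by (simp add: q_def coord_def)
    also have "\<dots> = (\<integral>\<^sup>+x. (\<integral>\<^sup>+u. ?I i (lev i x) u \<partial>unit_uniform) \<partial>D i)" by (rule one_coordinate_swap[OF Im[OF i]])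
    also have "\<dots> = emeasure (D i) (A i)" using A[of i] i by (intro law) (auto simp: sets_D)
    finally show "(\<integral>\<^sup>+u. q i u \<partial>coord i) = emeasure (D i) (A i)" .
  qed
  finally show "emeasure (distr joint (PiM {..<d} D) representative) (PiE {..<d} A) = (\<Prod>i\<in>{..<d}. emeasure (D i) (A i))" .
qed auto

lemma prob_bad_coordinate:
  assumes i: "i < d" shows "(\<integral>p. of_bool (\<not> ok i (lev i (snd p i)) (fst p i)) \<partial>joint) \<le> 2 * \<kappa>"
proof -
  interpret PD: prob_space "PiM {..<d} D" by (rule prob_PD)
  let ?h = "\<lambda>j u. of_bool (\<not> ok i j u) :: ennreal"
  have [measurable]: "Measurable.pred joint (\<lambda>p. ok i (lev i (snd p i)) (fst p i))" by (rule ok_joint[OF i])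
  have hm: "(\<lambda>u. ?h j u) \<in> borel_measurable unit_uniform" for j
  proof -
    have [measurable]: "Measurable.pred unit_uniform (ok i j)" unfolding pred_def by (rule ok)
    show ?thesis by measurable
  qed
  have h2: "(\<lambda>x. ?h (lev i x) u) \<in> borel_measurable (D i)" for u
  proof -
    have "(\<lambda>x. ?h (lev i x) u) \<in> borel_measurable borel"
      by (rule measurable_compose[OF mono_measurable_count_space[OF lev(1)]]) simp
    then show ?thesis by (simp add: measurable_cong_sets[OF sets_D refl])
  qed
  have "(\<integral>\<^sup>+p. ?h (lev i (snd p i)) (fst p i) \<partial>joint) = (\<integral>\<^sup>+\<omega>. (\<integral>\<^sup>+x. ?h (lev i (x i)) (\<omega> i) \<partial>PiM {..<d} D) \<partial>seed_space)"
    by (subst PD.nn_integral_fst[symmetric]) auto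
  also have "\<dots> = (\<integral>\<^sup>+\<omega>. (\<integral>\<^sup>+x. ?h (lev i x) (\<omega> i) \<partial>D i) \<partial>seed_space)"
  proof (intro nn_integral_cong)
    fix \<omega>
    have "(\<integral>\<^sup>+x. ?h (lev i x) (\<omega> i) \<partial>D i) = (\<integral>\<^sup>+x. ?h (lev i x) (\<omega> i) \<partial>distr (PiM {..<d} D) (D i) (\<lambda>x. x i))"
      using i by (subst distr_PiM_component) (auto intro: prob_D)
    also have "\<dots> = (\<integral>\<^sup>+x. ?h (lev i (x i)) (\<omega> i) \<partial>PiM {..<d} D)"
      using i h2 by (intro nn_integral_distr) auto
    finally show "(\<integral>\<^sup>+x. ?h (lev i (x i)) (\<omega> i) \<partial>PiM {..<d} D) = (\<integral>\<^sup>+x. ?h (lev i x) (\<omega> i) \<partial>D i)" by simp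
  qed
  also have "\<dots> = (\<integral>\<^sup>+u. (\<integral>\<^sup>+x. ?h (lev i x) u \<partial>D i) \<partial>unit_uniform)"
  proof -
    have m: "(\<lambda>u. \<integral>\<^sup>+x. ?h (lev i x) u \<partial>D i) \<in> borel_measurable unit_uniform"
      using DP.M.borel_measurable_nn_integral_fst[OF one_coordinate_measurable[where i=i, OF hm]] by simp
    have c: "coord i = unit_uniform" using i by (simp add: coord_def)
    have "distr seed_space unit_uniform (\<lambda>\<omega>. \<omega> i) = unit_uniform"
      using distr_PiM_component[of "{..d}" coord i] i prob_coord c by (simp add: seed_space_def)
    then have "(\<integral>\<^sup>+u. (\<integral>\<^sup>+x. ?h (lev i x) u \<partial>D i) \<partial>unit_uniform) = (\<integral>\<^sup>+u. (\<integral>\<^sup>+x. ?h (lev i x) u \<partial>D i) \<partial>distr seed_space unit_uniform (\<lambda>\<omega>. \<omega> i))" by simp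
    also have "\<dots> = (\<integral>\<^sup>+\<omega>. (\<integral>\<^sup>+x. ?h (lev i x) (\<omega> i) \<partial>D i) \<partial>seed_space)"
      using m by (intro nn_integral_distr seed_component[OF i]) simp_all
    finally show ?thesis by simp
  qed
  also have "\<dots> = (\<integral>\<^sup>+x. (\<integral>\<^sup>+u. ?h (lev i x) u \<partial>unit_uniform) \<partial>D i)" by (rule one_coordinate_swap[OF hm])
  also have "\<dots> \<le> ennreal (2 * \<kappa>)" by (rule bad)
  finally have le: "(\<integral>\<^sup>+p. ?h (lev i (snd p i)) (fst p i) \<partial>joint) \<le> ennreal (2 * \<kappa>)" .
  have "(\<integral>p. of_bool (\<not> ok i (lev i (snd p i)) (fst p i)) \<partial>joint) = enn2real (\<integral>\<^sup>+p. ennreal (of_bool (\<not> ok i (lev i (snd p i)) (fst p i))) \<partial>joint)"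
    by (intro integral_eq_nn_integral) auto
  also have "(\<integral>\<^sup>+p. ennreal (of_bool (\<not> ok i (lev i (snd p i)) (fst p i))) \<partial>joint) = (\<integral>\<^sup>+p. ?h (lev i (snd p i)) (fst p i) \<partial>joint)"
    by (intro nn_integral_cong) (auto simp: of_bool_def)
  also have "enn2real \<dots> \<le> 2 * \<kappa>" using le kappa by (intro enn2real_leI) auto
  finally show ?thesis .
qed

text \<open>By \<open>representative_law\<close>, \<open>f\<close> at the representative of a random
  input has the expectation of \<open>f\<close> itself. The grid function falls below it through
  rounding and where a coordinate is not \<open>ok\<close>, which costs at most
  \<open>2 * \<kappa>\<close> per coordinate.\<close>

lemma expect_grid_fun:
  assumes f: "f \<in> oracles d"
  shows "(\<integral>x. f x \<partial>PiM {..<d} D) - 2 * \<kappa> * d - 1 / G \<le> (\<integral>p. grid_fun f (fst p) (levels (snd p)) \<partial>joint)"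
proof -
  interpret S: prob_space seed_space by (rule prob_seed)
  interpret PD: prob_space "PiM {..<d} D" by (rule prob_PD)
  interpret J: pair_prob_space seed_space "PiM {..<d} D" ..
  have fm: "f \<in> borel_measurable (Rd d)" and f01: "\<And>y. y \<in> space (Rd d) \<Longrightarrow> 0 \<le> f y \<and> f y \<le> 1"
    using f by (auto simp: oracles_def)
  have rin: "representative p \<in> space (Rd d)" for p by (auto simp: representative_def space_PiM)
  have im: "(\<lambda>p. f (representative p)) \<in> borel_measurable joint" by (rule measurable_compose[OF representative_measurable fm])
  have if1: "integrable joint (\<lambda>p. f (representative p))"
    using f01[OF rin] by (intro J.integrable_const_bound[of _ 1] im AE_I2) auto
  have ib: "integrable joint (\<lambda>p. of_bool (\<not> ok i (lev i (snd p i)) (fst p i)) :: real)" if "i < d" for i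
  proof -
    have [measurable]: "Measurable.pred joint (\<lambda>p. ok i (lev i (snd p i)) (fst p i))" by (rule ok_joint[OF that])
    show ?thesis by (intro J.integrable_const_bound[of _ 1] AE_I2) auto
  qed
  have gm: "(\<lambda>p. grid_fun f (fst p) (levels (snd p))) \<in> borel_measurable joint"
    using joint_measurable[OF f, of "\<lambda>a b z. a z"] unfolding joint_cong by (simp add: case_prod_unfold)
  have ig: "integrable joint (\<lambda>p. grid_fun f (fst p) (levels (snd p)))"
    using admissible_grid_fun by (intro J.integrable_const_bound[of _ 1] gm AE_I2) (auto simp: admissible_def)
  have pw: "f (representative p) - (\<Sum>i<d. of_bool (\<not> ok i (lev i (snd p i)) (fst p i))) - 1 / G \<le> grid_fun f (fst p) (levels (snd p))" for p
  proof (cases "\<forall>i<d. ok i (lev i (snd p i)) (fst p i)")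
    case True
    have eq: "lift_point (fst p) (levels (snd p)) = representative p"
      by (auto simp: lift_point_def representative_def levels_def)
    have "f (representative p) - 1 / G \<le> grid_fun f (fst p) (levels (snd p))"
      unfolding grid_fun_def eq using f01[OF rin[of p]] True levels_X by (intro round_value_bounds(4)) (auto simp: levels_def)
    moreover have "0 \<le> (\<Sum>i<d. of_bool (\<not> ok i (lev i (snd p i)) (fst p i)) :: real)" by (intro sum_nonneg) auto
    ultimately show ?thesis by linarith
  next
    case False
    then obtain i where i: "i < d" "\<not> ok i (lev i (snd p i)) (fst p i)" by auto
    have "(of_bool (\<not> ok i (lev i (snd p i)) (fst p i)) :: real) \<le> (\<Sum>i<d. of_bool (\<not> ok i (lev i (snd p i)) (fst p i)))"
      using i by (intro member_le_sum) auto
    then have "1 \<le> (\<Sum>i<d. of_bool (\<not> ok i (lev i (snd p i)) (fst p i)) :: real)" using i by simp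
    moreover have "0 \<le> grid_fun f (fst p) (levels (snd p))" using admissible_grid_fun by (auto simp: admissible_def)
    moreover have "0 \<le> 1 / real G" by simp
    ultimately show ?thesis using f01[OF rin[of p]] by linarith
  qed
  have "(\<integral>x. f x \<partial>PiM {..<d} D) = (\<integral>x. f x \<partial>distr joint (PiM {..<d} D) representative)" by (simp only: representative_law)
  also have "\<dots> = (\<integral>p. f (representative p) \<partial>joint)"
    using representative_measurable fm by (intro integral_distr) (auto simp: measurable_cong_sets[OF refl sets_PD] measurable_cong_sets[OF sets_PD refl])
  finally have e1: "(\<integral>x. f x \<partial>PiM {..<d} D) = (\<integral>p. f (representative p) \<partial>joint)" .
  have isum: "integrable joint (\<lambda>p. \<Sum>i<d. of_bool (\<not> ok i (lev i (snd p i)) (fst p i)) :: real)"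
    using ib by (intro Bochner_Integration.integrable_sum) auto
  have e2: "(\<integral>p. (\<Sum>i<d. of_bool (\<not> ok i (lev i (snd p i)) (fst p i))) \<partial>joint) \<le> d * (2 * \<kappa>)"
  proof -
    have "(\<integral>p. (\<Sum>i<d. of_bool (\<not> ok i (lev i (snd p i)) (fst p i)) :: real) \<partial>joint)
        = (\<Sum>i<d. \<integral>p. of_bool (\<not> ok i (lev i (snd p i)) (fst p i)) \<partial>joint)"
      using ib by (intro Bochner_Integration.integral_sum) auto
    also have "\<dots> \<le> (\<Sum>i<d. 2 * \<kappa>)" using prob_bad_coordinate by (intro sum_mono) auto
    finally show ?thesis by simp
  qed
  have "(\<integral>p. f (representative p) \<partial>joint) - (\<integral>p. (\<Sum>i<d. of_bool (\<not> ok i (lev i (snd p i)) (fst p i))) \<partial>joint) - 1 / G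
      = (\<integral>p. f (representative p) - (\<Sum>i<d. of_bool (\<not> ok i (lev i (snd p i)) (fst p i))) - 1 / G \<partial>joint)"
    using if1 isum by (simp add: J.prob_space)
  also have "\<dots> \<le> (\<integral>p. grid_fun f (fst p) (levels (snd p)) \<partial>joint)"
    using if1 isum ig pw by (intro integral_mono) auto
  finally show ?thesis using e1 e2 by (simp add: mult_ac)
qed

lemma lifted_joint_measurable: "f \<in> oracles d \<Longrightarrow> (\<lambda>(\<omega>, x). lifted f \<omega> x) \<in> borel_measurable (seed_space \<Otimes>\<^sub>M Rd d)"
  unfolding lifted_def by (rule joint_measurable)

lemma lifted_total:
  assumes f: "f \<in> oracles d"
  shows "(\<integral>x. f x \<partial>PiM {..<d} D) - 2 * \<kappa> * d - 1 / G - \<epsilon> / 4 - 3 * \<delta> \<le> (\<integral>(\<omega>, x). lifted f \<omega> x \<partial>joint)"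
proof -
  interpret S: prob_space seed_space by (rule prob_seed)
  interpret PD: prob_space "PiM {..<d} D" by (rule prob_PD)
  interpret J: pair_prob_space seed_space "PiM {..<d} D" ..
  let ?g = "\<lambda>\<omega>. expect pz (grid_fun f \<omega>)" and ?A = "\<lambda>\<omega>. expect pz (result (grid_fun f \<omega>) (decode \<omega>))"
  have lm: "(\<lambda>(\<omega>, x). lifted f \<omega> x) \<in> borel_measurable joint" unfolding joint_cong by (rule lifted_joint_measurable[OF f])
  have il: "integrable joint (\<lambda>(\<omega>, x). lifted f \<omega> x)"
    using lifted_01 by (intro J.integrable_const_bound[of _ 1] lm AE_I2) auto
  have 1: "(\<integral>(\<omega>, x). lifted f \<omega> x \<partial>joint) = (\<integral>\<omega>. ?A \<omega> \<partial>seed_space)"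
    using J.integral_fst'[OF il] by (simp add: lifted_expect)
  have gm: "(\<lambda>p. grid_fun f (fst p) (levels (snd p))) \<in> borel_measurable joint"
    using joint_measurable[OF f, of "\<lambda>a b z. a z"] unfolding joint_cong by (simp add: case_prod_unfold)
  have ig: "integrable joint (\<lambda>p. grid_fun f (fst p) (levels (snd p)))"
    using admissible_grid_fun by (intro J.integrable_const_bound[of _ 1] gm AE_I2) (auto simp: admissible_def)
  have 2: "(\<integral>p. grid_fun f (fst p) (levels (snd p)) \<partial>joint) = (\<integral>\<omega>. ?g \<omega> \<partial>seed_space)"
  proof -
    have "(\<integral>x. grid_fun f \<omega> (levels x) \<partial>PiM {..<d} D) = ?g \<omega>" for \<omega>
      using expect_levels_law[of "{..<d}" "grid_fun f \<omega>"] by (simp add: levels_def[abs_def] pz_def)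
    then show ?thesis using J.integral_fst'[OF ig] by simp
  qed
  have bm: "(\<lambda>\<omega>. h (grid_fun f \<omega>) (decode \<omega>) :: real) \<in> borel_measurable seed_space" for h
    by (rule measurable_compose[OF state_borel[OF f, of h]]) simp
  have g01: "0 \<le> ?g \<omega>" "?g \<omega> \<le> 1" for \<omega>
    using admissible_grid_fun[of f \<omega>] by (auto simp: admissible_def intro!: expect_nonneg expect_le_const[OF finite_pz])
  have r01: "0 \<le> result (grid_fun f \<omega>) s z" "result (grid_fun f \<omega>) s z \<le> 1" for \<omega> s z
    using result_bounds[OF admissible_grid_fun, of z f \<omega> 1 s] admissible_grid_fun[of f \<omega>] by (auto simp: admissible_def)
  have A01: "0 \<le> ?A \<omega>" "?A \<omega> \<le> 1" for \<omega>
    by (rule expect_nonneg, rule r01) (rule expect_le_const[OF finite_pz], rule r01)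
  have iA: "integrable seed_space ?A"
    using A01 by (intro S.integrable_const_bound[of _ 1] AE_I2 bm[of "\<lambda>a b. expect pz (result a b)"]) auto
  have igg: "integrable seed_space ?g"
    using g01 by (intro S.integrable_const_bound[of _ 1] AE_I2 bm[of "\<lambda>a b. expect pz a"]) auto
  have ib: "integrable seed_space (\<lambda>\<omega>. 1 - indicator (good_seeds f) \<omega> :: real)"
    using good_seeds_sets[OF f] by (intro Bochner_Integration.integrable_diff) (auto simp: less_top[symmetric])
  have "(\<integral>\<omega>. ?g \<omega> \<partial>seed_space) - \<epsilon> / 4 - (1 - measure seed_space (good_seeds f))
      = (\<integral>\<omega>. ?g \<omega> - \<epsilon> / 4 - (1 - indicator (good_seeds f) \<omega>) \<partial>seed_space)"
    using igg ib good_seeds_sets[OF f]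
    by (subst Bochner_Integration.integral_diff) (auto simp: S.prob_space less_top[symmetric])
  also have "\<dots> \<le> (\<integral>\<omega>. ?A \<omega> \<partial>seed_space)"
  proof (intro integral_mono)
    fix \<omega> assume w: "\<omega> \<in> space seed_space"
    show "?g \<omega> - \<epsilon> / 4 - (1 - indicator (good_seeds f) \<omega>) \<le> ?A \<omega>"
    proof (cases "\<omega> \<in> good_seeds f")
      case True
      then show ?thesis using good_expect[OF admissible_grid_fun] by (simp add: good_seeds_def)
    next
      \<comment> \<open>A bad seed costs at most 1, the full range of values; this gives the term
        \<open>3 * \<delta>\<close>.\<close>
      case False
      then show ?thesis using A01[of \<omega>] g01[of \<omega>] eps by simp
    qed
  qed (use iA igg ib in auto)
  finally show ?thesis using 1 2 expect_grid_fun[OF f] good_seeds_prob[OF f] by linarith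
qed

text \<open>The preliminary phase prunes and plays the game, with at most \<open>d + 2\<close> calls
  per round; an answer adds one call per round, at the end of the stored walk.\<close>

lemma meta_algorithm_exists:
  obtains M where "valid_meta_algorithm d M" "seed M = seed_space" "\<And>f \<omega> x. meta_fun M f \<omega> x = lifted f \<omega> x"
    "\<And>f \<omega> x. calls_on M f \<omega> x \<le> prune_queries + rounds * (d + 3)"
proof -
  have pt: "range (lift_point \<omega>) \<subseteq> space (Rd d)" for \<omega> using lift_point_in by auto
  have "\<forall>\<omega>. \<exists>c. queries c \<subseteq> space (Rd d) \<and> (\<forall>f. run f c = final_state (grid_fun f \<omega>) (decode \<omega>) \<and> calls f c \<le> prune_queries + rounds * (d + 2))"
  proof
    fix \<omega>
    show "\<exists>c. queries c \<subseteq> space (Rd d) \<and> (\<forall>f. run f c = final_state (grid_fun f \<omega>) (decode \<omega>) \<and> calls f c \<le> prune_queries + rounds * (d + 2))"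
      using computable_final_state[where \<phi>="round_value \<omega>" and s="decode \<omega>", OF pt[of \<omega>] admissible_round]
      unfolding computable_def grid_fun_def[abs_def] .
  qed
  then obtain c where c: "\<And>\<omega>. queries (c \<omega>) \<subseteq> space (Rd d)" "\<And>\<omega> f. run f (c \<omega>) = final_state (grid_fun f \<omega>) (decode \<omega>)"
    "\<And>\<omega> f. calls f (c \<omega>) \<le> prune_queries + rounds * (d + 2)" by metis
  have "\<forall>\<omega> st z. \<exists>c. queries c \<subseteq> space (Rd d) \<and> (\<forall>f. run f c = answer st z (grid_fun f \<omega>) \<and> calls f c \<le> rounds)"
  proof (intro allI)
    fix \<omega> st z
    show "\<exists>c. queries c \<subseteq> space (Rd d) \<and> (\<forall>f. run f c = answer st z (grid_fun f \<omega>) \<and> calls f c \<le> rounds)"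
      using computable_answer[OF pt[of \<omega>], of st z "round_value \<omega>"] unfolding computable_def grid_fun_def[abs_def] .
  qed
  then obtain a where a: "\<And>\<omega> st z. queries (a \<omega> st z) \<subseteq> space (Rd d)" "\<And>\<omega> st z f. run f (a \<omega> st z) = answer st z (grid_fun f \<omega>)"
    "\<And>\<omega> st z f. calls f (a \<omega> st z) \<le> rounds" by metis
  define M where "M = \<lparr>seed = seed_space, procedure = (\<lambda>\<omega>. oc_bind (c \<omega>) (\<lambda>st. Return (\<lambda>x. a \<omega> st (levels x))))\<rparr>"
  have mf: "meta_fun M f \<omega> x = lifted f \<omega> x" for f \<omega> x
    by (simp add: meta_fun_def M_def run_oc_bind c a lifted_def result_def)
  have q1: "queries (procedure M \<omega>) \<subseteq> space (Rd d)" for \<omega>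
    by (simp add: M_def, rule queries_oc_bind) (use c in auto)
  have q2: "queries (h x) \<subseteq> space (Rd d)" if "h \<in> results (procedure M \<omega>)" for h \<omega> x
    using that results_oc_bind[of "c \<omega>" "\<lambda>st. Return (\<lambda>x. a \<omega> st (levels x))"] a(1) by (fastforce simp: M_def)
  show ?thesis
  proof (rule that)
    show "valid_meta_algorithm d M"
      unfolding valid_meta_algorithm_def mf using prob_seed q1 q2 lifted_01 lifted_joint_measurable
      by (auto simp: M_def)
    show "calls_on M f \<omega> x \<le> prune_queries + rounds * (d + 3)" for f \<omega> x
    proof -
      have "calls_on M f \<omega> x = calls f (c \<omega>) + calls f (a \<omega> (final_state (grid_fun f \<omega>) (decode \<omega>)) (levels x))"
        by (simp add: calls_on_def M_def calls_oc_bind run_oc_bind c)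
      also have "\<dots> \<le> (prune_queries + rounds * (d + 2)) + rounds" by (intro add_mono c a)
      finally show ?thesis by (simp add: algebra_simps)
    qed
  qed (simp_all add: M_def mf[unfolded M_def])
qed

end

section \<open>Query complexity\<close>

text \<open>The crude \<open>ln c \<le> c\<close> suffices because \<open>c\<close> will depend on
  \<open>k\<close> only. All logarithms become multiples of the single factor
  \<open>1 + ln (d / \<epsilon>)\<close>.\<close>

lemma ln_le_of_power_bound:
  fixes t :: real
  assumes "1 \<le> t" "1 \<le> c" "0 \<le> x" "x \<le> c * t ^ m"
  shows "ln x \<le> (c + real m) * (1 + ln t)"
proof -
  have lt: "0 \<le> ln t" using assms by simp
  have ct: "1 \<le> c * t ^ m" using assms one_le_power[of t m] mult_mono[of 1 c 1 "t ^ m"] by simp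
  have "ln x \<le> ln (c * t ^ m)" using assms ct by (cases "x = 0") auto
  also have "\<dots> = ln c + m * ln t" using assms by (simp add: ln_mult ln_realpow)
  also have "\<dots> \<le> c + m * ln t" using ln_le_minus_one[of c] assms by simp
  also have "\<dots> \<le> (c + real m) * (1 + ln t)" using assms lt by (simp add: algebra_simps)
  finally show ?thesis .
qed

lemma power_ratio_mono:
  fixes x e :: real
  assumes "1 \<le> x" "0 < e" "e \<le> 1" "a \<le> a'" "b \<le> b'"
  shows "x ^ a / e ^ b \<le> x ^ a' / e ^ b'"
  using assms by (intro frac_le power_increasing power_decreasing) auto

lemma (in prob_space) nat_valued_pmf_exists:
  assumes T: "T \<in> measurable M (count_space (UNIV :: nat set))"
  shows "\<exists>p. \<forall>j. pmf p j = prob {x\<in>space M. T x = j}"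
proof -
  let ?A = "\<lambda>j. {x\<in>space M. T x = j}"
  have A: "?A j \<in> events" for j using measurable_sets[OF T, of "{j}"] by (simp add: vimage_def Int_def conj_commute)
  have "(\<integral>\<^sup>+j. ennreal (prob (?A j)) \<partial>count_space UNIV) = (\<Sum>j. emeasure M (?A j))"
    by (simp add: nn_integral_count_space_nat emeasure_eq_measure)
  also have "\<dots> = emeasure M (\<Union>j. ?A j)" using A by (intro suminf_emeasure) (auto simp: disjoint_family_on_def)
  also have "(\<Union>j. ?A j) = space M" by auto
  finally have "(\<integral>\<^sup>+j. ennreal (prob (?A j)) \<partial>count_space UNIV) = 1" by (simp add: emeasure_space_1)
  then have "pmf (embed_pmf (\<lambda>j. prob (?A j))) j = prob (?A j)" for j by (intro pmf_embed_pmf) auto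
  then show ?thesis by blast
qed

text \<open>The first summand stems from pruning, the second from the game. Of its numbers, 96 comes
  from \<open>e1\<close>, 385 from \<open>rh\<close>, 1024 from \<open>\<eta>1\<close>, and the
  powers of 16 from \<open>\<kappa>\<close>.\<close>

definition query_constant :: "nat \<Rightarrow> real" where
  "query_constant k = 16 ^ k * (385 + 2 * real k) * (5 * (96 * (288 * 256 ^ k + real (4 * k + 1)) + 2))
     + (4 * (40000 * 16 ^ k * 1024\<^sup>2 * (288 * 16 ^ k + real (2 * k + 2))) + 8)"

lemma (in algorithm) queries_le:
  assumes \<kappa>_eq: "\<kappa> = \<epsilon> / (16 * real d)" and \<delta>_eq: "\<delta> = \<epsilon> / (48 * real d)"
  shows "real (prune_queries + rounds * (d + 3)) \<le> query_constant k * (1 + ln (real d / \<epsilon>))\<^sup>2 * (real d ^ (2 * k + 6) / \<epsilon> ^ (2 * k + 3))"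
proof -
  define t where "t = d / \<epsilon>"
  define l where "l = 1 + ln t"
  define B where "B = real d ^ (2 * k + 6) / \<epsilon> ^ (2 * k + 3)"
  define c1 :: real where "c1 = 288 * 256 ^ k + real (4 * k + 1)"
  define c4 :: real where "c4 = 288 * 16 ^ k + real (2 * k + 2)"
  have d1: "1 \<le> real d" using d_pos by simp
  have e0: "0 < \<epsilon>" "\<epsilon> \<le> 1" using eps by auto
  have dt: "real d \<le> t" using d1 e0 by (simp add: t_def le_divide_eq mult_left_le)
  have t1: "1 \<le> t" using dt d1 by simp
  have l1: "1 \<le> l" using t1 by (simp add: l_def)
  have rat: "real d ^ a / \<epsilon> ^ b \<le> real d ^ a' / \<epsilon> ^ b'" if "a \<le> a'" "b \<le> b'" for a b a' b'
    by (rule power_ratio_mono[OF d1 e0 that])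
  have tpow: "real d ^ a / \<epsilon> ^ b \<le> t ^ m" if "a \<le> m" "b \<le> m" for a b m
    using rat[OF that] by (simp add: t_def power_divide)
  have B1: "1 \<le> B" using rat[of 0 "2 * k + 6" 0 "2 * k + 3"] by (simp add: B_def)
  have sb: "slice_bound = 16 ^ k * (real d ^ (2 * k) / \<epsilon> ^ k)"
    using d1 e0 unfolding slice_bound_def by (simp add: \<kappa>_eq power_divide power_mult_distrib power_mult power2_eq_square)
  have sbt: "slice_bound \<le> 16 ^ k * t ^ (2 * k)"
    unfolding sb by (intro mult_left_mono tpow) auto
  have sb0: "0 \<le> slice_bound" using slice_bound(2) by simp
  have inv\<delta>: "x / \<delta> = x * (48 * t)" for x using d1 e0 by (simp add: \<delta>_eq t_def field_simps)
  have p: "1 \<le> (288::real) * 256 ^ k" "1 \<le> (288::real) * 16 ^ k"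
    using mult_mono[of 1 "288::real" 1 "256 ^ k"] mult_mono[of 1 "288::real" 1 "16 ^ k"] by simp_all
  have nn: "real nn \<le> (96 * c1 + 2) * l / \<epsilon>"
  proof -
    have "slice_bound ^ 2 \<le> (16 ^ k * t ^ (2 * k)) ^ 2" using sbt sb0 by (intro power_mono)
    also have "\<dots> = 256 ^ k * t ^ (4 * k)" 
    proof -
      have "((16::real) ^ k)\<^sup>2 = 256 ^ k" by (simp add: power2_eq_square flip: power_mult_distrib)
      moreover have "(t ^ (2 * k))\<^sup>2 = t ^ (4 * k)" by (simp flip: power_mult)
      ultimately show ?thesis by (simp only: power_mult_distrib)
    qed
    finally have "6 * slice_bound ^ 2 * (48 * t) \<le> 6 * (256 ^ k * t ^ (4 * k)) * (48 * t)"
      using t1 by (intro mult_right_mono mult_left_mono) auto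
    also have "\<dots> = (288 * 256 ^ k) * t ^ (4 * k + 1)" by simp
    finally have "ln (6 * slice_bound ^ 2 * (48 * t)) \<le> (288 * 256 ^ k + real (4 * k + 1)) * (1 + ln t)"
      using t1 sb0 by (intro ln_le_of_power_bound p) auto
    then have ln1: "ln (6 * slice_bound ^ 2 / \<delta>) \<le> c1 * l" unfolding inv\<delta> c1_def l_def .
    have c0: "0 \<le> c1" by (simp add: c1_def)
    have "real nn \<le> max 0 (ln (6 * slice_bound ^ 2 / \<delta>) / e1) + 2"
      unfolding nn_def by (simp add: of_nat_nat) linarith
    also have "\<dots> \<le> c1 * l / e1 + 2" using ln1 e1 c0 l1 by (intro add_right_mono) (auto simp: divide_right_mono)
    also have "\<dots> \<le> 96 * c1 * l / \<epsilon> + 2 * (l / \<epsilon>)"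
    proof -
      have "1 \<le> l / \<epsilon>" using l1 e0 by (simp add: le_divide_eq)
      moreover have "c1 * l / e1 = 96 * c1 * l / \<epsilon>" by (simp add: e1_def)
      ultimately show ?thesis by linarith
    qed
    also have "\<dots> = (96 * c1 + 2) * l / \<epsilon>" using e0 by (simp add: field_simps)
    finally show ?thesis .
  qed
  have lev: "real (level_of rh + 1) \<le> (385 + 2 * real k) * l"
  proof -
    have "rh \<le> 1" using rh e1 by simp
    then have "2 ^ level_of rh * rh \<le> 2" using rh by (intro level_of)
    then have "2 ^ level_of rh \<le> 2 / rh" using rh by (simp add: le_divide_eq)
    also have "\<dots> = 192 * (real d ^ k / \<epsilon> ^ 1)" by (simp add: rh_def)
    also have "\<dots> \<le> 192 * t ^ k" using k by (intro mult_left_mono tpow) auto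
    finally have "ln (2 ^ level_of rh) \<le> (192 + real k) * (1 + ln t)" using t1 by (intro ln_le_of_power_bound) auto
    then have 1: "level_of rh * ln 2 \<le> (192 + real k) * l" by (simp add: ln_realpow l_def)
    have "1 / 2 \<le> ln (2::real)" using ln_le_minus_one[of "1 / 2 :: real"] by (simp add: ln_div)
    then have "level_of rh * (1 / 2) \<le> level_of rh * ln (2::real)" by (intro mult_left_mono) auto
    with 1 have "real (level_of rh) \<le> 2 * ((192 + real k) * l)" by simp
    then show ?thesis using l1 by (simp add: algebra_simps)
  qed
  have prune: "real prune_queries \<le> 16 ^ k * (385 + 2 * real k) * (5 * (96 * c1 + 2)) * l\<^sup>2 * B"
  proof -
    have "real prune_queries = real (card (slices k)) * (real (level_of rh + 1) * (5 * real nn))"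
      by (simp only: prune_queries_def of_nat_mult of_nat_numeral)
    also have "\<dots> \<le> (16 ^ k * (real d ^ (2 * k) / \<epsilon> ^ k)) * (((385 + 2 * real k) * l) * (5 * ((96 * c1 + 2) * l / \<epsilon>)))"
      using slice_bound(1) sb lev nn e0 l1 by (intro mult_mono) (auto simp: c1_def)
    also have "\<dots> = 16 ^ k * (385 + 2 * real k) * (5 * (96 * c1 + 2)) * l\<^sup>2 * (real d ^ (2 * k) / \<epsilon> ^ (k + 1))"
    proof -
      have "P * (x / y) * ((a * l) * (5 * (b * l / e))) = P * a * (5 * b) * l\<^sup>2 * (x / (y * e))" for P x y a b e :: real
        by (simp add: power2_eq_square mult_ac)
      then show ?thesis by (simp only: power_add power_one_right)
    qed
    also have "\<dots> \<le> 16 ^ k * (385 + 2 * real k) * (5 * (96 * c1 + 2)) * l\<^sup>2 * B"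
      unfolding B_def using k by (intro mult_left_mono rat) (auto simp: c1_def)
    finally show ?thesis .
  qed
  have Lc: "L \<le> c4 * l"
  proof -
    have "real (card (game.constraints d r k)) \<le> real (card (slices k) * (d + 1))"
      using constraints_card(1) by (simp only: of_nat_le_iff)
    also have "\<dots> = real (card (slices k)) * (real d + 1)" by (simp add: algebra_simps)
    also have "\<dots> \<le> (16 ^ k * t ^ (2 * k)) * (2 * t)"
      using order_trans[OF slice_bound(1) sbt] dt t1 by (intro mult_mono) auto
    finally have "3 * real (card (game.constraints d r k)) * (48 * t) \<le> 3 * ((16 ^ k * t ^ (2 * k)) * (2 * t)) * (48 * t)"
      using t1 by (intro mult_right_mono mult_left_mono) auto
    also have "\<dots> = (288 * 16 ^ k) * t ^ (2 * k + 2)" by (simp add: power_add power2_eq_square)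
    finally have "ln (3 * real (card (game.constraints d r k)) * (48 * t)) \<le> (288 * 16 ^ k + real (2 * k + 2)) * (1 + ln t)"
      using t1 by (intro ln_le_of_power_bound p) auto
    then show ?thesis unfolding L_def inv\<delta> c4_def l_def .
  qed
  define K :: real where "K = 40000 * 16 ^ k * 1024\<^sup>2 * c4"
  have K0: "0 \<le> K" by (simp add: K_def c4_def)
  have a: "admissible (\<lambda>_. 0)" by (simp add: admissible_def)
  have m: "margins_ok (\<lambda>_ _. \<eta>0)" using eta01 by (simp add: margins_ok_def)
  have Q: "game.Q \<kappa> k = 16 ^ k * (real d ^ k / \<epsilon> ^ k)"
    using d1 e0 unfolding game.Q_def[OF game_cut[OF a m]] by (simp add: \<kappa>_eq power_divide power_mult_distrib)
  have eta: "1 / \<eta>1\<^sup>2 = 1024\<^sup>2 * (real d ^ 4 / \<epsilon> ^ 4)"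
    using d1 e0 unfolding \<eta>1_def by (simp add: \<kappa>_eq field_simps power2_eq_square power4_eq_xxxx)
  \<comment> \<open>For \<open>k \<ge> 2\<close> the exponent \<open>k + 5\<close> of
    \<open>\<epsilon>\<close> is at most \<open>2 * k + 3\<close>. For \<open>k = 1\<close> the
    formula \<open>d ^ k / \<epsilon>\<close> would give the exponent 6 where the budget allows
    5.\<close>
  have \<Theta>B: "\<Theta> * (real d ^ k / \<epsilon> ^ k) * (real d ^ 4 / \<epsilon> ^ 4) * real d \<le> B"
  proof (cases "k = 1")
    case True
    have "\<Theta> * (real d ^ k / \<epsilon> ^ k) * (real d ^ 4 / \<epsilon> ^ 4) * real d = real d ^ 7 / \<epsilon> ^ 5"
      unfolding \<Theta>_def using True by (simp add: eval_nat_numeral)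
    moreover have "real d ^ 7 / \<epsilon> ^ 5 \<le> B" unfolding B_def using k by (intro rat) auto
    ultimately show ?thesis by (simp only:)
  next
    case False
    have "\<Theta> * (real d ^ k / \<epsilon> ^ k) * (real d ^ 4 / \<epsilon> ^ 4) * real d = real d ^ (2 * k + 5) / \<epsilon> ^ (k + 5)"
    proof -
      have "\<Theta> * (real d ^ k / \<epsilon> ^ k) * (real d ^ 4 / \<epsilon> ^ 4) * real d = (real d ^ k * real d ^ k * real d ^ 4 * real d ^ 1) / (\<epsilon> ^ 1 * \<epsilon> ^ k * \<epsilon> ^ 4)"
        unfolding \<Theta>_def using False by simp
      also have "\<dots> = real d ^ (2 * k + 5) / \<epsilon> ^ (k + 5)"
      proof -
        have "k + k + 4 + 1 = 2 * k + 5" "1 + k + 4 = k + 5" by simp_all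
        then show ?thesis by (simp only: power_add[symmetric])
      qed
      finally show ?thesis .
    qed
    moreover have "real d ^ (2 * k + 5) / \<epsilon> ^ (k + 5) \<le> B" unfolding B_def using False k by (intro rat) auto
    ultimately show ?thesis by (simp only:)
  qed
  have rnd: "real (rounds * (d + 3)) \<le> (4 * K + 8) * l * B"
  proof -
    let ?x = "40000 * \<Theta> * game.Q \<kappa> k * L / \<eta>1^2"
    have x0: "0 \<le> ?x" using Theta_ge1 Q_ge1 L_nonneg by (intro divide_nonneg_nonneg mult_nonneg_nonneg) auto
    have "real (nat \<lceil>y\<rceil> + 1) \<le> y + 2" if "0 \<le> y" for y :: real using that by linarith
    from this[OF x0] have r: "real rounds \<le> ?x + 2" unfolding rounds_def .
    have xe: "?x * real d = K / c4 * L * (\<Theta> * (real d ^ k / \<epsilon> ^ k) * (real d ^ 4 / \<epsilon> ^ 4) * real d)"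
    proof -
      have "?x * real d = 40000 * \<Theta> * game.Q \<kappa> k * L * (1 / \<eta>1^2) * real d" by simp
      also have "\<dots> = (40000 * 16 ^ k * 1024\<^sup>2) * L * (\<Theta> * (real d ^ k / \<epsilon> ^ k) * (real d ^ 4 / \<epsilon> ^ 4) * real d)"
      proof -
        have "40000 * \<theta> * (s * q) * y * (c * e) * x = (40000 * s * c) * y * (\<theta> * q * e * x)" for \<theta> s q y c e x :: real by simp
        then show ?thesis unfolding Q eta .
      qed
      also have "40000 * 16 ^ k * 1024\<^sup>2 = K / c4"
      proof -
        have "0 < c4" by (simp add: c4_def add_pos_nonneg)
        then show ?thesis by (simp add: K_def)
      qed
      finally show ?thesis .
    qed
    have c4p: "0 < c4" by (simp add: c4_def add_pos_nonneg)
    have "?x * real d \<le> K / c4 * (c4 * l) * B"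
      unfolding xe using Lc \<Theta>B K0 c4p L_nonneg Theta_ge1 e0 B1 l1 by (intro mult_mono) auto
    also have "\<dots> = K * l * B" using c4p by simp
    finally have xd: "?x * real d \<le> K * l * B" .
    have dB: "real d \<le> B" using rat[of 1 "2 * k + 6" 0 "2 * k + 3"] by (simp add: B_def)
    have "real (rounds * (d + 3)) \<le> (?x + 2) * (4 * real d)"
      using r d1 x0 by (simp only: of_nat_mult) (intro mult_mono; simp)
    also have "\<dots> = 4 * (?x * real d) + 8 * real d" by (simp only: distrib_right mult.left_commute) simp
    also have "\<dots> \<le> 4 * (K * l * B) + 8 * (1 * B)" using xd dB by (intro add_mono mult_left_mono) auto
    also have "\<dots> \<le> 4 * (K * l * B) + 8 * (l * B)" using l1 B1 by (intro add_mono mult_left_mono mult_right_mono) auto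
    finally show ?thesis by (simp add: algebra_simps)
  qed
  have "(4 * K + 8) * l * B \<le> (4 * K + 8) * l\<^sup>2 * B"
    using K0 B1 l1 by (intro mult_right_mono mult_left_mono) (auto simp: power2_eq_square)
  with prune rnd have "real prune_queries + real (rounds * (d + 3))
      \<le> 16 ^ k * (385 + 2 * real k) * (5 * (96 * c1 + 2)) * l\<^sup>2 * B + (4 * K + 8) * l\<^sup>2 * B" by linarith
  also have "\<dots> = query_constant k * l\<^sup>2 * B"
    unfolding query_constant_def K_def c1_def c4_def by (simp only: distrib_right add.assoc)
  finally show ?thesis by (simp add: l_def t_def B_def)
qed

lemma discretised_coordinate:
  assumes "real_distribution N" "0 < \<kappa>" "\<kappa> \<le> 1"
  shows "\<exists>lev r rep ok p. mono lev \<and> (\<forall>x. lev x \<le> r) \<and> (\<forall>j. 1 \<le> j \<and> j \<le> r \<longrightarrow> \<kappa> \<le> pmf p j) \<and>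
    (\<forall>j. pmf p j = measure N {x. lev x = j}) \<and>
    (\<forall>j. rep j \<in> borel_measurable unit_uniform) \<and> (\<forall>j. {u\<in>space unit_uniform. ok j u} \<in> sets unit_uniform) \<and>
    (\<forall>j u x. u \<in> space unit_uniform \<longrightarrow> ok j u \<longrightarrow> j \<le> lev x \<longrightarrow> rep j u \<le> x) \<and> (\<forall>u. \<not> ok (0::nat) u) \<and>
    (\<forall>A\<in>sets borel. (\<integral>\<^sup>+x. (\<integral>\<^sup>+u. indicator A (rep (lev x) u) \<partial>unit_uniform) \<partial>N) = emeasure N A) \<and>
    (\<integral>\<^sup>+x. (\<integral>\<^sup>+u. of_bool (\<not> ok (lev x) u) \<partial>unit_uniform) \<partial>N) \<le> ennreal (2 * \<kappa>)"
proof -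
  interpret real_distribution N by fact
  obtain lev :: "real \<Rightarrow> nat" and r and rep :: "nat \<Rightarrow> real \<Rightarrow> real" and ok :: "nat \<Rightarrow> real \<Rightarrow> bool"
    where lv: "mono lev" "\<And>x. lev x \<le> r" "\<And>j. 1 \<le> j \<Longrightarrow> j \<le> r \<Longrightarrow> \<kappa> \<le> measure N {x. lev x = j}"
    and rest: "\<And>j. rep j \<in> borel_measurable unit_uniform" "\<And>j. {u\<in>space unit_uniform. ok j u} \<in> sets unit_uniform"
    "\<And>j u x. u \<in> space unit_uniform \<Longrightarrow> ok j u \<Longrightarrow> j \<le> lev x \<Longrightarrow> rep j u \<le> x" "\<And>u. \<not> ok 0 u"
    "\<And>A. A \<in> sets borel \<Longrightarrow> (\<integral>\<^sup>+x. (\<integral>\<^sup>+u. indicator A (rep (lev x) u) \<partial>unit_uniform) \<partial>N) = emeasure N A"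
    "(\<integral>\<^sup>+x. (\<integral>\<^sup>+u. of_bool (\<not> ok (lev x) u) \<partial>unit_uniform) \<partial>N) \<le> ennreal (2 * \<kappa>)"
    by (rule discretisation_exists[OF assms(2,3)]) rule
  have "lev \<in> measurable N (count_space UNIV)"
    using mono_measurable_count_space[OF lv(1)] by (simp add: measurable_cong_sets[OF events_eq_borel refl])
  from nat_valued_pmf_exists[OF this] obtain p where "\<forall>j. pmf p j = measure N {x. lev x = j}" by (auto simp: space_eq_univ)
  then show ?thesis using lv rest by (intro exI[of _ lev] exI[of _ r] exI[of _ rep] exI[of _ ok] exI[of _ p]) (simp del: of_bool_not_iff)
qed

lemma meta_algorithm_for_distribution:
  fixes \<epsilon> :: real
  assumes k: "1 \<le> k" "k \<le> d" and D: "\<And>i. i < d \<Longrightarrow> real_distribution (D i)" and \<epsilon>: "0 < \<epsilon>" "\<epsilon> < 1"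
  shows "\<exists>M. valid_meta_algorithm d M \<and>
    (\<forall>f\<in>oracles d.
      with_prob_at_least (seed M) (1 - 1 / (16 * (real d / \<epsilon>))) (\<lambda>\<omega>. marginally_monotone k d D (meta_fun M f \<omega>)) \<and>
      (\<forall>\<omega>\<in>space (seed M). feasible d f (meta_fun M f \<omega>)) \<and>
      (\<integral>(\<omega>, x). meta_fun M f \<omega> x \<partial>(seed M \<Otimes>\<^sub>M PiM {..<d} D)) \<ge> (\<integral>x. f x \<partial>PiM {..<d} D) - \<epsilon>) \<and>
    ereal_of_enat (query_complexity d M)
      \<le> ereal (query_constant k * (1 + ln (real d / \<epsilon>))\<^sup>2 * (real d ^ (2 * k + 6) / \<epsilon> ^ (2 * k + 3)))"
proof -
  \<comment> \<open>Nothing is known about \<open>D i\<close> for \<open>i \<ge> d\<close>. A point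
    mass there turns all coordinates into probability distributions, as the locale of infinite
    products requires.\<close>
  define E where "E i = (if i < d then D i else return borel 0)" for i
  have E: "real_distribution (E i)" for i
    using D[of i] by (auto simp: E_def real_distribution_def real_distribution_axioms_def prob_space_return)
  have PE: "PiM {..<d} E = PiM {..<d} D" by (intro PiM_cong) (auto simp: E_def)
  have mE: "marginally_monotone k d E g \<longleftrightarrow> marginally_monotone k d D g" for g
  proof -
    have "PiM ({..<d} - I) E = PiM ({..<d} - I) D" for I by (intro PiM_cong) (auto simp: E_def)
    then show ?thesis by (simp add: marginally_monotone_def marginal_def)
  qed
  define \<kappa> where "\<kappa> = \<epsilon> / (16 * real d)"
  define \<delta> where "\<delta> = \<epsilon> / (48 * real d)"
  define G where "G = nat \<lceil>16 / \<epsilon>\<rceil>"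
  have d1: "1 \<le> real d" using k by simp
  have \<kappa>: "0 < \<kappa>" "\<kappa> \<le> \<epsilon>" using \<epsilon> d1 by (auto simp: \<kappa>_def divide_le_eq mult_le_cancel_left1)
  have \<delta>: "0 < \<delta>" "\<delta> \<le> 1" using \<epsilon> d1 by (auto simp: \<delta>_def divide_le_eq)
  have G16: "16 / \<epsilon> \<le> real G" unfolding G_def by (rule real_nat_ceiling_ge)
  then have G1: "1 \<le> G" using \<epsilon> by (cases G) (auto simp: divide_le_eq)
  have "1 / real G \<le> 1 / (16 / \<epsilon>)" using G16 G1 \<epsilon> by (intro divide_left_mono) auto
  then have invG: "1 / real G \<le> \<epsilon> / 16" by simp
  define good_coordinate where "good_coordinate i lev r rep ok p \<longleftrightarrow> mono lev \<and> (\<forall>x. lev x \<le> r) \<and> (\<forall>j. 1 \<le> j \<and> j \<le> r \<longrightarrow> \<kappa> \<le> pmf p j) \<and>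
    (\<forall>j. pmf p j = measure (E i) {x. lev x = j}) \<and>
    (\<forall>j. rep j \<in> borel_measurable unit_uniform) \<and> (\<forall>j. {u\<in>space unit_uniform. ok j u} \<in> sets unit_uniform) \<and>
    (\<forall>j u x. u \<in> space unit_uniform \<longrightarrow> ok j u \<longrightarrow> j \<le> lev x \<longrightarrow> rep j u \<le> x) \<and> (\<forall>u. \<not> ok (0::nat) u) \<and>
    (\<forall>A\<in>sets borel. (\<integral>\<^sup>+x. (\<integral>\<^sup>+u. indicator A (rep (lev x) u) \<partial>unit_uniform) \<partial>E i) = emeasure (E i) A) \<and>
    (\<integral>\<^sup>+x. (\<integral>\<^sup>+u. of_bool (\<not> ok (lev x) u) \<partial>unit_uniform) \<partial>E i) \<le> ennreal (2 * \<kappa>)"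
    for i and lev :: "real \<Rightarrow> nat" and r rep ok p
  have "\<exists>lev r rep ok p. good_coordinate i lev r rep ok p" for i
    unfolding good_coordinate_def using \<kappa> \<epsilon> by (intro discretised_coordinate E) auto
  then obtain lev r rep ok bp where c: "\<And>i. good_coordinate i (lev i) (r i) (rep i) (ok i) (bp i)" by metis
  note c' = c[unfolded good_coordinate_def]
  interpret lifting d r bp \<kappa> k \<epsilon> \<delta> E lev rep ok G
  proof (intro lifting.intro algorithm.intro grid.intro algorithm_axioms.intro lifting_axioms.intro)
    show "set_pmf (bp i) \<subseteq> {..r i}" if "i < d" for i
    proof
      fix j assume j: "j \<in> set_pmf (bp i)"
      show "j \<in> {..r i}"
      proof (rule ccontr)
        assume "j \<notin> {..r i}"
        then have e: "{x. lev i x = j} = {}" using c'[of i] by auto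
        have "pmf (bp i) j = measure (E i) {x. lev i x = j}" using c'[of i] by blast
        then show False using j unfolding e by (simp add: set_pmf_iff)
      qed
    qed
    show "\<kappa> \<le> pmf (bp i) j" if "i < d" "1 \<le> j" "j \<le> r i" for i j using c'[of i] that by blast
    show "pmf (bp i) j = measure (E i) {x. lev i x = j}" for i j using c'[of i] by blast
    show "mono (lev i)" for i using c'[of i] by blast
    show "lev i x \<le> r i" for i x using c'[of i] by blast
    show "rep i j \<in> borel_measurable unit_uniform" for i j using c'[of i] by blast
    show "{u \<in> space unit_uniform. ok i j u} \<in> sets unit_uniform" for i j using c'[of i] by blast
    show "rep i j u \<le> x" if "u \<in> space unit_uniform" "ok i j u" "j \<le> lev i x" for i j u x using c'[of i] that by blast
    show "\<not> ok i 0 u" for i u using c'[of i] by blast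
    show "(\<integral>\<^sup>+x. (\<integral>\<^sup>+u. indicator A (rep i (lev i x) u) \<partial>unit_uniform) \<partial>E i) = emeasure (E i) A" if "A \<in> sets borel" for i A
      using c'[of i] that by blast
    show "(\<integral>\<^sup>+x. (\<integral>\<^sup>+u. of_bool (\<not> ok i (lev i x) u) \<partial>unit_uniform) \<partial>E i) \<le> ennreal (2 * \<kappa>)" for i using c'[of i] by blast
  qed (use k \<epsilon> \<kappa> \<delta> G1 E in simp_all)
  obtain M where M: "valid_meta_algorithm d M" "seed M = seed_space" "\<And>f \<omega> x. meta_fun M f \<omega> x = lifted f \<omega> x"
    "\<And>f \<omega> x. calls_on M f \<omega> x \<le> prune_queries + rounds * (d + 3)"
    by (rule meta_algorithm_exists) rule
  have Mf: "meta_fun M f \<omega> = lifted f \<omega>" for f \<omega> using M(3) by blast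
  have mono: "with_prob_at_least (seed M) (1 - 1 / (16 * (real d / \<epsilon>))) (\<lambda>\<omega>. marginally_monotone k d D (meta_fun M f \<omega>))"
    if f: "f \<in> oracles d" for f
    unfolding with_prob_at_least_def Mf M(2)
  proof (rule bexI[OF _ good_seeds_sets[OF f]], intro conjI ballI)
    show "marginally_monotone k d D (lifted f \<omega>)" if "\<omega> \<in> good_seeds f" for \<omega>
      using that lifted_monotone[of f \<omega>] mE by (simp add: good_seeds_def)
    have "3 * \<delta> = 1 / (16 * (real d / \<epsilon>))" by (simp add: \<delta>_def)
    then show "1 - 1 / (16 * (real d / \<epsilon>)) \<le> measure seed_space (good_seeds f)" using good_seeds_prob[OF f] by simp
  qed
  have feas: "feasible d f (meta_fun M f \<omega>)" if "f \<in> oracles d" "\<omega> \<in> space (seed M)" for f \<omega>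
    unfolding feasible_def Mf using lifted_feasible that M(2) by auto
  have loss: "(\<integral>x. f x \<partial>PiM {..<d} D) - \<epsilon> \<le> (\<integral>(\<omega>, x). meta_fun M f \<omega> x \<partial>(seed M \<Otimes>\<^sub>M PiM {..<d} D))"
    if f: "f \<in> oracles d" for f
  proof -
    \<comment> \<open>The shares are \<open>\<epsilon> / 8\<close> for the discretisation,
      \<open>\<epsilon> / 16\<close> for rounding, \<open>\<epsilon> / 4\<close> for the algorithm
      on the grid, and at most \<open>\<epsilon> / 16\<close> for bad seeds.\<close>
    have "2 * \<kappa> * d = \<epsilon> / 8" using d1 by (simp add: \<kappa>_def)
    moreover have "3 * \<delta> \<le> \<epsilon> / 16" using d1 \<epsilon> by (simp add: \<delta>_def field_simps)
    ultimately have "2 * \<kappa> * d + 1 / G + \<epsilon> / 4 + 3 * \<delta> \<le> \<epsilon>" using invG \<epsilon> by linarith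
    then show ?thesis using lifted_total[OF f] unfolding Mf M(2) PE by linarith
  qed
  have "query_complexity d M \<le> enat (prune_queries + rounds * (d + 3))"
    unfolding query_complexity_def using M(4) by (auto intro!: SUP_least)
  then have "ereal_of_enat (query_complexity d M) \<le> ereal_of_enat (enat (prune_queries + rounds * (d + 3)))"
    by (simp only: ereal_of_enat_le_iff)
  also have "\<dots> = ereal (real (prune_queries + rounds * (d + 3)))" by simp
  also have "\<dots> \<le> ereal (query_constant k * (1 + ln (real d / \<epsilon>))\<^sup>2 * (real d ^ (2 * k + 6) / \<epsilon> ^ (2 * k + 3)))"
    using queries_le[OF \<kappa>_def \<delta>_def] by (simp only: ereal_less_eq(3))
  finally show ?thesis using M(1) mono feas loss by (intro exI[of _ M] conjI ballI)
qed

theorem theorem4: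
  shows "\<exists>(C :: nat \<Rightarrow> real) (p :: nat) (\<delta> :: real \<Rightarrow> real). (\<delta> \<longlongrightarrow> 0) at_top \<and>
    (\<forall>(k :: nat) (d :: nat) (D :: nat \<Rightarrow> real measure) (\<epsilon> :: real).
      1 \<le> k \<and> k \<le> d \<and> (\<forall>i<d. real_distribution (D i)) \<and> 0 < \<epsilon> \<and> \<epsilon> < 1 \<longrightarrow>
      (\<exists>M :: meta_algorithm. valid_meta_algorithm d M \<and>
        (\<forall>f\<in>oracles d.
          with_prob_at_least (seed M) (1 - \<delta> (real d / \<epsilon>))
            (\<lambda>\<omega>. marginally_monotone k d D (meta_fun M f \<omega>)) \<and>
          (\<forall>\<omega>\<in>space (seed M). feasible d f (meta_fun M f \<omega>)) \<and>
          (\<integral>(\<omega>, x). meta_fun M f \<omega> x \<partial>(seed M \<Otimes>\<^sub>M PiM {..<d} D))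
            \<ge> (\<integral>x. f x \<partial>PiM {..<d} D) - \<epsilon>) \<and>
        ereal_of_enat (query_complexity d M)
          \<le> ereal (C k * (1 + ln (real d / \<epsilon>)) ^ p * (real d ^ (2 * k + 6) / \<epsilon> ^ (2 * k + 3)))))"
proof -
  have lim: "((\<lambda>t::real. 1 / (16 * t)) \<longlongrightarrow> 0) at_top"
  proof -
    have "((\<lambda>t::real. (1 / 16) * inverse t) \<longlongrightarrow> (1 / 16) * 0) at_top"
      by (intro tendsto_mult tendsto_const tendsto_inverse_0_at_top filterlim_ident)
    then show ?thesis by (simp add: field_simps)
  qed
  show ?thesis
  \<comment> \<open>The exponent 2 is due to pruning, where the sample size and the number of
    sampling levels are both logarithmic. The failure probability is
    \<open>3 * \<epsilon> / (48 * d)\<close>, that is \<open>1 / (16 * t)\<close> at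
    \<open>t = d / \<epsilon>\<close>.\<close>
  proof (rule exI[of _ query_constant], rule exI[of _ 2], rule exI[of _ "\<lambda>t. 1 / (16 * t)"], intro conjI lim allI impI)
    fix k d :: nat and D :: "nat \<Rightarrow> real measure" and \<epsilon> :: real
    assume "1 \<le> k \<and> k \<le> d \<and> (\<forall>i<d. real_distribution (D i)) \<and> 0 < \<epsilon> \<and> \<epsilon> < 1"
    then show "\<exists>M. valid_meta_algorithm d M \<and>
        (\<forall>f\<in>oracles d.
          with_prob_at_least (seed M) (1 - 1 / (16 * (real d / \<epsilon>)))
            (\<lambda>\<omega>. marginally_monotone k d D (meta_fun M f \<omega>)) \<and>
          (\<forall>\<omega>\<in>space (seed M). feasible d f (meta_fun M f \<omega>)) \<and>
          (\<integral>(\<omega>, x). meta_fun M f \<omega> x \<partial>(seed M \<Otimes>\<^sub>M PiM {..<d} D))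
            \<ge> (\<integral>x. f x \<partial>PiM {..<d} D) - \<epsilon>) \<and>
        ereal_of_enat (query_complexity d M)
          \<le> ereal (query_constant k * (1 + ln (real d / \<epsilon>)) ^ 2 * (real d ^ (2 * k + 6) / \<epsilon> ^ (2 * k + 3)))"
      by (intro meta_algorithm_for_distribution) auto
  qed
qed

end
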